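(* Let $N \ge 2$, let $0<\alpha<1$, and let $\Omega=\bigcup_{j=1}^m \Omega_j \subset \mathbb{R}^N$ be the union of finitely many bounded domains $\Omega_1,\dots,\Omega_m$, each with boundary $\partial\Omega_j$ of class $C^{2,\alpha}$, such that $\overline{\Omega}_i\cap\overline{\Omega}_j=\emptyset$ for $i\neq j$. Let $\sigma_+,\sigma_->0$ be constants with $\sigma_+\neq\sigma_-$, and define $\sigma(x)=\sigma_+$ for $x\in\Omega$ and $\sigma(x)=\sigma_-$ for $x\in\mathbb{R}^N\setminus\Omega$. Let $u=u(x,t)$ be the unique bounded solution of the Cauchy problem $$u_t=\operatorname{div}(\sigma\nabla u)\ \text{ in } \mathbb{R}^N\times(0,+\infty),\qquad u=\mathcal{X}_\Omega\ \text{ on } \mathbb{R}^N\times\{0\},$$ where $\mathcal{X}_\Omega$ is the characteristic function of $\Omega$. If there exists a function $a:(0,+\infty)\to(0,+\infty)$ such that $u(x,t)=a(t)$ for every $(x,t)\in\partial\Omega\times(0,+\infty)$, then $\Omega$ must be a ball.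
   Context: The equation $u_t=\operatorname{div}(\sigma\nabla u)$ with the piecewise constant (discontinuous) coefficient $\sigma$ is understood in the weak (distributional) sense on $\mathbb{R}^N\times(0,+\infty)$. *)

theory Defs
  imports "HOL-Analysis.Analysis"
begin

definition holder_C2 :: "real \<Rightarrow> ('a::euclidean_space \<Rightarrow> real) \<Rightarrow> bool" where
  "holder_C2 \<alpha> \<phi> \<longleftrightarrow>
     (\<exists>(D\<phi> :: 'a \<Rightarrow> ('a \<Rightarrow>\<^sub>L real)) (D2\<phi> :: 'a \<Rightarrow> ('a \<Rightarrow>\<^sub>L ('a \<Rightarrow>\<^sub>L real))) C.
        (\<forall>x. (\<phi> has_derivative blinfun_apply (D\<phi> x)) (at x)) \<and>
        (\<forall>x. (D\<phi> has_derivative blinfun_apply (D2\<phi> x)) (at x)) \<and>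
        (\<forall>x y. norm (D2\<phi> x - D2\<phi> y) \<le> C * dist x y powr \<alpha>))"

text \<open>Boundary of class C^{2,alpha}: near each boundary point p, in suitable
  orthonormal coordinates (last axis along the unit vector nu), D is the region
  below the graph of a C^{2,alpha} function of the remaining N-1 coordinates
  (the function is evaluated at the orthogonal projection onto nu's complement).\<close>
definition C2alpha_boundary :: "real \<Rightarrow> 'a::euclidean_space set \<Rightarrow> bool" where
  "C2alpha_boundary \<alpha> D \<longleftrightarrow>
     (\<forall>p\<in>frontier D. \<exists>r>0. \<exists>(\<nu>::'a) (\<phi>::'a \<Rightarrow> real).
        norm \<nu> = 1 \<and> holder_C2 \<alpha> \<phi> \<and>
        (\<forall>x\<in>ball p r. x \<in> D \<longleftrightarrow> x \<bullet> \<nu> < \<phi> (x - (x \<bullet> \<nu>) *\<^sub>R \<nu>)))"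

definition bounded_domain :: "'a::euclidean_space set \<Rightarrow> bool" where
  "bounded_domain D \<longleftrightarrow> open D \<and> connected D \<and> bounded D \<and> D \<noteq> {}"

coinductive smooth_fun :: "('b::euclidean_space \<Rightarrow> real) \<Rightarrow> bool" where
  "(\<forall>z. f differentiable (at z)) \<Longrightarrow>
   (\<forall>v. smooth_fun (\<lambda>z. frechet_derivative f (at z) v)) \<Longrightarrow> smooth_fun f"

definition test_fun_on :: "'b::euclidean_space set \<Rightarrow> ('b \<Rightarrow> real) \<Rightarrow> bool" where
  "test_fun_on S \<phi> \<longleftrightarrow> smooth_fun \<phi> \<and>
     (\<exists>K. compact K \<and> K \<subseteq> S \<and> (\<forall>z. z \<notin> K \<longrightarrow> \<phi> z = 0))"

definition weak_space_gradient ::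
  "('a::euclidean_space \<Rightarrow> real \<Rightarrow> real) \<Rightarrow> ('a \<Rightarrow> real \<Rightarrow> 'a) \<Rightarrow> bool" where
  "weak_space_gradient u g \<longleftrightarrow>
     (\<forall>T>0. set_integrable lborel (UNIV \<times> {0<..<T}) (\<lambda>(x,t). (norm (g x t))\<^sup>2)) \<and>
     set_borel_measurable lborel (UNIV \<times> {0<..}) (\<lambda>(x,t). g x t) \<and>
     (\<forall>\<phi>. test_fun_on (UNIV \<times> {0<..}) \<phi> \<longrightarrow> (\<forall>v::'a.
        (LINT z:UNIV \<times> {0<..}|lborel. u (fst z) (snd z) * frechet_derivative \<phi> (at z) (v, 0))
        = - (LINT z:UNIV \<times> {0<..}|lborel. (g (fst z) (snd z) \<bullet> v) * \<phi> z)))"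

text \<open>u is a bounded (continuous on R^N x (0,inf)) weak solution of
  u_t = div(sigma grad u) in R^N x (0,inf), u = u0 at t = 0, in the standard
  weak formulation incorporating the initial datum.\<close>
definition bounded_weak_solution ::
  "('a::euclidean_space \<Rightarrow> real) \<Rightarrow> ('a \<Rightarrow> real) \<Rightarrow> ('a \<Rightarrow> real \<Rightarrow> real) \<Rightarrow> bool" where
  "bounded_weak_solution \<sigma> u0 u \<longleftrightarrow>
     (\<exists>M. \<forall>x t. t > 0 \<longrightarrow> \<bar>u x t\<bar> \<le> M) \<and>
     continuous_on (UNIV \<times> {0<..}) (\<lambda>(x,t). u x t) \<and>
     (\<exists>g. weak_space_gradient u g \<and>
        (\<forall>\<phi>. test_fun_on UNIV \<phi> \<longrightarrow>
           (LINT z:UNIV \<times> {0<..}|lborel.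
               u (fst z) (snd z) * frechet_derivative \<phi> (at z) (0, 1)
               - \<sigma> (fst z) * frechet_derivative \<phi> (at z) (g (fst z) (snd z), 0))
           + (LINT x|lborel. u0 x * \<phi> (x, 0)) = 0))"

end

theory Submission
  imports Defs
begin

text \<open>Since \<open>u - a(t)\<close> vanishes on the interface, \<open>W = \<sigma> (u - a) + \<sigma>m a\<close> has weak gradient \<open>\<sigma> \<nabla>u\<close>, so that
  \<open>u\<^sub>t = \<Delta>W\<close> without an interface term. The Laplace transforms \<open>w\<close>, \<open>A\<close>, \<open>V\<close> of \<open>u\<close>, \<open>a\<close>, \<open>W\<close> at frequency 1 then satisfy
  \<open>\<Delta>V = w - 1\<^sub>\<Omega>\<close> in the whole space, where \<open>w\<close> is a piecewise affine function of \<open>V\<close>. Maximum principles give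
  \<open>A < 1\<close> and \<open>\<Omega> = {V > \<sigma>m A}\<close>. Now let planes orthogonal to a unit vector move in from infinity, as long as the reflected
  caps stay in \<open>\<Omega>\<close>. In a position where the process stops, the difference of \<open>V\<close> and its reflection is nonnegative on one side;
  if it did not vanish identically, it would be positive there with nonzero normal derivative on the plane, and the plane
  could move further. Hence \<open>\<Omega>\<close> is symmetric in every direction, with all caps reflecting inwards, and so a ball. The heat semigroup
  replaces elliptic regularity throughout, and the smoothness of the boundary is only used for the measure of its
  neighbourhoods.\<close>

section \<open>Elementary smooth functions\<close>

text \<open>The source \<open>f\<close> is discontinuous: at the interface it tends to A from
  outside and to A - 1 from inside. Classical maximum principles, Hopf's lemma and a corner lemma
  would require regularity theory for V. The substitute is the identity d/ds (P_s V) = P_s f for the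
  Gaussian semigroup P_s: the weak equation enters only when this identity is proved, and P_s V is
  differentiable for s > 0 although f jumps. A sign of f near a point then controls V there up to
  Gaussian tails, and strict positivity of the kernel replaces the strong maximum principle. The
  jump has the favourable sign: once A < 1 shows that \<Omega> is a superlevel set of V, f drops by
  1 as V rises through the interface value, so a large multiple of V minus f is still monotone in V,
  and the comparison with the reflection also holds where the two points lie in different phases.
  Boundedness of u makes the Laplace transform converge; frequency 1 is a convenient choice.
  Symmetry in all directions alone would still permit concentric shells; the inward reflection of
  all caps excludes them.\<close>

text \<open>One nonnegative term of the exponential series. The bound serves twice: for the flatness
  of \<open>expinv\<close> at 0 and for the moments of the Gaussian.\<close>

lemma power_le_fact_exp:
  fixes x :: real assumes "x \<ge> 0" shows "x ^ n \<le> fact n * exp x"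
proof -
  have "(\<Sum>i\<in>{n}. inverse (fact i) * x ^ i) \<le> (\<Sum>i. inverse (fact i) * x ^ i)"
    by (rule sum_le_suminf) (use assms summable_exp[of x] in auto)
  then show ?thesis by (simp add: exp_def field_simps)
qed

text \<open>The derivative of a member of this family is a linear combination of members.\<close>

definition expinv :: "nat \<Rightarrow> real \<Rightarrow> real" where
  "expinv k s = (if s > 0 then exp (- 1 / s) / s ^ k else 0)"

lemma expinv_nonneg: "0 \<le> expinv k s" by (simp add: expinv_def)

text \<open>The exponential bound at 1 / s absorbs the pole of order k and leaves j powers of s. The
  case j = 0 gives boundedness, j = 2 differentiability at 0.\<close>

lemma expinv_le_power:
  assumes "s > 0" shows "expinv k s \<le> fact (k + j) * s ^ j"
proof -
  have "(1/s) ^ (k+j) \<le> fact (k+j) * exp (1/s)"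
    using power_le_fact_exp[of "1/s" "k+j"] assms by simp
  then have "(1/s) ^ (k+j) * exp (-1/s) * s^j \<le> fact (k+j) * exp (1/s) * exp (-1/s) * s^j"
    using assms by (intro mult_right_mono) auto
  moreover have "exp (1/s) * exp (-1/s) = 1" by (simp flip: exp_add)
  moreover have "(1/s) ^ (k+j) * exp (-1/s) * s^j = expinv k s"
    using assms by (simp add: expinv_def power_add field_simps)
  ultimately show ?thesis by (metis mult.assoc mult_1_right)
qed

lemma abs_expinv_le: "\<bar>expinv k s\<bar> \<le> fact k"
  using expinv_le_power[of s k 0] by (cases "s > 0") (auto simp: expinv_def)

lemma expinv_0_1_pos: "expinv 0 1 > 0" by (simp add: expinv_def)

text \<open>For s > 0 this is the quotient rule; at s = 0 the quadratic bound makes the difference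
  quotient O(h).\<close>

lemma has_real_derivative_expinv:
  "(expinv k has_real_derivative (expinv (k+2) s - real k * expinv (k+1) s)) (at s)"
proof -
  consider "s > 0" | "s < 0" | "s = 0" by linarith
  then show ?thesis
  proof cases
    case 1
    have ev: "\<forall>\<^sub>F x in nhds s. expinv k x = exp (- 1 / x) / x ^ k"
      using 1 eventually_nhds_in_open[of "{0<..}" s]
      by (auto elim!: eventually_mono simp: expinv_def)
    have "((\<lambda>x. exp (- 1 / x) / x ^ k) has_real_derivative
       (expinv (k+2) s - real k * expinv (k+1) s)) (at s)"
    proof -
      have "((\<lambda>x. exp (- 1 / x) / x ^ k) has_real_derivative
         (exp (- 1 / s) * (1 / s\<^sup>2) * s ^ k - exp (- 1 / s) * (real k * s ^ (k - 1))) / (s ^ k * s ^ k)) (at s)"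
        using 1 by (auto intro!: derivative_eq_intros simp: power2_eq_square)
      moreover have "(exp (- 1 / s) * (1 / s\<^sup>2) * s ^ k - exp (- 1 / s) * (real k * s ^ (k - 1))) / (s ^ k * s ^ k)
          = expinv (k+2) s - real k * expinv (k+1) s"
        using 1 by (cases k) (auto simp: expinv_def power2_eq_square field_simps)
      ultimately show ?thesis by simp
    qed
    then show ?thesis using DERIV_cong_ev[OF refl ev refl] by blast
  next
    case 2
    have ev: "\<forall>\<^sub>F x in nhds s. expinv k x = 0"
      using 2 eventually_nhds_in_open[of "{..<0}" s]
      by (auto elim!: eventually_mono simp: expinv_def)
    have "((\<lambda>x. 0::real) has_real_derivative 0) (at s)" by simp
    then have "(expinv k has_real_derivative 0) (at s)" using DERIV_cong_ev[OF refl ev refl] by blast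
    then show ?thesis using 2 by (simp add: expinv_def)
  next
    case 3
    have "((\<lambda>h. (expinv k (0+h) - expinv k 0) / h) \<longlongrightarrow> 0) (at 0)"
    proof (rule Lim_null_comparison)
      show "\<forall>\<^sub>F h in at 0. norm ((expinv k (0+h) - expinv k 0) / h) \<le> fact (k+2) * \<bar>h\<bar>"
      proof (rule always_eventually, rule allI)
        fix h :: real
        have z: "expinv k 0 = 0" by (simp add: expinv_def)
        show "norm ((expinv k (0+h) - expinv k 0) / h) \<le> fact (k+2) * \<bar>h\<bar>"
        proof (cases "h > 0")
          case True
          have "expinv k h / h \<le> fact (k+2) * h"
            using expinv_le_power[of h k 2] True by (simp add: pos_divide_le_eq power2_eq_square del: fact_Suc)
          then show ?thesis using True expinv_nonneg[of k h] z by simp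
        next
          case False
          then have "(expinv k (0+h) - expinv k 0) / h = 0" by (simp add: expinv_def)
          then show ?thesis by (simp only: norm_zero mult_nonneg_nonneg fact_ge_zero abs_ge_zero)
        qed
      qed
      show "((\<lambda>h. fact (k+2) * \<bar>h\<bar>) \<longlongrightarrow> 0) (at (0::real))"
        by (rule tendsto_eq_intros refl | simp)+
    qed
    then show ?thesis using 3 by (simp add: DERIV_def expinv_def)
  qed
qed

text \<open>This class is closed under directional derivatives, so its members are smooth in the coinductive sense;
  all test functions below are chosen from it.\<close>

inductive elementary :: "('b::euclidean_space \<Rightarrow> real) \<Rightarrow> bool" where
  const: "elementary (\<lambda>z. c)"
| inner: "elementary (\<lambda>z. z \<bullet> b)"
| add: "elementary f \<Longrightarrow> elementary g \<Longrightarrow> elementary (\<lambda>z. f z + g z)"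
| mult: "elementary f \<Longrightarrow> elementary g \<Longrightarrow> elementary (\<lambda>z. f z * g z)"
| exp: "elementary f \<Longrightarrow> elementary (\<lambda>z. exp (f z))"
| expinv: "elementary f \<Longrightarrow> elementary (\<lambda>z. expinv k (f z))"

text \<open>Both halves are carried through one induction. That the derivative is elementary in z
  for every fixed v is the invariant of the coinduction in \<open>elementary_smooth\<close>.\<close>

lemma elementary_derivative:
  assumes "elementary f"
  shows "\<exists>f'. (\<forall>z. (f has_derivative f' z) (at z)) \<and> (\<forall>v. elementary (\<lambda>z. f' z v))"
  using assms
proof induction
  case (const c)
  then show ?case by (intro exI[of _ "\<lambda>z v. 0"]) (auto intro: elementary.intros)
next
  case (inner b)
  show ?case by (intro exI[of _ "\<lambda>z v. v \<bullet> b"])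
     (auto intro!: elementary.intros derivative_eq_intros)
next
  case (add f g)
  then obtain f' g' where
    "\<forall>z. (f has_derivative f' z) (at z)" "\<forall>v. elementary (\<lambda>z. f' z v)"
    "\<forall>z. (g has_derivative g' z) (at z)" "\<forall>v. elementary (\<lambda>z. g' z v)" by blast
  then show ?case by (intro exI[of _ "\<lambda>z v. f' z v + g' z v"])
     (auto intro!: elementary.intros has_derivative_add)
next
  case (mult f g)
  then obtain f' g' where
    "\<forall>z. (f has_derivative f' z) (at z)" "\<forall>v. elementary (\<lambda>z. f' z v)"
    "\<forall>z. (g has_derivative g' z) (at z)" "\<forall>v. elementary (\<lambda>z. g' z v)" by blast
  then show ?case using mult.hyps by (intro exI[of _ "\<lambda>z v. f z * g' z v + f' z v * g z"])
     (auto intro!: elementary.intros has_derivative_mult)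
next
  case (exp f)
  then obtain f' where f: "\<forall>z. (f has_derivative f' z) (at z)" "\<forall>v. elementary (\<lambda>z. f' z v)" by blast
  have "((\<lambda>z. exp (f z)) has_derivative (\<lambda>v. exp (f z) * f' z v)) (at z)" for z
    using f(1) by (auto intro!: derivative_eq_intros)
  then show ?case using f(2) exp.hyps by (intro exI[of _ "\<lambda>z v. exp (f z) * f' z v"])
     (auto intro!: elementary.intros)
next
  case (expinv f k)
  then obtain f' where f: "\<forall>z. (f has_derivative f' z) (at z)" "\<forall>v. elementary (\<lambda>z. f' z v)" by blast
  let ?D = "\<lambda>z. expinv (k+2) (f z) + (- real k) * expinv (k+1) (f z)"
  have "((\<lambda>z. expinv k (f z)) has_derivative (\<lambda>v. ?D z * f' z v)) (at z)" for z
    using has_derivative_compose[OF f(1)[rule_format, of z]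
      has_real_derivative_expinv[of k "f z", unfolded has_field_derivative_def]] by simp
  moreover have "elementary (\<lambda>z. ?D z * f' z v)" for v
    using f(2) expinv.hyps by (intro elementary.intros) auto
  ultimately show ?case by (intro exI[of _ "\<lambda>z v. ?D z * f' z v"] conjI allI)
qed

text \<open>The direction is the first argument so that the operator can be iterated, as in
  \<open>lap\<close>.\<close>

definition dirderiv :: "'b::euclidean_space \<Rightarrow> ('b \<Rightarrow> real) \<Rightarrow> 'b \<Rightarrow> real" where
  "dirderiv v f z = frechet_derivative f (at z) v"

lemma dirderiv_eqI: "(f has_derivative f') (at z) \<Longrightarrow> dirderiv v f z = f' v"
  by (simp add: dirderiv_def frechet_derivative_at[symmetric])

lemma elementary_has_derivative:
  assumes "elementary f"
  shows "(f has_derivative (\<lambda>v. dirderiv v f z)) (at z)"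
proof -
  obtain f' where "(f has_derivative f' z) (at z)" using elementary_derivative[OF assms] by blast
  moreover from this have "(\<lambda>v. dirderiv v f z) = f' z" using dirderiv_eqI by blast
  ultimately show ?thesis by simp
qed

lemma elementary_dirderiv:
  assumes "elementary f" shows "elementary (dirderiv v f)"
proof -
  obtain f' where f: "\<forall>z. (f has_derivative f' z) (at z)" "\<forall>v. elementary (\<lambda>z. f' z v)"
    using elementary_derivative[OF assms] by blast
  then have "dirderiv v f = (\<lambda>z. f' z v)" using dirderiv_eqI by blast
  then show ?thesis using f(2) by simp
qed

lemma elementary_smooth: "elementary f \<Longrightarrow> smooth_fun f"
proof (coinduction arbitrary: f)
  case smooth_fun
  then show ?case
    using elementary_has_derivative elementary_dirderiv
    by (auto simp: differentiable_def dirderiv_def[abs_def])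
qed

lemma elementary_continuous: "elementary f \<Longrightarrow> continuous_on S f"
  by (meson elementary_has_derivative has_derivative_continuous continuous_at_imp_continuous_on)

lemma elementary_fst: "elementary f \<Longrightarrow> elementary (\<lambda>z::'a::euclidean_space \<times> 'b::euclidean_space. f (fst z))"
proof (induction rule: elementary.induct)
  case (inner b)
  have "(\<lambda>z::'a\<times>'b. fst z \<bullet> b) = (\<lambda>z. z \<bullet> (b,0))" by (auto simp: inner_prod_def)
  then show ?case by (simp add: elementary.inner)
qed (auto intro: elementary.intros)

lemma elementary_snd: "elementary f \<Longrightarrow> elementary (\<lambda>z::'a::euclidean_space \<times> 'b::euclidean_space. f (snd z))"
proof (induction rule: elementary.induct)
  case (inner b)
  have "(\<lambda>z::'a\<times>'b. snd z \<bullet> b) = (\<lambda>z. z \<bullet> (0,b))" by (auto simp: inner_prod_def)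
  then show ?case by (simp add: elementary.inner)
qed (auto intro: elementary.intros)

lemma elementary_ident: "elementary (\<lambda>z::real. z)"
  using elementary.inner[of "1::real"] by simp

lemma elementary_sum: "finite I \<Longrightarrow> (\<And>i. i \<in> I \<Longrightarrow> elementary (f i)) \<Longrightarrow> elementary (\<lambda>z. \<Sum>i\<in>I. f i z)"
  by (induction rule: finite_induct) (auto intro: elementary.intros)

lemma elementary_diff:
  assumes "elementary f" "elementary g" shows "elementary (\<lambda>z. f z - g z)"
  using elementary.add[OF assms(1) elementary.mult[OF elementary.const[of "-1"] assms(2)]] by simp

lemma elementary_translate:
  "elementary f \<Longrightarrow> elementary (\<lambda>z. f (c *\<^sub>R (z - y)))"
proof (induction rule: elementary.induct)
  case (inner b)
  have "(\<lambda>z. (c *\<^sub>R (z - y)) \<bullet> b) = (\<lambda>z. z \<bullet> (c *\<^sub>R b) + - (c * (y \<bullet> b)))"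
    by (auto simp: algebra_simps)
  then show ?case using elementary.add[OF elementary.inner elementary.const] by metis
qed (auto intro: elementary.intros)

lemma elementary_norm_sq: "elementary (\<lambda>z. (norm z)\<^sup>2)"
proof -
  have "(\<lambda>z::'a. (norm z)\<^sup>2) = (\<lambda>z. \<Sum>b\<in>Basis. (z \<bullet> b) * (z \<bullet> b))"
    by (auto simp: power2_norm_eq_inner euclidean_inner[symmetric])
  then show ?thesis by (auto intro!: elementary_sum elementary.intros)
qed

section \<open>Compactly supported elementary functions\<close>

definition test_elem :: "('b::euclidean_space \<Rightarrow> real) \<Rightarrow> bool" where
  "test_elem f \<longleftrightarrow> elementary f \<and> (\<exists>R. \<forall>z. norm z > R \<longrightarrow> f z = 0)"

lemma test_elemD: "test_elem f \<Longrightarrow> elementary f" by (simp add: test_elem_def)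

lemma test_elem_mult: "test_elem f \<Longrightarrow> elementary g \<Longrightarrow> test_elem (\<lambda>z. f z * g z)"
  "test_elem f \<Longrightarrow> elementary g \<Longrightarrow> test_elem (\<lambda>z. g z * f z)"
  unfolding test_elem_def by (auto intro!: elementary.mult)

lemma test_elem_dirderiv: assumes "test_elem f" shows "test_elem (dirderiv v f)"
proof -
  obtain R where R: "\<forall>z. norm z > R \<longrightarrow> f z = 0" using assms by (auto simp: test_elem_def)
  have "dirderiv v f z = 0" if "norm z > R" for z
  proof -
    have op: "open {z::'a. norm z > R}" by (intro open_Collect_less continuous_intros)
    have "((\<lambda>z. 0) has_derivative (\<lambda>v. 0)) (at z)" by simp
    then have "(f has_derivative (\<lambda>v. 0)) (at z)"
      by (rule has_derivative_transform_within_open[OF _ op]) (use R that in auto)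
    then show ?thesis using dirderiv_eqI by blast
  qed
  then show ?thesis using assms elementary_dirderiv by (auto simp: test_elem_def)
qed

lemma test_elem_test_fun:
  assumes "elementary f" "compact K" "K \<subseteq> S" "\<And>z. z \<notin> K \<Longrightarrow> f z = 0"
  shows "test_fun_on S f"
  using assms elementary_smooth unfolding test_fun_on_def by blast

lemma test_elem_bounded: assumes "test_elem f" obtains B where "B > 0" "\<And>z. \<bar>f z\<bar> \<le> B"
proof -
  obtain R where R: "\<forall>z. norm z > R \<longrightarrow> f z = 0" and e: "elementary f" using assms by (auto simp: test_elem_def)
  have "compact (f ` cball 0 R)" by (intro compact_continuous_image elementary_continuous e compact_cball)
  then have "bounded (f ` cball 0 R)" by (rule compact_imp_bounded)
  then obtain B where B: "B > 0" "\<And>z. z \<in> cball 0 R \<Longrightarrow> norm (f z) \<le> B"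
    unfolding bounded_pos by blast
  have "\<bar>f z\<bar> \<le> B" for z
  proof (cases "norm z > R")
    case True then show ?thesis using B(1) R by simp
  next
    case False then show ?thesis using B(2)[of z] by simp
  qed
  then show ?thesis using that B by blast
qed

lemma test_elem_integrable: assumes "test_elem f" shows "integrable lborel f"
proof -
  obtain R where R: "\<forall>z. norm z > R \<longrightarrow> f z = 0" and e: "elementary f" using assms by (auto simp: test_elem_def)
  have "integrable lborel (\<lambda>x. indicator (cball 0 R) x *\<^sub>R f x)"
    by (rule borel_integrable_compact) (use e elementary_continuous in auto)
  moreover have "(\<lambda>x. indicator (cball 0 R) x *\<^sub>R f x) = f"
  proof
    fix x show "indicator (cball 0 R) x *\<^sub>R f x = f x" using R by (cases "norm x \<le> R") auto
  qed
  ultimately show ?thesis by simp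
qed

lemma test_elem_measurable: "elementary f \<Longrightarrow> f \<in> borel_measurable borel"
  using elementary_continuous by (intro borel_measurable_continuous_onI)

section \<open>Differentiation under the integral sign and changes of variables\<close>

lemma has_real_derivative_integral:
  fixes f f' :: "real \<Rightarrow> 'b \<Rightarrow> real"
  assumes r: "r > 0"
    and int: "\<And>t. \<bar>t - s\<bar> < r \<Longrightarrow> integrable M (f t)"
    and der: "\<And>t y. \<bar>t - s\<bar> < r \<Longrightarrow> y \<in> space M \<Longrightarrow> ((\<lambda>t. f t y) has_real_derivative f' t y) (at t)"
    and bd: "\<And>t y. \<bar>t - s\<bar> < r \<Longrightarrow> y \<in> space M \<Longrightarrow> \<bar>f' t y\<bar> \<le> w y"
    and w: "integrable M w" and meas: "f' s \<in> borel_measurable M"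
  shows "((\<lambda>t. \<integral>y. f t y \<partial>M) has_real_derivative (\<integral>y. f' s y \<partial>M)) (at s)"
proof -
  \<comment> \<open>Within the ball of radius r every s + h stays in the range of the hypotheses.
    The mean value inequality bounds the difference quotients by w, so dominated convergence applies
    along every sequence.\<close>
  have "((\<lambda>h. ((\<integral>y. f (s+h) y \<partial>M) - (\<integral>y. f s y \<partial>M)) / h) \<longlongrightarrow> (\<integral>y. f' s y \<partial>M)) (at 0 within ball 0 r)"
    unfolding tendsto_at_iff_sequentially comp_def
  proof (intro allI impI)
    fix X :: "nat \<Rightarrow> real" assume X: "\<forall>i. X i \<in> ball 0 r - {0}" and lim: "X \<longlonglongrightarrow> 0"
    have Xr: "\<bar>X i\<bar> < r" "X i \<noteq> 0" for i using X[rule_format, of i] by (auto simp: dist_norm)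
    have *: "(\<integral>y. f (s+X i) y \<partial>M) - (\<integral>y. f s y \<partial>M) = (\<integral>y. f (s+X i) y - f s y \<partial>M)" for i
      by (intro Bochner_Integration.integral_diff[symmetric] int) (use Xr(1)[of i] r in simp_all)
    have "(\<lambda>i. \<integral>y. (f (s+X i) y - f s y) / X i \<partial>M) \<longlonglongrightarrow> (\<integral>y. f' s y \<partial>M)"
    proof (rule integral_dominated_convergence[where w=w])
      show "(\<lambda>y. (f (s+X i) y - f s y) / X i) \<in> borel_measurable M" for i
        by (intro borel_measurable_divide borel_measurable_diff borel_measurable_const
             borel_measurable_integrable int) (use Xr(1)[of i] r in simp_all)
      show "AE y in M. (\<lambda>i. (f (s+X i) y - f s y) / X i) \<longlonglongrightarrow> f' s y"
      proof (rule AE_I2)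
        fix y assume y: "y \<in> space M"
        have "((\<lambda>h. (f (s+h) y - f s y) / h) \<longlongrightarrow> f' s y) (at 0)"
          using der[of s y] r y unfolding DERIV_def by simp
        then show "(\<lambda>i. (f (s+X i) y - f s y) / X i) \<longlonglongrightarrow> f' s y"
          using Xr(2) lim unfolding tendsto_at_iff_sequentially comp_def by simp
      qed
      show "AE y in M. norm ((f (s+X i) y - f s y) / X i) \<le> w y" for i
      proof (rule AE_I2)
        fix y assume y: "y \<in> space M"
        have "norm (f (s+X i) y - f s y) \<le> w y * norm ((s + X i) - s)"
        proof (rule field_differentiable_bound[where f'="\<lambda>t. f' t y" and S="ball s r"])
          show "((\<lambda>t. f t y) has_field_derivative f' z y) (at z within ball s r)" if "z \<in> ball s r" for z
            by (rule has_field_derivative_at_within[OF der]) (use that y in \<open>simp_all add: dist_norm abs_minus_commute\<close>)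
          show "norm (f' z y) \<le> w y" if "z \<in> ball s r" for z
            using bd[of z y] that y by (simp add: dist_norm abs_minus_commute)
        qed (use Xr[of i] r in \<open>auto simp: dist_norm\<close>)
        then show "norm ((f (s+X i) y - f s y) / X i) \<le> w y"
          using Xr(2)[of i] by (simp add: pos_divide_le_eq del: divide_le_eq)
      qed
    qed (use w meas in auto)
    then show "(\<lambda>i. ((\<integral>y. f (s+X i) y \<partial>M) - (\<integral>y. f s y \<partial>M)) / X i) \<longlonglongrightarrow> (\<integral>y. f' s y \<partial>M)"
      unfolding * by simp
  qed
  then have "((\<lambda>h. ((\<integral>y. f (s+h) y \<partial>M) - (\<integral>y. f s y \<partial>M)) / h) \<longlongrightarrow> (\<integral>y. f' s y \<partial>M)) (at 0)"
    using r by (subst (asm) at_within_open) auto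
  then show ?thesis by (simp add: DERIV_def)
qed

lemma
  fixes T :: "'a::euclidean_space \<Rightarrow> 'a" and f :: "'a \<Rightarrow> 'b::{banach, second_countable_topology}"
  assumes T: "T \<in> borel_measurable borel" "distr lborel borel T = lborel"
    and f: "f \<in> borel_measurable borel"
  shows lborel_integral_preserved: "(LINT x|lborel. f (T x)) = (LINT x|lborel. f x)"
    and lborel_integrable_preserved: "integrable lborel (\<lambda>x. f (T x)) \<longleftrightarrow> integrable lborel f"
proof -
  have T': "T \<in> measurable lborel borel" using T(1) by simp
  show "(LINT x|lborel. f (T x)) = (LINT x|lborel. f x)"
    using integral_distr[OF T' f] T(2) by simp
  show "integrable lborel (\<lambda>x. f (T x)) \<longleftrightarrow> integrable lborel f"
    using integrable_distr_eq[OF T' f] T(2) by simp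
qed

lemma
  fixes f :: "'a::euclidean_space \<Rightarrow> real"
  assumes c: "c \<noteq> 0" and f: "f \<in> borel_measurable borel"
  shows lborel_integral_affine: "(LINT x|lborel. f x) = \<bar>c\<bar> ^ DIM('a) * (LINT x|lborel. f (t + c *\<^sub>R x))"
    and lborel_integrable_affine: "integrable lborel (\<lambda>x. f (t + c *\<^sub>R x)) \<longleftrightarrow> integrable lborel f"
proof -
  let ?T = "\<lambda>x::'a. t + c *\<^sub>R x"
  have T: "?T \<in> measurable lborel borel" by simp
  have A: "lborel = density (distr lborel borel ?T) (\<lambda>_. ennreal (\<bar>c\<bar> ^ DIM('a)))"
    using lborel_affine[OF c, of t] by simp
  have "(LINT x|lborel. f x) = (LINT x|distr lborel borel ?T. \<bar>c\<bar> ^ DIM('a) *\<^sub>R f x)"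
    by (subst A, subst integral_density) (use f in auto)
  then show "(LINT x|lborel. f x) = \<bar>c\<bar> ^ DIM('a) * (LINT x|lborel. f (?T x))"
    using f by (simp add: integral_distr[OF T])
  have "integrable lborel f \<longleftrightarrow> integrable (distr lborel borel ?T) (\<lambda>x. \<bar>c\<bar> ^ DIM('a) *\<^sub>R f x)"
    by (subst A, subst integrable_density) (use f in auto)
  then show "integrable lborel (\<lambda>x. f (?T x)) \<longleftrightarrow> integrable lborel f"
    using f c by (simp add: integrable_distr_eq[OF T] integrable_mult_left_iff)
qed

text \<open>By translation invariance the integral of f (t v + x) does not depend on t; its
  derivative at t = 0 is the integral in question.\<close>

lemma test_elem_integral_dirderiv:
  assumes f: "test_elem f" shows "(LINT x|lborel. dirderiv v f x) = 0"
proof -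
  obtain B where B: "B > 0" "\<And>z. \<bar>dirderiv v f z\<bar> \<le> B" using test_elem_bounded[OF test_elem_dirderiv[OF f]] by blast
  obtain R where R: "\<forall>z. norm z > R \<longrightarrow> dirderiv v f z = 0" using test_elem_dirderiv[OF f, of v] by (auto simp: test_elem_def)
  have e: "elementary f" and fm: "f \<in> borel_measurable borel" using test_elemD[OF f] test_elem_measurable by auto
  have fi: "integrable lborel (\<lambda>x. f (t *\<^sub>R v + x))" and fe: "(LINT x|lborel. f (t *\<^sub>R v + x)) = (LINT x|lborel. f x)" for t
    using lborel_integrable_affine[OF one_neq_zero fm, of "t *\<^sub>R v"]
      lborel_integral_affine[OF one_neq_zero fm, of "t *\<^sub>R v"] test_elem_integrable[OF f]
    unfolding abs_one power_one mult_1_left scaleR_one by simp_all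
  have "((\<lambda>t. LINT x|lborel. f (t *\<^sub>R v + x)) has_real_derivative (LINT x|lborel. dirderiv v f (0 *\<^sub>R v + x))) (at 0)"
  proof (rule has_real_derivative_integral[where r=1 and w="\<lambda>x. B * indicator (cball 0 (R + norm v)) x"])
    fix t y assume t: "\<bar>t - 0\<bar> < (1::real)"
    have lin: "((\<lambda>t. t *\<^sub>R v + y) has_derivative (\<lambda>h. h *\<^sub>R v)) (at t)"
      by (auto intro!: derivative_eq_intros)
    have fd: "(f has_derivative (\<lambda>v. dirderiv v f z)) (at z)" for z
      by (rule elementary_has_derivative[OF e])
    have "dirderiv (h *\<^sub>R v) f z = h * dirderiv v f z" for h z
      using linear_cmul[OF has_derivative_linear[OF fd[of z]], of h v] by simp
    then show "((\<lambda>t. f (t *\<^sub>R v + y)) has_real_derivative dirderiv v f (t *\<^sub>R v + y)) (at t)"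
      using has_derivative_compose[OF lin fd] by (simp add: has_field_derivative_def mult.commute[of _ "dirderiv v f (t *\<^sub>R v + y)"])
    show "\<bar>dirderiv v f (t *\<^sub>R v + y)\<bar> \<le> B * indicator (cball 0 (R + norm v)) y"
    proof (cases "norm y \<le> R + norm v")
      case True then show ?thesis using B by simp
    next
      case False
      have "norm (t *\<^sub>R v) \<le> norm v" using t by (auto intro: mult_left_le_one_le)
      then have "norm (t *\<^sub>R v + y) > R" using False norm_triangle_ineq4[of "t *\<^sub>R v + y" "t *\<^sub>R v"] by simp
      then show ?thesis using R False by simp
    qed
  qed (use fi test_elem_measurable[OF elementary_dirderiv[OF e, of v]] emeasure_bounded_finite[of "cball 0 (R + norm v)"] in \<open>auto\<close>)
  then have "((\<lambda>t::real. LINT x|lborel. f x) has_real_derivative (LINT x|lborel. dirderiv v f x)) (at 0)"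
    by (simp add: fe)
  then show ?thesis using DERIV_unique DERIV_const by blast
qed

section \<open>Reflections preserve Lebesgue measure\<close>

lemma nn_integral_lborel_affine:
  fixes f :: "'a::euclidean_space \<Rightarrow> ennreal"
  assumes c: "\<bar>c\<bar> = 1" and f: "f \<in> borel_measurable borel"
  shows "(\<integral>\<^sup>+x. f (t + c *\<^sub>R x) \<partial>lborel) = (\<integral>\<^sup>+x. f x \<partial>lborel)"
proof -
  have "c \<noteq> 0" using c by auto
  have A: "lborel = density (distr lborel borel (\<lambda>x. t + c *\<^sub>R x)) (\<lambda>_. 1)"
    using lborel_affine[OF \<open>c \<noteq> 0\<close>, of t] c by simp
  show ?thesis
    by (subst (2) A) (use f in \<open>simp add: nn_integral_density nn_integral_distr\<close>)
qed

text \<open>Uniqueness of Haar measure: both orders of integration of \<open>1\<^sub>A(x) 1\<^sub>B(T w - x)\<close> over \<open>(x, w)\<close>, with the unit ball as \<open>B\<close>.\<close>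

lemma lborel_distr_orthogonal:
  fixes T :: "'a::euclidean_space \<Rightarrow> 'a"
  assumes lin: "linear T" and nrm: "\<And>x. norm (T x) = norm x" and inv: "\<And>x. T (T x) = x"
  shows "distr lborel borel T = lborel"
proof (rule measure_eqI)
  fix A assume "A \<in> sets (distr lborel borel T)"
  then have A[measurable]: "A \<in> sets borel" by simp
  have Tm[measurable]: "T \<in> borel_measurable borel"
    using lin by (intro borel_measurable_continuous_onI linear_continuous_on) (auto simp: linear_conv_bounded_linear)
  define B :: "'a set" where "B = ball 0 1"
  have B[measurable]: "B \<in> sets borel" by (simp add: B_def)
  \<comment> \<open>As T is a linear involution, T w - z = T (w - T z), and translation invariance
    removes z.\<close>
  have inv_int: "(\<integral>\<^sup>+w. indicator S (T w - z) \<partial>lborel) = emeasure lborel (T -` S)"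
    if [measurable]: "S \<in> sets borel" for S z
  proof -
    have "T w - z = T (- T z + 1 *\<^sub>R w)" for w using lin inv by (simp add: linear_add linear_neg linear_diff)
    then have "(\<integral>\<^sup>+w. indicator S (T w - z) \<partial>lborel) = (\<integral>\<^sup>+w. indicator S (T (- T z + 1 *\<^sub>R w)) \<partial>lborel)" by simp
    also have "\<dots> = (\<integral>\<^sup>+w. indicator S (T w) \<partial>lborel)"
      by (rule nn_integral_lborel_affine) auto
    also have "\<dots> = (\<integral>\<^sup>+w. indicator (T -` S) w \<partial>lborel)" by (simp add: indicator_def)
    also have "\<dots> = emeasure lborel (T -` S)"
      using measurable_sets[OF Tm that] by (intro nn_integral_indicator) simp
    finally show ?thesis .
  qed
  have "emeasure lborel A * emeasure lborel B = (\<integral>\<^sup>+x. indicator A x * emeasure lborel B \<partial>lborel)"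
    by (simp add: nn_integral_multc)
  also have "T -` B = B" by (auto simp: B_def nrm)
  then have "(\<integral>\<^sup>+x. indicator A x * emeasure lborel B \<partial>lborel) =
     (\<integral>\<^sup>+x. \<integral>\<^sup>+w. indicator A x * indicator B (T w - x) \<partial>lborel \<partial>lborel)"
    by (simp add: nn_integral_cmult inv_int)
  also have "\<dots> = (\<integral>\<^sup>+w. \<integral>\<^sup>+x. indicator A x * indicator B (T w - x) \<partial>lborel \<partial>lborel)"
    by (rule lborel_pair.Fubini'[symmetric]) measurable
  \<comment> \<open>The substitution x = T w - z exchanges the roles of A and B.\<close>
  also have "\<dots> = (\<integral>\<^sup>+w. \<integral>\<^sup>+z. indicator A (T w - z) * indicator B z \<partial>lborel \<partial>lborel)"
  proof (rule nn_integral_cong)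
    fix w
    have "(\<integral>\<^sup>+z. indicator A (T w + (-1) *\<^sub>R z) * indicator B (T w - (T w + (-1) *\<^sub>R z)) \<partial>lborel) =
       (\<integral>\<^sup>+x. indicator A x * indicator B (T w - x) \<partial>lborel)"
      by (rule nn_integral_lborel_affine[where f="\<lambda>x. indicator A x * indicator B (T w - x)"]) auto
    then show "(\<integral>\<^sup>+x. indicator A x * indicator B (T w - x) \<partial>lborel) =
       (\<integral>\<^sup>+z. indicator A (T w - z) * indicator B z \<partial>lborel)" by simp
  qed
  also have "\<dots> = (\<integral>\<^sup>+z. \<integral>\<^sup>+w. indicator A (T w - z) * indicator B z \<partial>lborel \<partial>lborel)"
    by (rule lborel_pair.Fubini') measurable
  also have "\<dots> = emeasure lborel (T -` A) * emeasure lborel B"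
    by (simp add: nn_integral_multc inv_int nn_integral_cmult)
  finally have eq: "emeasure lborel A * emeasure lborel B = emeasure lborel (T -` A) * emeasure lborel B" .
  have "emeasure lborel B \<noteq> \<infinity>" "emeasure lborel B \<noteq> 0"
    using emeasure_lborel_ball_finite[of "0::'a" 1] content_ball_pos[of 1 "0::'a"] by (auto simp: B_def measure_def)
  then have "emeasure lborel A = emeasure lborel (T -` A)"
    using eq ennreal_mult_cancel_left[of "emeasure lborel B" "emeasure lborel A" "emeasure lborel (T -` A)"] by (simp add: mult.commute)
  then show "emeasure (distr lborel borel T) A = emeasure lborel A"
    by (simp add: emeasure_distr)
qed simp

text \<open>For a unit vector e this is the mirror image in the hyperplane of all x with
  \<open>x \<bullet> e = \<tau>\<close>.\<close>

definition refl_at :: "'a::euclidean_space \<Rightarrow> real \<Rightarrow> 'a \<Rightarrow> 'a" where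
  "refl_at e \<tau> x = x - (2 * (x \<bullet> e - \<tau>)) *\<^sub>R e"

lemma refl_at_inner: "norm e = 1 \<Longrightarrow> refl_at e \<tau> x \<bullet> e = 2 * \<tau> - x \<bullet> e"
  by (simp add: refl_at_def inner_diff_left norm_eq_1)

lemma refl_at_refl_at: "norm e = 1 \<Longrightarrow> refl_at e \<tau> (refl_at e \<tau> x) = x"
  unfolding refl_at_def[of e \<tau> "refl_at e \<tau> x"] refl_at_inner
  by (simp add: refl_at_def algebra_simps flip: scaleR_add_left)

text \<open>The sign of the additional term tells whether x is closer to y or to the mirror image of
  y. Every comparison of heat kernels across the plane rests on it.\<close>

lemma dist_refl_at_sq:
  assumes "norm e = 1"
  shows "(norm (x - refl_at e \<tau> y))\<^sup>2 = (norm (x - y))\<^sup>2 + 4 * (\<tau> - x \<bullet> e) * (\<tau> - y \<bullet> e)"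
proof -
  have ee: "e \<bullet> e = 1" using assms by (simp add: norm_eq_1)
  have "x - refl_at e \<tau> y = (x - y) + (2 * (y \<bullet> e - \<tau>)) *\<^sub>R e" by (simp add: refl_at_def)
  then have "(norm (x - refl_at e \<tau> y))\<^sup>2 = (norm (x - y))\<^sup>2 + 2 * ((2 * (y \<bullet> e - \<tau>)) * ((x - y) \<bullet> e))
      + (2 * (y \<bullet> e - \<tau>)) * ((2 * (y \<bullet> e - \<tau>)) * (e \<bullet> e))"
    by (simp only: power2_norm_eq_inner inner_add_left inner_add_right inner_scaleR_left inner_scaleR_right
         inner_commute[of e "x - y"]) (simp add: algebra_simps)
  then show ?thesis by (simp add: ee inner_diff_left algebra_simps)
qed

lemma dist_refl_at_refl_at:
  assumes "norm e = 1" shows "norm (refl_at e \<tau> x - refl_at e \<tau> y) = norm (x - y)"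
proof -
  have "(norm (refl_at e \<tau> x - refl_at e \<tau> y))\<^sup>2 = (norm (x - y))\<^sup>2"
    unfolding dist_refl_at_sq[OF assms] norm_minus_commute[of "refl_at e \<tau> x" y] refl_at_inner[OF assms]
    by (simp add: norm_minus_commute algebra_simps)
  then show ?thesis by simp
qed

lemma continuous_refl_at: "continuous_on S (refl_at e \<tau>)"
  unfolding refl_at_def[abs_def] by (intro continuous_intros)

lemma refl_at_measurable: "refl_at e \<tau> \<in> borel_measurable borel"
  by (intro borel_measurable_continuous_onI continuous_refl_at)

text \<open>The reflection at level 0 is a linear isometric involution; the one at level \<tau> is
  this followed by a translation by 2 \<tau> e.\<close>

lemma lborel_distr_refl_at:
  assumes e: "norm e = 1" shows "distr lborel borel (refl_at e \<tau>) = lborel"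
proof -
  have lin: "linear (refl_at e 0)"
    by (rule linearI) (simp_all add: refl_at_def algebra_simps inner_add_left flip: scaleR_add_left)
  have "norm (refl_at e 0 x) = norm x" for x
    using dist_refl_at_refl_at[OF e, of 0 x 0] by (simp add: refl_at_def)
  then have D: "distr lborel borel (refl_at e 0) = lborel"
    using lborel_distr_orthogonal[OF lin] refl_at_refl_at[OF e] by blast
  have "refl_at e \<tau> = (\<lambda>x. (2 * \<tau>) *\<^sub>R e + x) \<circ> refl_at e 0"
    by (auto simp: refl_at_def algebra_simps fun_eq_iff)
  then have "distr lborel borel (refl_at e \<tau>) = distr (distr lborel borel (refl_at e 0)) borel (\<lambda>x. (2 * \<tau>) *\<^sub>R e + x)"
    by (simp add: distr_distr refl_at_measurable)
  then show ?thesis unfolding D by (simp add: lborel_distr_plus)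
qed

section \<open>The Gaussian heat semigroup\<close>

text \<open>On the shell n <= |z| < n + 1 the integrand is at most exp (- n^2), and the volume of
  the ball of radius n + 1 grows only polynomially in n.\<close>

lemma integrable_exp_norm_sq_1: "integrable lborel (\<lambda>z::'a::euclidean_space. exp (- (norm z)\<^sup>2))"
proof (rule integrableI_nonneg)
  let ?N = "DIM('a)"
  have "(\<integral>\<^sup>+z. ennreal (exp (- (norm (z::'a))\<^sup>2)) \<partial>lborel) \<le>
      (\<integral>\<^sup>+z. (\<Sum>n. ennreal (exp (- (real n)\<^sup>2)) * indicator (ball 0 (real n + 1)) (z::'a)) \<partial>lborel)"
  proof (rule nn_integral_mono)
    fix z :: 'a
    define n where "n = nat \<lfloor>norm z\<rfloor>"
    have n: "real n \<le> norm z" "norm z < real n + 1"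
    proof -
      have "real n = of_int \<lfloor>norm z\<rfloor>" by (simp add: n_def)
      then show "real n \<le> norm z" "norm z < real n + 1" by linarith+
    qed
    let ?g = "\<lambda>n. ennreal (exp (- (real n)\<^sup>2)) * indicator (ball 0 (real n + 1)) z"
    have "ennreal (exp (- (norm z)\<^sup>2)) \<le> ?g n" using n by (auto intro!: ennreal_leI power_mono)
    also have "\<dots> = sum ?g {n}" by (subst sum.insert) simp_all
    also have "\<dots> \<le> suminf ?g" by (rule sum_le_suminf) auto
    finally show "ennreal (exp (- (norm z)\<^sup>2)) \<le> suminf ?g" .
  qed
  also have "\<dots> = (\<Sum>n. ennreal (exp (- (real n)\<^sup>2)) * emeasure lborel (ball (0::'a) (real n + 1)))"
  proof -
    have "(\<integral>\<^sup>+z. ennreal (exp (- (real n)\<^sup>2)) * indicator (ball 0 (real n + 1)) (z::'a) \<partial>lborel) =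
      ennreal (exp (- (real n)\<^sup>2)) * emeasure lborel (ball (0::'a) (real n + 1))" for n
      by (rule nn_integral_cmult_indicator) simp
    moreover have "(\<lambda>z::'a. ennreal (exp (- (real n)\<^sup>2)) * indicator (ball 0 (real n + 1)) z) \<in> borel_measurable lborel" for n
      by (intro borel_measurable_times_ennreal borel_measurable_indicator) auto
    ultimately show ?thesis by (simp only: nn_integral_suminf)
  qed
  also have "\<dots> = (\<Sum>n. ennreal (exp (- (real n)\<^sup>2) * ((real n + 1) ^ ?N * measure lborel (ball (0::'a) 1))))"
  proof (intro suminf_cong)
    fix n :: nat
    have "emeasure lborel (ball (0::'a) (real n + 1)) = ennreal (measure lborel (ball (0::'a) (real n + 1)))"
      by (rule emeasure_eq_ennreal_measure) (use emeasure_lborel_ball_finite[of "0::'a" "real n + 1"] in auto)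
    also have "measure lborel (ball (0::'a) (real n + 1)) = (real n + 1) ^ ?N * measure lborel (ball (0::'a) 1)"
      using content_ball_conv_unit_ball[of "real n + 1" "0::'a"] by simp
    finally show "ennreal (exp (- (real n)\<^sup>2)) * emeasure lborel (ball (0::'a) (real n + 1)) =
      ennreal (exp (- (real n)\<^sup>2) * ((real n + 1) ^ ?N * measure lborel (ball (0::'a) 1)))"
      by (simp add: ennreal_mult')
  qed
  also have "\<dots> < \<infinity>"
  proof -
    have "summable (\<lambda>n. exp (- (real n)\<^sup>2) * ((real n + 1) ^ ?N * measure lborel (ball (0::'a) 1)))"
    proof (rule summable_comparison_test)
      let ?C = "fact (?N+2) * exp 2 * measure lborel (ball (0::'a) 1)"
      show "\<exists>N. \<forall>n\<ge>N. norm (exp (- (real n)\<^sup>2) * ((real n + 1) ^ ?N * measure lborel (ball (0::'a) 1)))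
          \<le> ?C * (1 / (real (n + 1))\<^sup>2)"
      proof (intro exI allI impI)
        fix n :: nat assume "0 \<le> n"
        \<comment> \<open>Of the N + 2 powers, N pay for the volume of the ball and two produce the
          convergent majorant 1 / (n + 1)^2.\<close>
        have "(real n + 1) ^ (?N+2) \<le> fact (?N+2) * exp (real n + 1)" by (rule power_le_fact_exp) simp
        also have "\<dots> \<le> fact (?N+2) * exp ((real n)\<^sup>2 + 2)"
        proof -
          have "real n \<le> (real n)\<^sup>2" by (cases n) (auto simp: power2_eq_square algebra_simps)
          then have "real n + 1 \<le> (real n)\<^sup>2 + 2" by linarith
          then show ?thesis by (intro mult_left_mono iffD2[OF exp_le_cancel_iff]) auto
        qed
        finally have "(real n + 1) ^ ?N * (real n + 1)\<^sup>2 * exp (- (real n)\<^sup>2)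
            \<le> fact (?N+2) * exp ((real n)\<^sup>2 + 2) * exp (- (real n)\<^sup>2)"
          unfolding power_add by (intro mult_right_mono) auto
        also have "\<dots> = fact (?N+2) * exp 2" by (simp add: exp_add exp_minus)
        finally have "exp (- (real n)\<^sup>2) * (real n + 1) ^ ?N \<le> fact (?N+2) * exp 2 * (1 / (real n + 1)\<^sup>2)"
          by (simp add: divide_simps mult_ac del: fact_Suc)
        then have "exp (- (real n)\<^sup>2) * (real n + 1) ^ ?N * measure lborel (ball (0::'a) 1) \<le>
           fact (?N+2) * exp 2 * (1 / (real n + 1)\<^sup>2) * measure lborel (ball (0::'a) 1)"
          by (rule mult_right_mono) simp
        then show "norm (exp (- (real n)\<^sup>2) * ((real n + 1) ^ ?N * measure lborel (ball (0::'a) 1)))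
          \<le> ?C * (1 / (real (n + 1))\<^sup>2)"
          by (simp add: mult_ac add.commute del: fact_Suc)
      qed
      have "summable (\<lambda>n. 1 / (real (Suc n))\<^sup>2)"
        using inverse_power_summable[of 2, where 'a=real] by (subst summable_Suc_iff) (simp add: inverse_eq_divide)
      then show "summable (\<lambda>n. ?C * (1 / (real (n + 1))\<^sup>2))" by (intro summable_mult) simp
    qed
    then show ?thesis by (subst suminf_ennreal2) (auto simp: top_unique)
  qed
  finally show "(\<integral>\<^sup>+z. ennreal (exp (- (norm (z::'a))\<^sup>2)) \<partial>lborel) < \<infinity>" .
qed auto

lemma integrable_exp_norm_sq:
  assumes "c > 0" shows "integrable lborel (\<lambda>z::'a::euclidean_space. exp (- c * (norm z)\<^sup>2))"
proof -
  have "integrable lborel (\<lambda>z::'a. exp (- (norm (0 + sqrt c *\<^sub>R z))\<^sup>2))"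
    by (subst lborel_integrable_affine) (use assms integrable_exp_norm_sq_1 in auto)
  then show ?thesis using assms by (simp add: power_mult_distrib)
qed

text \<open>Half of the exponent absorbs the power of the norm. In the constant, 1 covers |z| <= 1
  and the other term comes from \<open>power_le_fact_exp\<close> at (c / 2) |z|^2.\<close>

lemma integrable_norm_power_exp:
  assumes c: "c > 0" shows "integrable lborel (\<lambda>z::'a::euclidean_space. norm z ^ j * exp (- c * (norm z)\<^sup>2))"
proof (rule Bochner_Integration.integrable_bound)
  let ?C = "1 + fact j / (c/2) ^ j"
  show "integrable lborel (\<lambda>z::'a. ?C * exp (- (c/2) * (norm z)\<^sup>2))"
    using integrable_exp_norm_sq[of "c/2", where 'a='a] c by (intro integrable_mult_right) auto
  show "AE z in lborel. norm (norm (z::'a) ^ j * exp (- c * (norm z)\<^sup>2)) \<le> norm (?C * exp (- (c/2) * (norm z)\<^sup>2))"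
  proof (rule AE_I2)
    fix z :: 'a
    let ?r = "norm z"
    have "(c/2 * ?r\<^sup>2) ^ j \<le> fact j * exp (c/2 * ?r\<^sup>2)" using c by (intro power_le_fact_exp) auto
    then have "(?r\<^sup>2) ^ j \<le> fact j / (c/2) ^ j * exp (c/2 * ?r\<^sup>2)"
      using c by (simp only: power_mult_distrib) (simp add: field_simps)
    moreover have "?r ^ j \<le> 1 + (?r\<^sup>2) ^ j"
    proof (cases "?r \<le> 1")
      case True then have "?r ^ j \<le> 1" by (simp add: power_le_one)
      then show ?thesis by (smt (verit) zero_le_power zero_le_power2)
    next
      case False then have "?r ^ j \<le> ?r ^ (2*j)" by (intro power_increasing) auto
      then show ?thesis by (simp add: power_mult)
    qed
    moreover have "1 \<le> exp (c/2 * ?r\<^sup>2)" using c by simp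
    ultimately have "?r ^ j \<le> ?C * exp (c/2 * ?r\<^sup>2)" unfolding distrib_right by linarith
    then have "?r ^ j * exp (- c * ?r\<^sup>2) \<le> ?C * exp (c/2 * ?r\<^sup>2) * exp (- c * ?r\<^sup>2)"
      by (rule mult_right_mono) simp
    also have "\<dots> = ?C * (exp (c/2 * ?r\<^sup>2) * exp (- c * ?r\<^sup>2))" by (rule mult.assoc)
    also have "exp (c/2 * ?r\<^sup>2) * exp (- c * ?r\<^sup>2) = exp (- (c/2) * ?r\<^sup>2)"
      unfolding exp_add[symmetric] by (rule arg_cong[of _ _ exp]) (simp add: algebra_simps)
    finally show "norm (?r ^ j * exp (- c * ?r\<^sup>2)) \<le> norm (?C * exp (- (c/2) * ?r\<^sup>2))"
      using c by simp
  qed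
qed simp

text \<open>The value of the Gaussian integral is never needed, so it serves as the normalising constant.\<close>

definition heat :: "real \<Rightarrow> 'a::euclidean_space \<Rightarrow> real" where
  "heat s z = s powr (- (DIM('a) / 2)) * exp (- (norm z)\<^sup>2 / (4 * s)) / (LINT w::'a|lborel. exp (- (norm w)\<^sup>2 / 4))"

lemma heat_const_pos: "(LINT w::'a::euclidean_space|lborel. exp (- (norm w)\<^sup>2 / 4)) > 0"
proof -
  have i: "integrable lborel (\<lambda>w::'a. exp (- (norm w)\<^sup>2 / 4))" using integrable_exp_norm_sq[of "1/4", where 'a='a] by simp
  have "exp (-1/4) * measure lborel (ball (0::'a) 1) = (LINT w::'a|lborel. exp (-1/4 :: real) * indicator (ball 0 1) w)" by simp
  also have "\<dots> \<le> (LINT w::'a|lborel. exp (- (norm w)\<^sup>2 / 4))"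
  proof (rule integral_mono[OF _ i])
    show "integrable lborel (\<lambda>w::'a. exp (-1/4 :: real) * indicator (ball 0 1) w)"
      using emeasure_lborel_ball_finite[of "0::'a" 1] by auto
    fix w :: 'a show "exp (-1/4 :: real) * indicator (ball 0 1) w \<le> exp (- (norm w)\<^sup>2 / 4)"
      by (auto simp: indicator_def abs_square_le_1)
  qed
  finally show ?thesis using content_ball_pos[of 1 "0::'a"] by (smt (verit) exp_gt_zero mult_pos_pos)
qed

lemma heat_pos: "s > 0 \<Longrightarrow> heat s z > 0"
  using heat_const_pos[where 'a='a] by (simp add: heat_def)

lemma heat_measurable [measurable]: "heat s \<in> borel_measurable borel"
  unfolding heat_def[abs_def] by measurable

lemma integrable_heat_moment:
  assumes "s > 0" shows "integrable lborel (\<lambda>z::'a::euclidean_space. norm z ^ j * heat s z)"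
proof -
  have "integrable lborel (\<lambda>z::'a. (s powr (- (DIM('a) / 2)) / (LINT w::'a|lborel. exp (- (norm w)\<^sup>2 / 4))) *
     (norm z ^ j * exp (- (1/(4 * s)) * (norm z)\<^sup>2)))"
    using integrable_norm_power_exp[of "1/(4 * s)" j] assms by (intro integrable_mult_right) auto
  then show ?thesis by (simp add: heat_def mult_ac)
qed

text \<open>Parabolic scaling: with y = x - sqrt s w, estimates at time s become moments of the
  kernel at time 1.\<close>

lemma heat_scale:
  assumes "s > 0" shows "sqrt s ^ DIM('a) * heat s (sqrt s *\<^sub>R w) = heat 1 (w::'a::euclidean_space)"
proof -
  have "sqrt s ^ DIM('a) = s powr (DIM('a) / 2)"
    using assms by (simp add: powr_half_sqrt[symmetric] powr_realpow[symmetric] powr_powr)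
  moreover have "s powr (DIM('a) / 2) * s powr (- (DIM('a) / 2)) = 1"
    using assms by (simp flip: powr_add)
  ultimately show ?thesis using assms by (simp add: heat_def power_mult_distrib mult.assoc[symmetric])
qed

definition heat_op :: "real \<Rightarrow> ('a::euclidean_space \<Rightarrow> real) \<Rightarrow> 'a \<Rightarrow> real" where
  "heat_op s f x = (LINT y|lborel. heat s (x - y) * f y)"

lemma lborel_integral_heat_subst:
  fixes g :: "'a::euclidean_space \<Rightarrow> real"
  assumes s: "s > 0" and g[measurable]: "g \<in> borel_measurable borel"
  shows "(LINT y|lborel. heat s (x - y) * g y) = (LINT w|lborel. heat 1 w * g (x - sqrt s *\<^sub>R w))"
proof -
  have "(LINT y|lborel. heat s (x - y) * g y) = \<bar>- sqrt s\<bar> ^ DIM('a) *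
      (LINT w|lborel. heat s (x - (x + (- sqrt s) *\<^sub>R w)) * g (x + (- sqrt s) *\<^sub>R w))"
    by (rule lborel_integral_affine) (use s in auto)
  also have "\<dots> = (LINT w|lborel. sqrt s ^ DIM('a) * heat s (sqrt s *\<^sub>R w) * g (x - sqrt s *\<^sub>R w))"
    using s by (simp add: mult.assoc)
  finally show ?thesis unfolding heat_scale[OF s] .
qed

lemma heat_integral_1: "(LINT w|lborel. heat 1 (w::'a::euclidean_space)) = 1"
  using heat_const_pos[where 'a='a] by (simp add: heat_def)

text \<open>The bound is a parameter because the tail, gradient and Lipschitz estimates are linear
  in it.\<close>

definition bdd_meas :: "real \<Rightarrow> ('a::euclidean_space \<Rightarrow> real) \<Rightarrow> bool" where
  "bdd_meas M f \<longleftrightarrow> f \<in> borel_measurable borel \<and> (\<forall>x. \<bar>f x\<bar> \<le> M)"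

lemma heat_shift_integrable:
  assumes "s > 0" shows "integrable lborel (\<lambda>y. norm (x - y) ^ j * heat s (x - (y::'a::euclidean_space)))"
proof -
  have "integrable lborel (\<lambda>y. norm (x - (x + (-1) *\<^sub>R y)) ^ j * heat s (x - (x + (-1) *\<^sub>R (y::'a))))"
    using integrable_heat_moment[OF assms, of j, where 'a='a] by simp
  then show ?thesis by (subst (asm) lborel_integrable_affine) auto
qed

lemma heat_op_integrable_gen:
  fixes f :: "'a::euclidean_space \<Rightarrow> real"
  assumes s: "s > 0" and f: "bdd_meas M f"
    and g: "g \<in> borel_measurable borel" "\<And>y. \<bar>g y\<bar> \<le> C * norm (x - y) ^ j"
  shows "integrable lborel (\<lambda>y. g y * heat s (x - y) * f y)"
proof (rule Bochner_Integration.integrable_bound)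
  show "integrable lborel (\<lambda>y. C * M * (norm (x - y) ^ j * heat s (x - y)))"
    by (intro integrable_mult_right heat_shift_integrable s)
  show "AE y in lborel. norm (g y * heat s (x - y) * f y) \<le> norm (C * M * (norm (x - y) ^ j * heat s (x - y)))"
  proof (rule AE_I2)
    fix y
    have "\<bar>g y\<bar> * \<bar>f y\<bar> * heat s (x - y) \<le> (C * norm (x - y) ^ j) * M * heat s (x - y)"
      using f g(2)[of y] heat_pos[OF s, of "x - y"] abs_ge_zero[of "g y"]
      by (intro mult_right_mono mult_mono) (auto simp: bdd_meas_def intro: order_trans)
    also have "\<dots> = C * M * (norm (x - y) ^ j * heat s (x - y))" by (simp only: mult_ac)
    also have "\<dots> \<le> norm (C * M * (norm (x - y) ^ j * heat s (x - y)))" by simp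
    finally show "norm (g y * heat s (x - y) * f y) \<le> norm (C * M * (norm (x - y) ^ j * heat s (x - y)))"
      using heat_pos[OF s, of "x - y"] by (simp add: abs_mult mult.commute mult.left_commute)
  qed
qed (use f g in \<open>auto simp: bdd_meas_def\<close>)

lemma heat_op_integrable:
  assumes "s > 0" "bdd_meas M f" shows "integrable lborel (\<lambda>y. heat s (x - y) * f y)"
  using heat_op_integrable_gen[OF assms, of "\<lambda>_. 1" 1 x 0] by simp

lemma heat_op_subst:
  assumes "s > 0" "bdd_meas M f"
  shows "heat_op s f x = (LINT w|lborel. heat 1 w * f (x - sqrt s *\<^sub>R w))"
  unfolding heat_op_def using assms by (intro lborel_integral_heat_subst) (auto simp: bdd_meas_def)

text \<open>Chebyshev's inequality with the fourth moment: where sqrt s |w| >= r one has 1 <= s^2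
  |w|^4 / r^4. The fourth power makes the error O(s^2), of smaller order than the linear growth in s
  with which it competes.\<close>

lemma heat_op_tail:
  fixes f :: "'a::euclidean_space \<Rightarrow> real"
  assumes s: "s > 0" and f: "bdd_meas M f" and r: "r > 0" and z: "\<And>y. norm (y - x) < r \<Longrightarrow> f y = 0"
  shows "\<bar>heat_op s f x\<bar> \<le> M * s\<^sup>2 / r ^ 4 * (LINT w::'a|lborel. norm w ^ 4 * heat 1 w)"
proof -
  have M: "M \<ge> 0" using f by (auto simp: bdd_meas_def intro: order_trans[OF abs_ge_zero])
  have "\<bar>heat_op s f x\<bar> \<le> (LINT w|lborel. \<bar>heat 1 w * f (x - sqrt s *\<^sub>R w)\<bar>)"
    unfolding heat_op_subst[OF s f] by (rule integral_abs_bound)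
  also have "\<dots> \<le> (LINT w::'a|lborel. (M * s\<^sup>2 / r ^ 4) * (norm w ^ 4 * heat 1 w))"
  proof (rule integral_mono')
    show "integrable lborel (\<lambda>w::'a. (M * s\<^sup>2 / r ^ 4) * (norm w ^ 4 * heat 1 w))"
      by (intro integrable_mult_right integrable_heat_moment) simp
    fix w :: 'a
    have h: "heat 1 w > 0" by (simp add: heat_pos)
    have "\<bar>f (x - sqrt s *\<^sub>R w)\<bar> \<le> M * s\<^sup>2 / r ^ 4 * norm w ^ 4"
    proof (cases "sqrt s * norm w < r")
      case True then show ?thesis using z[of "x - sqrt s *\<^sub>R w"] s M r by simp
    next
      case False
      then have "r ^ 4 \<le> (sqrt s * norm w) ^ 4" using r by (intro power_mono) auto
      also have "\<dots> = s\<^sup>2 * norm w ^ 4" using s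
        by (simp add: power_mult_distrib power4_eq_xxxx power2_eq_square mult.assoc[symmetric])
      finally have "1 \<le> s\<^sup>2 / r ^ 4 * norm w ^ 4" using r by (simp add: divide_simps)
      then have "M * 1 \<le> M * (s\<^sup>2 / r ^ 4 * norm w ^ 4)" using M by (rule mult_left_mono)
      moreover have "\<bar>f (x - sqrt s *\<^sub>R w)\<bar> \<le> M" using f by (auto simp: bdd_meas_def)
      ultimately show ?thesis by simp
    qed
    then have "heat 1 w * \<bar>f (x - sqrt s *\<^sub>R w)\<bar> \<le> heat 1 w * (M * s\<^sup>2 / r ^ 4 * norm w ^ 4)"
      using h by (intro mult_left_mono) auto
    then show "\<bar>heat 1 w * f (x - sqrt s *\<^sub>R w)\<bar> \<le> (M * s\<^sup>2 / r ^ 4) * (norm w ^ 4 * heat 1 w)"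
      using h by (simp add: abs_mult mult_ac)
    show "0 \<le> (M * s\<^sup>2 / r ^ 4) * (norm w ^ 4 * heat 1 w)" using h M by simp
  qed
  finally show ?thesis by simp
qed

lemma heat_op_mono:
  assumes s: "s > 0" and f: "bdd_meas M f" and g: "bdd_meas M' g" and "\<And>x. f x \<le> g x"
  shows "heat_op s f x \<le> heat_op s g x"
  unfolding heat_op_def
  by (intro integral_mono heat_op_integrable[OF s f] heat_op_integrable[OF s g] mult_left_mono order.strict_implies_order[OF heat_pos])
     (auto intro: assms)

lemma heat_op_const: "s > 0 \<Longrightarrow> heat_op s (\<lambda>_. c) x = c"
  using heat_op_subst[of s "\<bar>c\<bar>" "\<lambda>_. c" x] by (simp add: bdd_meas_def heat_integral_1)

lemma heat_op_diff:
  assumes s: "s > 0" and f: "bdd_meas M f" and g: "bdd_meas M' g"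
  shows "heat_op s (\<lambda>x. f x - g x) x = heat_op s f x - heat_op s g x"
  unfolding heat_op_def right_diff_distrib
  by (intro Bochner_Integration.integral_diff heat_op_integrable[OF s f] heat_op_integrable[OF s g])

lemma heat_op_cmult: "heat_op s (\<lambda>x. c * f x) x = c * heat_op s f x"
  unfolding heat_op_def mult.left_commute[of _ c] by simp

lemma heat_op_bound:
  assumes s: "s > 0" and f: "bdd_meas M f" shows "\<bar>heat_op s f x\<bar> \<le> M"
proof -
  have c: "bdd_meas \<bar>c\<bar> (\<lambda>_. c)" for c by (simp add: bdd_meas_def)
  have "heat_op s f x \<le> heat_op s (\<lambda>_. M) x"
    by (rule heat_op_mono[OF s f c]) (use f in \<open>auto simp: bdd_meas_def intro: order_trans[OF abs_ge_self]\<close>)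
  moreover have "heat_op s (\<lambda>_. - M) x \<le> heat_op s f x"
    by (rule heat_op_mono[OF s c f]) (use f in \<open>auto simp: bdd_meas_def abs_le_iff\<close>, smt (verit))
  ultimately show ?thesis using heat_op_const[OF s, of M x] heat_op_const[OF s, of "- M" x] by linarith
qed

lemma heat_op_tendsto:
  fixes f :: "'a::euclidean_space \<Rightarrow> real"
  assumes f: "bdd_meas M f" and c: "isCont f x"
  shows "((\<lambda>s. heat_op s f x) \<longlongrightarrow> f x) (at_right 0)"
proof -
  have [measurable]: "f \<in> borel_measurable borel" using f by (simp add: bdd_meas_def)
  have "((\<lambda>s. LINT w|lborel. heat 1 w * f (x - sqrt s *\<^sub>R w)) \<longlongrightarrow> (LINT w::'a|lborel. heat 1 w * f x)) (at 0 within {0<..})"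
    unfolding tendsto_at_iff_sequentially comp_def
  proof (intro allI impI)
    fix X :: "nat \<Rightarrow> real" assume X: "\<forall>i. X i \<in> {0<..} - {0}" "X \<longlonglongrightarrow> 0"
    show "(\<lambda>i. LINT w|lborel. heat 1 w * f (x - sqrt (X i) *\<^sub>R w)) \<longlonglongrightarrow> (LINT w::'a|lborel. heat 1 w * f x)"
    proof (rule integral_dominated_convergence[where w="\<lambda>w::'a. M * heat 1 w"])
      show "AE w in lborel. (\<lambda>i. heat 1 w * f (x - sqrt (X i) *\<^sub>R w)) \<longlonglongrightarrow> heat 1 w * f x"
      proof (intro AE_I2 tendsto_intros)
        fix w :: 'a
        have "(\<lambda>i. x - sqrt (X i) *\<^sub>R w) \<longlonglongrightarrow> x - sqrt 0 *\<^sub>R w" using X(2) by (intro tendsto_intros)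
        then show "(\<lambda>i. f (x - sqrt (X i) *\<^sub>R w)) \<longlonglongrightarrow> f x"
          using c by (intro isCont_tendsto_compose[OF c]) simp
      qed
      show "integrable lborel (\<lambda>w::'a. M * heat 1 w)" using integrable_heat_moment[of 1 0, where 'a='a] by simp
      show "AE w in lborel. norm (heat 1 w * f (x - sqrt (X i) *\<^sub>R w)) \<le> M * heat 1 w" for i
        using f by (auto simp: abs_mult abs_of_pos[OF heat_pos] bdd_meas_def mult.commute[of M] less_imp_le[OF heat_pos]
            intro!: mult_left_mono AE_I2)
    qed measurable
  qed
  moreover have "\<forall>\<^sub>F s in at 0 within {0<..}. (LINT w|lborel. heat 1 w * f (x - sqrt s *\<^sub>R w)) = heat_op s f x"
    using heat_op_subst[OF _ f] by (auto simp: eventually_at_filter)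
  moreover have "(LINT w::'a|lborel. heat 1 w * f x) = f x" by (simp add: heat_integral_1)
  ultimately show ?thesis by (simp add: tendsto_cong heat_integral_1)
qed

section \<open>The Laplacian of radial functions and the heat equation\<close>

definition lap :: "('a::euclidean_space \<Rightarrow> real) \<Rightarrow> 'a \<Rightarrow> real" where
  "lap f x = (\<Sum>b\<in>Basis. dirderiv b (dirderiv b f) x)"

text \<open>With the squared distance as variable, radial functions are differentiable at the centre
  without a case distinction.\<close>

lemma dirderiv_radial:
  assumes p: "\<And>r. (p has_real_derivative p' r) (at r)"
  shows "dirderiv b (\<lambda>y. p ((norm (y - x))\<^sup>2)) = (\<lambda>y. 2 * ((y - x) \<bullet> b) * p' ((norm (y - x))\<^sup>2))"
proof
  fix y
  have 1: "((\<lambda>y. (norm (y - x))\<^sup>2) has_derivative (\<lambda>v. 2 * ((y - x) \<bullet> v))) (at y)"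
    unfolding power2_norm_eq_inner by (auto intro!: derivative_eq_intros simp: inner_commute)
  show "dirderiv b (\<lambda>y. p ((norm (y - x))\<^sup>2)) y = 2 * ((y - x) \<bullet> b) * p' ((norm (y - x))\<^sup>2)"
    using dirderiv_eqI[OF has_derivative_compose[OF 1 p[unfolded has_field_derivative_def]], of b] by simp
qed

lemma lap_radial:
  fixes x :: "'a::euclidean_space" and p p' p'' :: "real \<Rightarrow> real"
  assumes p: "\<And>r. (p has_real_derivative p' r) (at r)" and p': "\<And>r. (p' has_real_derivative p'' r) (at r)"
  shows "lap (\<lambda>y. p ((norm (y - x))\<^sup>2)) y = 2 * real DIM('a) * p' ((norm (y - x))\<^sup>2) + 4 * (norm (y - x))\<^sup>2 * p'' ((norm (y - x))\<^sup>2)"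
proof -
  let ?r = "\<lambda>y. (norm (y - x))\<^sup>2"
  have "dirderiv b (\<lambda>y. 2 * ((y - x) \<bullet> b) * p' (?r y)) y = 2 * p' (?r y) + 4 * ((y - x) \<bullet> b)\<^sup>2 * p'' (?r y)"
    if b: "b \<in> Basis" for b
  proof -
    have 1: "((\<lambda>y. (norm (y - x))\<^sup>2) has_derivative (\<lambda>v. 2 * ((y - x) \<bullet> v))) (at y)"
      unfolding power2_norm_eq_inner by (auto intro!: derivative_eq_intros simp: inner_commute)
    have 2: "((\<lambda>y. 2 * ((y - x) \<bullet> b)) has_derivative (\<lambda>v. 2 * (v \<bullet> b))) (at y)"
      by (auto intro!: derivative_eq_intros)
    show ?thesis
      using dirderiv_eqI[OF has_derivative_mult[OF 2 has_derivative_compose[OF 1 p'[unfolded has_field_derivative_def]]], of b] b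
      by (simp add: power2_eq_square mult_ac)
  qed
  then have "lap (\<lambda>y. p (?r y)) y = (\<Sum>b\<in>Basis. 2 * p' (?r y) + 4 * ((y - x) \<bullet> b)\<^sup>2 * p'' (?r y))"
    unfolding lap_def dirderiv_radial[OF p] by (rule sum.cong[OF refl])
  also have "\<dots> = 2 * real DIM('a) * p' (?r y) + 4 * (\<Sum>b\<in>Basis. ((y - x) \<bullet> b)\<^sup>2) * p'' (?r y)"
    by (simp add: sum.distrib sum_distrib_left sum_distrib_right mult_ac)
  also have "(\<Sum>b\<in>Basis. ((y - x) \<bullet> b)\<^sup>2) = ?r y"
    unfolding power2_norm_eq_inner euclidean_inner[of "y - x" "y - x"] by (simp add: power2_eq_square)
  finally show ?thesis .
qed

lemma heat_time_deriv:
  fixes z :: "'a::euclidean_space"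
  assumes t: "t > 0"
  shows "((\<lambda>t. heat t z) has_real_derivative heat t z * ((norm z)\<^sup>2 / (4 * t\<^sup>2) - DIM('a) / (2 * t))) (at t)"
proof -
  have p: "((\<lambda>t. t powr (- (DIM('a) / 2))) has_real_derivative - (DIM('a) / 2) * t powr (- (DIM('a) / 2) - 1)) (at t)"
    using has_real_derivative_powr[OF t, of "- (DIM('a) / 2)"] .
  have e: "((\<lambda>t. exp (- (norm z)\<^sup>2 / (4 * t))) has_real_derivative exp (- (norm z)\<^sup>2 / (4 * t)) * ((norm z)\<^sup>2 / (4 * t\<^sup>2))) (at t)"
    using t by (auto intro!: derivative_eq_intros simp: field_simps power2_eq_square)
  have q: "t powr (- (DIM('a) / 2) - 1) = t powr (- (DIM('a) / 2)) / t"
    using t by (simp add: powr_diff)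
  show ?thesis unfolding heat_def
    by (rule DERIV_cong[OF DERIV_cdivide[OF DERIV_mult[OF p e]]]) (simp add: q algebra_simps diff_divide_distrib add_divide_distrib)
qed

text \<open>A single majorant for all times near s, as needed for differentiating in s. The time t
  is bounded below by s / 4 in the prefactor, and 6 is the ratio of 3 s / 2 to s / 4.\<close>

lemma heat_le_on_half:
  fixes z :: "'a::euclidean_space"
  assumes s: "s > 0" and t: "\<bar>t - s\<bar> < s / 2"
  shows "heat t z \<le> 6 powr (DIM('a) / 2) * heat (3/2 * s) z"
proof -
  have ts: "s / 2 < t" "t < 3/2 * s" using t by linarith+
  have "t powr (- (DIM('a) / 2)) \<le> (s/4) powr (- (DIM('a) / 2))"
    using ts s by (intro powr_mono2') auto
  also have "(s/4) powr (- (DIM('a) / 2)) = ((1/6) * (3/2 * s)) powr (- (DIM('a) / 2))" by simp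
  also have "\<dots> = (1/6) powr (- (DIM('a) / 2)) * (3/2 * s) powr (- (DIM('a) / 2))" using s by (subst powr_mult) auto
  also have "(1/6) powr (- (DIM('a) / 2)) = 6 powr (DIM('a) / 2)" by (simp add: powr_minus powr_divide)
  finally have 1: "t powr (- (DIM('a) / 2)) \<le> 6 powr (DIM('a) / 2) * (3/2 * s) powr (- (DIM('a) / 2))" .
  have 2: "exp (- (norm z)\<^sup>2 / (4 * t)) \<le> exp (- (norm z)\<^sup>2 / (4 * (3/2 * s)))"
    using ts s by (intro iffD2[OF exp_le_cancel_iff]) (simp add: divide_left_mono)
  have "t powr (- (DIM('a) / 2)) * exp (- (norm z)\<^sup>2 / (4 * t)) \<le>
     6 powr (DIM('a) / 2) * (3/2 * s) powr (- (DIM('a) / 2)) * exp (- (norm z)\<^sup>2 / (4 * (3/2 * s)))"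
    by (intro mult_mono 1 2) auto
  then show ?thesis unfolding heat_def
    using heat_const_pos[where 'a='a] by (simp add: divide_right_mono)
qed

lemma heat_op_time_derivative:
  fixes f :: "'a::euclidean_space \<Rightarrow> real"
  assumes s: "s > 0" and f: "bdd_meas M f"
  shows "((\<lambda>s. heat_op s f x) has_real_derivative
     (LINT y|lborel. heat s (x - y) * ((norm (x - y))\<^sup>2 / (4 * s\<^sup>2) - DIM('a) / (2 * s)) * f y)) (at s)"
  unfolding heat_op_def
proof (rule has_real_derivative_integral[where r="s/2" and
    w="\<lambda>y. M * 6 powr (DIM('a) / 2) / s\<^sup>2 * (norm (x - y) ^ 2 * heat (3/2 * s) (x - y)) +
           M * 6 powr (DIM('a) / 2) * DIM('a) / s * (norm (x - y) ^ 0 * heat (3/2 * s) (x - y))"])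
  have [measurable]: "f \<in> borel_measurable borel" using f by (simp add: bdd_meas_def)
  fix t y assume t: "\<bar>t - s\<bar> < s / 2"
  then have ts: "s / 2 < t" "t < 3/2 * s" and t0: "t > 0" using s by linarith+
  show "integrable lborel (\<lambda>y. heat t (x - y) * f y)" by (rule heat_op_integrable[OF t0 f])
  show "((\<lambda>t. heat t (x - y) * f y) has_real_derivative
      heat t (x - y) * ((norm (x - y))\<^sup>2 / (4 * t\<^sup>2) - DIM('a) / (2 * t)) * f y) (at t)"
    by (rule DERIV_cmult_right[OF heat_time_deriv[OF t0]])
  have M: "\<bar>f y\<bar> \<le> M" using f by (auto simp: bdd_meas_def)
  let ?D = "(norm (x - y))\<^sup>2 / (4 * t\<^sup>2) - DIM('a) / (2 * t)"
  have "\<bar>?D\<bar> \<le> (norm (x - y))\<^sup>2 / (4 * t\<^sup>2) + DIM('a) / (2 * t)"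
    using t0 abs_triangle_ineq4[of "(norm (x - y))\<^sup>2 / (4 * t\<^sup>2)" "DIM('a) / (2 * t)"] by simp
  also have "\<dots> \<le> (norm (x - y))\<^sup>2 / s\<^sup>2 + DIM('a) / s"
  proof (intro add_mono divide_left_mono)
    have "s\<^sup>2 \<le> (2 * t)\<^sup>2" using ts s by (intro power_mono) auto
    then show "s\<^sup>2 \<le> 4 * t\<^sup>2" by (simp add: power_mult_distrib)
  qed (use ts s in auto)
  finally have D: "\<bar>?D\<bar> \<le> (norm (x - y))\<^sup>2 / s\<^sup>2 + DIM('a) / s" .
  have "\<bar>heat t (x - y) * ?D * f y\<bar> = heat t (x - y) * \<bar>?D\<bar> * \<bar>f y\<bar>"
    by (simp add: abs_mult abs_of_pos[OF heat_pos[OF t0]])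
  also have "\<dots> \<le> (6 powr (DIM('a) / 2) * heat (3/2 * s) (x - y)) * ((norm (x - y))\<^sup>2 / s\<^sup>2 + DIM('a) / s) * M"
    using D M heat_le_on_half[OF s t, of "x - y"] heat_pos[of "3/2 * s" "x - y"] s
    by (intro mult_mono mult_nonneg_nonneg) auto
  also have "\<dots> = M * 6 powr (DIM('a) / 2) / s\<^sup>2 * (norm (x - y) ^ 2 * heat (3/2 * s) (x - y)) +
           M * 6 powr (DIM('a) / 2) * DIM('a) / s * (norm (x - y) ^ 0 * heat (3/2 * s) (x - y))"
    by (simp add: algebra_simps)
  finally show "\<bar>heat t (x - y) * ?D * f y\<bar> \<le> \<dots>" .
next
  have [measurable]: "f \<in> borel_measurable borel" using f by (simp add: bdd_meas_def)
  show "(\<lambda>y. heat s (x - y) * ((norm (x - y))\<^sup>2 / (4 * s\<^sup>2) - DIM('a) / (2 * s)) * f y) \<in> borel_measurable lborel"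
    by simp
  show "integrable lborel (\<lambda>y. M * 6 powr (DIM('a) / 2) / s\<^sup>2 * (norm (x - y) ^ 2 * heat (3/2 * s) (x - y)) +
           M * 6 powr (DIM('a) / 2) * DIM('a) / s * (norm (x - y) ^ 0 * heat (3/2 * s) (x - y)))"
    using s by (intro Bochner_Integration.integrable_add integrable_mult_right heat_shift_integrable) auto
qed (use s in simp)

text \<open>The heat kernel, cut off by \<open>expinv\<close>, is inserted as a test function.\<close>

lemma heat_op_heat_equation:
  fixes V f :: "'a::euclidean_space \<Rightarrow> real"
  assumes s: "s > 0" and V: "bdd_meas M V" and f: "bdd_meas M' f"
    and weak: "\<And>\<psi>. test_elem \<psi> \<Longrightarrow> (LINT y|lborel. V y * lap \<psi> y) = (LINT y|lborel. f y * \<psi> y)"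
  shows "((\<lambda>s. heat_op s V x) has_real_derivative heat_op s f x) (at s)"
proof -
  have [measurable]: "f \<in> borel_measurable borel" "V \<in> borel_measurable borel" using f V by (simp_all add: bdd_meas_def)
  define c where "c = s powr (- (DIM('a) / 2)) / (LINT w::'a|lborel. exp (- (norm w)\<^sup>2 / 4))"
  have c: "heat s z = c * exp (- (norm z)\<^sup>2 / (4 * s))" for z :: 'a by (simp add: heat_def c_def)
  \<comment> \<open>The cutoff as a function of r = |y - x|^2: it vanishes for r >= (n + 1)^2 and
    tends to \<open>expinv k 1\<close> as n grows. The limit \<open>expinv 0 1\<close> of the cutoff
    itself is a common factor that is cancelled at the end.\<close>
  define p0 where "p0 = (\<lambda>k n r. expinv k (1 - r / (real (Suc n))\<^sup>2))"
  define E where "E = (\<lambda>r. c * exp (- r / (4 * s)))"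
  have DE: "(E has_real_derivative - E r / (4 * s)) (at r)" for r
    unfolding E_def using s by (auto intro!: derivative_eq_intros simp: field_simps)
  define N where "N = (\<lambda>n. 1 / (real (Suc n))\<^sup>2)"
  have DH: "(p0 k n has_real_derivative (p0 (k+2) n r - k * p0 (k+1) n r) * (- N n)) (at r)" for k n r
  proof -
    have "((\<lambda>r. 1 - N n * r) has_real_derivative - N n) (at r)"
      by (auto intro!: derivative_eq_intros)
    from DERIV_chain2[OF has_real_derivative_expinv this, of k] show ?thesis by (simp add: p0_def N_def)
  qed
  define p where "p = (\<lambda>n r. E r * p0 0 n r)"
  define p' where "p' = (\<lambda>n r. - E r / (4 * s) * p0 0 n r - N n * E r * p0 2 n r)"
  \<comment> \<open>Only the first term survives in the limit; the others, where a derivative falls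
    on the cutoff, carry a factor \<open>N n\<close> tending to 0.\<close>
  define p'' where "p'' = (\<lambda>n r. E r / (16 * s\<^sup>2) * p0 0 n r + N n * E r / (2 * s) * p0 2 n r
      + (N n)\<^sup>2 * E r * (p0 4 n r - 2 * p0 3 n r))"
  have Dp: "(p n has_real_derivative p' n r) (at r)" for n r
    unfolding p_def p'_def
    by (rule DERIV_cong[OF DERIV_mult[OF DE DH]]) (simp add: field_simps numeral_2_eq_2)
  have Dp': "(p' n has_real_derivative p'' n r) (at r)" for n r
    unfolding p'_def p''_def
    apply (rule DERIV_cong[OF DERIV_diff[OF DERIV_mult[OF DERIV_cdivide[OF DERIV_minus[OF DE]] DH]
       DERIV_mult[OF DERIV_cmult[OF DE] DH]]])
    using s by (simp add: field_simps power2_eq_square eval_nat_numeral)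
  let ?r = "\<lambda>y. (norm (y - x))\<^sup>2"
  define L where "L = (\<lambda>n r. 2 * real DIM('a) * p' n r + 4 * r * p'' n r)"
  have lapp: "lap (\<lambda>y. p n (?r y)) y = L n (?r y)" for n y
    unfolding L_def by (rule lap_radial[OF Dp Dp'])
  have te: "test_elem (\<lambda>y. p n (?r y))" for n
  proof -
    have er: "elementary (\<lambda>y. ?r y)" using elementary_translate[OF elementary_norm_sq, of 1 x] by simp
    have "elementary (\<lambda>y. c * exp ((-1/(4 * s)) * ?r y) * expinv 0 (1 + (- 1 / (real (Suc n))\<^sup>2) * ?r y))"
      by (intro elementary.intros er)
    moreover have "p n (?r y) = 0" if "norm y > norm x + real (Suc n)" for y
    proof -
      have "real (Suc n) \<le> norm (y - x)" using that norm_triangle_ineq2[of y x] by linarith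
      then have "(real (Suc n))\<^sup>2 \<le> ?r y" by (intro power_mono) auto
      then have "1 \<le> ?r y / (real (Suc n))\<^sup>2"
        by (simp only: le_divide_eq_1_pos zero_less_power of_nat_0_less_iff zero_less_Suc)
      then have "\<not> 1 - ?r y / (real (Suc n))\<^sup>2 > 0" by linarith
      then show ?thesis by (simp only: p_def p0_def expinv_def if_False mult_zero_right)
    qed
    ultimately show ?thesis unfolding test_elem_def p_def p0_def E_def by (auto simp: algebra_simps)
  qed
  have eq: "(LINT y|lborel. V y * L n (?r y)) = (LINT y|lborel. f y * p n (?r y))" for n
    using weak[OF te, of n] unfolding lapp .
  have N01: "0 \<le> N n" "N n \<le> 1" for n by (auto simp: N_def divide_simps)
  have Nlim: "N \<longlonglongrightarrow> 0"
    using tendsto_power[OF LIMSEQ_inverse_real_of_nat, of 2] by (simp add: N_def[abs_def] power_inverse inverse_eq_divide power_one_over)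
  have p0lim: "(\<lambda>n. p0 k n r) \<longlonglongrightarrow> expinv k 1" for k r
  proof -
    have "(\<lambda>n. 1 - r * N n) \<longlonglongrightarrow> 1 - r * 0" by (intro tendsto_intros Nlim)
    then show ?thesis unfolding p0_def
      using isCont_tendsto_compose[OF DERIV_isCont[OF has_real_derivative_expinv]] by (simp add: N_def)
  qed
  have p0b: "\<bar>p0 k n r\<bar> \<le> fact k" for k n r unfolding p0_def by (rule abs_expinv_le)
  have Ehe: "E (?r y) = heat s (x - y)" for y by (simp add: E_def c norm_minus_commute)
  have hp: "heat s (x - y) > 0" for y by (rule heat_pos[OF s])
  have p0m[measurable]: "p0 k n \<in> borel_measurable borel" for k n
    by (intro borel_measurable_continuous_onI continuous_at_imp_continuous_on ballI DERIV_isCont[OF DH])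
  have Em[measurable]: "E \<in> borel_measurable borel"
    by (intro borel_measurable_continuous_onI continuous_at_imp_continuous_on ballI DERIV_isCont[OF DE])
  have rm[measurable]: "?r \<in> borel_measurable borel" by (intro borel_measurable_continuous_onI continuous_intros)
  have R: "(\<lambda>n. LINT y|lborel. f y * p n (?r y)) \<longlonglongrightarrow> (LINT y|lborel. f y * (heat s (x - y) * expinv 0 1))"
  proof (rule integral_dominated_convergence[where w="\<lambda>y. M' * (norm (x - y) ^ 0 * heat s (x - y))"])
    show "AE y in lborel. (\<lambda>n. f y * p n (?r y)) \<longlonglongrightarrow> f y * (heat s (x - y) * expinv 0 1)"
      unfolding p_def Ehe by (intro AE_I2 tendsto_intros p0lim)
    show "integrable lborel (\<lambda>y. M' * (norm (x - y) ^ 0 * heat s (x - y)))"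
      by (intro integrable_mult_right heat_shift_integrable s)
    show "AE y in lborel. norm (f y * p n (?r y)) \<le> M' * (norm (x - y) ^ 0 * heat s (x - y))" for n
    proof (rule AE_I2)
      fix y
      have "\<bar>f y\<bar> * (heat s (x - y) * \<bar>p0 0 n (?r y)\<bar>) \<le> M' * (heat s (x - y) * 1)"
        using p0b[of 0 n "?r y"] f hp[of y] by (intro mult_mono) (auto simp: bdd_meas_def intro: order_trans[OF abs_ge_zero])
      then show "norm (f y * p n (?r y)) \<le> M' * (norm (x - y) ^ 0 * heat s (x - y))"
        unfolding p_def Ehe using hp[of y] by (simp add: abs_mult)
    qed
  qed (auto simp: p_def)
  \<comment> \<open>This is V times the Laplacian of the kernel, written in the form of its time
    derivative; the two agree because the Gaussian solves the heat equation.\<close>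
  let ?G = "\<lambda>y. heat s (x - y) * ((norm (x - y))\<^sup>2 / (4 * s\<^sup>2) - DIM('a) / (2 * s)) * V y"
  have LV: "(\<lambda>n. LINT y|lborel. V y * L n (?r y)) \<longlonglongrightarrow> (LINT y|lborel. ?G y * expinv 0 1)"
  proof (rule integral_dominated_convergence[where w="\<lambda>y. M * (2 * real DIM('a) * (1 / (4 * s) + 2)) * (norm (x - y) ^ 0 * heat s (x - y))
        + M * (4 * (1 / (16 * s\<^sup>2) + 1 / s + 36)) * (norm (x - y) ^ 2 * heat s (x - y))"])
    show "AE y in lborel. (\<lambda>n. V y * L n (?r y)) \<longlonglongrightarrow> ?G y * expinv 0 1"
    proof (rule AE_I2)
      fix y
      let ?h = "heat s (x - y)"
      have "(\<lambda>n. V y * L n (?r y)) \<longlonglongrightarrow> V y * (2 * real DIM('a) * (- ?h / (4 * s) * expinv 0 1 - 0 * ?h * expinv 2 1) +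
         4 * ?r y * (?h / (16 * s\<^sup>2) * expinv 0 1 + 0 * ?h / (2 * s) * expinv 2 1 + 0\<^sup>2 * ?h * (expinv 4 1 - 2 * expinv 3 1)))"
        unfolding L_def p'_def p''_def Ehe by (intro tendsto_intros p0lim Nlim) (use s in auto)
      also have "V y * (2 * real DIM('a) * (- ?h / (4 * s) * expinv 0 1 - 0 * ?h * expinv 2 1) +
         4 * ?r y * (?h / (16 * s\<^sup>2) * expinv 0 1 + 0 * ?h / (2 * s) * expinv 2 1 + 0\<^sup>2 * ?h * (expinv 4 1 - 2 * expinv 3 1)))
         = ?G y * expinv 0 1"
        using s by (simp add: norm_minus_commute[of y x] field_simps power2_eq_square)
      finally show "(\<lambda>n. V y * L n (?r y)) \<longlonglongrightarrow> ?G y * expinv 0 1" .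
    qed
    show "integrable lborel (\<lambda>y. M * (2 * real DIM('a) * (1 / (4 * s) + 2)) * (norm (x - y) ^ 0 * heat s (x - y))
        + M * (4 * (1 / (16 * s\<^sup>2) + 1 / s + 36)) * (norm (x - y) ^ 2 * heat s (x - y)))"
      by (intro Bochner_Integration.integrable_add integrable_mult_right heat_shift_integrable s)
    show "AE y in lborel. norm (V y * L n (?r y)) \<le> M * (2 * real DIM('a) * (1 / (4 * s) + 2)) * (norm (x - y) ^ 0 * heat s (x - y))
        + M * (4 * (1 / (16 * s\<^sup>2) + 1 / s + 36)) * (norm (x - y) ^ 2 * heat s (x - y))" for n
    proof (rule AE_I2)
      fix y
      let ?h = "heat s (x - y)"
      have MV: "\<bar>V y\<bar> \<le> M" using V by (auto simp: bdd_meas_def)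
      \<comment> \<open>The numbers are factorials: 0! = 1, 2! = 2 and 4! + 2 * 3! = 36.\<close>
      have b: "\<bar>p0 0 n (?r y)\<bar> \<le> 1" "\<bar>p0 2 n (?r y)\<bar> \<le> 2" "\<bar>p0 4 n (?r y) - 2 * p0 3 n (?r y)\<bar> \<le> 36"
        using p0b[of 0 n "?r y"] p0b[of 2 n "?r y"] p0b[of 3 n "?r y"] p0b[of 4 n "?r y"] by (auto simp: fact_numeral)
      have 1: "\<bar>p' n (?r y)\<bar> \<le> ?h * (1 / (4 * s) + 2)"
      proof -
        have "p' n (?r y) = ?h * (- (1 / (4 * s) * p0 0 n (?r y)) - N n * p0 2 n (?r y))"
          unfolding p'_def Ehe by (simp add: algebra_simps)
        moreover have "\<bar>- (1 / (4 * s) * p0 0 n (?r y)) - N n * p0 2 n (?r y)\<bar> \<le> 1 / (4 * s) + 2"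
        proof -
          have "\<bar>1 / (4 * s) * p0 0 n (?r y)\<bar> \<le> 1 / (4 * s) * 1" unfolding abs_mult
            using b s by (intro mult_mono) auto
          moreover have "\<bar>N n * p0 2 n (?r y)\<bar> \<le> 1 * 2" unfolding abs_mult
            using b N01[of n] by (intro mult_mono) auto
          ultimately show ?thesis by linarith
        qed
        ultimately show ?thesis using hp[of y] by (simp add: abs_mult)
      qed
      have 2: "\<bar>p'' n (?r y)\<bar> \<le> ?h * (1 / (16 * s\<^sup>2) + 1 / s + 36)"
      proof -
        have "p'' n (?r y) = ?h * (1 / (16 * s\<^sup>2) * p0 0 n (?r y) + N n * (1 / (2 * s) * p0 2 n (?r y))
            + (N n)\<^sup>2 * (p0 4 n (?r y) - 2 * p0 3 n (?r y)))"
          unfolding p''_def Ehe by (simp add: algebra_simps)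
        moreover have "\<bar>1 / (16 * s\<^sup>2) * p0 0 n (?r y) + N n * (1 / (2 * s) * p0 2 n (?r y))
            + (N n)\<^sup>2 * (p0 4 n (?r y) - 2 * p0 3 n (?r y))\<bar> \<le> 1 / (16 * s\<^sup>2) + 1 / s + 36"
        proof -
          have "\<bar>1 / (16 * s\<^sup>2) * p0 0 n (?r y)\<bar> \<le> 1 / (16 * s\<^sup>2) * 1" unfolding abs_mult
            using b s by (intro mult_mono) auto
          moreover have "\<bar>N n * (1 / (2 * s) * p0 2 n (?r y))\<bar> \<le> 1 * (1 / (2 * s) * 2)" unfolding abs_mult
            using b N01[of n] s by (intro mult_mono) auto
          moreover have "\<bar>(N n)\<^sup>2 * (p0 4 n (?r y) - 2 * p0 3 n (?r y))\<bar> \<le> 1 * 36" unfolding abs_mult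
            using b N01[of n] by (intro mult_mono) (auto simp: power_le_one)
          moreover have "1 * (1 / (2 * s) * 2) = 1 / s" by simp
          ultimately show ?thesis by linarith
        qed
        ultimately show ?thesis using hp[of y] by (simp add: abs_mult)
      qed
      have "\<bar>L n (?r y)\<bar> \<le> \<bar>2 * real DIM('a) * p' n (?r y)\<bar> + \<bar>4 * ?r y * p'' n (?r y)\<bar>"
        unfolding L_def by (rule abs_triangle_ineq)
      also have "\<dots> \<le> 2 * real DIM('a) * (?h * (1 / (4 * s) + 2)) + 4 * ?r y * (?h * (1 / (16 * s\<^sup>2) + 1 / s + 36))"
        unfolding abs_mult by (intro add_mono mult_mono 1 2) auto
      finally have "\<bar>V y\<bar> * \<bar>L n (?r y)\<bar> \<le> M * (2 * real DIM('a) * (?h * (1 / (4 * s) + 2)) + 4 * ?r y * (?h * (1 / (16 * s\<^sup>2) + 1 / s + 36)))"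
        using MV by (intro mult_mono) auto
      then show "norm (V y * L n (?r y)) \<le> M * (2 * real DIM('a) * (1 / (4 * s) + 2)) * (norm (x - y) ^ 0 * heat s (x - y))
        + M * (4 * (1 / (16 * s\<^sup>2) + 1 / s + 36)) * (norm (x - y) ^ 2 * heat s (x - y))"
        by (simp add: abs_mult norm_minus_commute[of y x] distrib_left mult_ac)
    qed
  qed (auto simp: L_def p'_def p''_def)
  have "(LINT y|lborel. ?G y * expinv 0 1) = (LINT y|lborel. f y * (heat s (x - y) * expinv 0 1))"
    using LIMSEQ_unique[OF LV R[folded eq]] .
  then have "(LINT y|lborel. ?G y) * expinv 0 1 = heat_op s f x * expinv 0 1"
    by (simp add: heat_op_def mult.commute[of "f _"] mult.assoc flip: Bochner_Integration.integral_mult_left_zero)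
  then have "(LINT y|lborel. ?G y) = heat_op s f x" using expinv_0_1_pos by simp
  then show ?thesis using heat_op_time_derivative[OF s V, of x] by simp
qed

section \<open>The spatial gradient of the heat semigroup\<close>

definition heat_grad :: "real \<Rightarrow> ('a::euclidean_space \<Rightarrow> real) \<Rightarrow> 'a \<Rightarrow> 'a \<Rightarrow> real" where
  "heat_grad s f v x = (LINT y|lborel. - ((x - y) \<bullet> v) / (2 * s) * heat s (x - y) * f y)"

text \<open>From |z|^2 <= 2 |z + t v|^2 + 2 |v|^2: doubling the time pays for the shift. This is the
  majorant for differentiating along a line.\<close>

lemma heat_le_shift:
  fixes z v :: "'a::euclidean_space"
  assumes s: "s > 0" and t: "\<bar>t\<bar> < 1"
  shows "heat s (z + t *\<^sub>R v) \<le> exp ((norm v)\<^sup>2 / (4 * s)) * 2 powr (DIM('a) / 2) * heat (2 * s) z"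
proof -
  have "norm z \<le> norm (z + t *\<^sub>R v) + norm v"
  proof -
    have "norm z \<le> norm (z + t *\<^sub>R v) + norm (t *\<^sub>R v)" using norm_triangle_ineq4[of "z + t *\<^sub>R v" "t *\<^sub>R v"] by simp
    also have "norm (t *\<^sub>R v) \<le> norm v" using t by (auto intro: mult_left_le_one_le)
    finally show ?thesis by simp
  qed
  then have "(norm z)\<^sup>2 \<le> (norm (z + t *\<^sub>R v) + norm v)\<^sup>2" by (intro power_mono) auto
  also have "\<dots> \<le> 2 * (norm (z + t *\<^sub>R v))\<^sup>2 + 2 * (norm v)\<^sup>2"
    using zero_le_power2[of "norm (z + t *\<^sub>R v) - norm v"] by (simp add: power2_sum power2_diff)
  finally have "- (norm (z + t *\<^sub>R v))\<^sup>2 / (4 * s) \<le> (norm v)\<^sup>2 / (4 * s) + - (norm z)\<^sup>2 / (4 * (2 * s))"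
    using s by (simp add: field_simps)
  then have 1: "exp (- (norm (z + t *\<^sub>R v))\<^sup>2 / (4 * s)) \<le> exp ((norm v)\<^sup>2 / (4 * s)) * exp (- (norm z)\<^sup>2 / (4 * (2 * s)))"
    unfolding exp_add[symmetric] by simp
  have 2: "s powr (- (DIM('a) / 2)) = 2 powr (DIM('a) / 2) * (2 * s) powr (- (DIM('a) / 2))"
    using s by (simp add: powr_mult powr_minus field_simps)
  have "2 powr (DIM('a) / 2) * (2 * s) powr (- (DIM('a) / 2)) * exp (- (norm (z + t *\<^sub>R v))\<^sup>2 / (4 * s))
    \<le> 2 powr (DIM('a) / 2) * (2 * s) powr (- (DIM('a) / 2)) * (exp ((norm v)\<^sup>2 / (4 * s)) * exp (- (norm z)\<^sup>2 / (4 * (2 * s))))"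
    by (intro mult_left_mono 1) auto
  from divide_right_mono[OF this less_imp_le[OF heat_const_pos[where 'a='a]]]
  show ?thesis unfolding heat_def 2 by (simp only: mult_ac times_divide_eq_right times_divide_eq_left)
qed

lemma heat_line_deriv:
  fixes z v :: "'a::euclidean_space"
  assumes s: "s > 0"
  shows "((\<lambda>u. heat s (z + u *\<^sub>R v)) has_real_derivative - ((z + t *\<^sub>R v) \<bullet> v) / (2 * s) * heat s (z + t *\<^sub>R v)) (at t)"
proof -
  have q: "(norm (z + u *\<^sub>R v))\<^sup>2 = z \<bullet> z + 2 * u * (z \<bullet> v) + u * u * (v \<bullet> v)" for u
    unfolding power2_norm_eq_inner by (simp add: inner_add_left inner_add_right inner_commute algebra_simps)
  have "((\<lambda>u. (norm (z + u *\<^sub>R v))\<^sup>2) has_real_derivative 2 * ((z + t *\<^sub>R v) \<bullet> v)) (at t)"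
    unfolding q by (auto intro!: derivative_eq_intros simp: inner_add_left)
  from DERIV_cdivide[OF DERIV_cmult[OF DERIV_fun_exp[OF DERIV_cdivide[OF DERIV_minus[OF this], of "4 * s"]],
     of "s powr (- (DIM('a) / 2))"], of "LINT w::'a|lborel. exp (- (norm w)\<^sup>2 / 4)"]
  show ?thesis unfolding heat_def
    by (rule DERIV_cong) (use s in \<open>simp add: field_simps\<close>)
qed

text \<open>The derivative falls on the kernel, so f need only be bounded and measurable.\<close>

lemma heat_op_dir_derivative:
  fixes f :: "'a::euclidean_space \<Rightarrow> real"
  assumes s: "s > 0" and f: "bdd_meas M f"
  shows "((\<lambda>t. heat_op s f (x + t *\<^sub>R v)) has_real_derivative heat_grad s f v (x + t *\<^sub>R v)) (at t)"
  unfolding heat_op_def heat_grad_def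
proof (rule has_real_derivative_integral[where r=1 and
    w="\<lambda>y. M * exp ((norm v)\<^sup>2 / (4 * s)) * 2 powr (DIM('a) / 2) * norm v / (2 * s) * (norm (x + t *\<^sub>R v - y) ^ 1 * heat (2 * s) (x + t *\<^sub>R v - y)) +
           M * exp ((norm v)\<^sup>2 / (4 * s)) * 2 powr (DIM('a) / 2) * norm v / (2 * s) * norm v * (norm (x + t *\<^sub>R v - y) ^ 0 * heat (2 * s) (x + t *\<^sub>R v - y))"])
  fix t' y assume t': "\<bar>t' - t\<bar> < 1"
  let ?z = "x + t' *\<^sub>R v - y" and ?w = "x + t *\<^sub>R v - y"
  show "integrable lborel (\<lambda>y. heat s (x + t' *\<^sub>R v - y) * f y)" by (rule heat_op_integrable[OF s f])
  have "((\<lambda>t. heat s (x + t *\<^sub>R v - y)) has_real_derivative - (?z \<bullet> v) / (2 * s) * heat s ?z) (at t')"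
    using heat_line_deriv[OF s, of "x - y" v t'] by (simp add: algebra_simps)
  then show "((\<lambda>t. heat s (x + t *\<^sub>R v - y) * f y) has_real_derivative - (?z \<bullet> v) / (2 * s) * heat s ?z * f y) (at t')"
    by (rule DERIV_cmult_right)
  have M: "\<bar>f y\<bar> \<le> M" using f by (auto simp: bdd_meas_def)
  have ze: "?z = ?w + (t' - t) *\<^sub>R v" by (simp add: algebra_simps)
  have h: "heat s ?z \<le> exp ((norm v)\<^sup>2 / (4 * s)) * 2 powr (DIM('a) / 2) * heat (2 * s) ?w"
    unfolding ze by (rule heat_le_shift[OF s t'])
  have "norm ?z \<le> norm ?w + norm ((t' - t) *\<^sub>R v)" unfolding ze by (rule norm_triangle_ineq)
  also have "norm ((t' - t) *\<^sub>R v) \<le> norm v" using t' by (auto intro: mult_left_le_one_le)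
  finally have zz: "norm ?z \<le> norm ?w + norm v" by simp
  have "\<bar>?z \<bullet> v\<bar> \<le> norm ?z * norm v" by (rule Cauchy_Schwarz_ineq2)
  also have "\<dots> \<le> (norm ?w + norm v) * norm v" using zz by (intro mult_right_mono) auto
  finally have "\<bar>- (?z \<bullet> v) / (2 * s)\<bar> \<le> (norm ?w + norm v) * norm v / (2 * s)"
    using s by (simp add: divide_right_mono)
  then have "\<bar>- (?z \<bullet> v) / (2 * s)\<bar> * heat s ?z * \<bar>f y\<bar> \<le>
     (norm ?w + norm v) * norm v / (2 * s) * (exp ((norm v)\<^sup>2 / (4 * s)) * 2 powr (DIM('a) / 2) * heat (2 * s) ?w) * M"
    using M h s heat_pos[of "2 * s" ?w] heat_pos[of s ?z] by (intro mult_mono) auto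
  also have "\<dots> = M * exp ((norm v)\<^sup>2 / (4 * s)) * 2 powr (DIM('a) / 2) * norm v / (2 * s) * (norm ?w ^ 1 * heat (2 * s) ?w) +
           M * exp ((norm v)\<^sup>2 / (4 * s)) * 2 powr (DIM('a) / 2) * norm v / (2 * s) * norm v * (norm ?w ^ 0 * heat (2 * s) ?w)"
    by (simp add: algebra_simps add_divide_distrib)
  finally show "\<bar>- (?z \<bullet> v) / (2 * s) * heat s ?z * f y\<bar> \<le> \<dots>"
    by (simp only: abs_mult abs_of_pos[OF heat_pos[OF s]])
next
  have [measurable]: "f \<in> borel_measurable borel" using f by (simp add: bdd_meas_def)
  show "(\<lambda>y. - ((x + t *\<^sub>R v - y) \<bullet> v) / (2 * s) * heat s (x + t *\<^sub>R v - y) * f y) \<in> borel_measurable lborel" by simp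
  show "integrable lborel (\<lambda>y. M * exp ((norm v)\<^sup>2 / (4 * s)) * 2 powr (DIM('a) / 2) * norm v / (2 * s) * (norm (x + t *\<^sub>R v - y) ^ 1 * heat (2 * s) (x + t *\<^sub>R v - y)) +
           M * exp ((norm v)\<^sup>2 / (4 * s)) * 2 powr (DIM('a) / 2) * norm v / (2 * s) * norm v * (norm (x + t *\<^sub>R v - y) ^ 0 * heat (2 * s) (x + t *\<^sub>R v - y)))"
    using s by (intro Bochner_Integration.integrable_add integrable_mult_right heat_shift_integrable) auto
qed simp

lemma heat_grad_subst:
  assumes s: "s > 0" and f: "bdd_meas M f"
  shows "heat_grad s f v x = (LINT w|lborel. - (w \<bullet> v) / (2 * sqrt s) * heat 1 w * f (x - sqrt s *\<^sub>R w))"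
proof -
  have [measurable]: "f \<in> borel_measurable borel" using f by (simp add: bdd_meas_def)
  have ss: "sqrt s * a / (2 * s) = a / (2 * sqrt s)" for a
    using s real_sqrt_mult_self[of s] by (simp add: field_simps)
  have "heat_grad s f v x = (LINT y|lborel. heat s (x - y) * (- ((x - y) \<bullet> v) / (2 * s) * f y))"
    unfolding heat_grad_def by (simp add: mult_ac)
  also have "\<dots> = (LINT w|lborel. heat 1 w * (- ((x - (x - sqrt s *\<^sub>R w)) \<bullet> v) / (2 * s) * f (x - sqrt s *\<^sub>R w)))"
    by (rule lborel_integral_heat_subst[OF s]) measurable
  also have "\<dots> = (LINT w|lborel. - (w \<bullet> v) / (2 * sqrt s) * heat 1 w * f (x - sqrt s *\<^sub>R w))"
  proof (rule Bochner_Integration.integral_cong[OF refl])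
    fix w
    have "- ((x - (x - sqrt s *\<^sub>R w)) \<bullet> v) / (2 * s) = - (w \<bullet> v) / (2 * sqrt s)"
      using ss[of "w \<bullet> v"] by simp
    then show "heat 1 w * (- ((x - (x - sqrt s *\<^sub>R w)) \<bullet> v) / (2 * s) * f (x - sqrt s *\<^sub>R w)) =
       - (w \<bullet> v) / (2 * sqrt s) * heat 1 w * f (x - sqrt s *\<^sub>R w)" by (simp only: mult_ac)
  qed
  finally show ?thesis .
qed

lemma integrable_heat_grad:
  fixes f :: "'a::euclidean_space \<Rightarrow> real"
  assumes s: "s > 0" and f: "bdd_meas M f"
  shows "integrable lborel (\<lambda>y. - ((x - y) \<bullet> v) / (2 * s) * heat s (x - y) * f y)"
proof (rule heat_op_integrable_gen[OF s f, where C="norm v / (2 * s)" and j=1])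
  show "\<bar>- ((x - y) \<bullet> v) / (2 * s)\<bar> \<le> norm v / (2 * s) * norm (x - y) ^ 1" for y
    using Cauchy_Schwarz_ineq2[of "x - y" v] s by (simp add: divide_right_mono mult.commute)
qed measurable

lemma heat_grad_bound:
  fixes f :: "'a::euclidean_space \<Rightarrow> real"
  assumes s: "s > 0" and f: "bdd_meas M f"
  shows "\<bar>heat_grad s f v x\<bar> \<le> M * norm v / (2 * sqrt s) * (LINT w::'a|lborel. norm w * heat 1 w)"
proof -
  have M: "M \<ge> 0" using f by (auto simp: bdd_meas_def intro: order_trans[OF abs_ge_zero])
  have "\<bar>heat_grad s f v x\<bar> \<le> (LINT w|lborel. \<bar>- (w \<bullet> v) / (2 * sqrt s) * heat 1 w * f (x - sqrt s *\<^sub>R w)\<bar>)"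
    unfolding heat_grad_subst[OF s f] by (rule integral_abs_bound)
  also have "\<dots> \<le> (LINT w::'a|lborel. M * norm v / (2 * sqrt s) * (norm w * heat 1 w))"
  proof (rule integral_mono')
    show "integrable lborel (\<lambda>w::'a. M * norm v / (2 * sqrt s) * (norm w * heat 1 w))"
      using integrable_heat_moment[of 1 1, where 'a='a] by (intro integrable_mult_right) simp
    fix w :: 'a
    have h: "heat 1 w > 0" by (simp add: heat_pos)
    have "\<bar>- (w \<bullet> v) / (2 * sqrt s)\<bar> \<le> norm w * norm v / (2 * sqrt s)"
      using Cauchy_Schwarz_ineq2[of w v] s by (simp add: divide_right_mono)
    then have "\<bar>- (w \<bullet> v) / (2 * sqrt s)\<bar> * heat 1 w * \<bar>f (x - sqrt s *\<^sub>R w)\<bar> \<le> norm w * norm v / (2 * sqrt s) * heat 1 w * M"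
      using h f s by (intro mult_mono) (auto simp: bdd_meas_def)
    then show "\<bar>- (w \<bullet> v) / (2 * sqrt s) * heat 1 w * f (x - sqrt s *\<^sub>R w)\<bar> \<le> M * norm v / (2 * sqrt s) * (norm w * heat 1 w)"
      by (simp only: abs_mult abs_of_pos[OF h]) (simp add: mult_ac)
    show "0 \<le> M * norm v / (2 * sqrt s) * (norm w * heat 1 w)" using h M s by simp
  qed
  finally show ?thesis by simp
qed

lemma heat_grad_isCont:
  fixes f :: "'a::euclidean_space \<Rightarrow> real"
  assumes s: "s > 0" and f: "bdd_meas M f" and c: "continuous_on UNIV f"
  shows "isCont (heat_grad s f v) x"
proof -
  have [measurable]: "f \<in> borel_measurable borel" using f by (simp add: bdd_meas_def)
  have "isCont (\<lambda>x. LINT w|lborel. - (w \<bullet> v) / (2 * sqrt s) * heat 1 w * f (x - sqrt s *\<^sub>R w)) x"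
    unfolding continuous_within tendsto_at_iff_sequentially comp_def
  proof (intro allI impI)
    fix X :: "nat \<Rightarrow> 'a" assume X: "\<forall>i. X i \<in> UNIV - {x}" "X \<longlonglongrightarrow> x"
    show "(\<lambda>i. LINT w|lborel. - (w \<bullet> v) / (2 * sqrt s) * heat 1 w * f (X i - sqrt s *\<^sub>R w)) \<longlonglongrightarrow>
      (LINT w|lborel. - (w \<bullet> v) / (2 * sqrt s) * heat 1 w * f (x - sqrt s *\<^sub>R w))"
    proof (rule integral_dominated_convergence[where w="\<lambda>w::'a. M * norm v / (2 * sqrt s) * (norm w * heat 1 w)"])
      show "AE w in lborel. (\<lambda>i. - (w \<bullet> v) / (2 * sqrt s) * heat 1 w * f (X i - sqrt s *\<^sub>R w)) \<longlonglongrightarrow>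
        - (w \<bullet> v) / (2 * sqrt s) * heat 1 w * f (x - sqrt s *\<^sub>R w)"
      proof (intro AE_I2 tendsto_intros)
        fix w :: 'a
        have "isCont f (x - sqrt s *\<^sub>R w)" using c by (simp add: continuous_on_eq_continuous_at)
        then show "(\<lambda>i. f (X i - sqrt s *\<^sub>R w)) \<longlonglongrightarrow> f (x - sqrt s *\<^sub>R w)"
          by (rule isCont_tendsto_compose) (intro tendsto_intros X)
      qed
      show "integrable lborel (\<lambda>w::'a. M * norm v / (2 * sqrt s) * (norm w * heat 1 w))"
        using integrable_heat_moment[of 1 1, where 'a='a] by (intro integrable_mult_right) simp
      show "AE w in lborel. norm (- (w \<bullet> v) / (2 * sqrt s) * heat 1 w * f (X i - sqrt s *\<^sub>R w)) \<le> M * norm v / (2 * sqrt s) * (norm w * heat 1 w)" for i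
      proof (rule AE_I2)
        fix w :: 'a
        have h: "heat 1 w > 0" by (simp add: heat_pos)
        have "\<bar>- (w \<bullet> v) / (2 * sqrt s)\<bar> \<le> norm w * norm v / (2 * sqrt s)"
          using Cauchy_Schwarz_ineq2[of w v] s by (simp add: divide_right_mono)
        then have "\<bar>- (w \<bullet> v) / (2 * sqrt s)\<bar> * heat 1 w * \<bar>f (X i - sqrt s *\<^sub>R w)\<bar> \<le> norm w * norm v / (2 * sqrt s) * heat 1 w * M"
          using h f s by (intro mult_mono) (auto simp: bdd_meas_def)
        then show "norm (- (w \<bullet> v) / (2 * sqrt s) * heat 1 w * f (X i - sqrt s *\<^sub>R w)) \<le> M * norm v / (2 * sqrt s) * (norm w * heat 1 w)"
          by (simp only: real_norm_def abs_mult abs_of_pos[OF h]) (simp add: mult_ac)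
      qed
    qed measurable
  qed
  then show ?thesis unfolding heat_grad_subst[OF s f, abs_def] .
qed

text \<open>The mean value inequality on the segment from x' to x. The singularity 1 / sqrt s is
  integrable at 0; integrated over (0, \<epsilon>) it gives the order sqrt \<epsilon> used in
  \<open>V_strictly_decreasing_near\<close>.\<close>

lemma heat_op_lipschitz:
  fixes f :: "'a::euclidean_space \<Rightarrow> real"
  assumes s: "s > 0" and f: "bdd_meas M f"
  shows "\<bar>heat_op s f x - heat_op s f x'\<bar> \<le> M * norm (x - x') / (2 * sqrt s) * (LINT w::'a|lborel. norm w * heat 1 w)"
proof -
  have "norm (heat_op s f (x' + 1 *\<^sub>R (x - x')) - heat_op s f (x' + 0 *\<^sub>R (x - x'))) \<le>
    M * norm (x - x') / (2 * sqrt s) * (LINT w::'a|lborel. norm w * heat 1 w) * norm (1 - (0::real))"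
    by (rule field_differentiable_bound[where S=UNIV and f'="\<lambda>t. heat_grad s f (x - x') (x' + t *\<^sub>R (x - x'))"])
       (use heat_op_dir_derivative[OF s f] heat_grad_bound[OF s f] in auto)
  then show ?thesis by simp
qed

section \<open>Antisymmetric functions under the heat semigroup\<close>

lemma bdd_meas_refl: "bdd_meas M f \<Longrightarrow> bdd_meas M (\<lambda>x. f (refl_at e \<tau> x))"
  using refl_at_measurable[of e \<tau>] unfolding bdd_meas_def by auto

lemma heat_op_refl:
  assumes e: "norm e = 1" and f: "bdd_meas M f"
  shows "heat_op s (\<lambda>x. f (refl_at e \<tau> x)) x = heat_op s f (refl_at e \<tau> x)"
proof -
  have [measurable]: "f \<in> borel_measurable borel" using f by (simp add: bdd_meas_def)
  have h: "heat s (refl_at e \<tau> x - refl_at e \<tau> y) = heat s (x - y)" for y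
    by (simp add: heat_def dist_refl_at_refl_at[OF e])
  have "(LINT y|lborel. heat s (refl_at e \<tau> x - refl_at e \<tau> y) * f (refl_at e \<tau> y)) = (LINT y|lborel. heat s (refl_at e \<tau> x - y) * f y)"
    by (rule lborel_integral_preserved[OF refl_at_measurable lborel_distr_refl_at[OF e]]) measurable
  then show ?thesis unfolding heat_op_def h .
qed

text \<open>Averaging the convolution with its reflected form replaces the kernel by its difference
  with the mirrored kernel, the Dirichlet heat kernel of the half-space. This difference and g both
  change sign across the plane, so for x on the lower side their product is nonnegative in the whole
  space.\<close>

lemma heat_op_antisym_ge:
  fixes g :: "'a::euclidean_space \<Rightarrow> real"
  assumes e: "norm e = 1" and s: "s > 0" and g: "bdd_meas M g" and anti: "\<And>y. g (refl_at e \<tau> y) = - g y"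
    and nn: "\<And>y. y \<bullet> e < \<tau> \<Longrightarrow> g y \<ge> 0"
  shows "2 * heat_op s g x = (LINT y|lborel. (heat s (x - y) - heat s (x - refl_at e \<tau> y)) * g y)"
    and "integrable lborel (\<lambda>y. (heat s (x - y) - heat s (x - refl_at e \<tau> y)) * g y)"
    and "x \<bullet> e \<le> \<tau> \<Longrightarrow> (heat s (x - y) - heat s (x - refl_at e \<tau> y)) * g y \<ge> 0"
    and "x \<bullet> e < \<tau> \<Longrightarrow> y \<bullet> e < \<tau> \<Longrightarrow> heat s (x - y) - heat s (x - refl_at e \<tau> y) > 0"
proof -
  have [measurable]: "g \<in> borel_measurable borel" using g by (simp add: bdd_meas_def)
  have m: "(\<lambda>y. heat s (x - y) * g y) \<in> borel_measurable borel" by measurable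
  have i1: "integrable lborel (\<lambda>y. heat s (x - y) * g y)" by (rule heat_op_integrable[OF s g])
  have i2: "integrable lborel (\<lambda>y. heat s (x - refl_at e \<tau> y) * g y)"
    using lborel_integrable_preserved[OF refl_at_measurable lborel_distr_refl_at[OF e] m, of \<tau>] i1
    by (simp add: anti)
  have "(LINT y|lborel. heat s (x - refl_at e \<tau> y) * g (refl_at e \<tau> y)) = heat_op s g x"
    using lborel_integral_preserved[OF refl_at_measurable lborel_distr_refl_at[OF e] m, of \<tau>] by (simp add: heat_op_def)
  then have e2: "(LINT y|lborel. heat s (x - refl_at e \<tau> y) * g y) = - heat_op s g x"
    by (simp add: anti)
  show "2 * heat_op s g x = (LINT y|lborel. (heat s (x - y) - heat s (x - refl_at e \<tau> y)) * g y)"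
    unfolding left_diff_distrib by (subst Bochner_Integration.integral_diff[OF i1 i2]) (simp add: e2 heat_op_def[symmetric])
  show "integrable lborel (\<lambda>y. (heat s (x - y) - heat s (x - refl_at e \<tau> y)) * g y)"
    unfolding left_diff_distrib by (rule Bochner_Integration.integrable_diff[OF i1 i2])
  have cmp: "heat s z \<le> heat s z'" if "(norm z')\<^sup>2 \<le> (norm z)\<^sup>2" for z z' :: 'a
    unfolding heat_def using that s heat_const_pos[where 'a='a]
    by (intro divide_right_mono mult_left_mono iffD2[OF exp_le_cancel_iff]) auto
  have cmps: "heat s z < heat s z'" if "(norm z')\<^sup>2 < (norm z)\<^sup>2" for z z' :: 'a
    unfolding heat_def using that s heat_const_pos[where 'a='a]
    by (intro divide_strict_right_mono mult_strict_left_mono iffD2[OF exp_less_cancel_iff]) auto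
  show "heat s (x - y) - heat s (x - refl_at e \<tau> y) > 0" if "x \<bullet> e < \<tau>" "y \<bullet> e < \<tau>"
    using cmps[of "x - y" "x - refl_at e \<tau> y"] that unfolding dist_refl_at_sq[OF e] by simp
  show "(heat s (x - y) - heat s (x - refl_at e \<tau> y)) * g y \<ge> 0" if x: "x \<bullet> e \<le> \<tau>"
  proof -
    consider "y \<bullet> e < \<tau>" | "y \<bullet> e = \<tau>" | "y \<bullet> e > \<tau>" by linarith
    then show ?thesis
    proof cases
      case 1
      then show ?thesis using nn[OF 1] x cmp[of "x - y" "x - refl_at e \<tau> y"] unfolding dist_refl_at_sq[OF e] by simp
    next
      case 2 then show ?thesis by (simp add: refl_at_def)
    next
      case 3
      have "refl_at e \<tau> y \<bullet> e < \<tau>" using 3 by (simp add: refl_at_inner[OF e])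
      then have "g y \<le> 0" using nn[of "refl_at e \<tau> y"] anti[of y] by simp
      moreover have "heat s (x - y) \<le> heat s (x - refl_at e \<tau> y)"
      proof (rule cmp)
        have "(\<tau> - x \<bullet> e) * (\<tau> - y \<bullet> e) \<le> 0" using x 3 by (intro mult_nonneg_nonpos) auto
        then have "4 * (\<tau> - x \<bullet> e) * (\<tau> - y \<bullet> e) \<le> 0" by linarith
        then show "(norm (x - refl_at e \<tau> y))\<^sup>2 \<le> (norm (x - y))\<^sup>2" unfolding dist_refl_at_sq[OF e] by simp
      qed
      ultimately show ?thesis by (simp add: mult_nonpos_nonpos)
    qed
  qed
qed

lemma integral_pos_of_continuous:
  fixes h :: "'a::euclidean_space \<Rightarrow> real"
  assumes i: "integrable lborel h" and nn: "\<And>y. h y \<ge> 0" and r: "r > 0" and pos: "\<And>y. y \<in> ball q r \<Longrightarrow> h y > 0"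
  shows "(LINT y|lborel. h y) > 0"
proof -
  have "(LINT y|lborel. h y) \<noteq> 0"
  proof
    assume "(LINT y|lborel. h y) = 0"
    then have "AE y in lborel. h y = 0" using integral_nonneg_eq_0_iff_AE[OF i] nn by simp
    then have "AE y in lborel. y \<notin> ball q r" by eventually_elim (use pos in force)
    then have "emeasure lborel (ball q r) = 0" by (subst (asm) AE_iff_measurable[where N="ball q r"]) auto
    then show False using content_ball_pos[OF r, of q] by (simp add: measure_def)
  qed
  moreover have "(LINT y|lborel. h y) \<ge> 0" using nn by simp
  ultimately show ?thesis by simp
qed

lemma heat_op_antisym_nonneg:
  fixes g :: "'a::euclidean_space \<Rightarrow> real"
  assumes e: "norm e = 1" and s: "s > 0" and g: "bdd_meas M g" and anti: "\<And>y. g (refl_at e \<tau> y) = - g y"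
    and nn: "\<And>y. y \<bullet> e < \<tau> \<Longrightarrow> g y \<ge> 0" and x: "x \<bullet> e \<le> \<tau>"
  shows "heat_op s g x \<ge> 0"
proof -
  have "(LINT y|lborel. (heat s (x - y) - heat s (x - refl_at e \<tau> y)) * g y) \<ge> 0"
    using heat_op_antisym_ge(3)[OF e s g anti nn x] by simp
  then show ?thesis using heat_op_antisym_ge(1)[OF e s g anti nn, of x] by simp
qed

lemma positive_ball:
  fixes g :: "'a::euclidean_space \<Rightarrow> real"
  assumes c: "continuous_on UNIV g" and q: "g q > 0" "q \<bullet> e < \<tau>"
  obtains r where "r > 0" "\<And>y. y \<in> ball q r \<Longrightarrow> g y > 0 \<and> y \<bullet> e < \<tau>"
proof -
  have "open {y. 0 < g y \<and> y \<bullet> e < \<tau>}"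
    by (intro open_Collect_conj open_Collect_less continuous_intros c)
  then obtain r where "r > 0" "ball q r \<subseteq> {y. 0 < g y \<and> y \<bullet> e < \<tau>}" using q by (auto simp: open_contains_ball)
  then show ?thesis using that by blast
qed

text \<open>Infinite speed of propagation: the difference of the kernels is strictly positive below
  the plane, so positivity of g near q is felt at every x there.\<close>

lemma heat_op_antisym_pos:
  fixes g :: "'a::euclidean_space \<Rightarrow> real"
  assumes e: "norm e = 1" and s: "s > 0" and g: "bdd_meas M g" and anti: "\<And>y. g (refl_at e \<tau> y) = - g y"
    and nn: "\<And>y. y \<bullet> e < \<tau> \<Longrightarrow> g y \<ge> 0" and x: "x \<bullet> e < \<tau>"
    and c: "continuous_on UNIV g" and q: "g q > 0" "q \<bullet> e < \<tau>"
  shows "heat_op s g x > 0"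
proof -
  obtain r where r: "r > 0" "\<And>y. y \<in> ball q r \<Longrightarrow> g y > 0 \<and> y \<bullet> e < \<tau>" using positive_ball[OF c q] by metis
  have "(LINT y|lborel. (heat s (x - y) - heat s (x - refl_at e \<tau> y)) * g y) > 0"
    by (rule integral_pos_of_continuous[OF heat_op_antisym_ge(2)[OF e s g anti nn] _ r(1), of _ q])
       (use heat_op_antisym_ge(3,4)[OF e s g anti nn] x r(2) in \<open>auto simp: less_imp_le\<close>)
  then show ?thesis using heat_op_antisym_ge(1)[OF e s g anti nn, of x] by simp
qed

text \<open>Hopf's lemma for the flow. At a point of the plane the normal derivative of the kernel
  carries the factor \<tau> - y \<bullet> e, which is antisymmetric like g, so the integrand has one
  sign.\<close>

lemma heat_grad_antisym_neg:
  fixes g :: "'a::euclidean_space \<Rightarrow> real"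
  assumes e: "norm e = 1" and s: "s > 0" and g: "bdd_meas M g" and anti: "\<And>y. g (refl_at e \<tau> y) = - g y"
    and nn: "\<And>y. y \<bullet> e < \<tau> \<Longrightarrow> g y \<ge> 0" and p: "p \<bullet> e = \<tau>"
    and c: "continuous_on UNIV g" and q: "g q > 0" "q \<bullet> e < \<tau>"
  shows "heat_grad s g e p < 0"
proof -
  obtain r where r: "r > 0" "\<And>y. y \<in> ball q r \<Longrightarrow> g y > 0 \<and> y \<bullet> e < \<tau>" using positive_ball[OF c q] by metis
  let ?h = "\<lambda>y. - (- ((p - y) \<bullet> e) / (2 * s) * heat s (p - y) * g y)"
  have hh: "?h y = (\<tau> - y \<bullet> e) * g y * (heat s (p - y) / (2 * s))" for y
    by (simp add: p inner_diff_left algebra_simps diff_divide_distrib)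
  have "(LINT y|lborel. ?h y) > 0"
  proof (rule integral_pos_of_continuous[OF _ _ r(1), of _ q])
    show "integrable lborel ?h" by (intro Bochner_Integration.integrable_minus integrable_heat_grad[OF s g])
    show "0 < ?h y" if "y \<in> ball q r" for y
      unfolding hh using r(2)[OF that] s heat_pos[OF s, of "p - y"] by simp
    show "0 \<le> ?h y" for y
    proof -
      have "(\<tau> - y \<bullet> e) * g y \<ge> 0"
      proof (cases "y \<bullet> e \<le> \<tau>")
        case True then show ?thesis using nn[of y] by (cases "y \<bullet> e = \<tau>") auto
      next
        case False
        then have "refl_at e \<tau> y \<bullet> e < \<tau>" by (simp add: refl_at_inner[OF e])
        then have "g y \<le> 0" using nn[of "refl_at e \<tau> y"] anti[of y] by simp
        then show ?thesis using False by (simp add: mult_nonpos_nonpos)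
      qed
      then show ?thesis unfolding hh using s heat_pos[OF s, of "p - y"] by simp
    qed
  qed
  then show ?thesis unfolding heat_grad_def by simp
qed

section \<open>Maximum principles via the heat semigroup\<close>

text \<open>Semigroup form of the distributional equation \<open>\<Delta>V = f\<close> with bounded data.\<close>

definition heat_pair :: "real \<Rightarrow> ('a::euclidean_space \<Rightarrow> real) \<Rightarrow> ('a \<Rightarrow> real) \<Rightarrow> bool" where
  "heat_pair M V f \<longleftrightarrow> bdd_meas M V \<and> bdd_meas M f \<and> continuous_on UNIV V \<and>
     (\<forall>s>0. \<forall>x. ((\<lambda>s. heat_op s V x) has_real_derivative heat_op s f x) (at s))"

lemma bdd_meas_diff: "bdd_meas M f \<Longrightarrow> bdd_meas M' g \<Longrightarrow> bdd_meas (M + M') (\<lambda>x. f x - g x)"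
  unfolding bdd_meas_def by (auto intro: order_trans[OF abs_triangle_ineq4] add_mono)

lemma bdd_meas_cmult: "bdd_meas M f \<Longrightarrow> bdd_meas (\<bar>c\<bar> * M) (\<lambda>x. c * f x)"
  unfolding bdd_meas_def by (auto simp: abs_mult intro: mult_left_mono)

lemma bdd_meas_weaken: "bdd_meas M f \<Longrightarrow> M \<le> M' \<Longrightarrow> bdd_meas M' f"
  unfolding bdd_meas_def by (auto intro: order_trans)

lemma heat_pair_uminus: assumes "heat_pair M V f" shows "heat_pair M (\<lambda>x. - V x) (\<lambda>x. - f x)"
proof -
  have *: "heat_op s (\<lambda>x. - g x) x = - heat_op s g x" for s x and g :: "'a \<Rightarrow> real"
    using heat_op_cmult[of s "-1" g x] by simp
  show ?thesis using assms unfolding heat_pair_def *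
    by (auto intro!: derivative_intros continuous_intros simp: bdd_meas_def)
qed

lemma heat_pair_diff:
  assumes "heat_pair M V f" "heat_pair M' W g"
  shows "heat_pair (M + M') (\<lambda>x. V x - W x) (\<lambda>x. f x - g x)"
proof -
  have V: "bdd_meas M V" "bdd_meas M f" "bdd_meas M' W" "bdd_meas M' g" using assms by (auto simp: heat_pair_def)
  have "((\<lambda>s. heat_op s (\<lambda>x. V x - W x) x) has_real_derivative heat_op s (\<lambda>x. f x - g x) x) (at s)" if "s > 0" for s x
  proof -
    have d: "((\<lambda>s. heat_op s V x - heat_op s W x) has_real_derivative heat_op s f x - heat_op s g x) (at s)"
      using assms that by (intro DERIV_diff) (auto simp: heat_pair_def)
    have ev: "\<forall>\<^sub>F s in nhds s. heat_op s (\<lambda>x. V x - W x) x = heat_op s V x - heat_op s W x"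
      using eventually_nhds_in_open[of "{0<..}" s] that
      by (auto elim!: eventually_mono intro!: heat_op_diff V)
    show ?thesis unfolding DERIV_cong_ev[OF refl ev refl] heat_op_diff[OF that V(2,4)] by (rule d)
  qed
  then show ?thesis using assms unfolding heat_pair_def by (auto intro!: bdd_meas_diff continuous_intros)
qed

lemma heat_pair_refl:
  assumes e: "norm e = 1" and p: "heat_pair M V f"
  shows "heat_pair M (\<lambda>x. V (refl_at e \<tau> x)) (\<lambda>x. f (refl_at e \<tau> x))"
proof -
  have V: "bdd_meas M V" "bdd_meas M f" using p by (auto simp: heat_pair_def)
  have "continuous_on UNIV (\<lambda>x. V (refl_at e \<tau> x))"
    using p by (intro continuous_on_compose2[OF _ continuous_refl_at]) (auto simp: heat_pair_def)
  then show ?thesis using p bdd_meas_refl[OF V(1)] bdd_meas_refl[OF V(2)]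
    unfolding heat_pair_def heat_op_refl[OF e V(1)] heat_op_refl[OF e V(2)] by auto
qed

text \<open>The flow is differentiated only at positive times; monotonicity on (0, t] reaches the
  initial value through the limit.\<close>

lemma limit_le_of_deriv_nonneg:
  fixes Q :: "real \<Rightarrow> real"
  assumes t: "t > 0" and d: "\<And>s. 0 < s \<Longrightarrow> s \<le> t \<Longrightarrow> (Q has_real_derivative Q' s) (at s)"
    and nn: "\<And>s. 0 < s \<Longrightarrow> s \<le> t \<Longrightarrow> Q' s \<ge> 0" and l: "(Q \<longlongrightarrow> q) (at_right 0)"
  shows "q \<le> Q t"
proof (rule tendsto_upperbound[OF l])
  have "Q s \<le> Q t" if "0 < s" "s < t" for s
    by (rule DERIV_nonneg_imp_nondecreasing) (use that d nn in \<open>auto, meson less_le_trans order_le_less_trans\<close>)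
  then show "\<forall>\<^sub>F s in at_right 0. Q s \<le> Q t"
    using eventually_at_right_less[of 0] eventually_at_right[of 0 t] t by (auto simp: eventually_at_right_field intro!: exI[of _ t])
qed simp

lemma heat_pair_limit: "heat_pair M V f \<Longrightarrow> ((\<lambda>s. heat_op s V x) \<longlongrightarrow> V x) (at_right 0)"
  by (rule heat_op_tendsto[of M]) (auto simp: heat_pair_def continuous_on_eq_continuous_at)

lemma heat_pair_deriv: "heat_pair M V f \<Longrightarrow> s > 0 \<Longrightarrow> ((\<lambda>s. heat_op s V x) has_real_derivative heat_op s f x) (at s)"
  by (auto simp: heat_pair_def)

text \<open>By the Gaussian tail bound, values outside the ball change the heat flow at \<open>x0\<close> only by \<open>O(s\<^sup>2)\<close>,
  which cannot compensate the growth of order \<open>\<delta> s\<close>.\<close>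

lemma heat_pair_no_local_max:
  fixes V f :: "'a::euclidean_space \<Rightarrow> real"
  assumes p: "heat_pair M V f" and r: "r > 0" and \<delta>: "\<delta> > 0"
    and mx: "\<And>y. y \<in> ball x0 r \<Longrightarrow> V y \<le> V x0" and f: "\<And>y. y \<in> ball x0 r \<Longrightarrow> f y \<ge> \<delta>"
  shows False
proof -
  have V: "bdd_meas M V" and fb: "bdd_meas M f" using p by (auto simp: heat_pair_def)
  have [measurable]: "V \<in> borel_measurable borel" "f \<in> borel_measurable borel" using V fb by (auto simp: bdd_meas_def)
  have VM: "\<bar>V y\<bar> \<le> M" and fM: "\<bar>f y\<bar> \<le> M" for y using V fb by (auto simp: bdd_meas_def)
  define m4 where "m4 = (LINT w::'a|lborel. norm w ^ 4 * heat 1 w)"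
  have m4: "m4 \<ge> 0" unfolding m4_def by (intro integral_nonneg_AE) (auto simp: less_imp_le[OF heat_pos])
  have bc: "bdd_meas \<bar>c\<bar> (\<lambda>_::'a. c)" for c by (simp add: bdd_meas_def)
  define C where "C = (2 * M + \<delta>) / r ^ 4 * m4"
  have M0: "M \<ge> 0" using VM[of x0] by linarith
  have C: "C \<ge> 0" unfolding C_def using m4 M0 \<delta> r by simp
  have up: "heat_op s V x0 \<le> V x0 + C * s\<^sup>2" if s: "s > 0" for s
  proof -
    \<comment> \<open>The positive part vanishes in the ball, so the tail bound applies to it. The
      bound 2 M + \<delta> is generous enough for the estimate of f as well.\<close>
    define g where "g = (\<lambda>y. max 0 (V y - V x0))"
    have g: "bdd_meas (2 * M + \<delta>) g" unfolding bdd_meas_def g_def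
    proof safe
      fix y show "\<bar>max 0 (V y - V x0)\<bar> \<le> 2 * M + \<delta>" using VM[of y] VM[of x0] \<delta> by (auto simp: abs_le_iff)
    qed measurable
    have "heat_op s (\<lambda>y. V y - V x0) x0 \<le> heat_op s g x0"
      by (rule heat_op_mono[OF s bdd_meas_diff[OF V bc] g]) (simp add: g_def)
    also have "\<dots> \<le> \<bar>heat_op s g x0\<bar>" by simp
    also have "\<dots> \<le> (2 * M + \<delta>) * s\<^sup>2 / r ^ 4 * m4" unfolding m4_def
      by (rule heat_op_tail[OF s g r]) (use mx in \<open>auto simp: g_def dist_norm norm_minus_commute\<close>)
    also have "\<dots> = C * s\<^sup>2" by (simp add: C_def)
    finally show ?thesis using heat_op_diff[OF s V bc, of "V x0" x0] heat_op_const[OF s, of "V x0" x0] by simp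
  qed
  have dn: "heat_op s f x0 \<ge> \<delta> - C * s\<^sup>2" if s: "s > 0" for s
  proof -
    define g where "g = (\<lambda>y. max 0 (\<delta> - f y))"
    have g: "bdd_meas (2 * M + \<delta>) g" unfolding bdd_meas_def g_def
    proof safe
      fix y show "\<bar>max 0 (\<delta> - f y)\<bar> \<le> 2 * M + \<delta>" using fM[of y] \<delta> M0 by (auto simp: abs_le_iff)
    qed measurable
    have "heat_op s (\<lambda>y. \<delta> - f y) x0 \<le> heat_op s g x0"
      by (rule heat_op_mono[OF s bdd_meas_diff[OF bc fb] g]) (simp add: g_def)
    also have "\<dots> \<le> \<bar>heat_op s g x0\<bar>" by simp
    also have "\<dots> \<le> (2 * M + \<delta>) * s\<^sup>2 / r ^ 4 * m4" unfolding m4_def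
      by (rule heat_op_tail[OF s g r]) (use f in \<open>auto simp: g_def dist_norm norm_minus_commute\<close>)
    also have "\<dots> = C * s\<^sup>2" by (simp add: C_def)
    finally show ?thesis using heat_op_diff[OF s bc fb, of \<delta> x0] heat_op_const[OF s, of \<delta> x0] by simp
  qed
  \<comment> \<open>This gives C t <= \<delta> / 4. On (0, t] the flow then grows at rate at least
    \<delta> / 2, hence by \<delta> t / 2, whereas \<open>up\<close> permits only C t^2.\<close>
  define t where "t = min 1 (\<delta> / (4 * C + 4))"
  have t: "0 < t" "t \<le> 1" "t * (4 * C + 4) \<le> \<delta>"
  proof -
    show "0 < t" "t \<le> 1" using \<delta> C by (auto simp: t_def)
    have "t \<le> \<delta> / (4 * C + 4)" by (simp add: t_def)
    then show "t * (4 * C + 4) \<le> \<delta>" using C by (simp add: pos_le_divide_eq)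
  qed
  have Ct: "C * s\<^sup>2 \<le> \<delta> / 4" if "0 < s" "s \<le> t" for s
  proof -
    have "s\<^sup>2 \<le> s" using that t by (simp add: power2_eq_square mult_left_le)
    then have "C * s\<^sup>2 \<le> C * t" using that C by (intro mult_left_mono) auto
    then show ?thesis using t by (simp add: algebra_simps)
  qed
  have "V x0 \<le> heat_op t V x0 - \<delta> / 2 * t"
  proof (rule limit_le_of_deriv_nonneg[OF t(1)])
    show "((\<lambda>s. heat_op s V x0 - \<delta> / 2 * s) has_real_derivative heat_op s f x0 - \<delta> / 2) (at s)" if "0 < s" for s
      using heat_pair_deriv[OF p that, of x0] by (auto intro!: derivative_eq_intros)
    show "0 \<le> heat_op s f x0 - \<delta> / 2" if "0 < s" "s \<le> t" for s using dn[of s] Ct[OF that] that \<delta> by simp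
    have "((\<lambda>s. heat_op s V x0 - \<delta> / 2 * s) \<longlongrightarrow> V x0 - \<delta> / 2 * 0) (at_right 0)"
      by (intro tendsto_intros heat_pair_limit[OF p])
    then show "((\<lambda>s. heat_op s V x0 - \<delta> / 2 * s) \<longlongrightarrow> V x0) (at_right 0)" by simp
  qed
  then have "\<delta> / 2 * t \<le> C * t\<^sup>2" using up[OF t(1)] by simp
  then have "\<delta> / 2 \<le> C * t" using t(1) by (simp add: power2_eq_square)
  then show False using t \<delta> by (simp add: algebra_simps)
qed

text \<open>The derivative of exp (- c s) P_s V is exp (- c s) P_s (f - c V), and f - c V vanishes
  outside a ball. Far from this ball the tail bound makes the change of the weighted flow over (0,
  t] small, while its value at a late time t is small because of the weight.\<close>

lemma heat_pair_decay:
  fixes V f :: "'a::euclidean_space \<Rightarrow> real"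
  assumes p: "heat_pair M V f" and c: "c > 0" and G: "\<And>y. norm y \<ge> R \<Longrightarrow> f y = c * V y" and \<epsilon>: "\<epsilon> > 0"
  shows "\<exists>R'. \<forall>x. norm x > R' \<longrightarrow> \<bar>V x\<bar> < \<epsilon>"
proof -
  have V: "bdd_meas M V" and fb: "bdd_meas M f" using p by (auto simp: heat_pair_def)
  have M0: "M \<ge> 0" using V abs_ge_zero by (auto simp: bdd_meas_def intro: order_trans)
  define m4 where "m4 = (LINT w::'a|lborel. norm w ^ 4 * heat 1 w)"
  have m4: "m4 \<ge> 0" unfolding m4_def by (intro integral_nonneg_AE) (auto simp: less_imp_le[OF heat_pos])
  define g where "g = (\<lambda>y. f y - c * V y)"
  have g: "bdd_meas (M + \<bar>c\<bar> * M) g" unfolding g_def by (intro bdd_meas_diff fb bdd_meas_cmult V)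
  define M2 where "M2 = M + \<bar>c\<bar> * M"
  have M2: "M2 \<ge> 0" using M0 c by (simp add: M2_def)
  \<comment> \<open>Late enough for exp (- c t) M < \<epsilon> / 2, by exp x >= 1 + x.\<close>
  define t where "t = max 1 (2 * (M + 1) / (c * \<epsilon>))"
  have t: "t > 0" by (simp add: t_def)
  have et: "exp (- c * t) * M < \<epsilon> / 2"
  proof -
    have "2 * (M + 1) / (c * \<epsilon>) \<le> t" by (simp add: t_def)
    then have "2 * (M + 1) \<le> t * c * \<epsilon>" using c \<epsilon> by (simp add: pos_divide_le_eq mult_ac)
    then have "M < \<epsilon> / 2 * (c * t)" using M0 by (simp add: mult_ac)
    also have "\<dots> \<le> \<epsilon> / 2 * exp (c * t)" using \<epsilon> exp_ge_add_one_self[of "c * t"] by (intro mult_left_mono) linarith+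
    finally have "exp (- c * t) * M < exp (- c * t) * (\<epsilon> / 2 * exp (c * t))" by (intro mult_strict_left_mono) auto
    also have "\<dots> = \<epsilon> / 2 * (exp (- c * t) * exp (c * t))" by (simp only: mult_ac)
    also have "exp (- c * t) * exp (c * t) = 1" by (simp flip: exp_add)
    finally show ?thesis by simp
  qed
  define B where "B = M2 * t\<^sup>2 * m4"
  have B: "B \<ge> 0" using M2 m4 by (simp add: B_def)
  \<comment> \<open>The distance at which the tail accumulated over time t falls below \<epsilon> /
    2; d >= 1 allows d to be replaced by d^4.\<close>
  define d where "d = max 1 (2 * t * (B + 1) / \<epsilon>)"
  have d: "d \<ge> 1" by (simp add: d_def)
  have small: "t * (B / d ^ 4) < \<epsilon> / 2"
  proof -
    have "2 * t * (B + 1) / \<epsilon> \<le> d" by (simp add: d_def)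
    then have "2 * t * (B + 1) \<le> d * \<epsilon>" using \<epsilon> by (simp add: pos_divide_le_eq)
    also have "\<dots> \<le> d ^ 4 * \<epsilon>" using d \<epsilon> self_le_power[of d 4] by (intro mult_right_mono) auto
    finally have "t * B < \<epsilon> / 2 * d ^ 4" using t by (simp add: algebra_simps)
    then show ?thesis using d by (simp add: divide_simps split: if_splits)
  qed
  have "\<bar>V x\<bar> < \<epsilon>" if x: "norm x > R + d" for x
  proof -
    have gb: "\<bar>heat_op s g x\<bar> \<le> B / d ^ 4" if s: "0 < s" "s \<le> t" for s
    proof -
      have "\<bar>heat_op s g x\<bar> \<le> M2 * s\<^sup>2 / d ^ 4 * m4" unfolding m4_def M2_def
      proof (rule heat_op_tail[OF s(1) g])
        fix y assume "norm (y - x) < d"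
        then have "norm y \<ge> R" using x norm_triangle_ineq2[of x "x - y"] by (simp add: norm_minus_commute)
        then show "g y = 0" using G by (simp add: g_def)
      qed (use d in simp)
      also have "\<dots> \<le> M2 * t\<^sup>2 / d ^ 4 * m4"
        using s M2 m4 d by (intro mult_right_mono divide_right_mono mult_left_mono power_mono) auto
      finally show ?thesis by (simp add: B_def)
    qed
    have D: "((\<lambda>s. exp (- c * s) * heat_op s V x) has_real_derivative exp (- c * s) * heat_op s g x) (at s)" if "s > 0" for s
    proof -
      have "((\<lambda>s. exp (- c * s) * heat_op s V x) has_real_derivative exp (- c * s) * (- c) * heat_op s V x + exp (- c * s) * heat_op s f x) (at s)"
        using heat_pair_deriv[OF p that, of x] by (auto intro!: derivative_eq_intros)
      moreover have g_eq: "heat_op s g x = heat_op s f x - c * heat_op s V x"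
        unfolding g_def using heat_op_diff[OF that fb bdd_meas_cmult[OF V]] heat_op_cmult by simp
      ultimately show ?thesis unfolding g_eq by (elim DERIV_cong) (simp add: algebra_simps)
    qed
    have eg: "\<bar>exp (- c * s) * heat_op s g x\<bar> \<le> B / d ^ 4" if s: "0 < s" "s \<le> t" for s
    proof -
      have "\<bar>exp (- c * s) * heat_op s g x\<bar> \<le> 1 * (B / d ^ 4)" unfolding abs_mult
        using gb[OF s] c s by (intro mult_mono) auto
      then show ?thesis by simp
    qed
    have L: "((\<lambda>s. exp (- c * s) * heat_op s V x) \<longlongrightarrow> V x) (at_right 0)"
    proof -
      have "((\<lambda>s. exp (- c * s) * heat_op s V x) \<longlongrightarrow> exp (- c * 0) * V x) (at_right 0)"
        by (intro tendsto_intros heat_pair_limit[OF p])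
      then show ?thesis by simp
    qed
    have L1: "((\<lambda>s. B / d ^ 4 * s + exp (- c * s) * heat_op s V x) \<longlongrightarrow> V x) (at_right 0)"
      using tendsto_add[OF tendsto_mult[OF tendsto_const[of "B / d ^ 4"] tendsto_ident_at[of 0 "{0<..}"]] L] by simp
    have L2: "((\<lambda>s. B / d ^ 4 * s - exp (- c * s) * heat_op s V x) \<longlongrightarrow> - V x) (at_right 0)"
      using tendsto_diff[OF tendsto_mult[OF tendsto_const[of "B / d ^ 4"] tendsto_ident_at[of 0 "{0<..}"]] L] by simp
    have D1: "((\<lambda>s. B / d ^ 4 * s + exp (- c * s) * heat_op s V x) has_real_derivative B / d ^ 4 + exp (- c * s) * heat_op s g x) (at s)"
      and D2: "((\<lambda>s. B / d ^ 4 * s - exp (- c * s) * heat_op s V x) has_real_derivative B / d ^ 4 - exp (- c * s) * heat_op s g x) (at s)"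
      if "s > 0" for s
      using DERIV_add[OF DERIV_cmult_Id D[OF that], of "B / d ^ 4"] DERIV_diff[OF DERIV_cmult_Id D[OF that], of "B / d ^ 4"] by simp_all
    have "V x \<le> B / d ^ 4 * t + exp (- c * t) * heat_op t V x"
      by (rule limit_le_of_deriv_nonneg[OF t D1 _ L1]) (use eg in \<open>auto simp: abs_le_iff, force\<close>)
    moreover have "- V x \<le> B / d ^ 4 * t - exp (- c * t) * heat_op t V x"
      by (rule limit_le_of_deriv_nonneg[OF t D2 _ L2]) (use eg in \<open>auto simp: abs_le_iff\<close>)
    ultimately have "\<bar>V x\<bar> \<le> t * (B / d ^ 4) + \<bar>exp (- c * t) * heat_op t V x\<bar>" by (simp add: mult.commute)
    also have "\<bar>exp (- c * t) * heat_op t V x\<bar> \<le> exp (- c * t) * M"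
      unfolding abs_mult using heat_op_bound[OF t V, of x] by (intro mult_mono) auto
    finally show ?thesis using et small by linarith
  qed
  then show ?thesis by blast
qed

definition vanishes_at_infinity :: "('a::euclidean_space \<Rightarrow> real) \<Rightarrow> bool" where
  "vanishes_at_infinity V \<longleftrightarrow> (\<forall>\<epsilon>>0. \<exists>R. \<forall>x. norm x > R \<longrightarrow> \<bar>V x\<bar> < \<epsilon>)"

text \<open>Outside a large ball |V| stays below the positive value V x1, so a maximum over the
  compact part of S is a maximum over S.\<close>

lemma vanishing_attains_max:
  fixes V :: "'a::euclidean_space \<Rightarrow> real"
  assumes c: "continuous_on UNIV V" and v: "vanishes_at_infinity V" and S: "closed S" and x1: "x1 \<in> S" "V x1 > 0"
  obtains x0 where "x0 \<in> S" "\<And>y. y \<in> S \<Longrightarrow> V y \<le> V x0"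
proof -
  obtain R where R: "\<forall>x. norm x > R \<longrightarrow> \<bar>V x\<bar> < V x1" using v x1 by (auto simp: vanishes_at_infinity_def)
  have x1R: "norm x1 \<le> R" using R x1 by (metis abs_of_pos less_irrefl not_less)
  have "compact (S \<inter> cball 0 R)" using S by (simp add: closed_Int_compact)
  moreover have "S \<inter> cball 0 R \<noteq> {}" using x1 x1R by auto
  ultimately obtain x0 where x0: "x0 \<in> S \<inter> cball 0 R" "\<forall>y\<in>S \<inter> cball 0 R. V y \<le> V x0"
    using continuous_attains_sup[of "S \<inter> cball 0 R" V] continuous_on_subset[OF c] by blast
  have "V y \<le> V x0" if "y \<in> S" for y
  proof (cases "norm y \<le> R")
    case True then show ?thesis using x0 that by simp
  next
    case False
    then have "\<bar>V y\<bar> < V x1" using R by simp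
    moreover have "V x1 \<le> V x0" using x0 x1 x1R by simp
    ultimately show ?thesis by linarith
  qed
  then show ?thesis using that x0 by blast
qed

section \<open>Moving planes\<close>

text \<open>With \<open>w\<close> the Laplace transform of the temperature and \<open>A\<close> its value on the interface,
  \<open>V = \<sigma>m A + \<sigma> (w - A)\<close>. This has no jump of the flux across the interface, and \<open>f = w - 1\<^sub>\<Omega>\<close>.\<close>

locale two_phase =
  fixes \<Omega> :: "'a::euclidean_space set" and V f :: "'a \<Rightarrow> real" and M A \<sigma>p \<sigma>m :: real
  assumes op: "open \<Omega>" and bd: "bounded \<Omega>" and ne: "\<Omega> \<noteq> {}"
    and A: "A > 0" and sp: "\<sigma>p > 0" and sm: "\<sigma>m > 0"
    and hp: "heat_pair M V f"
    and fin: "\<And>x. x \<in> \<Omega> \<Longrightarrow> f x = A - 1 + (V x - \<sigma>m * A) / \<sigma>p"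
    and fout: "\<And>x. x \<notin> \<Omega> \<Longrightarrow> f x = V x / \<sigma>m"
    and fr: "\<And>x. x \<in> frontier \<Omega> \<Longrightarrow> V x = \<sigma>m * A"
begin

section \<open>The range of V and the description of the domain as a superlevel set\<close>

definition "level = \<sigma>m * A"

lemma level: "level > 0" using A sm by (simp add: level_def)

lemma V_continuous: "continuous_on UNIV V" and V_bdd_meas: "bdd_meas M V" and f_bdd_meas: "bdd_meas M f"
  using hp by (auto simp: heat_pair_def)

lemma V_vanishes: "vanishes_at_infinity V"
proof -
  obtain R where R: "\<forall>x\<in>\<Omega>. norm x \<le> R" using bd by (auto simp: bounded_iff)
  have "f y = (1 / \<sigma>m) * V y" if "norm y \<ge> R + 1" for y using fout[of y] R that by force
  then show ?thesis unfolding vanishes_at_infinity_def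
    using heat_pair_decay[OF hp, of "1 / \<sigma>m" "R + 1"] sm by auto
qed

lemma ball_where_greater:
  assumes "continuous_on UNIV g" "open S" "x0 \<in> S" "(g :: 'a \<Rightarrow> real) x0 > c"
  obtains r where "r > 0" "\<And>y. y \<in> ball x0 r \<Longrightarrow> y \<in> S \<and> g y > c"
proof -
  have "open (S \<inter> {y. c < g y})" using assms by (intro open_Int open_Collect_less continuous_intros) auto
  then obtain r where "r > 0" "ball x0 r \<subseteq> S \<inter> {y. c < g y}" using assms(3,4) open_contains_ball[of "S \<inter> {y. c < g y}"] by blast
  then show ?thesis using that by blast
qed

text \<open>An extremal point whose value differs from \<open>level\<close> thus has a whole
  neighbourhood in one phase, as required for \<open>heat_pair_no_local_max\<close>.\<close>

lemma exterior_cases: assumes "x \<notin> \<Omega>" obtains "V x = level" | "x \<in> - closure \<Omega>"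
  using assms fr[of x] op by (auto simp: frontier_def interior_open level_def)

text \<open>Near an exterior maximum above \<open>level\<close> the source V / \<sigma>m would
  exceed the positive constant level / \<sigma>m, which a local maximum forbids.\<close>

lemma outside_le: assumes "x \<notin> \<Omega>" shows "V x \<le> level"
proof (rule ccontr)
  assume *: "\<not> V x \<le> level"
  have "closed (- \<Omega>)" "x \<in> - \<Omega>" "V x > 0" using op assms * level by auto
  from vanishing_attains_max[OF V_continuous V_vanishes this] obtain x0 where x0: "x0 \<notin> \<Omega>" "\<And>y. y \<notin> \<Omega> \<Longrightarrow> V y \<le> V x0" by auto
  have "V x0 > level" using x0(2)[OF assms] * by linarith
  then have "x0 \<in> - closure \<Omega>" using exterior_cases[OF x0(1)] by auto
  then obtain r where r: "r > 0" "\<And>y. y \<in> ball x0 r \<Longrightarrow> y \<in> - closure \<Omega> \<and> V y > level"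
    using ball_where_greater[OF V_continuous, of "- closure \<Omega>" x0 level] \<open>V x0 > level\<close> by auto
  then have out: "\<And>y. y \<in> ball x0 r \<Longrightarrow> y \<notin> \<Omega>" using closure_subset by fast
  show False
    by (rule heat_pair_no_local_max[OF hp r(1), of "level / \<sigma>m" x0])
       (use level sm x0(2)[OF out] r(2) fout[OF out] in \<open>simp_all add: divide_right_mono less_imp_le\<close>)
qed

lemma outside_nonneg: assumes "x \<notin> \<Omega>" shows "V x \<ge> 0"
proof (rule ccontr)
  assume *: "\<not> V x \<ge> 0"
  have c: "continuous_on UNIV (\<lambda>x. - V x)" using V_continuous by (intro continuous_intros)
  have v: "vanishes_at_infinity (\<lambda>x. - V x)" using V_vanishes by (simp add: vanishes_at_infinity_def)
  have "closed (- \<Omega>)" "x \<in> - \<Omega>" "- V x > 0" using op assms * level by auto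
  from vanishing_attains_max[OF c v this] obtain x0 where x0: "x0 \<notin> \<Omega>" "\<And>y. y \<notin> \<Omega> \<Longrightarrow> - V y \<le> - V x0" by auto
  have n: "- V x0 > 0" using x0(2)[OF assms] * by linarith
  then have "x0 \<in> - closure \<Omega>" using level by (cases rule: exterior_cases[OF x0(1)]) auto
  then obtain r where r: "r > 0" "\<And>y. y \<in> ball x0 r \<Longrightarrow> y \<in> - closure \<Omega> \<and> - V y > - V x0 / 2"
    using ball_where_greater[OF c, of "- closure \<Omega>" x0 "- V x0 / 2"] n by auto
  then have out: "\<And>y. y \<in> ball x0 r \<Longrightarrow> y \<notin> \<Omega>" using closure_subset by fast
  show False
  proof (rule heat_pair_no_local_max[OF heat_pair_uminus[OF hp] r(1), of "(- V x0 / 2) / \<sigma>m" x0])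
    show "(- V x0 / 2) / \<sigma>m > 0" using n sm by (intro divide_pos_pos) auto
    show "- V y \<le> - V x0" if "y \<in> ball x0 r" for y using x0(2)[OF out[OF that]] .
    show "- V x0 / 2 / \<sigma>m \<le> - f y" if "y \<in> ball x0 r" for y
      using r(2)[OF that] fout[OF out[OF that]] sm by (simp add: divide_simps)
  qed
qed

lemma closure_cases: assumes "x \<in> closure \<Omega>" obtains "x \<in> \<Omega>" | "V x = level"
  using assms fr[of x] op by (auto simp: frontier_def interior_open level_def)

lemma closure_compact_nonempty: "compact (closure \<Omega>)" "closure \<Omega> \<noteq> {}" using bd ne by (auto simp: compact_closure)

text \<open>The last hypothesis says that the source is negative at x. At a minimum point in
  \<Omega> it is at least as negative, and a local minimum forbids this. The form with conclusion
  \<open>False\<close> serves both the exclusion of A >= 1 and, afterwards, the case A < 1.\<close>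

lemma inside_min:
  assumes x: "x \<in> \<Omega>" and c: "V x \<le> level" and d: "A - 1 + (V x - level) / \<sigma>p < 0"
  shows False
proof -
  obtain x1 where x1: "x1 \<in> closure \<Omega>" "\<And>y. y \<in> closure \<Omega> \<Longrightarrow> V x1 \<le> V y"
    using continuous_attains_inf[OF closure_compact_nonempty continuous_on_subset[OF V_continuous]] by auto
  have "V x1 \<le> V x" using x1(2) x closure_subset by blast
  \<comment> \<open>If the minimum is taken on the interface, its value is \<open>level\<close>;
    since V x <= level, x itself is then a minimum point inside.\<close>
  obtain x0 where x0: "x0 \<in> \<Omega>" "V x0 = V x1"
    using closure_cases[OF x1(1)] x1 \<open>V x1 \<le> V x\<close> x c by (metis antisym)
  define \<delta> where "\<delta> = - (A - 1 + (V x0 - level) / \<sigma>p)"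
  have "(V x0 - level) / \<sigma>p \<le> (V x - level) / \<sigma>p" using sp x0 \<open>V x1 \<le> V x\<close> by (intro divide_right_mono) auto
  then have \<delta>: "\<delta> > 0" using d by (simp add: \<delta>_def)
  have c: "continuous_on UNIV (\<lambda>y. - (A - 1 + (V y - level) / \<sigma>p))" using V_continuous sp by (intro continuous_intros) auto
  obtain r where r: "r > 0" "\<And>y. y \<in> ball x0 r \<Longrightarrow> y \<in> \<Omega> \<and> - (A - 1 + (V y - level) / \<sigma>p) > \<delta> / 2"
    using ball_where_greater[OF c op x0(1), of "\<delta> / 2"] \<delta> unfolding \<delta>_def by (metis field_sum_of_halves less_add_same_cancel1 half_gt_zero)
  show False
  proof (rule heat_pair_no_local_max[OF heat_pair_uminus[OF hp] r(1), of "\<delta> / 2" x0])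
    show "- V y \<le> - V x0" if "y \<in> ball x0 r" for y
      using r(2)[OF that] x1(2)[of y] x0 closure_subset by auto
    show "\<delta> / 2 \<le> - f y" if "y \<in> ball x0 r" for y
      using r(2)[OF that] fin[of y] by (auto simp: level_def)
  qed (use \<delta> in simp)
qed

text \<open>For A >= 1 the source is positive wherever V > level in \<Omega>, so no interior maximum
  above \<open>level\<close> can exist.\<close>

lemma inside_max: assumes A1: "A \<ge> 1" and x: "x \<in> \<Omega>" shows "V x \<le> level"
proof (rule ccontr)
  assume *: "\<not> V x \<le> level"
  obtain x0 where x0: "x0 \<in> closure \<Omega>" "\<And>y. y \<in> closure \<Omega> \<Longrightarrow> V y \<le> V x0"
    using continuous_attains_sup[OF closure_compact_nonempty continuous_on_subset[OF V_continuous]] by auto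
  have "V x \<le> V x0" using x0(2) x closure_subset by blast
  then have g: "V x0 > level" using * by simp
  then have i: "x0 \<in> \<Omega>" using closure_cases[OF x0(1)] by auto
  obtain r where r: "r > 0" "\<And>y. y \<in> ball x0 r \<Longrightarrow> y \<in> \<Omega> \<and> V y > (V x0 + level) / 2"
    using ball_where_greater[OF V_continuous op i, of "(V x0 + level) / 2"] g by auto
  show False
  proof (rule heat_pair_no_local_max[OF hp r(1), of "(V x0 - level) / 2 / \<sigma>p" x0])
    show "V y \<le> V x0" if "y \<in> ball x0 r" for y
      using r(2)[OF that] x0(2)[of y] closure_subset by auto
    show "(V x0 - level) / 2 / \<sigma>p \<le> f y" if "y \<in> ball x0 r" for y
    proof -
      have "(V x0 - level) / 2 / \<sigma>p \<le> (V y - level) / \<sigma>p" using r(2)[OF that] sp by (intro divide_right_mono) auto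
      then show ?thesis using r(2)[OF that] fin[of y] A1 by (auto simp: level_def)
    qed
  qed (use g sp in simp)
qed

text \<open>If A >= 1, then V <= level everywhere and f >= 0, so the flow at a boundary point p
  starts at its largest possible value \<open>level\<close>. It would increase strictly, since f is
  positive on an open set, yet it cannot exceed \<open>level\<close>.\<close>

lemma A_less_1: "A < 1"
proof (rule ccontr)
  assume "\<not> A < 1" then have A1: "A \<ge> 1" by simp
  have le: "V y \<le> level" for y using outside_le[of y] inside_max[OF A1, of y] by blast
  have fnn: "f y \<ge> 0" for y
  proof (cases "y \<in> \<Omega>")
    case True then show ?thesis using inside_min[OF True le] fin[OF True] by (auto simp: level_def not_less[symmetric])
  next
    case False then show ?thesis using outside_nonneg[OF False] fout[OF False] sm by simp
  qed
  obtain b :: 'a where b: "b \<in> Basis" using nonempty_Basis by blast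
  \<comment> \<open>An extreme point in a coordinate direction: the half-space beyond it is disjoint
    from \<Omega>, and near p it contains a ball on which f >= level / (2 \<sigma>m).\<close>
  have "\<exists>x\<in>closure \<Omega>. \<forall>y\<in>closure \<Omega>. y \<bullet> b \<le> x \<bullet> b"
    by (rule continuous_attains_sup[OF closure_compact_nonempty]) (intro continuous_intros)
  then obtain p where p: "p \<in> closure \<Omega>" "\<And>y. y \<in> closure \<Omega> \<Longrightarrow> y \<bullet> b \<le> p \<bullet> b" by blast
  have out: "y \<notin> closure \<Omega>" if "y \<bullet> b > p \<bullet> b" for y using p(2)[of y] that by auto
  have "p \<notin> \<Omega>"
  proof
    assume "p \<in> \<Omega>"
    then obtain r where r: "r > 0" "ball p r \<subseteq> \<Omega>" using op openE by blast
    have "p + (r/2) *\<^sub>R b \<in> ball p r" using r b by (simp add: dist_norm)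
    then have "p + (r/2) *\<^sub>R b \<in> closure \<Omega>" using r closure_subset by blast
    moreover have "(p + (r/2) *\<^sub>R b) \<bullet> b > p \<bullet> b" using r b by (simp add: inner_add_left)
    ultimately show False using out by blast
  qed
  then have pk: "V p = level" using closure_cases[OF p(1)] by auto
  obtain r where r: "r > 0" "\<And>y. y \<in> ball p r \<Longrightarrow> V y > level / 2"
    using ball_where_greater[OF V_continuous open_UNIV, of p "level / 2"] pk level by auto
  define q where "q = p + (r/2) *\<^sub>R b"
  have fpos: "f y \<ge> level / 2 / \<sigma>m" if "y \<in> ball q (r/2)" for y
  proof -
    have d: "dist q y < r / 2" using that by simp
    have "dist p q = r / 2" using r b by (simp add: q_def dist_norm)
    then have "y \<in> ball p r" using d dist_triangle[of p y q] by simp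
    moreover have "(q - y) \<bullet> b < r / 2"
      using d Basis_le_norm[OF b, of "q - y"] by (simp add: dist_norm)
    then have "y \<bullet> b > p \<bullet> b" using b by (simp add: q_def inner_diff_left inner_add_left)
    then have "y \<notin> \<Omega>" using out closure_subset by blast
    ultimately show ?thesis using r(2)[of y] fout[of y] sm divide_right_mono[of "level / 2" "V y" \<sigma>m] by simp
  qed
  have pos: "heat_op s f p > 0" if s: "s > 0" for s unfolding heat_op_def
  proof (rule integral_pos_of_continuous[OF heat_op_integrable[OF s f_bdd_meas] _ half_gt_zero[OF r(1)], of p q])
    show "0 \<le> heat s (p - y) * f y" for y using fnn[of y] heat_pos[OF s, of "p - y"] by simp
    show "0 < heat s (p - y) * f y" if "y \<in> ball q (r / 2)" for y
    proof -
      have "level / 2 / \<sigma>m > 0" using level sm by simp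
      then show ?thesis using fpos[OF that] heat_pos[OF s, of "p - y"] by simp
    qed
  qed
  \<comment> \<open>The limit at time 0 yields only a weak inequality; strictness is gained between
    the times 1 and 2.\<close>
  have "V p \<le> heat_op 1 V p"
    by (rule limit_le_of_deriv_nonneg[OF _ heat_pair_deriv[OF hp] _ heat_pair_limit[OF hp]])
       (use pos in \<open>auto simp: less_imp_le\<close>)
  also have "heat_op 1 V p < heat_op 2 V p"
  proof (rule DERIV_pos_imp_increasing[where f="\<lambda>s. heat_op s V p"])
    fix s :: real assume "1 \<le> s"
    then have "s > 0" by simp
    then show "\<exists>D. ((\<lambda>s. heat_op s V p) has_real_derivative D) (at s) \<and> 0 < D"
      by (intro exI[of _ "heat_op s f p"] conjI heat_pair_deriv[OF hp] pos)
  qed simp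
  also have "heat_op 2 V p \<le> heat_op 2 (\<lambda>_. level) p"
    by (rule heat_op_mono[OF _ V_bdd_meas, of _ "\<bar>level\<bar>"]) (use le in \<open>auto simp: bdd_meas_def\<close>)
  finally show False using pk heat_op_const[of 2 level p] by simp
qed

lemma inside_gt: assumes "x \<in> \<Omega>" shows "V x > level"
proof (rule ccontr)
  assume *: "\<not> V x > level"
  then have "(V x - level) / \<sigma>p \<le> 0" using sp by (simp add: divide_le_0_iff)
  then show False using inside_min[OF assms] * A_less_1 by simp
qed

text \<open>Turns statements about reflected parts of \<Omega> into inequalities between values of
  V.\<close>

lemma mem_iff: "x \<in> \<Omega> \<longleftrightarrow> V x > level" using inside_gt outside_le by (meson not_less)

text \<open>As V rises through \<open>level\<close> the source drops from A = level / \<sigma>m to A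
  - 1; this sign of the jump is what \<open>G_nonneg\<close> exploits.\<close>

lemma f_eq: "f x = (if V x > level then A - 1 + (V x - level) / \<sigma>p else V x / \<sigma>m)"
  using fin[of x] fout[of x] mem_iff[of x] by (auto simp: level_def)

section \<open>Admissible plane positions and the comparison of V with its reflection\<close>

definition "cap e \<tau> \<longleftrightarrow> (\<forall>x\<in>\<Omega>. x \<bullet> e > \<tau> \<longrightarrow> refl_at e \<tau> x \<in> \<Omega>)"

lemma refl_vanishes:
  assumes e: "norm e = 1" shows "vanishes_at_infinity (\<lambda>x. V (refl_at e \<tau> x) - V x)"
  unfolding vanishes_at_infinity_def
proof (intro allI impI)
  fix \<epsilon> :: real assume "\<epsilon> > 0"
  then obtain R where R: "\<forall>x. norm x > R \<longrightarrow> \<bar>V x\<bar> < \<epsilon> / 2" using V_vanishes half_gt_zero unfolding vanishes_at_infinity_def by blast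
  show "\<exists>R. \<forall>x. R < norm x \<longrightarrow> \<bar>V (refl_at e \<tau> x) - V x\<bar> < \<epsilon>"
  proof (intro exI allI impI)
    fix x :: 'a assume x: "\<bar>R\<bar> + norm (refl_at e \<tau> 0) < norm x"
    have "norm (refl_at e \<tau> x - refl_at e \<tau> 0) = norm x" using dist_refl_at_refl_at[OF e, of \<tau> x 0] by simp
    then have "norm x \<le> norm (refl_at e \<tau> x) + norm (refl_at e \<tau> 0)" by (metis norm_triangle_ineq4)
    then have "norm (refl_at e \<tau> x) > R" "norm x > R" using x norm_ge_zero[of "refl_at e \<tau> 0"] by linarith+
    then show "\<bar>V (refl_at e \<tau> x) - V x\<bar> < \<epsilon>" using R by (smt (verit) field_sum_of_halves)
  qed
qed

lemma V_refl_continuous: "continuous_on UNIV (\<lambda>x. V (refl_at e \<tau> x))"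
  by (rule continuous_on_compose2[OF V_continuous continuous_refl_at]) auto

text \<open>At a positive maximum of V (refl x) - V x over the half-space, both points lie in the
  same phase: if x is in \<Omega>, because V is even larger at the image; if not, because of the cap
  condition. There the sources differ by a positive multiple of the difference, which is impossible
  at a maximum.\<close>

lemma cap_imp_ge:
  assumes e: "norm e = 1" and cap: "cap e \<tau>" and x: "x \<bullet> e \<le> \<tau>"
  shows "V (refl_at e \<tau> x) \<le> V x"
proof (rule ccontr)
  let ?Z = "\<lambda>x. V (refl_at e \<tau> x) - V x" and ?g = "\<lambda>x. f (refl_at e \<tau> x) - f x"
  assume "\<not> ?thesis"
  then have p: "?Z x > 0" by simp
  have Zc: "continuous_on UNIV ?Z" by (intro continuous_intros V_refl_continuous V_continuous)
  have "closed {x. x \<bullet> e \<le> \<tau>}" by (intro closed_Collect_le continuous_intros)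
  from vanishing_attains_max[OF Zc refl_vanishes[OF e] this _ p] x
  obtain x0 where x0: "x0 \<bullet> e \<le> \<tau>" "\<And>y. y \<bullet> e \<le> \<tau> \<Longrightarrow> ?Z y \<le> ?Z x0" by auto
  have Z0: "?Z x0 > 0" using x0(2)[OF x] p by linarith
  have "x0 \<bullet> e \<noteq> \<tau>" using Z0 by (auto simp: refl_at_def)
  then have lt: "x0 \<bullet> e < \<tau>" using x0 by simp
  have oph: "open {y. y \<bullet> e < \<tau>}" by (intro open_Collect_less continuous_intros)
  \<comment> \<open>The common end of both cases, with 1 / c as the proportionality factor of the
    phase; near x0 the difference stays above half of its maximum.\<close>
  have concl: False if S: "open S" "x0 \<in> S" "c > 0" "\<And>y. y \<in> S \<Longrightarrow> y \<bullet> e < \<tau> \<Longrightarrow> ?g y = ?Z y / c" for S c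
  proof -
    have "x0 \<in> S \<inter> {y. y \<bullet> e < \<tau>}" "?Z x0 > ?Z x0 / 2" using S lt Z0 by auto
    from ball_where_greater[OF Zc open_Int[OF S(1) oph] this]
    obtain r where r: "r > 0" "\<And>y. y \<in> ball x0 r \<Longrightarrow> y \<in> S \<inter> {y. y \<bullet> e < \<tau>} \<and> ?Z y > ?Z x0 / 2" by blast
    show False
    proof (rule heat_pair_no_local_max[OF heat_pair_diff[OF heat_pair_refl[OF e hp] hp] r(1), of "?Z x0 / 2 / c" x0])
      show "?Z x0 / 2 / c > 0" using Z0 S by simp
      show "?Z y \<le> ?Z x0" if "y \<in> ball x0 r" for y using x0(2)[of y] r(2)[OF that] by simp
      show "?Z x0 / 2 / c \<le> ?g y" if y: "y \<in> ball x0 r" for y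
      proof -
        have "?g y = ?Z y / c" using r(2)[OF y] S(4)[of y] by blast
        moreover have "?Z x0 / 2 / c \<le> ?Z y / c" using r(2)[OF y] \<open>c > 0\<close> by (intro divide_right_mono) auto
        ultimately show ?thesis by linarith
      qed
    qed
  qed
  show False
  proof (cases "x0 \<in> \<Omega>")
    case True
    then have "refl_at e \<tau> x0 \<in> \<Omega>" using Z0 unfolding mem_iff by simp
    then show False
    proof (intro concl[of "{y. level < V y} \<inter> {y. level < V (refl_at e \<tau> y)}" \<sigma>p])
      show "open ({y. level < V y} \<inter> {y. level < V (refl_at e \<tau> y)})"
        by (intro open_Int open_Collect_less continuous_intros V_continuous V_refl_continuous)
    qed (use True sp in \<open>auto simp: mem_iff f_eq diff_divide_distrib\<close>)
  next
    case False
    \<comment> \<open>Otherwise the image would be a point of \<Omega> beyond the plane whose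
      reflection y is not in \<Omega>.\<close>
    have ro: "refl_at e \<tau> y \<notin> \<Omega>" if "y \<notin> \<Omega>" "y \<bullet> e < \<tau>" for y
      using cap that refl_at_inner[OF e, of \<tau> y] refl_at_refl_at[OF e, of \<tau> y] unfolding cap_def by fastforce
    have "V (refl_at e \<tau> x0) \<le> level" using outside_le[OF ro[OF False lt]] .
    then have "V x0 \<noteq> level" using Z0 by simp
    then have "x0 \<in> - closure \<Omega>" using exterior_cases[OF False] by blast
    then show False
    proof (intro concl[of "- closure \<Omega>" \<sigma>m])
      fix y assume y: "y \<in> - closure \<Omega>" "y \<bullet> e < \<tau>"
      then have "y \<notin> \<Omega>" using closure_subset by blast
      then show "?g y = ?Z y / \<sigma>m" using ro[OF _ y(2)] by (simp add: fout diff_divide_distrib)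
    qed (use sm in auto)
  qed
qed

text \<open>With this rate, \<open>rate * V - f\<close> is a nondecreasing function of \<open>V\<close>, the jump at the interface included.\<close>

definition "rate = max (1 / \<sigma>p) (1 / \<sigma>m)"

lemma rate: "rate > 0" "rate \<ge> 1 / \<sigma>p" "rate \<ge> 1 / \<sigma>m" using sp sm by (auto simp: rate_def less_max_iff_disj)

context
  fixes e :: 'a and \<tau> :: real
  assumes e: "norm e = 1" and ge: "\<And>x. x \<bullet> e \<le> \<tau> \<Longrightarrow> V (refl_at e \<tau> x) \<le> V x"
begin

definition "Z x = V x - V (refl_at e \<tau> x)"
text \<open>Formally \<open>rate\<close> minus the Laplacian, applied to Z: the weighted flow exp (-
  rate s) P_s Z has derivative - exp (- rate s) P_s G.\<close>

definition "G x = rate * Z x - (f x - f (refl_at e \<tau> x))"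

lemma Z_pair: "heat_pair (M + M) Z (\<lambda>x. f x - f (refl_at e \<tau> x))"
  unfolding Z_def[abs_def] by (rule heat_pair_diff[OF hp heat_pair_refl[OF e hp]])

lemma Z_cont: "continuous_on UNIV Z" and Z_bdd_meas: "bdd_meas (M + M) Z" and source_diff_bdd_meas: "bdd_meas (M + M) (\<lambda>x. f x - f (refl_at e \<tau> x))"
  using Z_pair by (auto simp: heat_pair_def)

lemma Z_anti: "Z (refl_at e \<tau> x) = - Z x" by (simp add: Z_def refl_at_refl_at[OF e])

lemma G_anti: "G (refl_at e \<tau> x) = - G x" unfolding G_def Z_anti by (simp add: refl_at_refl_at[OF e])

lemma G_bdd_meas: "bdd_meas (\<bar>rate\<bar> * (M + M) + (M + M)) G"
  unfolding G_def[abs_def] by (intro bdd_meas_diff bdd_meas_cmult Z_bdd_meas source_diff_bdd_meas)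

lemma Z_nonneg: "x \<bullet> e \<le> \<tau> \<Longrightarrow> Z x \<ge> 0" using ge by (simp add: Z_def)

text \<open>If both values lie in one phase, G is (rate - 1 / \<sigma>) times the nonnegative
  difference. If they lie on different sides of \<open>level\<close>, the distances to
  \<open>level\<close> are compared separately, and the jump of the source adds 1.\<close>

lemma G_nonneg: assumes "x \<bullet> e < \<tau>" shows "G x \<ge> 0"
proof -
  let ?V' = "V (refl_at e \<tau> x)"
  have g: "?V' \<le> V x" using ge assms by simp
  consider "?V' > level" | "V x > level" "?V' \<le> level" | "V x \<le> level" by linarith
  then show ?thesis
  proof cases
    case 1
    then have "G x = (rate - 1 / \<sigma>p) * (V x - ?V')"
      using g by (simp add: G_def Z_def f_eq algebra_simps diff_divide_distrib)
    then show ?thesis using rate g by simp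
  next
    case 2
    have "(V x - level) / \<sigma>p \<le> rate * (V x - level)" using rate(2) 2 mult_right_mono[of "1 / \<sigma>p" rate "V x - level"] by simp
    moreover have "(level - ?V') / \<sigma>m \<le> rate * (level - ?V')" using rate(3) 2 mult_right_mono[of "1 / \<sigma>m" rate "level - ?V'"] by simp
    moreover have "level / \<sigma>m = A" using sm by (simp add: level_def)
    ultimately show ?thesis using 2 by (simp add: G_def Z_def f_eq algebra_simps diff_divide_distrib)
  next
    case 3
    then have "G x = (rate - 1 / \<sigma>m) * (V x - ?V')"
      using g by (simp add: G_def Z_def f_eq algebra_simps diff_divide_distrib)
    then show ?thesis using rate g by simp
  qed
qed

lemma Z_exp_deriv:
  assumes "s > 0"
  shows "((\<lambda>s. exp (- rate * s) * heat_op s Z x) has_real_derivative - (exp (- rate * s) * heat_op s G x)) (at s)"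
proof -
  have "((\<lambda>s. exp (- rate * s) * heat_op s Z x) has_real_derivative exp (- rate * s) * (- rate) * heat_op s Z x +
       exp (- rate * s) * heat_op s (\<lambda>x. f x - f (refl_at e \<tau> x)) x) (at s)"
    using heat_pair_deriv[OF Z_pair assms, of x] by (auto intro!: derivative_eq_intros)
  moreover have g_eq: "heat_op s G x = rate * heat_op s Z x - heat_op s (\<lambda>x. f x - f (refl_at e \<tau> x)) x"
    unfolding G_def[abs_def] using heat_op_diff[OF assms bdd_meas_cmult[OF Z_bdd_meas] source_diff_bdd_meas] heat_op_cmult by simp
  ultimately show ?thesis unfolding g_eq by (elim DERIV_cong) (simp add: algebra_simps)
qed

lemma heat_G_nonneg: "s > 0 \<Longrightarrow> x \<bullet> e \<le> \<tau> \<Longrightarrow> heat_op s G x \<ge> 0"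
  by (rule heat_op_antisym_nonneg[OF e _ G_bdd_meas G_anti G_nonneg])

lemma Z_exp_decreasing:
  assumes "0 < s" "s \<le> t" "x \<bullet> e \<le> \<tau>"
  shows "exp (- rate * t) * heat_op t Z x \<le> exp (- rate * s) * heat_op s Z x"
proof (rule DERIV_nonpos_imp_nonincreasing[where f="\<lambda>s. exp (- rate * s) * heat_op s Z x"])
  fix u assume "s \<le> u"
  then have "u > 0" using assms by simp
  then show "\<exists>y. ((\<lambda>s. exp (- rate * s) * heat_op s Z x) has_real_derivative y) (at u) \<and> y \<le> 0"
    using Z_exp_deriv[of u x] heat_G_nonneg[of u x] assms by (intro exI[of _ "- (exp (- rate * u) * heat_op u G x)"]) simp
qed (use assms in simp)

context
  fixes q assumes q: "q \<bullet> e < \<tau>" "Z q > 0"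
begin

text \<open>Strong maximum principle: the weighted flow of Z is nonincreasing in s below the plane,
  so Z x is at least its value at s = 1, which is positive by propagation from q.\<close>

lemma Z_pos: assumes x: "x \<bullet> e < \<tau>" shows "Z x > 0"
proof -
  have "- Z x \<le> - (exp (- rate * 1) * heat_op 1 Z x)"
  proof (rule limit_le_of_deriv_nonneg[of 1 "\<lambda>s. - (exp (- rate * s) * heat_op s Z x)" "\<lambda>s. exp (- rate * s) * heat_op s G x"])
    show "((\<lambda>s. - (exp (- rate * s) * heat_op s Z x)) has_real_derivative exp (- rate * s) * heat_op s G x) (at s)" if "s > 0" for s
      using DERIV_minus[OF Z_exp_deriv[OF that, of x]] by simp
    show "0 \<le> exp (- rate * s) * heat_op s G x" if "s > 0" for s using heat_G_nonneg[OF that, of x] x by simp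
    have "((\<lambda>s. - (exp (- rate * s) * heat_op s Z x)) \<longlongrightarrow> - (exp (- rate * 0) * Z x)) (at_right 0)"
      by (intro tendsto_intros heat_pair_limit[OF Z_pair])
    then show "((\<lambda>s. - (exp (- rate * s) * heat_op s Z x)) \<longlongrightarrow> - Z x) (at_right 0)" by simp
  qed simp
  moreover have "heat_op 1 Z x > 0"
    by (rule heat_op_antisym_pos[OF e _ Z_bdd_meas Z_anti _ x Z_cont q(2,1)]) (auto intro: Z_nonneg)
  then have "exp (- rate * 1) * heat_op 1 Z x > 0" by simp
  ultimately show ?thesis by linarith
qed

text \<open>Split \<open>V = E + (V - E)\<close> with \<open>E = exp (- rate \<epsilon>) heat_op \<epsilon> V\<close>. The normal derivative of \<open>E\<close> on the plane is bounded
  away from 0 uniformly in \<open>\<epsilon>\<close>, while \<open>V - E\<close> has Lipschitz constant \<open>O(sqrt \<epsilon>)\<close>; so no corner lemma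
  is needed where the plane meets the interface orthogonally.\<close>

lemma V_strictly_decreasing_near:
  assumes p: "p \<bullet> e = \<tau>"
  shows "\<exists>\<rho>>0. \<forall>y h. h > 0 \<longrightarrow> y \<in> ball p \<rho> \<longrightarrow> y + h *\<^sub>R e \<in> ball p \<rho> \<longrightarrow> V (y + h *\<^sub>R e) < V y"
proof -
  define D where "D s = exp (- rate * s) * heat_grad s V e p" for s
  have rp: "refl_at e \<tau> p = p" using p by (simp add: refl_at_def)
  have ee: "e \<bullet> e = 1" using e by (simp add: norm_eq_1)
  \<comment> \<open>Reflection fixes p and reverses the normal, so the reflected part of Z
    contributes the same derivative once more.\<close>
  have gradZ: "heat_grad s Z e p = 2 * heat_grad s V e p" if s: "s > 0" for s
  proof -
    have mV: "(\<lambda>y. - ((p - y) \<bullet> e) / (2 * s) * heat s (p - y) * V y) \<in> borel_measurable borel"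
      using V_bdd_meas by (auto simp: bdd_meas_def)
    have i1: "integrable lborel (\<lambda>y. - ((p - y) \<bullet> e) / (2 * s) * heat s (p - y) * V y)"
      by (rule integrable_heat_grad[OF s V_bdd_meas])
    have i2: "integrable lborel (\<lambda>y. - ((p - y) \<bullet> e) / (2 * s) * heat s (p - y) * V (refl_at e \<tau> y))"
      by (rule integrable_heat_grad[OF s bdd_meas_refl[OF V_bdd_meas]])
    have sw: "- ((p - refl_at e \<tau> y) \<bullet> e) / (2 * s) * heat s (p - refl_at e \<tau> y) = - (- ((p - y) \<bullet> e) / (2 * s) * heat s (p - y))" for y
    proof -
      have "norm (p - refl_at e \<tau> y) = norm (p - y)" using dist_refl_at_refl_at[OF e, of \<tau> p y] rp by simp
      then have "heat s (p - refl_at e \<tau> y) = heat s (p - y)" by (simp add: heat_def)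
      moreover have "(p - refl_at e \<tau> y) \<bullet> e = - ((p - y) \<bullet> e)" by (simp add: inner_diff_left refl_at_inner[OF e] p)
      ultimately show ?thesis by simp
    qed
    have "(LINT y|lborel. - ((p - refl_at e \<tau> y) \<bullet> e) / (2 * s) * heat s (p - refl_at e \<tau> y) * V (refl_at e \<tau> y)) = heat_grad s V e p"
      using lborel_integral_preserved[OF refl_at_measurable lborel_distr_refl_at[OF e] mV, of \<tau>] by (simp add: heat_grad_def)
    then have e2: "(LINT y|lborel. - ((p - y) \<bullet> e) / (2 * s) * heat s (p - y) * V (refl_at e \<tau> y)) = - heat_grad s V e p"
      unfolding sw by simp
    have "heat_grad s Z e p = (LINT y|lborel. - ((p - y) \<bullet> e) / (2 * s) * heat s (p - y) * V y) -
        (LINT y|lborel. - ((p - y) \<bullet> e) / (2 * s) * heat s (p - y) * V (refl_at e \<tau> y))"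
      unfolding heat_grad_def[of s Z] Z_def right_diff_distrib by (rule Bochner_Integration.integral_diff[OF i1 i2])
    then show ?thesis unfolding e2 heat_grad_def[of s V, symmetric] by simp
  qed
  have D1: "D 1 < 0"
  proof -
    have "heat_grad 1 Z e p < 0"
      by (rule heat_grad_antisym_neg[OF e _ Z_bdd_meas Z_anti _ p Z_cont q(2,1)]) (auto intro: Z_nonneg)
    then show ?thesis using gradZ[of 1] by (simp add: D_def mult_pos_neg)
  qed
  \<comment> \<open>The uniform bound in s. The function \<Phi> vanishes on the plane and is
    nonnegative just below it, since the weighted flow decreases in s; hence its normal derivative,
    twice D s - D 1, is at most 0.\<close>
  have De: "D s \<le> D 1" if s: "0 < s" "s \<le> 1" for s
  proof -
    define \<Phi> where "\<Phi> h = exp (- rate * s) * heat_op s Z (p + h *\<^sub>R e) - exp (- rate * 1) * heat_op 1 Z (p + h *\<^sub>R e)" for h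
    have "(\<Phi> has_real_derivative exp (- rate * s) * heat_grad s Z e (p + 0 *\<^sub>R e) - exp (- rate * 1) * heat_grad 1 Z e (p + 0 *\<^sub>R e)) (at 0)"
      unfolding \<Phi>_def[abs_def]
      by (intro DERIV_diff DERIV_cmult heat_op_dir_derivative[OF _ Z_bdd_meas]) (use s in auto)
    then have d: "(\<Phi> has_real_derivative 2 * (D s - D 1)) (at 0)"
      using gradZ[of s] gradZ[of 1] s by (simp add: D_def algebra_simps)
    have z0: "heat_op t Z p = 0" if t: "t > 0" for t
    proof -
      have "heat_op t (\<lambda>x. Z (refl_at e \<tau> x)) p = heat_op t Z (refl_at e \<tau> p)" by (rule heat_op_refl[OF e Z_bdd_meas])
      then have "heat_op t (\<lambda>x. - Z x) p = heat_op t Z p" unfolding Z_anti rp .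
      then show ?thesis using heat_op_cmult[of t "-1" Z p] by simp
    qed
    have \<Phi>0: "\<Phi> 0 = 0" using z0[of s] z0[of 1] s by (simp add: \<Phi>_def)
    have \<Phi>nn: "\<Phi> h \<ge> 0" if "h < 0" for h
      using Z_exp_decreasing[of s 1 "p + h *\<^sub>R e"] s that by (simp add: \<Phi>_def inner_add_left p ee)
    have "2 * (D s - D 1) \<le> 0"
    proof (rule ccontr)
      assume "\<not> ?thesis"
      then have "2 * (D s - D 1) > 0" by simp
      from DERIV_pos_inc_left[OF d this] obtain \<delta> where "\<delta> > 0" "\<forall>h>0. h < \<delta> \<longrightarrow> \<Phi> (0 - h) < \<Phi> 0" by auto
      then have "\<Phi> (0 - \<delta> / 2) < \<Phi> 0" by simp
      then show False using \<Phi>0 \<Phi>nn[of "- (\<delta> / 2)"] \<open>\<delta> > 0\<close> by simp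
    qed
    then show ?thesis by simp
  qed
  \<comment> \<open>The weighted flow of V has derivative - exp (- rate s) P_s W, so V - E is the
    accumulation of P_s W over (0, \<epsilon>).\<close>
  define W where "W x = rate * V x - f x" for x
  have Wb: "bdd_meas (\<bar>rate\<bar> * M + M) W" unfolding W_def[abs_def] by (intro bdd_meas_diff bdd_meas_cmult V_bdd_meas f_bdd_meas)
  define B where "B = (\<bar>rate\<bar> * M + M) * (LINT w::'a|lborel. norm w * heat 1 w)"
  have B: "B \<ge> 0"
  proof -
    have "\<bar>rate\<bar> * M + M \<ge> 0" using Wb by (auto simp: bdd_meas_def intro: order_trans[OF abs_ge_zero])
    then show ?thesis unfolding B_def by (intro mult_nonneg_nonneg integral_nonneg_AE) (auto simp: less_imp_le[OF heat_pos])
  qed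
  \<comment> \<open>Makes the Lipschitz constant B sqrt \<epsilon> of V - E at most a quarter of - D
    1, while E retains slope at most D 1 / 2 near p. The summand 1 in B + 1 avoids division by 0,
    and \<epsilon> <= 1 is needed for \<open>De\<close>.\<close>
  define \<epsilon> where "\<epsilon> = min 1 ((- D 1 / (4 * (B + 1)))\<^sup>2)"
  have \<epsilon>: "0 < \<epsilon>" "\<epsilon> \<le> 1" using D1 B by (auto simp: \<epsilon>_def)
  have B\<epsilon>: "B * sqrt \<epsilon> \<le> - D 1 / 4"
  proof -
    have "sqrt \<epsilon> \<le> sqrt ((- D 1 / (4 * (B + 1)))\<^sup>2)" unfolding \<epsilon>_def by (intro real_sqrt_le_mono) simp
    also have "\<dots> = - D 1 / (4 * (B + 1))" unfolding real_sqrt_abs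
      by (rule abs_of_nonneg, rule divide_nonneg_pos) (use D1 B in auto)
    finally have "(B + 1) * sqrt \<epsilon> \<le> (B + 1) * (- D 1 / (4 * (B + 1)))" using B by (intro mult_left_mono) auto
    also have "\<dots> = - D 1 / 4" using B by (simp add: field_simps)
    finally show ?thesis using \<epsilon> by (simp add: algebra_simps) (smt (verit) real_sqrt_ge_zero)
  qed
  define E where "E x = exp (- rate * \<epsilon>) * heat_op \<epsilon> V x" for x
  have Rlip: "(V x - V x') - (E x - E x') \<le> B * sqrt \<epsilon> * norm (x - x')" for x x'
  proof -
    let ?Q = "\<lambda>s. exp (- rate * s) * (heat_op s V x - heat_op s V x')"
    have DV: "((\<lambda>s. exp (- rate * s) * heat_op s V x) has_real_derivative - (exp (- rate * s) * heat_op s W x)) (at s)" if "s > 0" for s x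
    proof -
      have "((\<lambda>s. exp (- rate * s) * heat_op s V x) has_real_derivative exp (- rate * s) * (- rate) * heat_op s V x + exp (- rate * s) * heat_op s f x) (at s)"
        using heat_pair_deriv[OF hp that, of x] by (auto intro!: derivative_eq_intros)
      moreover have g_eq: "heat_op s W x = rate * heat_op s V x - heat_op s f x"
        unfolding W_def[abs_def] using heat_op_diff[OF that bdd_meas_cmult[OF V_bdd_meas] f_bdd_meas] heat_op_cmult by simp
      ultimately show ?thesis unfolding g_eq by (elim DERIV_cong) (simp add: algebra_simps)
    qed
    \<comment> \<open>Adding B |x - x'| sqrt s, whose derivative is the Lipschitz bound of P_s W,
      makes the weighted difference nondecreasing in s.\<close>
    have "V x - V x' \<le> B * norm (x - x') * sqrt \<epsilon> + ?Q \<epsilon>"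
    proof (rule limit_le_of_deriv_nonneg[OF \<epsilon>(1), of "\<lambda>s. B * norm (x - x') * sqrt s + ?Q s"
        "\<lambda>s. B * norm (x - x') / (2 * sqrt s) - exp (- rate * s) * (heat_op s W x - heat_op s W x')"])
      fix s :: real assume s: "0 < s"
      have "((\<lambda>s. B * norm (x - x') * sqrt s) has_real_derivative B * norm (x - x') / (2 * sqrt s)) (at s)"
        using s by (auto intro!: derivative_eq_intros simp: field_simps)
      from DERIV_add[OF this DERIV_diff[OF DV[OF s, of x] DV[OF s, of x']]]
      show "((\<lambda>s. B * norm (x - x') * sqrt s + ?Q s) has_real_derivative B * norm (x - x') / (2 * sqrt s) - exp (- rate * s) * (heat_op s W x - heat_op s W x')) (at s)"
        by (simp add: algebra_simps)
      have "exp (- rate * s) * (heat_op s W x - heat_op s W x') \<le> exp (- rate * s) * \<bar>heat_op s W x - heat_op s W x'\<bar>"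
        by (intro mult_left_mono) auto
      also have "\<dots> \<le> 1 * \<bar>heat_op s W x - heat_op s W x'\<bar>" using rate s by (intro mult_right_mono) auto
      also have "\<dots> \<le> (\<bar>rate\<bar> * M + M) * norm (x - x') / (2 * sqrt s) * (LINT w::'a|lborel. norm w * heat 1 w)"
        using heat_op_lipschitz[OF s Wb, of x x'] by simp
      also have "\<dots> = B * norm (x - x') / (2 * sqrt s)" by (simp add: B_def)
      finally show "0 \<le> B * norm (x - x') / (2 * sqrt s) - exp (- rate * s) * (heat_op s W x - heat_op s W x')" by simp
    next
      have "((\<lambda>s. B * norm (x - x') * sqrt s + ?Q s) \<longlongrightarrow> B * norm (x - x') * sqrt 0 + exp (- rate * 0) * (V x - V x')) (at_right 0)"
        by (intro tendsto_intros heat_pair_limit[OF hp])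
      then show "((\<lambda>s. B * norm (x - x') * sqrt s + ?Q s) \<longlongrightarrow> V x - V x') (at_right 0)" by simp
    qed
    then show ?thesis by (simp add: E_def algebra_simps)
  qed
  \<comment> \<open>With \<epsilon> now fixed, the slope of E is continuous, so its bound at p
    persists in a ball about p.\<close>
  have "isCont (\<lambda>x. exp (- rate * \<epsilon>) * heat_grad \<epsilon> V e x) p"
    by (intro continuous_intros heat_grad_isCont[OF \<epsilon>(1) V_bdd_meas V_continuous])
  moreover have "exp (- rate * \<epsilon>) * heat_grad \<epsilon> V e p < D 1 / 2" using De[OF \<epsilon>] D1 by (simp add: D_def[of \<epsilon>])
  ultimately have "\<forall>\<^sub>F x in at p. exp (- rate * \<epsilon>) * heat_grad \<epsilon> V e x < D 1 / 2"
    unfolding isCont_def by (rule order_tendstoD)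
  then obtain \<rho> where \<rho>: "\<rho> > 0" "\<And>x. x \<noteq> p \<Longrightarrow> dist x p < \<rho> \<Longrightarrow> exp (- rate * \<epsilon>) * heat_grad \<epsilon> V e x < D 1 / 2"
    unfolding eventually_at by blast
  have g: "exp (- rate * \<epsilon>) * heat_grad \<epsilon> V e x < D 1 / 2" if "x \<in> ball p \<rho>" for x
    using \<rho>(2)[of x] \<open>exp (- rate * \<epsilon>) * heat_grad \<epsilon> V e p < D 1 / 2\<close> that by (cases "x = p") (auto simp: dist_commute)
  have "V (y + h *\<^sub>R e) < V y" if h: "h > 0" and y: "y \<in> ball p \<rho>" "y + h *\<^sub>R e \<in> ball p \<rho>" for y h
  proof -
    have seg: "y + t *\<^sub>R e \<in> ball p \<rho>" if "0 \<le> t" "t \<le> h" for t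
    proof -
      have "y + t *\<^sub>R e = (1 - t / h) *\<^sub>R y + (t / h) *\<^sub>R (y + h *\<^sub>R e)" using h by (simp add: algebra_simps)
      moreover have "(1 - t / h) *\<^sub>R y + (t / h) *\<^sub>R (y + h *\<^sub>R e) \<in> ball p \<rho>"
        using that h by (intro convexD[OF convex_ball y]) auto
      ultimately show ?thesis by simp
    qed
    have dE: "((\<lambda>t. E (y + t *\<^sub>R e)) has_real_derivative exp (- rate * \<epsilon>) * heat_grad \<epsilon> V e (y + t *\<^sub>R e)) (at t)" for t
      unfolding E_def[abs_def] by (intro DERIV_cmult heat_op_dir_derivative[OF \<epsilon>(1) V_bdd_meas])
    obtain z where z: "0 < z" "z < h" "E (y + h *\<^sub>R e) - E (y + 0 *\<^sub>R e) = (h - 0) * (exp (- rate * \<epsilon>) * heat_grad \<epsilon> V e (y + z *\<^sub>R e))"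
      using MVT2[OF h dE] by blast
    have "h * (exp (- rate * \<epsilon>) * heat_grad \<epsilon> V e (y + z *\<^sub>R e)) \<le> h * (D 1 / 2)"
      using g[OF seg[of z]] z h by (intro mult_left_mono) auto
    then have "E (y + h *\<^sub>R e) - E y \<le> h * (D 1 / 2)" using z by simp
    moreover have "V (y + h *\<^sub>R e) - V y - (E (y + h *\<^sub>R e) - E y) \<le> (- D 1 / 4) * h"
    proof -
      have "V (y + h *\<^sub>R e) - V y - (E (y + h *\<^sub>R e) - E y) \<le> B * sqrt \<epsilon> * h"
        using Rlip[of "y + h *\<^sub>R e" y] h e by simp
      also have "\<dots> \<le> (- D 1 / 4) * h" using B\<epsilon> h by (intro mult_right_mono) auto
      finally show ?thesis .
    qed
    moreover have "h * (D 1 / 2) + (- D 1 / 4) * h < 0"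
    proof -
      have "h * (D 1 / 2) + (- D 1 / 4) * h = h * (D 1 / 4)" by (simp add: algebra_simps)
      then show ?thesis using mult_pos_neg[OF h, of "D 1 / 4"] D1 by simp
    qed
    ultimately show ?thesis by linarith
  qed
  then show ?thesis using \<rho>(1) by blast
qed

end
end

end

lemma tendsto_refl_at:
  assumes "t \<longlonglongrightarrow> \<tau>" "x \<longlonglongrightarrow> p" shows "(\<lambda>n. refl_at e (t n) (x n)) \<longlonglongrightarrow> refl_at e \<tau> p"
  unfolding refl_at_def by (intro tendsto_intros assms)

section \<open>The critical position, symmetry in every direction, and the ball\<close>

context two_phase
begin

text \<open>Without symmetry at the critical position, there are inadmissible positions t n < \<tau>
  tending to \<tau> and points X n in \<Omega> beyond them whose images leave \<Omega>, so that V is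
  smaller at the images. A limit point p beyond the plane contradicts the strict inequality for Z,
  one on the plane contradicts the decrease of V along e.\<close>

lemma symmetric_in_direction:
  assumes e: "norm e = 1"
  shows "\<exists>\<tau>. (\<forall>x. V (refl_at e \<tau> x) = V x) \<and> (\<forall>t\<ge>\<tau>. cap e t)"
proof -
  have cV: "isCont V y" for y using V_continuous by (simp add: continuous_on_eq_continuous_at)
  obtain R where R: "R > 0" "\<forall>x\<in>\<Omega>. norm x \<le> R" using bd by (auto simp: bounded_pos)
  have xe: "\<bar>x \<bullet> e\<bar> \<le> R" if "x \<in> \<Omega>" for x using Cauchy_Schwarz_ineq2[of x e] R(2) that e by fastforce
  \<comment> \<open>Requiring all later positions as well makes S upward closed, so that every t
    above its infimum is admissible.\<close>
  define S where "S = {\<tau>. \<forall>t\<ge>\<tau>. cap e t}"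
  have "R \<in> S" using xe by (force simp: S_def cap_def)
  have lb: "t \<ge> - R" if t: "t \<in> S" for t
  proof (rule ccontr)
    assume c: "\<not> - R \<le> t"
    obtain x where x: "x \<in> \<Omega>" using ne by blast
    have "x \<bullet> e > t" using xe[OF x] c by linarith
    then have "refl_at e t x \<in> \<Omega>" using t x by (auto simp: S_def cap_def)
    then have "\<bar>2 * t - x \<bullet> e\<bar> \<le> R" using xe[of "refl_at e t x"] refl_at_inner[OF e] by simp
    then show False using c xe[OF x] by linarith
  qed
  define \<tau> where "\<tau> = Inf S"
  have bS: "bdd_below S" using lb by (rule bdd_belowI)
  have up: "cap e t" if "t > \<tau>" for t
  proof -
    have "S \<noteq> {}" "Inf S < t" using \<open>R \<in> S\<close> that by (auto simp: \<tau>_def)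
    from cInf_lessD[OF this] obtain s where "s \<in> S" "s < t" by blast
    then show ?thesis by (auto simp: S_def)
  qed
  have ge: "V (refl_at e \<tau> x) \<le> V x" if x: "x \<bullet> e \<le> \<tau>" for x
  proof -
    let ?t = "\<lambda>n. \<tau> + 1 / real (Suc n)"
    have lim: "?t \<longlonglongrightarrow> \<tau>"
      using tendsto_add[OF tendsto_const[of \<tau>] LIMSEQ_inverse_real_of_nat] by (simp add: inverse_eq_divide)
    have "(\<lambda>n. V (refl_at e (?t n) x)) \<longlonglongrightarrow> V (refl_at e \<tau> x)"
      by (rule isCont_tendsto_compose[OF cV tendsto_refl_at[OF lim tendsto_const]])
    moreover have "V (refl_at e (?t n) x) \<le> V x" for n
    proof (rule cap_imp_ge[OF e up])
      have "1 / real (Suc n) > 0" by simp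
      then show "?t n > \<tau>" "x \<bullet> e \<le> ?t n" using x by linarith+
    qed
    ultimately show ?thesis by (meson LIMSEQ_le_const2)
  qed
  have cap\<tau>: "cap e \<tau>" unfolding cap_def
  proof (intro ballI impI)
    fix x assume x: "x \<in> \<Omega>" "x \<bullet> e > \<tau>"
    have "refl_at e \<tau> x \<bullet> e \<le> \<tau>" using x by (simp add: refl_at_inner[OF e])
    from ge[OF this] show "refl_at e \<tau> x \<in> \<Omega>" using x(1) by (simp add: refl_at_refl_at[OF e] mem_iff)
  qed
  have "V (refl_at e \<tau> x) = V x" for x
  proof (rule ccontr)
    assume neq: "V (refl_at e \<tau> x) \<noteq> V x"
    have "\<exists>q. q \<bullet> e < \<tau> \<and> Z e \<tau> q > 0"
    proof -
      consider "x \<bullet> e < \<tau>" | "x \<bullet> e = \<tau>" | "x \<bullet> e > \<tau>" by linarith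
      then show ?thesis
      proof cases
        case 1 then show ?thesis using ge[of x] neq Z_def[OF e ge] by (intro exI[of _ x]) auto
      next
        case 2 then show ?thesis using neq by (simp add: refl_at_def)
      next
        case 3
        then have "refl_at e \<tau> x \<bullet> e < \<tau>" by (simp add: refl_at_inner[OF e])
        then show ?thesis using ge[of "refl_at e \<tau> x"] neq Z_def[OF e ge]
          by (intro exI[of _ "refl_at e \<tau> x"]) (auto simp: refl_at_refl_at[OF e])
      qed
    qed
    then obtain q where q: "q \<bullet> e < \<tau>" "Z e \<tau> q > 0" by blast
    have strict: "V (refl_at e \<tau> y) < V y" if "y \<bullet> e < \<tau>" for y
      using Z_pos[OF e ge q that] Z_def[OF e ge] by simp
    \<comment> \<open>Otherwise all positions from \<tau> - 1 / (2 (n + 1)) onwards would be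
      admissible, although \<tau> is the infimum.\<close>
    have "\<exists>t. \<tau> - 1 / real (Suc n) < t \<and> t < \<tau> \<and> \<not> cap e t" for n
    proof (rule ccontr)
      assume *: "\<not> ?thesis"
      have "cap e t" if "t \<ge> \<tau> - 1 / real (Suc n) / 2" for t
      proof -
        have "1 / real (Suc n) / 2 > 0" by simp
        then have "\<tau> - 1 / real (Suc n) < t" using that by linarith
        then show ?thesis using * up[of t] cap\<tau> by (cases t \<tau> rule: linorder_cases) auto
      qed
      then have "\<tau> - 1 / real (Suc n) / 2 \<in> S" by (simp add: S_def)
      then have "\<tau> \<le> \<tau> - 1 / real (Suc n) / 2" unfolding \<tau>_def by (rule cInf_lower[OF _ bS])
      moreover have "1 / real (Suc n) / 2 > 0" by simp
      ultimately show False by linarith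
    qed
    then obtain t where t: "\<And>n. \<tau> - 1 / real (Suc n) < t n" "\<And>n. t n < \<tau>" "\<And>n. \<not> cap e (t n)" by metis
    then have "\<forall>n. \<exists>x. x \<in> \<Omega> \<and> x \<bullet> e > t n \<and> refl_at e (t n) x \<notin> \<Omega>" unfolding cap_def by blast
    then obtain X where X: "\<And>n. X n \<in> \<Omega>" "\<And>n. X n \<bullet> e > t n" "\<And>n. refl_at e (t n) (X n) \<notin> \<Omega>" by metis
    have tl: "t \<longlonglongrightarrow> \<tau>"
    proof (rule tendsto_sandwich)
      show "(\<lambda>n. \<tau> - 1 / real (Suc n)) \<longlonglongrightarrow> \<tau>"
        using tendsto_diff[OF tendsto_const[of \<tau>] LIMSEQ_inverse_real_of_nat] by (simp add: inverse_eq_divide)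
    qed (use t in \<open>auto intro!: always_eventually less_imp_le\<close>)
    have "\<forall>n. X n \<in> closure \<Omega>" using X(1) closure_subset by blast
    then obtain p \<phi> where p: "p \<in> closure \<Omega>" and \<phi>: "strict_mono \<phi>" and Xl: "(X \<circ> \<phi>) \<longlonglongrightarrow> p"
      using closure_compact_nonempty(1) unfolding compact_def by metis
    have tl': "(\<lambda>n. t (\<phi> n)) \<longlonglongrightarrow> \<tau>" using LIMSEQ_subseq_LIMSEQ[OF tl \<phi>] by (simp add: comp_def)
    have Xl': "(\<lambda>n. X (\<phi> n)) \<longlonglongrightarrow> p" using Xl by (simp add: comp_def)
    have rl: "(\<lambda>n. refl_at e (t (\<phi> n)) (X (\<phi> n))) \<longlonglongrightarrow> refl_at e \<tau> p" by (rule tendsto_refl_at[OF tl' Xl'])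
    have VXl: "(\<lambda>n. V (X (\<phi> n))) \<longlonglongrightarrow> V p" and Vrl: "(\<lambda>n. V (refl_at e (t (\<phi> n)) (X (\<phi> n)))) \<longlonglongrightarrow> V (refl_at e \<tau> p)"
      by (rule isCont_tendsto_compose[OF cV Xl'], rule isCont_tendsto_compose[OF cV rl])
    have lt: "V (refl_at e (t n) (X n)) < V (X n)" for n using X(1)[of n] X(3)[of n] by (simp add: mem_iff)
    have Vp: "V (refl_at e \<tau> p) \<le> V p" by (rule LIMSEQ_le[OF Vrl VXl]) (use lt in \<open>auto intro: less_imp_le\<close>)
    have "\<tau> \<le> p \<bullet> e"
      by (rule LIMSEQ_le[OF tl' tendsto_inner[OF Xl' tendsto_const[of e]]]) (use X(2) in \<open>auto intro: less_imp_le\<close>)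
    then consider "p \<bullet> e > \<tau>" | "p \<bullet> e = \<tau>" by linarith
    then show False
    proof cases
      case 1
      then have "refl_at e \<tau> p \<bullet> e < \<tau>" by (simp add: refl_at_inner[OF e])
      from strict[OF this] show False using Vp by (simp add: refl_at_refl_at[OF e])
    next
      case 2
      obtain \<rho> where \<rho>: "\<rho> > 0" "\<And>y h. h > 0 \<Longrightarrow> y \<in> ball p \<rho> \<Longrightarrow> y + h *\<^sub>R e \<in> ball p \<rho> \<Longrightarrow> V (y + h *\<^sub>R e) < V y"
        using V_strictly_decreasing_near[OF e ge q 2] by blast
      have rp: "refl_at e \<tau> p = p" using 2 by (simp add: refl_at_def)
      have "\<forall>\<^sub>F n in sequentially. dist (X (\<phi> n)) p < \<rho> \<and> dist (refl_at e (t (\<phi> n)) (X (\<phi> n))) p < \<rho>"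
        using tendstoD[OF Xl' \<rho>(1)] tendstoD[OF rl[unfolded rp] \<rho>(1)] by (rule eventually_conj)
      then obtain n where n: "dist (X (\<phi> n)) p < \<rho>" "dist (refl_at e (t (\<phi> n)) (X (\<phi> n))) p < \<rho>"
        by (auto dest: eventually_happens)
      let ?y = "refl_at e (t (\<phi> n)) (X (\<phi> n))" and ?h = "2 * (X (\<phi> n) \<bullet> e - t (\<phi> n))"
      \<comment> \<open>The point is its image moved forward along e, so near p the value of V at
        the point must be the smaller one, against \<open>lt\<close>.\<close>
      have "X (\<phi> n) = ?y + ?h *\<^sub>R e" by (simp add: refl_at_def)
      moreover have "?h > 0" using X(2)[of "\<phi> n"] by simp
      ultimately have "V (X (\<phi> n)) < V ?y" using \<rho>(2)[of ?h ?y] n by (metis mem_ball dist_commute)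
      then show False using lt[of "\<phi> n"] by simp
    qed
  qed
  moreover have "\<forall>t\<ge>\<tau>. cap e t" using up cap\<tau> by (metis less_eq_real_def)
  ultimately show ?thesis by blast
qed

lemma Omega_lmeasurable: "\<Omega> \<in> sets borel" "emeasure lborel \<Omega> < \<infinity>" "measure lborel \<Omega> > 0"
proof -
  show "\<Omega> \<in> sets borel" using op by simp
  show fin: "emeasure lborel \<Omega> < \<infinity>" by (rule emeasure_bounded_finite[OF bd])
  obtain x r where "r > 0" "ball x r \<subseteq> \<Omega>" using ne op openE by blast
  then have "measure lborel (ball x r) \<le> measure lborel \<Omega>"
    using op fin by (intro measure_mono_fmeasurable) (auto simp: fmeasurable_def)
  then show "measure lborel \<Omega> > 0" using content_ball_pos[OF \<open>r > 0\<close>, of x] by linarith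
qed

text \<open>Every symmetry plane passes through the barycentre \<open>c\<close>.\<close>

theorem is_ball: "\<exists>c r. r > 0 \<and> \<Omega> = ball c r"
proof -
  have "\<forall>e. \<exists>\<tau>. norm e = 1 \<longrightarrow> (\<forall>x. V (refl_at e \<tau> x) = V x) \<and> (\<forall>t\<ge>\<tau>. cap e t)"
    using symmetric_in_direction by blast
  then obtain \<tau> where \<tau>: "\<And>e x. norm e = 1 \<Longrightarrow> V (refl_at e (\<tau> e) x) = V x" "\<And>e t. norm e = 1 \<Longrightarrow> t \<ge> \<tau> e \<Longrightarrow> cap e t"
    by metis
  have sym: "refl_at e (\<tau> e) x \<in> \<Omega> \<longleftrightarrow> x \<in> \<Omega>" if "norm e = 1" for e x using \<tau>(1)[OF that] by (simp add: mem_iff)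
  define m where "m = measure lborel \<Omega>"
  define c where "c = (\<Sum>b\<in>Basis. ((LINT x|lborel. indicator \<Omega> x * (x \<bullet> b)) / m) *\<^sub>R b)"
  obtain R where R: "\<forall>x\<in>\<Omega>. norm x \<le> R" using bd by (auto simp: bounded_iff)
  have [measurable]: "\<Omega> \<in> sets borel" by (rule Omega_lmeasurable)
  have int: "integrable lborel (\<lambda>x. indicator \<Omega> x * (x \<bullet> v))" for v
  proof (rule Bochner_Integration.integrable_bound)
    show "integrable lborel (\<lambda>x. (R * norm v) * indicator \<Omega> x :: real)"
      using Omega_lmeasurable by (intro integrable_mult_right) (simp add: integrable_indicator_iff)
    show "AE x in lborel. norm (indicator \<Omega> x * (x \<bullet> v)) \<le> norm (R * norm v * indicator \<Omega> x)"
    proof (rule AE_I2)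
      fix x
      have "x \<in> \<Omega> \<Longrightarrow> \<bar>x \<bullet> v\<bar> \<le> \<bar>R * norm v\<bar>"
        using Cauchy_Schwarz_ineq2[of x v] R mult_right_mono[of "norm x" R "norm v"] by force
      then show "norm (indicator \<Omega> x * (x \<bullet> v)) \<le> norm (R * norm v * indicator \<Omega> x)"
        by (simp add: indicator_def abs_mult)
    qed
  qed simp
  have inti: "integrable lborel (\<lambda>x. indicator \<Omega> x :: real)"
    using Omega_lmeasurable by (simp add: integrable_indicator_iff)
  have cv: "c \<bullet> v = (LINT x|lborel. indicator \<Omega> x * (x \<bullet> v)) / m" for v
  proof -
    have "(LINT x|lborel. indicator \<Omega> x * (x \<bullet> v)) = (LINT x|lborel. (\<Sum>b\<in>Basis. (v \<bullet> b) * (indicator \<Omega> x * (x \<bullet> b))))"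
      by (rule Bochner_Integration.integral_cong[OF refl])
         (subst (1) euclidean_inner, simp add: sum_distrib_left mult_ac)
    also have "\<dots> = (\<Sum>b\<in>Basis. (v \<bullet> b) * (LINT x|lborel. indicator \<Omega> x * (x \<bullet> b)))"
      using int by (subst Bochner_Integration.integral_sum) auto
    finally show ?thesis by (simp add: c_def inner_sum_left sum_divide_distrib inner_commute[of v] mult.commute)
  qed
  \<comment> \<open>The indicator of \<Omega> times x \<bullet> e - \<tau> e is antisymmetric under
    the reflection, so its integral is 0.\<close>
  have \<tau>c: "\<tau> e = c \<bullet> e" if e: "norm e = 1" for e
  proof -
    let ?g = "\<lambda>x. indicator \<Omega> x * (x \<bullet> e - \<tau> e) :: real"
    have gi: "integrable lborel ?g" unfolding right_diff_distrib using int inti by (intro Bochner_Integration.integrable_diff) auto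
    have gm: "?g \<in> borel_measurable borel" by measurable
    have "?g (refl_at e (\<tau> e) x) = - ?g x" for x
      using sym[OF e, of x] by (auto simp: indicator_def refl_at_inner[OF e])
    then have "- (LINT x|lborel. ?g x) = (LINT x|lborel. ?g x)"
      using lborel_integral_preserved[OF refl_at_measurable lborel_distr_refl_at[OF e] gm, of "\<tau> e"] by simp
    then have "(LINT x|lborel. ?g x) = 0" by simp
    then have "(LINT x|lborel. indicator \<Omega> x * (x \<bullet> e)) - (LINT x|lborel. indicator \<Omega> x * \<tau> e) = 0"
      unfolding right_diff_distrib using int inti by (subst (asm) Bochner_Integration.integral_diff) auto
    then have "(LINT x|lborel. indicator \<Omega> x * (x \<bullet> e)) = m * \<tau> e" by (simp add: m_def)
    then show ?thesis unfolding cv using Omega_lmeasurable(3) by (simp add: m_def)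
  qed
  \<comment> \<open>Two points at the same distance from c are mirror images in the plane through c
    orthogonal to x - y.\<close>
  have radial: "x \<in> \<Omega> \<longleftrightarrow> y \<in> \<Omega>" if d: "norm (x - c) = norm (y - c)" for x y
  proof (cases "x = y")
    case False
    define e where "e = (1 / norm (x - y)) *\<^sub>R (x - y)"
    have n: "norm (x - y) > 0" using False by simp
    have e: "norm e = 1" using n by (simp add: e_def)
    have xy: "x - y = norm (x - y) *\<^sub>R e" using n by (simp add: e_def)
    have "(x - c) \<bullet> (x - c) = (y - c) \<bullet> (y - c)" using d by (simp add: norm_eq)
    then have "2 * ((x - c) \<bullet> (x - y)) = (x - y) \<bullet> (x - y)"
      by (simp add: inner_diff_left inner_diff_right inner_commute algebra_simps)
    then have "2 * ((x - c) \<bullet> (x - y)) = norm (x - y) * norm (x - y)" by (simp add: power2_norm_eq_inner[symmetric] power2_eq_square)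
    moreover have "(x - c) \<bullet> (x - y) = norm (x - y) * ((x - c) \<bullet> e)"
      using arg_cong[OF xy, of "\<lambda>z. (x - c) \<bullet> z"] by (simp only: inner_scaleR_right)
    ultimately have "norm (x - y) * (2 * ((x - c) \<bullet> e)) = norm (x - y) * norm (x - y)" by simp
    then have "2 * ((x - c) \<bullet> e) = norm (x - y)" using n by simp
    then have "2 * (x \<bullet> e - \<tau> e) = norm (x - y)" by (simp add: \<tau>c[OF e] inner_diff_left)
    then have "refl_at e (\<tau> e) x = x - norm (x - y) *\<^sub>R e" unfolding refl_at_def by (simp only:)
    then have "refl_at e (\<tau> e) x = x - (x - y)" by (simp only: xy[symmetric])
    then show ?thesis using sym[OF e, of x] by simp
  qed simp
  \<comment> \<open>The plane orthogonal to y - c halfway between the two radii is an admissible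
    position; it reflects y to the point of the same ray at distance |x - c|, and
    \<open>radial\<close> does the rest. This is where shells are excluded.\<close>
  have star: "x \<in> \<Omega>" if y: "y \<in> \<Omega>" and lt: "norm (x - c) < norm (y - c)" for x y
  proof -
    define e where "e = (1 / norm (y - c)) *\<^sub>R (y - c)"
    have n: "norm (y - c) > 0" using lt norm_ge_zero[of "x - c"] by linarith
    have e: "norm e = 1" using n by (simp add: e_def)
    have ee: "e \<bullet> e = 1" using e by (simp add: norm_eq_1)
    have yc: "y = c + norm (y - c) *\<^sub>R e" using n by (simp add: e_def)
    define t where "t = c \<bullet> e + (norm (x - c) + norm (y - c)) / 2"
    have "cap e t" using \<tau>(2)[OF e, of t] \<tau>c[OF e] by (simp add: t_def)
    have ye: "y \<bullet> e = c \<bullet> e + norm (y - c)" by (subst yc) (simp add: inner_add_left ee)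
    then have "y \<bullet> e > t" using lt by (simp add: t_def)
    then have "refl_at e t y \<in> \<Omega>" using \<open>cap e t\<close> y by (auto simp: cap_def)
    moreover have "refl_at e t y - c = norm (x - c) *\<^sub>R e"
    proof -
      have "2 * (y \<bullet> e - t) = norm (y - c) - norm (x - c)" by (simp add: ye t_def field_simps)
      then have "refl_at e t y = y - (norm (y - c) - norm (x - c)) *\<^sub>R e" by (simp add: refl_at_def)
      also have "\<dots> = c + norm (x - c) *\<^sub>R e" by (subst (1) yc) (simp add: algebra_simps)
      finally show ?thesis by simp
    qed
    then have "norm (refl_at e t y - c) = norm (x - c)" by (simp add: e)
    ultimately show ?thesis using radial by metis
  qed
  define r where "r = (SUP y\<in>\<Omega>. norm (y - c))"
  have bdd: "bdd_above ((\<lambda>y. norm (y - c)) ` \<Omega>)"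
  proof (rule bdd_aboveI2)
    fix y assume "y \<in> \<Omega>"
    then have "norm y \<le> R" using R by blast
    then show "norm (y - c) \<le> R + norm c" using norm_triangle_ineq4[of y c] by linarith
  qed
  have sub: "ball c r \<subseteq> \<Omega>"
  proof
    fix x assume "x \<in> ball c r"
    then have "norm (x - c) < r" by (simp add: dist_norm norm_minus_commute)
    then obtain y where "y \<in> \<Omega>" "norm (x - c) < norm (y - c)"
      unfolding r_def using less_cSUP_iff[OF ne bdd] by blast
    then show "x \<in> \<Omega>" using star by blast
  qed
  \<comment> \<open>Since \<Omega> is open, x can be pushed outwards by \<delta> / 2, so the
    supremum r is not attained. At x = c any direction serves.\<close>
  have sup: "\<Omega> \<subseteq> ball c r"
  proof
    fix x assume x: "x \<in> \<Omega>"
    obtain \<delta> where \<delta>: "\<delta> > 0" "ball x \<delta> \<subseteq> \<Omega>" using op x openE by blast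
    obtain b :: 'a where b: "b \<in> Basis" using nonempty_Basis by blast
    define e where "e = (if x = c then b else (1 / norm (x - c)) *\<^sub>R (x - c))"
    have e: "norm e = 1" using b by (simp add: e_def)
    have xc: "x - c = norm (x - c) *\<^sub>R e" by (simp add: e_def)
    let ?y = "x + (\<delta> / 2) *\<^sub>R e"
    have "?y \<in> \<Omega>" using \<delta> e by (intro subsetD[OF \<delta>(2)]) (simp add: dist_norm)
    moreover have "?y - c = (norm (x - c) + \<delta> / 2) *\<^sub>R e"
    proof -
      have "?y - c = (x - c) + (\<delta> / 2) *\<^sub>R e" by simp
      also have "\<dots> = norm (x - c) *\<^sub>R e + (\<delta> / 2) *\<^sub>R e" by (subst xc) simp
      finally show ?thesis by (simp add: scaleR_add_left)
    qed
    then have "norm (?y - c) = norm (x - c) + \<delta> / 2" using e \<delta> by simp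
    ultimately have "norm (x - c) + \<delta> / 2 \<le> r" unfolding r_def using cSUP_upper[OF _ bdd, of ?y] by simp
    then show "x \<in> ball c r" using \<delta> by (simp add: dist_norm norm_minus_commute)
  qed
  have "r > 0" using sup ne by (metis ball_empty not_less subset_empty)
  then show ?thesis using sub sup by blast
qed

end

section \<open>Thin neighbourhoods of the boundary\<close>

lemma bounded_frontier: "bounded S \<Longrightarrow> bounded (frontier S)" for S :: "'a::euclidean_space set"
  unfolding frontier_def by (rule bounded_subset[OF bounded_closure]) auto

lemma ball_conj_borel:
  fixes p :: "'a::euclidean_space"
  assumes "{x. Q x} \<in> sets lborel" shows "{x \<in> ball p r. Q x} \<in> sets lborel"
proof -
  have "ball p r \<inter> {x. Q x} \<in> sets lborel" using assms by (intro sets.Int) auto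
  moreover have "ball p r \<inter> {x. Q x} = {x \<in> ball p r. Q x}" by blast
  ultimately show ?thesis by (simp only:)
qed

text \<open>About \<open>r / (3 \<delta>)\<close> translates of the slab along \<open>\<nu>\<close> are disjoint and fit into a ball of radius \<open>2 r\<close>.\<close>

lemma slab_measure_le:
  fixes \<Phi> :: "'a::euclidean_space \<Rightarrow> real"
  assumes c: "continuous_on UNIV \<Phi>" and sh: "\<And>x s. \<Phi> (x + s *\<^sub>R \<nu>) = \<Phi> x - s" and n: "norm \<nu> = 1"
    and \<delta>: "0 < \<delta>" "6 * \<delta> \<le> r"
  shows "measure lborel {x \<in> ball p r. \<bar>\<Phi> x\<bar> \<le> \<delta>} \<le> 6 * measure lborel (ball p (2 * r)) / r * \<delta>"
proof -
  let ?E = "{x \<in> ball p r. \<bar>\<Phi> x\<bar> \<le> \<delta>}"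
  have r: "r > 0" using \<delta> by linarith
  have Eb: "?E \<in> sets borel"
  proof -
    have "{x. \<bar>\<Phi> x\<bar> \<le> \<delta>} \<in> sets borel" by (intro borel_closed closed_Collect_le continuous_intros c)
    moreover have "?E = ball p r \<inter> {x. \<bar>\<Phi> x\<bar> \<le> \<delta>}" by auto
    ultimately show ?thesis by auto
  qed
  have fin: "emeasure lborel (ball p s) < \<infinity>" for s by (rule emeasure_lborel_ball_finite)
  have Ef: "?E \<in> fmeasurable lborel"
  proof (rule fmeasurableI2[of "ball p r"])
    show "ball p r \<in> fmeasurable lborel" using fin by (auto simp: fmeasurable_def)
  qed (use Eb in auto)
  \<comment> \<open>Translates at spacing 3 \<delta> are disjoint since \<Phi> varies by at most 2
    \<delta> on the slab. Rounding down loses at most half, because r / (3 \<delta>) >= 2.\<close>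
  define N where "N = nat \<lfloor>r / (3 * \<delta>)\<rfloor>"
  have N: "real N \<le> r / (3 * \<delta>)" "r / (6 * \<delta>) \<le> real N"
  proof -
    have "r / (3 * \<delta>) \<ge> 2" using \<delta> by (simp add: pos_le_divide_eq)
    moreover have "real N = of_int \<lfloor>r / (3 * \<delta>)\<rfloor>" using calculation by (simp add: N_def)
    moreover have "r / (6 * \<delta>) = r / (3 * \<delta>) / 2" by simp
    ultimately show "real N \<le> r / (3 * \<delta>)" "r / (6 * \<delta>) \<le> real N" by linarith+
  qed
  let ?T = "\<lambda>j::nat. (+) ((3 * \<delta> * real j) *\<^sub>R \<nu>) ` ?E"
  have Tm: "?T j \<in> fmeasurable lborel" "measure lborel (?T j) = measure lborel ?E" for j
  proof -
    have L: "?E \<in> lmeasurable" using Ef by (simp add: fmeasurable_def)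
    have "?T j = (\<lambda>x. - ((3 * \<delta> * real j) *\<^sub>R \<nu>) + x) -` ?E"
    proof (intro set_eqI iffI)
      fix x assume "x \<in> (\<lambda>x. - ((3 * \<delta> * real j) *\<^sub>R \<nu>) + x) -` ?E"
      then show "x \<in> ?T j" by (intro image_eqI[of x _ "- ((3 * \<delta> * real j) *\<^sub>R \<nu>) + x"]) auto
    qed auto
    moreover have "(\<lambda>x. - ((3 * \<delta> * real j) *\<^sub>R \<nu>) + x) -` ?E \<inter> space borel \<in> sets borel"
      by (rule measurable_sets[OF _ Eb]) simp
    ultimately have Tb: "?T j \<in> sets borel" by (simp only: space_borel Int_UNIV_right)
    have "?T j \<in> lmeasurable" using L by (rule measurable_translation)
    then show "?T j \<in> fmeasurable lborel" using Tb by (simp add: fmeasurable_def)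
    show "measure lborel (?T j) = measure lborel ?E"
      using measure_translation[of "(3 * \<delta> * real j) *\<^sub>R \<nu>" ?E] Tb Eb by simp
  qed
  have dis: "disjoint_family_on ?T {..<N}" unfolding disjoint_family_on_def
  proof (intro ballI impI, rule ccontr)
    fix i j assume "i \<noteq> j" "?T i \<inter> ?T j \<noteq> {}"
    then obtain x y where xy: "\<bar>\<Phi> x\<bar> \<le> \<delta>" "\<bar>\<Phi> y\<bar> \<le> \<delta>" "x + (3 * \<delta> * real i) *\<^sub>R \<nu> = y + (3 * \<delta> * real j) *\<^sub>R \<nu>"
      by (auto simp: add.commute)
    have "\<Phi> x - 3 * \<delta> * real i = \<Phi> y - 3 * \<delta> * real j" using arg_cong[OF xy(3), of \<Phi>] by (simp only: sh)
    then have "\<bar>3 * \<delta> * (real i - real j)\<bar> \<le> 2 * \<delta>" using xy by (simp add: algebra_simps)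
    moreover have "\<bar>real i - real j\<bar> \<ge> 1" using \<open>i \<noteq> j\<close> by linarith
    then have "3 * \<delta> * \<bar>real i - real j\<bar> \<ge> 3 * \<delta> * 1" using \<delta> by (intro mult_left_mono) auto
    ultimately show False using \<delta> by (simp add: abs_mult)
  qed
  have sub: "(\<Union>j<N. ?T j) \<subseteq> ball p (2 * r)"
  proof safe
    fix j x assume j: "j < N" "x \<in> ball p r"
    have "3 * \<delta> * real j \<le> 3 * \<delta> * real N" using j \<delta> by (intro mult_left_mono) auto
    also have "\<dots> \<le> r" using N(1) \<delta> by (simp add: pos_le_divide_eq mult.commute)
    finally have "norm ((3 * \<delta> * real j) *\<^sub>R \<nu>) \<le> r" using \<delta> n by simp
    moreover have "norm (p - ((3 * \<delta> * real j) *\<^sub>R \<nu> + x)) \<le> norm (p - x) + norm ((3 * \<delta> * real j) *\<^sub>R \<nu>)"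
      using norm_triangle_ineq4[of "p - x" "(3 * \<delta> * real j) *\<^sub>R \<nu>"] by (simp add: algebra_simps)
    ultimately show "(3 * \<delta> * real j) *\<^sub>R \<nu> + x \<in> ball p (2 * r)" using j by (simp add: dist_norm)
  qed
  have "real N * measure lborel ?E = (\<Sum>j<N. measure lborel (?T j))" by (simp only: Tm sum_constant card_lessThan)
  also have "\<dots> = measure lborel (\<Union>j<N. ?T j)"
    using dis fmeasurableD2[OF Tm(1)] fmeasurableD[OF Tm(1)] by (intro measure_finite_Union[symmetric]) auto
  also have "\<dots> \<le> measure lborel (ball p (2 * r))"
    using sub Tm(1) fin by (intro measure_mono_fmeasurable) (auto simp: fmeasurable_def intro!: sets.finite_UN)
  finally have "real N * measure lborel ?E \<le> measure lborel (ball p (2 * r))" .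
  moreover have "r / (6 * \<delta>) * measure lborel ?E \<le> real N * measure lborel ?E" using N(2) by (intro mult_right_mono) auto
  ultimately have "r / (6 * \<delta>) * measure lborel ?E \<le> measure lborel (ball p (2 * r))" by linarith
  then show ?thesis using r \<delta> by (simp add: field_simps)
qed

text \<open>The local graph function \<Phi> vanishes on the boundary and is Lipschitz on the ball,
  so the \<epsilon>-neighbourhood lies in the slab |\<Phi>| <= L \<epsilon>, to which
  \<open>slab_measure_le\<close> applies.\<close>

lemma strip_local:
  fixes D :: "'a::euclidean_space set"
  assumes op: "open D" and C: "C2alpha_boundary \<alpha> D" and p: "p \<in> frontier D"
  shows "\<exists>r>0. \<exists>C>0. \<exists>\<epsilon>0>0. \<forall>\<epsilon>. 0 < \<epsilon> \<longrightarrow> \<epsilon> \<le> \<epsilon>0 \<longrightarrow>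
     measure lborel {x \<in> ball p r. infdist x (frontier D) \<le> \<epsilon>} \<le> C * \<epsilon>"
proof -
  obtain r \<nu> \<phi> where r: "r > 0" and n: "norm \<nu> = 1" and h: "holder_C2 \<alpha> \<phi>"
    and D: "\<And>x. x \<in> ball p r \<Longrightarrow> x \<in> D \<longleftrightarrow> x \<bullet> \<nu> < \<phi> (x - (x \<bullet> \<nu>) *\<^sub>R \<nu>)"
    using C p unfolding C2alpha_boundary_def by blast
  obtain D\<phi> :: "'a \<Rightarrow> ('a \<Rightarrow>\<^sub>L real)" and D2\<phi> :: "'a \<Rightarrow> ('a \<Rightarrow>\<^sub>L ('a \<Rightarrow>\<^sub>L real))" where
    d1: "\<And>x. (\<phi> has_derivative blinfun_apply (D\<phi> x)) (at x)" and d2: "\<And>x. (D\<phi> has_derivative blinfun_apply (D2\<phi> x)) (at x)"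
    using h unfolding holder_C2_def by blast
  have nn: "\<nu> \<bullet> \<nu> = 1" using n by (simp add: norm_eq_1)
  define P where "P x = x - (x \<bullet> \<nu>) *\<^sub>R \<nu>" for x
  have Pc: "continuous_on S P" for S unfolding P_def by (intro continuous_intros)
  have phc: "continuous_on S \<phi>" for S using d1 by (meson has_derivative_continuous continuous_at_imp_continuous_on)
  have Dc: "continuous_on S D\<phi>" for S using d2 by (meson has_derivative_continuous continuous_at_imp_continuous_on)
  define \<Phi> where "\<Phi> x = \<phi> (P x) - x \<bullet> \<nu>" for x
  have \<Phi>c: "continuous_on UNIV \<Phi>" unfolding \<Phi>_def
    by (intro continuous_intros continuous_on_compose2[OF phc Pc]) auto
  have sh: "\<Phi> (x + s *\<^sub>R \<nu>) = \<Phi> x - s" for x s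
    by (simp add: \<Phi>_def P_def inner_add_left nn algebra_simps)
  have memD: "x \<in> D \<longleftrightarrow> \<Phi> x > 0" if "x \<in> ball p r" for x using D[OF that] by (simp add: \<Phi>_def P_def)
  have zero: "\<Phi> y = 0" if y: "y \<in> frontier D" "y \<in> ball p r" for y
  proof -
    have "y \<notin> D" "y \<in> closure D" using y op by (auto simp: frontier_def interior_open)
    then have "\<Phi> y \<le> 0" using memD[OF y(2)] by simp
    moreover have "\<not> \<Phi> y < 0"
    proof
      assume "\<Phi> y < 0"
      have "open (ball p r \<inter> {x. \<Phi> x < 0})" by (intro open_Int open_Collect_less continuous_intros \<Phi>c) auto
      moreover have "D \<inter> (ball p r \<inter> {x. \<Phi> x < 0}) = {}" using memD by force
      ultimately have "closure D \<inter> (ball p r \<inter> {x. \<Phi> x < 0}) = {}" by (metis open_Int_closure_eq_empty inf_commute)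
      then show False using \<open>y \<in> closure D\<close> y \<open>\<Phi> y < 0\<close> by blast
    qed
    ultimately show ?thesis by linarith
  qed
  have "compact (D\<phi> ` P ` cball p r)" by (intro compact_continuous_image Dc Pc compact_cball)
  then have "bounded (D\<phi> ` P ` cball p r)" by (rule compact_imp_bounded)
  then obtain L0 where L0: "L0 > 0" "\<And>x. x \<in> cball p r \<Longrightarrow> norm (D\<phi> (P x)) \<le> L0"
    unfolding bounded_pos by blast
  have Pl: "linear P" unfolding P_def by (rule linearI) (simp_all add: algebra_simps inner_add_left)
  have Pn: "norm (P v) \<le> 2 * norm v" for v
  proof -
    have "norm (P v) \<le> norm v + norm ((v \<bullet> \<nu>) *\<^sub>R \<nu>)" unfolding P_def by (rule norm_triangle_ineq4)
    also have "norm ((v \<bullet> \<nu>) *\<^sub>R \<nu>) \<le> norm v" using n Cauchy_Schwarz_ineq2[of v \<nu>] by simp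
    finally show ?thesis by simp
  qed
  \<comment> \<open>The factor 2 bounds the projection \<open>P\<close>, and 1 bounds the linear
    term x \<bullet> \<nu>.\<close>
  define L where "L = 2 * L0 + 1"
  have L: "L > 0" using L0 by (simp add: L_def)
  have lip: "norm (\<Phi> x - \<Phi> y) \<le> L * norm (x - y)" if "x \<in> ball p r" "y \<in> ball p r" for x y
  proof (rule differentiable_bound[OF convex_ball _ _ that, of \<Phi> "\<lambda>x v. D\<phi> (P x) (P v) - v \<bullet> \<nu>"])
    fix z assume z: "z \<in> ball p r"
    have "(P has_derivative P) (at z)" using Pl by (simp add: linear_imp_has_derivative)
    from has_derivative_compose[OF this d1]
    have "((\<lambda>x. \<phi> (P x)) has_derivative (\<lambda>v. D\<phi> (P z) (P v))) (at z)" .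
    then have "(\<Phi> has_derivative (\<lambda>v. D\<phi> (P z) (P v) - v \<bullet> \<nu>)) (at z)"
      unfolding \<Phi>_def[abs_def] by (auto intro!: derivative_eq_intros)
    then show "(\<Phi> has_derivative (\<lambda>v. D\<phi> (P z) (P v) - v \<bullet> \<nu>)) (at z within ball p r)" by (rule has_derivative_at_withinI)
    show "onorm (\<lambda>v. D\<phi> (P z) (P v) - v \<bullet> \<nu>) \<le> L"
    proof (rule onorm_le)
      fix v
      have "norm (D\<phi> (P z) (P v) - v \<bullet> \<nu>) \<le> norm (D\<phi> (P z) (P v)) + norm (v \<bullet> \<nu>)" by (rule norm_triangle_ineq4)
      also have "norm (D\<phi> (P z) (P v)) \<le> norm (D\<phi> (P z)) * norm (P v)" by (rule norm_blinfun)
      also have "\<dots> \<le> L0 * (2 * norm v)" using L0 z Pn by (intro mult_mono) auto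
      also have "norm (v \<bullet> \<nu>) \<le> norm v" using n Cauchy_Schwarz_ineq2[of v \<nu>] by simp
      finally show "norm (D\<phi> (P z) (P v) - v \<bullet> \<nu>) \<le> L * norm v" by (simp add: L_def algebra_simps)
    qed
  qed
  have F: "closed (frontier D)" "frontier D \<noteq> {}" using p by auto
  show ?thesis
  proof (rule exI[of _ "r/2"], rule conjI[rotated], rule exI[of _ "6 * measure lborel (ball p (2 * r)) / r * L"],
      rule conjI[rotated], rule exI[of _ "min (r/4) (r / (6 * L))"], rule conjI[rotated], intro allI impI)
    \<comment> \<open>The bound r / 4 keeps the nearest boundary point inside the ball of radius r;
      r / (6 L) is the size condition on the slab.\<close>
    fix \<epsilon> assume \<epsilon>: "0 < \<epsilon>" "\<epsilon> \<le> min (r/4) (r / (6 * L))"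
    have "measure lborel {x \<in> ball p (r/2). infdist x (frontier D) \<le> \<epsilon>} \<le> measure lborel {x \<in> ball p r. \<bar>\<Phi> x\<bar> \<le> L * \<epsilon>}"
    proof (rule measure_mono_fmeasurable)
      show "{x \<in> ball p (r/2). infdist x (frontier D) \<le> \<epsilon>} \<subseteq> {x \<in> ball p r. \<bar>\<Phi> x\<bar> \<le> L * \<epsilon>}"
      proof safe
        fix x assume x: "x \<in> ball p (r/2)" "infdist x (frontier D) \<le> \<epsilon>"
        show xr: "x \<in> ball p r" using x r by simp
        obtain y where y: "y \<in> frontier D" "infdist x (frontier D) = dist x y" using infdist_attains_inf[OF F] by blast
        have "dist p y \<le> dist p x + dist x y" by (rule dist_triangle)
        also have "\<dots> < r" using x y \<epsilon> r by simp
        finally have yr: "y \<in> ball p r" by simp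
        have "\<bar>\<Phi> x\<bar> \<le> L * norm (x - y)" using lip[OF xr yr] zero[OF y(1) yr] by simp
        also have "\<dots> \<le> L * \<epsilon>" using x y L by (intro mult_left_mono) (auto simp: dist_norm)
        finally show "\<bar>\<Phi> x\<bar> \<le> L * \<epsilon>" .
      qed
      have "{x. infdist x (frontier D) \<le> \<epsilon>} \<in> sets borel" by (intro borel_closed closed_Collect_le continuous_intros)
      then show "{x \<in> ball p (r/2). infdist x (frontier D) \<le> \<epsilon>} \<in> sets lborel" by (intro ball_conj_borel) simp
      have "{x. \<bar>\<Phi> x\<bar> \<le> L * \<epsilon>} \<in> sets borel" by (intro borel_closed closed_Collect_le continuous_intros \<Phi>c)
      then have "{x \<in> ball p r. \<bar>\<Phi> x\<bar> \<le> L * \<epsilon>} \<in> sets lborel" by (intro ball_conj_borel) simp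
      moreover have "ball p r \<in> fmeasurable lborel" using emeasure_lborel_ball_finite by (auto simp: fmeasurable_def)
      ultimately show "{x \<in> ball p r. \<bar>\<Phi> x\<bar> \<le> L * \<epsilon>} \<in> fmeasurable lborel" by (rule fmeasurableI2[rotated 2]) auto
    qed
    also have "\<dots> \<le> 6 * measure lborel (ball p (2 * r)) / r * (L * \<epsilon>)"
    proof (rule slab_measure_le[OF \<Phi>c sh n])
      show "0 < L * \<epsilon>" using L \<epsilon> by simp
      have "\<epsilon> \<le> r / (6 * L)" using \<epsilon> by simp
      then show "6 * (L * \<epsilon>) \<le> r" using L by (simp add: pos_le_divide_eq mult_ac)
    qed
    finally show "measure lborel {x \<in> ball p (r/2). infdist x (frontier D) \<le> \<epsilon>} \<le> 6 * measure lborel (ball p (2 * r)) / r * L * \<epsilon>"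
      by (simp add: mult.assoc)
  qed (use r L content_ball_pos[of "2 * r" p] in auto)
qed

lemma infdist_borel: "{x::'a::euclidean_space. infdist x F \<le> \<epsilon>} \<in> sets borel"
  by (intro borel_closed closed_Collect_le continuous_intros)

lemma infdist_bounded:
  fixes F :: "'a::euclidean_space set"
  assumes "bounded F" "closed F" "F \<noteq> {}" shows "bounded {x. infdist x F \<le> \<epsilon>}"
proof -
  obtain R where R: "\<And>x. x \<in> F \<Longrightarrow> norm x \<le> R" using assms(1) by (auto simp: bounded_iff)
  have "norm x \<le> R + \<epsilon>" if "infdist x F \<le> \<epsilon>" for x
  proof -
    obtain y where y: "y \<in> F" "infdist x F = dist x y" using infdist_attains_inf[OF assms(2,3)] by blast
    then show ?thesis using R[OF y(1)] that norm_triangle_ineq[of y "x - y"] by (simp add: dist_norm)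
  qed
  then show ?thesis by (auto simp: bounded_iff)
qed

text \<open>Finite upper Minkowski content of dimension N - 1.\<close>

definition thin_strip :: "'a::euclidean_space set \<Rightarrow> bool" where
  "thin_strip F \<longleftrightarrow> (\<exists>C>0. \<exists>\<epsilon>0>0. \<forall>\<epsilon>. 0 < \<epsilon> \<longrightarrow> \<epsilon> \<le> \<epsilon>0 \<longrightarrow> measure lborel {x. infdist x F \<le> \<epsilon>} \<le> C * \<epsilon>)"

text \<open>Used for two finite covers: of one boundary by small balls, and of the boundary of a
  union by the boundaries of its parts.\<close>

lemma thin_strip_cover:
  fixes F :: "'a::euclidean_space set"
  assumes F: "bounded F" "closed F" "F \<noteq> {}" and I: "finite I"
    and c: "\<And>i. i \<in> I \<Longrightarrow> \<exists>C>0. \<exists>\<epsilon>0>0. \<forall>\<epsilon>. 0 < \<epsilon> \<longrightarrow> \<epsilon> \<le> \<epsilon>0 \<longrightarrow>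
        measure lborel (S i \<epsilon>) \<le> C * \<epsilon>"
    and fm: "\<And>i \<epsilon>. i \<in> I \<Longrightarrow> S i \<epsilon> \<in> fmeasurable lborel"
    and e1: "\<epsilon>1 > 0" and cov: "\<And>\<epsilon>. 0 < \<epsilon> \<Longrightarrow> \<epsilon> \<le> \<epsilon>1 \<Longrightarrow> {x. infdist x F \<le> \<epsilon>} \<subseteq> (\<Union>i\<in>I. S i \<epsilon>)"
  shows "thin_strip F"
proof -
  obtain C \<epsilon>0 where C: "\<And>i. i \<in> I \<Longrightarrow> C i > 0" "\<And>i. i \<in> I \<Longrightarrow> \<epsilon>0 i > 0"
    "\<And>i \<epsilon>. i \<in> I \<Longrightarrow> 0 < \<epsilon> \<Longrightarrow> \<epsilon> \<le> \<epsilon>0 i \<Longrightarrow> measure lborel (S i \<epsilon>) \<le> C i * \<epsilon>"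
    using c by metis
  define e where "e = Min (insert \<epsilon>1 (\<epsilon>0 ` I))"
  have e: "e > 0" "e \<le> \<epsilon>1" "\<And>i. i \<in> I \<Longrightarrow> e \<le> \<epsilon>0 i" using I e1 C(2) by (auto simp: e_def)
  have "measure lborel {x. infdist x F \<le> \<epsilon>} \<le> ((\<Sum>i\<in>I. C i) + 1) * \<epsilon>" if \<epsilon>: "0 < \<epsilon>" "\<epsilon> \<le> e" for \<epsilon>
  proof -
    have S: "S i \<epsilon> \<in> fmeasurable lborel \<and> measure lborel (S i \<epsilon>) \<le> C i * \<epsilon>" if "i \<in> I" for i
      using C(3)[OF that] e(3)[OF that] fm[OF that] \<epsilon> by auto
    have "measure lborel {x. infdist x F \<le> \<epsilon>} \<le> measure lborel (\<Union>i\<in>I. S i \<epsilon>)"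
      using cov[of \<epsilon>] \<epsilon> e S I infdist_borel[of F \<epsilon>] by (intro measure_mono_fmeasurable fmeasurable.finite_UN) auto
    also have "\<dots> \<le> (\<Sum>i\<in>I. measure lborel (S i \<epsilon>))" using S I by (intro measure_UNION_le) (auto simp: fmeasurable_def)
    also have "\<dots> \<le> (\<Sum>i\<in>I. C i * \<epsilon>)" using S by (intro sum_mono) auto
    also have "\<dots> \<le> ((\<Sum>i\<in>I. C i) + 1) * \<epsilon>" using \<epsilon> by (simp add: sum_distrib_right[symmetric] distrib_right)
    finally show ?thesis .
  qed
  moreover have "(\<Sum>i\<in>I. C i) + 1 > 0" using C(1) by (simp add: add_nonneg_pos sum_nonneg less_imp_le)
  ultimately show ?thesis unfolding thin_strip_def using e(1) by blast
qed

lemma fmeasurable_bounded_borel: "A \<in> sets borel \<Longrightarrow> bounded A \<Longrightarrow> A \<in> fmeasurable lborel"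
  using emeasure_bounded_finite by (auto simp: fmeasurable_def)

text \<open>By compactness finitely many balls of half radius cover the boundary; for \<epsilon> at
  most a quarter of every radius, the \<epsilon>-neighbourhood stays in the full balls.\<close>

lemma thin_strip_domain:
  fixes D :: "'a::euclidean_space set"
  assumes op: "open D" and bd: "bounded D" and ne: "frontier D \<noteq> {}" and C: "C2alpha_boundary \<alpha> D"
  shows "thin_strip (frontier D)"
proof -
  let ?F = "frontier D"
  have F: "bounded ?F" "closed ?F" using bounded_frontier[OF bd] by simp_all
  then have Fc: "compact ?F" by (simp only: compact_eq_bounded_closed)
  define good where "good p r \<longleftrightarrow> (\<exists>C>0. \<exists>\<epsilon>0>0. \<forall>\<epsilon>. 0 < \<epsilon> \<longrightarrow> \<epsilon> \<le> \<epsilon>0 \<longrightarrow>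
     measure lborel {x \<in> ball p r. infdist x ?F \<le> \<epsilon>} \<le> C * \<epsilon>)" for p r
  have "\<forall>p\<in>?F. \<exists>r. r > 0 \<and> good p r" unfolding good_def using strip_local[OF op C] by blast
  from bchoice[OF this] obtain r where r: "\<And>p. p \<in> ?F \<Longrightarrow> r p > 0" and s: "\<And>p. p \<in> ?F \<Longrightarrow> good p (r p)" by blast
  have "?F \<subseteq> (\<Union>p\<in>?F. ball p (r p / 2))" using r by force
  then obtain I where I: "I \<subseteq> ?F" "finite I" "?F \<subseteq> (\<Union>p\<in>I. ball p (r p / 2))"
    using compactE_image[OF Fc, of ?F "\<lambda>p. ball p (r p / 2)"] by auto
  have "I \<noteq> {}" using I ne by auto
  define e where "e = Min ((\<lambda>p. r p / 4) ` I)"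
  have e: "e > 0" "\<And>p. p \<in> I \<Longrightarrow> e \<le> r p / 4"
  proof -
    show "e > 0" unfolding e_def using I r \<open>I \<noteq> {}\<close> by auto
    show "e \<le> r p / 4" if "p \<in> I" for p unfolding e_def by (rule Min_le) (use I that in auto)
  qed
  show ?thesis
  proof (rule thin_strip_cover[OF F(1,2) ne I(2) _ _ e(1), of "\<lambda>p \<epsilon>. {x \<in> ball p (r p). infdist x ?F \<le> \<epsilon>}"])
    fix p assume "p \<in> I"
    then have "p \<in> ?F" using I by auto
    show "{x \<in> ball p (r p). infdist x ?F \<le> \<epsilon>} \<in> fmeasurable lborel" for \<epsilon>
    proof (rule fmeasurable_bounded_borel)
      have "{x. infdist x ?F \<le> \<epsilon>} \<in> sets lborel" using infdist_borel by simp
      then have "{x \<in> ball p (r p). infdist x ?F \<le> \<epsilon>} \<in> sets lborel" by (rule ball_conj_borel)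
      then show "{x \<in> ball p (r p). infdist x ?F \<le> \<epsilon>} \<in> sets borel" by simp
      show "bounded {x \<in> ball p (r p). infdist x ?F \<le> \<epsilon>}" by (rule bounded_subset[OF bounded_ball[of p "r p"]]) auto
    qed
    show "\<exists>C>0. \<exists>\<epsilon>0>0. \<forall>\<epsilon>. 0 < \<epsilon> \<longrightarrow> \<epsilon> \<le> \<epsilon>0 \<longrightarrow>
      measure lborel {x \<in> ball p (r p). infdist x ?F \<le> \<epsilon>} \<le> C * \<epsilon>" using s[OF \<open>p \<in> ?F\<close>] unfolding good_def .
  next
    fix \<epsilon> assume \<epsilon>: "0 < \<epsilon>" "\<epsilon> \<le> e"
    show "{x. infdist x ?F \<le> \<epsilon>} \<subseteq> (\<Union>p\<in>I. {x \<in> ball p (r p). infdist x ?F \<le> \<epsilon>})"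
    proof
      fix x assume "x \<in> {x. infdist x ?F \<le> \<epsilon>}"
      then have x: "infdist x ?F \<le> \<epsilon>" by simp
      obtain y where y: "y \<in> ?F" "infdist x ?F = dist x y" using infdist_attains_inf[OF F(2) ne] by blast
      obtain p where p: "p \<in> I" "y \<in> ball p (r p / 2)" using I(3) y(1) by blast
      have "p \<in> ?F" using p I by auto
      have "dist p x \<le> dist p y + dist x y" by (metis dist_triangle dist_commute)
      also have "\<dots> < r p / 2 + r p / 4 + 0" using p y x \<epsilon> e(2)[OF p(1)] by (simp add: dist_commute)
      also have "\<dots> \<le> r p" using r[OF \<open>p \<in> ?F\<close>] by simp
      finally show "x \<in> (\<Union>p\<in>I. {x \<in> ball p (r p). infdist x ?F \<le> \<epsilon>})" using p x by auto
    qed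
  qed
qed

lemma frontier_UN_subset:
  assumes "finite J" shows "frontier (\<Union>j\<in>J. A j) \<subseteq> (\<Union>j\<in>J. frontier (A j))"
proof -
  have "closure (\<Union>j\<in>J. A j) = (\<Union>j\<in>J. closure (A j))" using assms by (induction rule: finite_induct) auto
  moreover have "(\<Union>j\<in>J. interior (A j)) \<subseteq> interior (\<Union>j\<in>J. A j)"
    by (rule UN_least, rule interior_mono) auto
  ultimately show ?thesis unfolding frontier_def by blast
qed

lemma thin_strip_union:
  fixes A :: "nat \<Rightarrow> 'a::euclidean_space set"
  assumes op: "\<And>j. j < m \<Longrightarrow> open (A j)" and bd: "\<And>j. j < m \<Longrightarrow> bounded (A j)"
    and C: "\<And>j. j < m \<Longrightarrow> C2alpha_boundary \<alpha> (A j)" and ne: "frontier (\<Union>j<m. A j) \<noteq> {}"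
  shows "thin_strip (frontier (\<Union>j<m. A j))"
proof -
  let ?F = "frontier (\<Union>j<m. A j)"
  \<comment> \<open>Empty boundaries are removed, since \<open>infdist\<close> to the empty set is 0
    and its neighbourhoods would be the whole space.\<close>
  let ?J = "{j. j < m \<and> frontier (A j) \<noteq> {}}"
  have b: "bounded (\<Union>j<m. A j)" using bd by (intro bounded_UN) auto
  have F: "bounded ?F" "closed ?F" using bounded_frontier[OF b] by simp_all
  show ?thesis
  proof (rule thin_strip_cover[OF F ne, of ?J _ 1])
    show "finite ?J" by simp
    fix j assume j: "j \<in> ?J"
    show "{x. infdist x (frontier (A j)) \<le> \<epsilon>} \<in> fmeasurable lborel" for \<epsilon>
      by (rule fmeasurable_bounded_borel[OF infdist_borel infdist_bounded]) (use j bounded_frontier[OF bd[of j]] in simp_all)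
    have "thin_strip (frontier (A j))" by (rule thin_strip_domain[OF op bd _ C]) (use j in auto)
    then show "\<exists>C>0. \<exists>\<epsilon>0>0. \<forall>\<epsilon>. 0 < \<epsilon> \<longrightarrow> \<epsilon> \<le> \<epsilon>0 \<longrightarrow>
      measure lborel {x. infdist x (frontier (A j)) \<le> \<epsilon>} \<le> C * \<epsilon>" unfolding thin_strip_def .
  next
    fix \<epsilon> :: real
    show "{x. infdist x ?F \<le> \<epsilon>} \<subseteq> (\<Union>j\<in>?J. {x. infdist x (frontier (A j)) \<le> \<epsilon>})"
    proof
      fix x assume "x \<in> {x. infdist x ?F \<le> \<epsilon>}"
      then have x: "infdist x ?F \<le> \<epsilon>" by simp
      obtain y where y: "y \<in> ?F" "infdist x ?F = dist x y" using infdist_attains_inf[OF F(2) ne] by blast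
      obtain j where j: "j < m" "y \<in> frontier (A j)" using y(1) frontier_UN_subset[of "{..<m}" A] by auto
      then have "infdist x (frontier (A j)) \<le> dist x y" by (intro infdist_le)
      then show "x \<in> (\<Union>j\<in>?J. {x. infdist x (frontier (A j)) \<le> \<epsilon>})" using j x y by auto
    qed
  qed simp
qed

lemma thin_strip_null:
  fixes F :: "'a::euclidean_space set"
  assumes F: "bounded F" "closed F" "F \<noteq> {}" and t: "thin_strip F"
  shows "F \<in> null_sets lborel"
proof -
  obtain C e where C: "C > 0" "e > 0" "\<And>\<epsilon>. 0 < \<epsilon> \<Longrightarrow> \<epsilon> \<le> e \<Longrightarrow> measure lborel {x. infdist x F \<le> \<epsilon>} \<le> C * \<epsilon>"
    using t unfolding thin_strip_def by blast
  have Fm: "F \<in> fmeasurable lborel" using F by (intro fmeasurable_bounded_borel) auto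
  have "measure lborel F \<le> C * \<epsilon>" if \<epsilon>: "0 < \<epsilon>" "\<epsilon> \<le> e" for \<epsilon>
  proof -
    have "measure lborel F \<le> measure lborel {x. infdist x F \<le> \<epsilon>}"
      using Fm \<epsilon> by (intro measure_mono_fmeasurable fmeasurable_bounded_borel infdist_borel infdist_bounded F) auto
    then show ?thesis using C(3)[OF \<epsilon>] by simp
  qed
  then have "measure lborel F \<le> 0 + \<delta>" if "\<delta> > 0" for \<delta>
  proof -
    have "measure lborel F \<le> C * min e (\<delta> / C)" using C that \<open>\<And>\<epsilon>. 0 < \<epsilon> \<Longrightarrow> \<epsilon> \<le> e \<Longrightarrow> measure lborel F \<le> C * \<epsilon>\<close> by simp
    also have "\<dots> \<le> C * (\<delta> / C)" using C by (intro mult_left_mono) auto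
    finally show ?thesis using C by simp
  qed
  then have "measure lborel F \<le> 0" by (rule field_le_epsilon)
  then have "measure lborel F = 0" using measure_nonneg[of lborel F] by linarith
  then show ?thesis using Fm by (auto simp: null_sets_def fmeasurable_def emeasure_eq_ennreal_measure)
qed

section \<open>Mollified indicator functions\<close>

lemma
  fixes f :: "'a::euclidean_space \<Rightarrow> real" and h :: "'b::euclidean_space \<Rightarrow> real"
  assumes f: "integrable lborel f" and h: "integrable lborel h"
  shows lborel_integrable_prod: "integrable lborel (\<lambda>z. f (fst z) * h (snd z))"
    and lborel_integral_prod: "(LINT z|lborel. f (fst z) * h (snd z)) = (LINT x|lborel. f x) * (LINT y|lborel. h y)"
proof -
  have [measurable]: "f \<in> borel_measurable borel" "h \<in> borel_measurable borel" using f h by (auto dest: borel_measurable_integrable)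
  have i: "integrable (lborel \<Otimes>\<^sub>M lborel) (\<lambda>(x, y). f x * h y)"
  proof (rule lborel_pair.Fubini_integrable)
    have "integrable lborel (\<lambda>x. \<bar>f x\<bar> * (LINT y|lborel. \<bar>h y\<bar>))" using f by simp
    then show "integrable lborel (\<lambda>x. LINT y|lborel. norm (case (x, y) of (x, y) \<Rightarrow> f x * h y))" by (simp add: abs_mult)
    show "AE x in lborel. integrable lborel (\<lambda>y. case (x, y) of (x, y) \<Rightarrow> f x * h y)" using h by simp
  qed measurable
  then show "integrable lborel (\<lambda>z. f (fst z) * h (snd z))" by (simp add: lborel_prod case_prod_unfold)
  have "(LINT x|lborel. LINT y|lborel. f x * h y) = integral\<^sup>L (lborel \<Otimes>\<^sub>M lborel) (\<lambda>(x, y). f x * h y)"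
    by (rule lborel_pair.integral_fst[OF i])
  then show "(LINT z|lborel. f (fst z) * h (snd z)) = (LINT x|lborel. f x) * (LINT y|lborel. h y)"
    by (simp add: lborel_prod case_prod_unfold)
qed

text \<open>Fubini's theorem for averaging, over the centre y in a bounded set, integrals tested
  against a bounded kernel.\<close>

lemma lborel_integral_average:
  fixes w :: "'c::euclidean_space \<Rightarrow> real" and q :: "'a::euclidean_space \<Rightarrow> 'c \<Rightarrow> real"
  assumes S: "S \<in> sets borel" "bounded S" and w: "integrable lborel w"
    and q: "(\<lambda>(y, z). q y z) \<in> borel_measurable (borel \<Otimes>\<^sub>M borel)" "\<And>y z. \<bar>q y z\<bar> \<le> B"
  shows "(LINT y|lborel. indicator S y * (LINT z|lborel. w z * q y z)) = (LINT z|lborel. w z * (LINT y|lborel. indicator S y * q y z))"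
    and "integrable lborel (\<lambda>z. w z * (LINT y|lborel. indicator S y * q y z))"
    and "integrable lborel (\<lambda>y. indicator S y * (LINT z|lborel. w z * q y z))"
proof -
  have wm[measurable]: "w \<in> borel_measurable borel" using w by (auto dest: borel_measurable_integrable)
  note [measurable] = S(1) q(1)
  have iS: "integrable lborel (\<lambda>y. indicator S y :: real)"
    using emeasure_bounded_finite[OF S(2)] S(1) by (simp add: integrable_indicator_iff)
  have B: "B \<ge> 0" using q(2) abs_ge_zero order_trans by blast
  have i: "integrable (lborel \<Otimes>\<^sub>M lborel) (\<lambda>(y, z). indicator S y * (w z * q y z))"
  proof (rule Bochner_Integration.integrable_bound)
    have "integrable lborel (\<lambda>p::'a \<times> 'c. indicator S (fst p) * (B * \<bar>w (snd p)\<bar>))"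
      by (rule lborel_integrable_prod[OF iS]) (use w in simp)
    then show "integrable (lborel \<Otimes>\<^sub>M lborel) (\<lambda>p::'a \<times> 'c. indicator S (fst p) * (B * \<bar>w (snd p)\<bar>))" by (simp add: lborel_prod)
    show "(\<lambda>(y, z). indicator S y * (w z * q y z)) \<in> borel_measurable (lborel \<Otimes>\<^sub>M lborel)" by measurable
    show "AE p in lborel \<Otimes>\<^sub>M lborel. norm (case p of (y, z) \<Rightarrow> indicator S y * (w z * q y z)) \<le> norm (indicator S (fst p) * (B * \<bar>w (snd p)\<bar>))"
    proof (rule AE_I2)
      fix p :: "'a \<times> 'c"
      have "\<bar>w (snd p)\<bar> * \<bar>q (fst p) (snd p)\<bar> \<le> \<bar>w (snd p)\<bar> * B" using q(2) by (intro mult_left_mono) auto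
      then show "norm (case p of (y, z) \<Rightarrow> indicator S y * (w z * q y z)) \<le> norm (indicator S (fst p) * (B * \<bar>w (snd p)\<bar>))"
        using B by (auto simp: indicator_def abs_mult case_prod_beta mult.commute)
    qed
  qed
  have "(LINT y|lborel. indicator S y * (LINT z|lborel. w z * q y z)) = (LINT y|lborel. LINT z|lborel. indicator S y * (w z * q y z))" by simp
  also have "\<dots> = (LINT z|lborel. LINT y|lborel. indicator S y * (w z * q y z))"
    using lborel_pair.Fubini_integral[OF i] by simp
  also have eq: "(\<lambda>z. LINT y|lborel. indicator S y * (w z * q y z)) = (\<lambda>z. w z * (LINT y|lborel. indicator S y * q y z))"
    by (simp add: mult.left_commute)
  finally show "(LINT y|lborel. indicator S y * (LINT z|lborel. w z * q y z)) = (LINT z|lborel. w z * (LINT y|lborel. indicator S y * q y z))" .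
  show "integrable lborel (\<lambda>z. w z * (LINT y|lborel. indicator S y * q y z))"
    using lborel_pair.integrable_snd[OF i] unfolding eq by simp
  show "integrable lborel (\<lambda>y. indicator S y * (LINT z|lborel. w z * q y z))"
    using lborel_pair.integrable_fst[OF i] by simp
qed

definition bump :: "'a::euclidean_space \<Rightarrow> real" where "bump z = expinv 0 (1 - (norm z)\<^sup>2)"

lemma bump_test: "test_elem (bump :: 'a::euclidean_space \<Rightarrow> real)" and bump_zero: "norm (z::'a) \<ge> 1 \<Longrightarrow> bump z = 0"
proof -
  show 0: "bump z = 0" if "norm z \<ge> 1" for z :: 'a
  proof -
    have "(norm z)\<^sup>2 \<ge> 1" using that by (simp add: one_le_power)
    then show ?thesis by (simp add: bump_def expinv_def)
  qed
  show "test_elem (bump :: 'a \<Rightarrow> real)" unfolding test_elem_def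
  proof
    show "elementary (bump :: 'a \<Rightarrow> real)" unfolding bump_def[abs_def]
      by (intro elementary.expinv elementary_diff elementary.const elementary_norm_sq)
    show "\<exists>R. \<forall>z::'a. R < norm z \<longrightarrow> bump z = 0" using 0 by (intro exI[of _ 1]) auto
  qed
qed

lemma bump_nonneg: "bump z \<ge> 0" by (simp add: bump_def expinv_nonneg)

lemma bump_integral_pos: "(LINT z::'a::euclidean_space|lborel. bump z) > 0"
proof -
  have i: "integrable lborel (bump :: 'a \<Rightarrow> real)" by (rule test_elem_integrable[OF bump_test])
  have "(LINT z::'a|lborel. bump z) \<noteq> 0"
  proof
    assume "(LINT z::'a|lborel. bump z) = 0"
    then have "AE z::'a in lborel. bump z = 0" using integral_nonneg_eq_0_iff_AE[OF i] by (simp add: bump_nonneg)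
    then have "AE z in lborel. z \<notin> ball (0::'a) 1"
    proof eventually_elim
      case (elim z)
      then show ?case using abs_square_less_1[of "norm z"] by (auto simp: bump_def expinv_def split: if_splits)
    qed
    then have "emeasure lborel (ball (0::'a) 1) = 0" by (subst (asm) AE_iff_measurable[where N="ball 0 1"]) auto
    then show False using content_ball_pos[of 1 "0::'a"] by (simp add: measure_def)
  qed
  moreover have "(LINT z::'a|lborel. bump z) \<ge> 0" by (simp add: bump_nonneg)
  ultimately show ?thesis by simp
qed

lemma dirderiv_bump_zero: assumes "norm z > 1" shows "dirderiv v bump z = 0"
proof -
  have op: "open {z::'a. norm z > 1}" by (intro open_Collect_less continuous_intros)
  have "((\<lambda>z. 0) has_derivative (\<lambda>v. 0)) (at z)" by simp
  then have "(bump has_derivative (\<lambda>v. 0)) (at z)"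
    by (rule has_derivative_transform_within_open[OF _ op]) (use assms in \<open>auto intro: bump_zero\<close>)
  then show ?thesis using dirderiv_eqI by blast
qed

lemma dirderiv_scaled:
  assumes f: "elementary f"
  shows "dirderiv v (\<lambda>x. f (c *\<^sub>R (x - y))) x = c * dirderiv v f (c *\<^sub>R (x - y))"
proof -
  have "((\<lambda>x. c *\<^sub>R (x - y)) has_derivative (\<lambda>v. c *\<^sub>R v)) (at x)" by (auto intro!: derivative_eq_intros)
  from has_derivative_compose[OF this elementary_has_derivative[OF f]]
  have "dirderiv v (\<lambda>x. f (c *\<^sub>R (x - y))) x = dirderiv (c *\<^sub>R v) f (c *\<^sub>R (x - y))" by (rule dirderiv_eqI)
  also have "\<dots> = c * dirderiv v f (c *\<^sub>R (x - y))"
    using linear_cmul[OF has_derivative_linear[OF elementary_has_derivative[OF f]], of c v] by simp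
  finally show ?thesis .
qed

lemma dirderiv_mult:
  assumes "elementary f" "elementary g"
  shows "dirderiv v (\<lambda>x. f x * g x) x = f x * dirderiv v g x + dirderiv v f x * g x"
  by (rule dirderiv_eqI[OF has_derivative_mult[OF elementary_has_derivative elementary_has_derivative]]) (use assms in auto)

lemma integral_scaled:
  fixes f :: "'a::euclidean_space \<Rightarrow> real"
  assumes f[measurable]: "f \<in> borel_measurable borel" and \<epsilon>: "\<epsilon> > 0"
  shows "(1 / \<epsilon>) ^ DIM('a) * (LINT y|lborel. f ((1 / \<epsilon>) *\<^sub>R (x - y))) = (LINT w|lborel. f w)"
proof -
  have "(LINT w|lborel. f w) = \<bar>- (1 / \<epsilon>)\<bar> ^ DIM('a) * (LINT y|lborel. f ((1 / \<epsilon>) *\<^sub>R x + (- (1 / \<epsilon>)) *\<^sub>R y))"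
    by (rule lborel_integral_affine) (use \<epsilon> in auto)
  then show ?thesis using \<epsilon> by (simp add: algebra_simps)
qed

lemma bump_meas[measurable]: "bump \<in> borel_measurable borel" "dirderiv v bump \<in> borel_measurable borel"
  using test_elemD[OF bump_test] by (auto intro!: test_elem_measurable elementary_dirderiv)

context
  fixes \<Omega> :: "'a::euclidean_space set" and \<epsilon> :: real
  assumes op: "open \<Omega>" and bd: "bounded \<Omega>" and \<epsilon>: "\<epsilon> > 0"
begin

text \<open>Normalises the rescaled \<open>bump\<close> to integral 1.\<close>

definition "mcoef = (1 / \<epsilon>) ^ DIM('a) / (LINT z::'a|lborel. bump z)"

definition "moll x = mcoef * (LINT y|lborel. indicator \<Omega> y * bump ((1 / \<epsilon>) *\<^sub>R (x - y)))"
text \<open>The derivative is placed under the integral sign by definition;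
  \<open>mollified_identity\<close> links it to \<open>moll\<close>.\<close>

definition "moll_d v x = mcoef * (LINT y|lborel. indicator \<Omega> y * ((1 / \<epsilon>) * dirderiv v bump ((1 / \<epsilon>) *\<^sub>R (x - y))))"

lemma mcoef_pos: "mcoef > 0" using \<epsilon> bump_integral_pos[where 'a='a] by (simp add: mcoef_def)

lemma mcoef_integral:
  assumes "f \<in> borel_measurable borel"
  shows "mcoef * (LINT y|lborel. f ((1 / \<epsilon>) *\<^sub>R (x - y))) = (LINT w::'a|lborel. f w) / (LINT z::'a|lborel. bump z)"
  using integral_scaled[OF assms \<epsilon>, of x] by (simp add: mcoef_def)

lemma scaled_integrable:
  assumes f: "f \<in> borel_measurable borel" "integrable lborel f"
  shows "integrable lborel (\<lambda>y. f ((1 / \<epsilon>) *\<^sub>R (x - (y::'a))) :: real)"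
proof -
  have "integrable lborel (\<lambda>y. f ((1 / \<epsilon>) *\<^sub>R x + (- (1 / \<epsilon>)) *\<^sub>R y))"
    by (subst lborel_integrable_affine) (use \<epsilon> f in auto)
  then show ?thesis by (simp add: algebra_simps)
qed

text \<open>A connected set that meets both \<Omega> and its complement meets the frontier.\<close>

lemma cball_inside_or_outside:
  assumes "infdist x (frontier \<Omega>) > \<epsilon>"
  shows "cball x \<epsilon> \<subseteq> \<Omega> \<or> cball x \<epsilon> \<inter> \<Omega> = {}"
proof (rule ccontr)
  assume "\<not> ?thesis"
  then have "cball x \<epsilon> \<inter> \<Omega> \<noteq> {}" "cball x \<epsilon> - \<Omega> \<noteq> {}" by auto
  then have "cball x \<epsilon> \<inter> frontier \<Omega> \<noteq> {}" by (intro connected_Int_frontier) auto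
  then obtain y where "y \<in> frontier \<Omega>" "dist x y \<le> \<epsilon>" by auto
  then show False using assms infdist_le2[of y "frontier \<Omega>" x \<epsilon>] by auto
qed

lemma indicator_times_scaled:
  assumes z: "\<And>w::'a. norm w > 1 \<Longrightarrow> f w = 0" and c: "infdist x (frontier \<Omega>) > \<epsilon>"
  shows "indicator \<Omega> y * f ((1 / \<epsilon>) *\<^sub>R (x - y)) = (if x \<in> \<Omega> then f ((1 / \<epsilon>) *\<^sub>R (x - y)) else (0::real))"
proof (cases "dist x y \<le> \<epsilon>")
  case True
  have "x \<in> cball x \<epsilon>" "y \<in> cball x \<epsilon>" using True \<epsilon> by auto
  then have "x \<in> \<Omega> \<longleftrightarrow> y \<in> \<Omega>" using cball_inside_or_outside[OF c] by blast
  then show ?thesis by (simp add: indicator_def)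
next
  case False
  then have "norm ((1 / \<epsilon>) *\<^sub>R (x - y)) > 1" using \<epsilon> by (simp add: dist_norm)
  then show ?thesis by (simp only: z mult_zero_right if_cancel)
qed

text \<open>At distance more than \<epsilon> from the frontier the kernel sees only one side of it:
  the normalisation yields the indicator, and the vanishing integral of a derivative of
  \<open>bump\<close> yields 0.\<close>

lemma moll_far:
  assumes c: "infdist x (frontier \<Omega>) > \<epsilon>" shows "moll x = indicator \<Omega> x" "moll_d v x = 0"
proof -
  have b0: "\<And>w::'a. norm w > 1 \<Longrightarrow> bump w = 0" by (rule bump_zero) simp
  have "moll x = (if x \<in> \<Omega> then mcoef * (LINT y|lborel. bump ((1 / \<epsilon>) *\<^sub>R (x - y))) else 0)"
  proof -
    have "indicator \<Omega> y * bump ((1 / \<epsilon>) *\<^sub>R (x - y)) = (if x \<in> \<Omega> then bump ((1 / \<epsilon>) *\<^sub>R (x - y)) else 0)" for y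
      by (rule indicator_times_scaled[OF b0 c])
    then have "(\<lambda>y. indicator \<Omega> y * bump ((1 / \<epsilon>) *\<^sub>R (x - y))) = (\<lambda>y. if x \<in> \<Omega> then bump ((1 / \<epsilon>) *\<^sub>R (x - y)) else 0)"
      by (rule ext)
    then show ?thesis by (simp only: moll_def) simp
  qed
  also have "\<dots> = indicator \<Omega> x" unfolding mcoef_integral[OF bump_meas(1)]
    using bump_integral_pos[where 'a='a] by simp
  finally show "moll x = indicator \<Omega> x" .
  have b1: "\<And>w::'a. norm w > 1 \<Longrightarrow> 1 / \<epsilon> * dirderiv v bump w = 0" by (simp add: dirderiv_bump_zero)
  have m: "(\<lambda>w. 1 / \<epsilon> * dirderiv v bump w) \<in> borel_measurable borel" by measurable
  have "moll_d v x = (if x \<in> \<Omega> then mcoef * (LINT y|lborel. 1 / \<epsilon> * dirderiv v bump ((1 / \<epsilon>) *\<^sub>R (x - y))) else 0)"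
  proof -
    have "indicator \<Omega> y * (1 / \<epsilon> * dirderiv v bump ((1 / \<epsilon>) *\<^sub>R (x - y))) =
        (if x \<in> \<Omega> then 1 / \<epsilon> * dirderiv v bump ((1 / \<epsilon>) *\<^sub>R (x - y)) else 0)" for y
      by (rule indicator_times_scaled[where f="\<lambda>w. 1 / \<epsilon> * dirderiv v bump w", OF b1 c])
    then have "(\<lambda>y. indicator \<Omega> y * (1 / \<epsilon> * dirderiv v bump ((1 / \<epsilon>) *\<^sub>R (x - y)))) =
        (\<lambda>y. if x \<in> \<Omega> then 1 / \<epsilon> * dirderiv v bump ((1 / \<epsilon>) *\<^sub>R (x - y)) else 0)"
      by (rule ext)
    then show ?thesis by (simp only: moll_d_def) simp
  qed
  also have "\<dots> = 0" unfolding mcoef_integral[OF m] using test_elem_integral_dirderiv[OF bump_test, of v] by simp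
  finally show "moll_d v x = 0" .
qed

lemma indicator_integral_abs_le:
  assumes f: "f \<in> borel_measurable borel" "integrable lborel f"
  shows "\<bar>mcoef * (LINT y|lborel. indicator \<Omega> y * f ((1 / \<epsilon>) *\<^sub>R (x - y)))\<bar> \<le> (LINT w::'a|lborel. \<bar>f w\<bar>) / (LINT z::'a|lborel. bump z)"
proof -
  have "\<bar>LINT y|lborel. indicator \<Omega> y * f ((1 / \<epsilon>) *\<^sub>R (x - y))\<bar> \<le> (LINT y|lborel. \<bar>indicator \<Omega> y * f ((1 / \<epsilon>) *\<^sub>R (x - y))\<bar>)"
    by (rule integral_abs_bound)
  also have "\<dots> \<le> (LINT y|lborel. \<bar>f ((1 / \<epsilon>) *\<^sub>R (x - y))\<bar>)"
    by (rule integral_mono') (use scaled_integrable[OF f, of x] in \<open>auto simp: indicator_def\<close>)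
  finally have "mcoef * \<bar>LINT y|lborel. indicator \<Omega> y * f ((1 / \<epsilon>) *\<^sub>R (x - y))\<bar> \<le> mcoef * (LINT y|lborel. \<bar>f ((1 / \<epsilon>) *\<^sub>R (x - y))\<bar>)"
    using mcoef_pos by (intro mult_left_mono) auto
  also have "\<dots> = (LINT w::'a|lborel. \<bar>f w\<bar>) / (LINT z::'a|lborel. bump z)"
    by (rule mcoef_integral[where f="\<lambda>w. \<bar>f w\<bar>"]) (use f in measurable)
  finally show ?thesis using mcoef_pos by (simp add: abs_mult)
qed

lemma moll_bound: "\<bar>moll x\<bar> \<le> 1"
proof -
  have "(LINT w::'a|lborel. \<bar>bump w\<bar>) = (LINT w::'a|lborel. bump w)" by (simp add: bump_nonneg)
  then show ?thesis using indicator_integral_abs_le[OF bump_meas(1) test_elem_integrable[OF bump_test], of x]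
     bump_integral_pos[where 'a='a] by (simp add: moll_def)
qed

lemma moll_d_bound: "\<bar>moll_d v x\<bar> \<le> (LINT w::'a|lborel. \<bar>dirderiv v bump w\<bar>) / (LINT z::'a|lborel. bump z) / \<epsilon>"
proof -
  have i: "integrable lborel (dirderiv v (bump :: 'a \<Rightarrow> real))" by (rule test_elem_integrable[OF test_elem_dirderiv[OF bump_test]])
  have "moll_d v x = (1 / \<epsilon>) * (mcoef * (LINT y|lborel. indicator \<Omega> y * dirderiv v bump ((1 / \<epsilon>) *\<^sub>R (x - y))))"
    unfolding moll_d_def mult.left_commute[of "indicator _ _"] by simp
  then have "\<bar>moll_d v x\<bar> = (1 / \<epsilon>) * \<bar>mcoef * (LINT y|lborel. indicator \<Omega> y * dirderiv v bump ((1 / \<epsilon>) *\<^sub>R (x - y)))\<bar>"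
    using \<epsilon> by (simp add: abs_mult)
  also have "\<dots> \<le> (1 / \<epsilon>) * ((LINT w::'a|lborel. \<bar>dirderiv v bump w\<bar>) / (LINT z::'a|lborel. bump z))"
    using \<epsilon> by (intro mult_left_mono indicator_integral_abs_le[OF bump_meas(2) i]) auto
  finally show ?thesis by (simp add: mult.commute)
qed

lemma moll_meas: "moll \<in> borel_measurable borel" "moll_d v \<in> borel_measurable borel"
proof -
  note [measurable] = borel_open[OF op]
  show "moll \<in> borel_measurable borel" unfolding moll_def[abs_def] by measurable
  show "moll_d v \<in> borel_measurable borel" unfolding moll_d_def[abs_def] by measurable
qed

end

section \<open>The flux across the interface\<close>

lemma integrable_of_bounded_support:
  fixes f :: "'b::euclidean_space \<Rightarrow> real"
  assumes f: "f \<in> borel_measurable borel" and B: "\<And>z. \<bar>f z\<bar> \<le> B" and K: "bounded K" "K \<in> sets borel" "\<And>z. z \<notin> K \<Longrightarrow> f z = 0"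
  shows "integrable lborel f"
proof (rule Bochner_Integration.integrable_bound)
  show "integrable lborel (\<lambda>z. B * indicator K z)"
    using emeasure_bounded_finite[OF K(1)] K(2) by (intro integrable_mult_right) (simp add: integrable_indicator_iff)
  show "AE z in lborel. norm (f z) \<le> norm (B * indicator K z)"
    using B K(3) by (intro AE_I2) (auto simp: indicator_def intro: order_trans[OF _ abs_ge_self])
qed (use f in simp)

lemma elementary_dirderiv_real:
  assumes "elementary \<theta>" "(\<theta> has_real_derivative D) (at t)" shows "dirderiv s \<theta> t = s * D"
  using dirderiv_eqI[OF assms(2)[unfolded has_field_derivative_def]] by (simp add: mult.commute)

lemma prod_test_has_derivative:
  assumes "elementary \<psi>" "elementary \<theta>"
  shows "((\<lambda>z::'a::euclidean_space \<times> real. \<psi> (fst z) * \<theta> (snd z)) has_derivative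
     (\<lambda>w. \<psi> (fst z) * dirderiv (snd w) \<theta> (snd z) + dirderiv (fst w) \<psi> (fst z) * \<theta> (snd z))) (at z)"
proof -
  have 1: "((\<lambda>z::'a \<times> real. \<psi> (fst z)) has_derivative (\<lambda>w. dirderiv (fst w) \<psi> (fst z))) (at z)"
    by (rule has_derivative_compose[OF _ elementary_has_derivative[OF assms(1)]]) (intro derivative_intros)
  have 2: "((\<lambda>z::'a \<times> real. \<theta> (snd z)) has_derivative (\<lambda>w. dirderiv (snd w) \<theta> (snd z))) (at z)"
    by (rule has_derivative_compose[OF _ elementary_has_derivative[OF assms(2)]]) (intro derivative_intros)
  show ?thesis by (rule has_derivative_mult[OF 1 2])
qed

lemma dirderiv_zero: "elementary f \<Longrightarrow> dirderiv 0 f z = 0"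
  using linear_0[OF has_derivative_linear[OF elementary_has_derivative]] by blast

lemma dirderiv_sum_Basis:
  assumes "elementary f" shows "dirderiv v f z = (\<Sum>b\<in>Basis. (v \<bullet> b) * dirderiv b f z)"
proof -
  have l: "linear (\<lambda>v. dirderiv v f z)" by (rule has_derivative_linear[OF elementary_has_derivative[OF assms]])
  have "dirderiv v f z = dirderiv (\<Sum>b\<in>Basis. (v \<bullet> b) *\<^sub>R b) f z" by (simp add: euclidean_representation)
  also have "\<dots> = (\<Sum>b\<in>Basis. dirderiv ((v \<bullet> b) *\<^sub>R b) f z)" using linear_sum[OF l] by (simp add: o_def)
  also have "\<dots> = (\<Sum>b\<in>Basis. (v \<bullet> b) * dirderiv b f z)" using linear_scale[OF l] by simp
  finally show ?thesis .
qed

lemma frechet_prod_test: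
  assumes "elementary \<psi>" "elementary \<theta>"
  shows "frechet_derivative (\<lambda>z::'a::euclidean_space \<times> real. \<psi> (fst z) * \<theta> (snd z)) (at z) (v, s) =
     \<psi> (fst z) * dirderiv s \<theta> (snd z) + dirderiv v \<psi> (fst z) * \<theta> (snd z)"
  using frechet_derivative_at[OF prod_test_has_derivative[OF assms, of z], symmetric] by simp

lemma elementary_prod: "elementary \<psi> \<Longrightarrow> elementary \<theta> \<Longrightarrow> elementary (\<lambda>z::'a::euclidean_space \<times> real. \<psi> (fst z) * \<theta> (snd z))"
  by (intro elementary.mult elementary_fst elementary_snd)

lemma bounded_on_interval:
  fixes \<theta> :: "real \<Rightarrow> real"
  assumes "continuous_on UNIV \<theta>" "\<And>t. \<theta> t \<noteq> 0 \<Longrightarrow> l \<le> t \<and> t \<le> T"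
  obtains B where "B > 0" "\<And>t. \<bar>\<theta> t\<bar> \<le> B"
proof -
  have "compact (\<theta> ` {l..T})" by (rule compact_continuous_image[OF continuous_on_subset[OF assms(1)]]) auto
  then have "bounded (\<theta> ` {l..T})" by (rule compact_imp_bounded)
  then obtain B where B: "B > 0" "\<And>t. t \<in> {l..T} \<Longrightarrow> norm (\<theta> t) \<le> B" unfolding bounded_pos by blast
  have "\<bar>\<theta> t\<bar> \<le> B" for t using B assms(2)[of t] by (cases "\<theta> t = 0") auto
  then show ?thesis using that B(1) by blast
qed

text \<open>\<open>p0\<close> is an arbitrary boundary point, so that \<open>u p0 t\<close> is the common boundary value at time \<open>t\<close>.\<close>

locale weak_solution =
  fixes \<Omega> :: "'a::euclidean_space set" and u :: "'a \<Rightarrow> real \<Rightarrow> real" and g :: "'a \<Rightarrow> real \<Rightarrow> 'a" and M :: real and p0 :: 'a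
  assumes op: "open \<Omega>" and bd: "bounded \<Omega>" and thin: "thin_strip (frontier \<Omega>)" and p0: "p0 \<in> frontier \<Omega>"
    and ub: "\<And>x t. t > 0 \<Longrightarrow> \<bar>u x t\<bar> \<le> M"
    and uc: "continuous_on (UNIV \<times> {0<..}) (\<lambda>(x,t). u x t)"
    and wg: "weak_space_gradient u g"
    and fr: "\<And>x t. x \<in> frontier \<Omega> \<Longrightarrow> t > 0 \<Longrightarrow> u x t = u p0 t"
begin

definition "pos_time = (UNIV \<times> {0<..} :: ('a \<times> real) set)"
text \<open>Values at \<open>t \<le> 0\<close> are arbitrary in the hypotheses; the following versions vanish there.\<close>

definition "u1 z = indicator pos_time z * u (fst z) (snd z)"
definition "a1 t = indicator {0<..} t * u p0 t"
definition "g1 z = indicator pos_time z *\<^sub>R g (fst z) (snd z)"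

lemma pos_time_borel[measurable]: "pos_time \<in> sets borel"
  unfolding pos_time_def by (auto intro!: open_Times borel_open)

lemma M_nonneg: "M \<ge> 0" using ub[of 1 p0] by linarith

lemma u1_meas[measurable]: "u1 \<in> borel_measurable borel"
proof -
  have "(\<lambda>z. indicator pos_time z *\<^sub>R (case z of (x, t) \<Rightarrow> u x t)) \<in> borel_measurable borel"
    by (rule borel_measurable_continuous_on_indicator) (use uc in \<open>simp_all add: pos_time_def[symmetric] pos_time_borel\<close>)
  then show ?thesis by (simp add: u1_def[abs_def] case_prod_unfold)
qed

lemma u1_bound: "\<bar>u1 z\<bar> \<le> M" using ub M_nonneg by (auto simp: u1_def pos_time_def indicator_def)

lemma a1_meas[measurable]: "a1 \<in> borel_measurable borel"
proof -
  have "continuous_on {0<..} (\<lambda>t. case (p0, t) of (x, t) \<Rightarrow> u x t)"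
    by (rule continuous_on_compose2[OF uc]) (auto intro!: continuous_intros)
  then have "(\<lambda>t. indicator {0<..} t *\<^sub>R u p0 t) \<in> borel_measurable borel"
    by (intro borel_measurable_continuous_on_indicator) auto
  then show ?thesis by (simp add: a1_def[abs_def])
qed

lemma a1_bound: "\<bar>a1 t\<bar> \<le> M" using ub M_nonneg by (auto simp: a1_def indicator_def)

lemma g1_meas[measurable]: "g1 \<in> borel_measurable borel"
  using wg unfolding weak_space_gradient_def set_borel_measurable_def by (simp add: g1_def[abs_def] pos_time_def case_prod_unfold)

lemma g1_sq: "T > 0 \<Longrightarrow> integrable lborel (\<lambda>z. indicator (UNIV \<times> {0<..<T}) z * (norm (g1 z))\<^sup>2)"
proof -
  assume "T > 0"
  then have "integrable lborel (\<lambda>z. indicator (UNIV \<times> {0<..<T}) z *\<^sub>R (case z of (x,t) \<Rightarrow> (norm (g x t))\<^sup>2))"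
    using wg unfolding weak_space_gradient_def set_integrable_def by blast
  moreover have "(\<lambda>z. indicator (UNIV \<times> {0<..<T}) z *\<^sub>R (case z of (x,t) \<Rightarrow> (norm (g x t))\<^sup>2)) =
      (\<lambda>z. indicator (UNIV \<times> {0<..<T}) z * (norm (g1 z))\<^sup>2)"
    by (auto simp: fun_eq_iff indicator_def g1_def pos_time_def)
  ultimately show ?thesis by simp
qed

lemma box_bounded: "bounded (cball (0::'a) R \<times> {l..T::real})" "cball (0::'a) R \<times> {l..T::real} \<in> sets borel"
  by (auto intro!: bounded_Times borel_closed closed_Times)

text \<open>The gradient is only known to be square integrable; |g| <= |g|^2 + 1 suffices on the
  bounded part of positive time where h may be nonzero.\<close>

lemma g1_integrable:
  assumes h: "h \<in> borel_measurable borel" and B: "\<And>z. \<bar>h z\<bar> \<le> B" and R: "\<And>z. h z \<noteq> 0 \<Longrightarrow> norm (fst z) \<le> R \<and> snd z \<le> T"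
  shows "integrable lborel (\<lambda>z. (g1 z \<bullet> v) * h z)"
proof (rule Bochner_Integration.integrable_bound)
  \<comment> \<open>Square integrability is given on intervals 0 < t < T' with T' > 0, so T is
    replaced by a larger positive number.\<close>
  have "T < max 1 (T + 1)" and p: "max 1 (T + 1) > 0" by auto
  have B0: "B \<ge> 0" using order_trans[OF abs_ge_zero B[of undefined]] .
  let ?w = "\<lambda>z. B * norm v * (indicator (UNIV \<times> {0<..<max 1 (T + 1)}) z * (norm (g1 z))\<^sup>2 + indicator (cball 0 R \<times> {0..T}) z)"
  have "integrable lborel (\<lambda>z. indicator (cball (0::'a) R \<times> {0..T}) z :: real)"
    using box_bounded[of R 0 T] emeasure_bounded_finite[OF box_bounded(1), of R 0 T] by (simp add: integrable_indicator_iff)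
  then show "integrable lborel ?w" using g1_sq[OF p] by (intro integrable_mult_right Bochner_Integration.integrable_add)
  show "AE z in lborel. norm ((g1 z \<bullet> v) * h z) \<le> norm (?w z)"
  proof (rule AE_I2)
    fix z :: "'a \<times> real"
    show "norm ((g1 z \<bullet> v) * h z) \<le> norm (?w z)"
    proof (cases "h z = 0 \<or> z \<notin> pos_time")
      case True then show ?thesis by (auto simp: g1_def)
    next
      case False
      then have z: "norm (fst z) \<le> R" "snd z \<le> T" "snd z > 0" using R[of z] by (auto simp: pos_time_def)
      have "norm (g1 z) \<le> (norm (g1 z))\<^sup>2 + 1"
        using zero_le_power2[of "norm (g1 z) - 1"] by (simp add: power2_diff) (smt (verit) zero_le_power2)
      then have "norm (g1 z) * norm v \<le> ((norm (g1 z))\<^sup>2 + 1) * norm v" by (rule mult_right_mono) simp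
      then have "\<bar>g1 z \<bullet> v\<bar> \<le> ((norm (g1 z))\<^sup>2 + 1) * norm v" using Cauchy_Schwarz_ineq2[of "g1 z" v] by linarith
      then have "\<bar>g1 z \<bullet> v\<bar> * \<bar>h z\<bar> \<le> ((norm (g1 z))\<^sup>2 + 1) * norm v * B" using B[of z] by (intro mult_mono) auto
      moreover have "?w z = B * norm v * ((norm (g1 z))\<^sup>2 + 1)" using z by (cases z) (auto simp: indicator_def)
      moreover have "((norm (g1 z))\<^sup>2 + 1) * norm v * B = B * norm v * ((norm (g1 z))\<^sup>2 + 1)" by (simp only: mult_ac)
      moreover have "norm ((g1 z \<bullet> v) * h z) = \<bar>g1 z \<bullet> v\<bar> * \<bar>h z\<bar>" by (simp only: real_norm_def abs_mult)
      moreover have "?w z \<le> norm (?w z)" by (simp only: real_norm_def abs_ge_self)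
      ultimately show ?thesis by linarith
    qed
  qed
qed (use h in measurable)

lemma bdd_integrable:
  fixes C B l T :: real and k h :: "'a \<times> real \<Rightarrow> real"
  assumes k: "k \<in> borel_measurable borel" "\<And>z. \<bar>k z\<bar> \<le> C" and h: "h \<in> borel_measurable borel" and B: "\<And>z. \<bar>h z\<bar> \<le> B"
    and R: "\<And>z. h z \<noteq> 0 \<Longrightarrow> norm (fst z) \<le> R \<and> l \<le> snd z \<and> snd z \<le> T"
  shows "integrable lborel (\<lambda>z::'a \<times> real. k z * h z)"
proof (rule integrable_of_bounded_support[OF _ _ box_bounded, of _ "C * B" R l T])
  have "C \<ge> 0" using order_trans[OF abs_ge_zero k(2)[of undefined]] .
  then show "\<bar>k z * h z\<bar> \<le> C * B" for z using k(2)[of z] B[of z] unfolding abs_mult by (intro mult_mono) auto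
  show "k z * h z = 0" if "z \<notin> cball 0 R \<times> {l..T}" for z using R[of z] that by (cases z) auto
qed (use k h in measurable)

lemma weak_gradient_test:
  assumes \<psi>: "test_elem \<psi>" and \<theta>: "elementary \<theta>" and \<delta>: "\<delta> > 0" and s: "\<And>t. \<theta> t \<noteq> 0 \<Longrightarrow> \<delta> \<le> t \<and> t \<le> T"
  shows "(LINT z|lborel. u1 z * (dirderiv v \<psi> (fst z) * \<theta> (snd z))) = - (LINT z|lborel. (g1 z \<bullet> v) * (\<psi> (fst z) * \<theta> (snd z)))"
proof -
  let ?\<Phi> = "\<lambda>z::'a \<times> real. \<psi> (fst z) * \<theta> (snd z)"
  have e: "elementary \<psi>" using test_elemD[OF \<psi>] .
  obtain R where R: "\<forall>z. norm z > R \<longrightarrow> \<psi> z = 0" using \<psi> by (auto simp: test_elem_def)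
  have "test_fun_on (UNIV \<times> {0<..}) ?\<Phi>"
  proof (rule test_elem_test_fun[OF elementary_prod[OF e \<theta>], of "cball 0 R \<times> {\<delta>..T}"])
    show "compact (cball (0::'a) R \<times> {\<delta>..T})" by (intro compact_Times) auto
    show "cball (0::'a) R \<times> {\<delta>..T} \<subseteq> UNIV \<times> {0<..}" using \<delta> by auto
    fix z :: "'a \<times> real" assume z: "z \<notin> cball 0 R \<times> {\<delta>..T}"
    show "?\<Phi> z = 0" using z R s[of "snd z"] by (cases z) (auto simp: not_le)
  qed
  then have "(LINT z:UNIV \<times> {0<..}|lborel. u (fst z) (snd z) * frechet_derivative ?\<Phi> (at z) (v, 0))
        = - (LINT z:UNIV \<times> {0<..}|lborel. (g (fst z) (snd z) \<bullet> v) * ?\<Phi> z)"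
    using wg unfolding weak_space_gradient_def by blast
  then show ?thesis
    unfolding set_lebesgue_integral_def frechet_prod_test[OF e \<theta>] dirderiv_zero[OF \<theta>]
    by (simp add: u1_def g1_def pos_time_def mult.assoc)
qed

end

lemma snd_borel: "(snd :: 'a::euclidean_space \<times> real \<Rightarrow> real) \<in> borel_measurable borel"
  by (intro borel_measurable_continuous_onI continuous_on_snd continuous_on_id)

lemma fst_borel: "(fst :: 'a::euclidean_space \<times> real \<Rightarrow> 'a) \<in> borel_measurable borel"
  by (intro borel_measurable_continuous_onI continuous_on_fst continuous_on_id)

lemma prod_meas:
  fixes p :: "'a::euclidean_space \<Rightarrow> real" and q :: "real \<Rightarrow> real"
  assumes "p \<in> borel_measurable borel" "q \<in> borel_measurable borel"
  shows "(\<lambda>z. p (fst z) * q (snd z)) \<in> borel_measurable borel"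
  by (intro borel_measurable_times measurable_compose[OF fst_borel assms(1)] measurable_compose[OF snd_borel assms(2)])

lemma prod_support:
  fixes p :: "'a::euclidean_space \<Rightarrow> real" and \<theta> :: "real \<Rightarrow> real"
  assumes "\<forall>z. norm z > R \<longrightarrow> p z = 0" "\<forall>t. \<theta> t \<noteq> 0 \<longrightarrow> \<delta> \<le> t \<and> t \<le> T" "p (fst z) * \<theta> (snd z) \<noteq> 0"
  shows "norm (fst z) \<le> R \<and> \<delta> \<le> snd z \<and> snd z \<le> T"
proof -
  have "p (fst z) \<noteq> 0" "\<theta> (snd z) \<noteq> 0" using assms(3) by auto
  then show ?thesis using assms(1,2) not_le by blast
qed

context weak_solution
begin

lemma frontier_props: "bounded (frontier \<Omega>)" "closed (frontier \<Omega>)" "frontier \<Omega> \<noteq> {}"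
  using bounded_frontier[OF bd] p0 by auto

text \<open>Uniform continuity of u holds on compact time intervals inside t > 0; this is why the
  functions \<theta> are at first supported in [\<delta>, T].\<close>

lemma near_frontier_small:
  assumes \<delta>: "\<delta> > 0" and \<omega>: "\<omega> > 0"
  shows "\<exists>\<epsilon>0>0. \<forall>x t. infdist x (frontier \<Omega>) \<le> \<epsilon>0 \<longrightarrow> \<delta> \<le> t \<longrightarrow> t \<le> T \<longrightarrow> \<bar>u x t - u p0 t\<bar> \<le> \<omega>"
proof -
  let ?F = "frontier \<Omega>"
  let ?K = "{x. infdist x ?F \<le> 1} \<times> {\<delta>..T}"
  have "closed {x. infdist x ?F \<le> 1}" by (intro closed_Collect_le continuous_intros)
  then have "compact {x. infdist x ?F \<le> 1}" using infdist_bounded[OF frontier_props] by (simp add: compact_eq_bounded_closed)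
  then have K: "compact ?K" by (intro compact_Times) auto
  have "continuous_on ?K (\<lambda>(x, t). u x t)" by (rule continuous_on_subset[OF uc]) (use \<delta> in auto)
  then have "uniformly_continuous_on ?K (\<lambda>(x, t). u x t)" by (rule compact_uniformly_continuous[OF _ K])
  then obtain d where d: "d > 0" "\<And>z z'. z \<in> ?K \<Longrightarrow> z' \<in> ?K \<Longrightarrow> dist z' z < d \<Longrightarrow> dist (case z' of (x, t) \<Rightarrow> u x t) (case z of (x, t) \<Rightarrow> u x t) < \<omega>"
    unfolding uniformly_continuous_on_def using \<omega> by metis
  show ?thesis
  proof (rule exI[of _ "min 1 (d / 2)"], rule conjI[rotated], intro allI impI)
    fix x t assume x: "infdist x ?F \<le> min 1 (d / 2)" and t: "\<delta> \<le> t" "t \<le> T"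
    obtain y where y: "y \<in> ?F" "infdist x ?F = dist x y" using infdist_attains_inf[OF frontier_props(2,3)] by blast
    have "(x, t) \<in> ?K" using x t by auto
    moreover have "(y, t) \<in> ?K" using y t by auto
    moreover have "dist (x, t) (y, t) < d" using x y d by (simp add: dist_Pair_Pair)
    ultimately have "dist (u x t) (u y t) < \<omega>" using d(2)[of "(y, t)" "(x, t)"] by simp
    then show "\<bar>u x t - u p0 t\<bar> \<le> \<omega>" using fr[OF y(1), of t] t \<delta> by (simp add: dist_real_def)
  qed (use d in simp)
qed

text \<open>The mollified indicator is not an elementary function. Hence \<open>\<psi>(x) bump((x - y) / \<epsilon>)\<close> is used as test function for
  each \<open>y\<close>, and the resulting identities are averaged over \<open>y \<in> \<Omega>\<close>.\<close>

lemma mollified_identity: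
  assumes \<psi>: "test_elem \<psi>" and \<theta>: "elementary \<theta>" and \<delta>: "\<delta> > 0" and s: "\<And>t. \<theta> t \<noteq> 0 \<Longrightarrow> \<delta> \<le> t \<and> t \<le> T"
    and \<epsilon>: "\<epsilon> > 0"
  shows "(LINT z|lborel. (u1 z - a1 (snd z)) * (\<psi> (fst z) * \<theta> (snd z)) * moll_d \<Omega> \<epsilon> v (fst z)) +
      (LINT z|lborel. (u1 z - a1 (snd z)) * (dirderiv v \<psi> (fst z) * \<theta> (snd z)) * moll \<Omega> \<epsilon> (fst z)) =
      - (LINT z|lborel. (g1 z \<bullet> v) * (\<psi> (fst z) * \<theta> (snd z)) * moll \<Omega> \<epsilon> (fst z))"
proof -
  have e: "elementary \<psi>" using test_elemD[OF \<psi>] .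
  obtain R where R: "\<forall>z. norm z > R \<longrightarrow> \<psi> z = 0" using \<psi> by (auto simp: test_elem_def)
  obtain R' where R': "\<forall>z. norm z > R' \<longrightarrow> dirderiv v \<psi> z = 0" using test_elem_dirderiv[OF \<psi>, of v] by (auto simp: test_elem_def)
  obtain B\<psi> where B\<psi>: "B\<psi> > 0" "\<And>z. \<bar>\<psi> z\<bar> \<le> B\<psi>" using test_elem_bounded[OF \<psi>] by blast
  obtain Bd where Bd: "Bd > 0" "\<And>z. \<bar>dirderiv v \<psi> z\<bar> \<le> Bd" using test_elem_bounded[OF test_elem_dirderiv[OF \<psi>]] by blast
  have sS: "\<forall>t. \<theta> t \<noteq> 0 \<longrightarrow> \<delta> \<le> t \<and> t \<le> T" using s by blast
  obtain B\<theta> where B\<theta>: "B\<theta> > 0" "\<And>t. \<bar>\<theta> t\<bar> \<le> B\<theta>" using bounded_on_interval[OF elementary_continuous[OF \<theta>] s] by blast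
  have ms[measurable]: "\<psi> \<in> borel_measurable borel" "dirderiv v \<psi> \<in> borel_measurable borel" "\<theta> \<in> borel_measurable borel"
    using e \<theta> by (auto intro!: test_elem_measurable elementary_dirderiv)
  \<comment> \<open>The rescaled bump centred at y and, in \<open>q1\<close>, its derivative in
    direction v, both read as functions on space-time.\<close>
  define q2 where "q2 y z = bump ((1 / \<epsilon>) *\<^sub>R (fst z - y))" for y :: 'a and z :: "'a \<times> real"
  define q1 where "q1 y z = 1 / \<epsilon> * dirderiv v bump ((1 / \<epsilon>) *\<^sub>R (fst z - y))" for y :: 'a and z :: "'a \<times> real"
  obtain B2 where B2: "B2 > 0" "\<And>z::'a. \<bar>bump z\<bar> \<le> B2" using test_elem_bounded[OF bump_test] by blast
  obtain B1 where B1: "B1 > 0" "\<And>z::'a. \<bar>dirderiv v bump z\<bar> \<le> B1" using test_elem_bounded[OF test_elem_dirderiv[OF bump_test]] by blast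
  have eb: "elementary (bump :: 'a \<Rightarrow> real)" using test_elemD[OF bump_test] .
  define c where "c z = u1 z - a1 (snd z)" for z
  have c: "c \<in> borel_measurable borel" "\<bar>c z\<bar> \<le> 2 * M" for z
  proof -
    show "c \<in> borel_measurable borel" unfolding c_def[abs_def]
      by (intro borel_measurable_diff u1_meas measurable_compose[OF snd_borel a1_meas])
    show "\<bar>c z\<bar> \<le> 2 * M" using u1_bound[of z] a1_bound[of "snd z"] unfolding c_def by linarith
  qed
  have bound_prod: "\<bar>p (fst z) * \<theta> (snd z)\<bar> \<le> B * B\<theta>" if "\<And>x. \<bar>p x\<bar> \<le> B" for p :: "'a \<Rightarrow> real" and B and z :: "'a \<times> real"
    unfolding abs_mult using that[of "fst z"] B\<theta>(2)[of "snd z"] order_trans[OF abs_ge_zero that[of "fst z"]] by (intro mult_mono) auto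
  have w1: "integrable lborel (\<lambda>z. c z * (\<psi> (fst z) * \<theta> (snd z)))"
    by (rule bdd_integrable[OF c prod_meas[OF ms(1,3)]], rule bound_prod[OF B\<psi>(2)], erule prod_support[OF R sS])
  have w2: "integrable lborel (\<lambda>z. c z * (dirderiv v \<psi> (fst z) * \<theta> (snd z)))"
    by (rule bdd_integrable[OF c prod_meas[OF ms(2,3)]], rule bound_prod[OF Bd(2)], erule prod_support[OF R' sS])
  have w3: "integrable lborel (\<lambda>z. (g1 z \<bullet> v) * (\<psi> (fst z) * \<theta> (snd z)))"
    by (rule g1_integrable[OF prod_meas[OF ms(1,3)]], rule bound_prod[OF B\<psi>(2)], drule prod_support[OF R sS], blast)
  have sm: "(\<lambda>p::'a \<times> ('a \<times> real). (1 / \<epsilon>) *\<^sub>R (fst (snd p) - fst p)) \<in> borel \<Otimes>\<^sub>M borel \<rightarrow>\<^sub>M borel"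
    unfolding borel_prod by (intro borel_measurable_continuous_onI continuous_intros)
  have q2: "(\<lambda>(y, z). q2 y z) \<in> borel_measurable (borel \<Otimes>\<^sub>M borel)" "\<bar>q2 y z\<bar> \<le> B2" for y z
    unfolding q2_def case_prod_unfold by (rule measurable_compose[OF sm bump_meas(1)]) (rule B2(2))
  have q1: "(\<lambda>(y, z). q1 y z) \<in> borel_measurable (borel \<Otimes>\<^sub>M borel)" "\<bar>q1 y z\<bar> \<le> 1 / \<epsilon> * B1" for y z
  proof -
    show "(\<lambda>(y, z). q1 y z) \<in> borel_measurable (borel \<Otimes>\<^sub>M borel)" unfolding q1_def case_prod_unfold
      by (intro borel_measurable_times borel_measurable_const measurable_compose[OF sm bump_meas(2)])
    show "\<bar>q1 y z\<bar> \<le> 1 / \<epsilon> * B1" unfolding q1_def abs_mult using \<epsilon> B1 by (intro mult_mono) auto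
  qed
  have I: "integrable lborel (\<lambda>z. w z * q y z)" if "integrable lborel w" "(\<lambda>(y, z). q y z) \<in> borel_measurable (borel \<Otimes>\<^sub>M borel)" "\<And>y z. \<bar>q y z\<bar> \<le> B"
    for w :: "'a \<times> real \<Rightarrow> real" and q and y :: 'a and B
  proof (rule Bochner_Integration.integrable_bound)
    show "integrable lborel (\<lambda>z. B * \<bar>w z\<bar>)" using that(1) by simp
    have [measurable]: "w \<in> borel_measurable borel" using that(1) by (auto dest: borel_measurable_integrable)
    have "(\<lambda>z. case (y, z) of (y, z) \<Rightarrow> q y z) \<in> borel_measurable borel"
      by (rule measurable_compose[OF measurable_Pair1' that(2)]) simp
    then have [measurable]: "q y \<in> borel_measurable borel" by simp
    show "(\<lambda>z. w z * q y z) \<in> borel_measurable lborel" by measurable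
    have "B \<ge> 0" using order_trans[OF abs_ge_zero that(3)] .
    then show "AE z in lborel. norm (w z * q y z) \<le> norm (B * \<bar>w z\<bar>)"
      using that(3)[of y] by (intro AE_I2) (auto simp: abs_mult mult.commute[of B] intro: mult_left_mono)
  qed
  have pt: "(LINT z|lborel. c z * (\<psi> (fst z) * \<theta> (snd z)) * q1 y z) + (LINT z|lborel. c z * (dirderiv v \<psi> (fst z) * \<theta> (snd z)) * q2 y z)
     = - (LINT z|lborel. (g1 z \<bullet> v) * (\<psi> (fst z) * \<theta> (snd z)) * q2 y z)" for y
  proof -
    define \<psi>y where "\<psi>y x = \<psi> x * bump ((1 / \<epsilon>) *\<^sub>R (x - y))" for x
    have ey: "elementary (\<lambda>x. bump ((1 / \<epsilon>) *\<^sub>R (x - y)))" by (rule elementary_translate[OF eb])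
    have ty: "test_elem \<psi>y" unfolding \<psi>y_def[abs_def] by (rule test_elem_mult(1)[OF \<psi> ey])
    have dy: "dirderiv v \<psi>y x = \<psi> x * (1 / \<epsilon> * dirderiv v bump ((1 / \<epsilon>) *\<^sub>R (x - y))) + dirderiv v \<psi> x * bump ((1 / \<epsilon>) *\<^sub>R (x - y))" for x
      unfolding \<psi>y_def[abs_def] dirderiv_mult[OF e ey] dirderiv_scaled[OF eb] ..
    obtain Ry where Ry: "\<forall>z. norm z > Ry \<longrightarrow> dirderiv v \<psi>y z = 0" using test_elem_dirderiv[OF ty, of v] by (auto simp: test_elem_def)
    obtain By where By: "By > 0" "\<And>z. \<bar>dirderiv v \<psi>y z\<bar> \<le> By" using test_elem_bounded[OF test_elem_dirderiv[OF ty]] by blast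
    have my[measurable]: "dirderiv v \<psi>y \<in> borel_measurable borel" using test_elemD[OF ty] by (auto intro!: test_elem_measurable elementary_dirderiv)
    have ia: "integrable lborel (\<lambda>t. a1 t * \<theta> t)"
    proof (rule integrable_of_bounded_support[where K="{\<delta>..T}" and B="M * B\<theta>"])
      show "\<bar>a1 t * \<theta> t\<bar> \<le> M * B\<theta>" for t unfolding abs_mult using a1_bound B\<theta> M_nonneg by (intro mult_mono) auto
      show "a1 t * \<theta> t = 0" if "t \<notin> {\<delta>..T}" for t using s[of t] that by auto
    qed (auto, measurable)
    \<comment> \<open>The function a depends on time alone, so subtracting it from u does not change
      integrals against a spatial derivative.\<close>
    have az: "(LINT z|lborel. dirderiv v \<psi>y (fst z) * (a1 (snd z) * \<theta> (snd z))) = 0"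
      using lborel_integral_prod[OF test_elem_integrable[OF test_elem_dirderiv[OF ty]] ia, of v] test_elem_integral_dirderiv[OF ty, of v] by simp
    have iz: "integrable lborel (\<lambda>z. dirderiv v \<psi>y (fst z) * (a1 (snd z) * \<theta> (snd z)))"
      by (rule lborel_integrable_prod[OF test_elem_integrable[OF test_elem_dirderiv[OF ty]] ia])
    have iu: "integrable lborel (\<lambda>z. u1 z * (dirderiv v \<psi>y (fst z) * \<theta> (snd z)))"
      by (rule bdd_integrable[OF u1_meas u1_bound prod_meas[OF my ms(3)]], rule bound_prod[OF By(2)], erule prod_support[OF Ry sS])
    have "(LINT z|lborel. c z * (\<psi> (fst z) * \<theta> (snd z)) * q1 y z) + (LINT z|lborel. c z * (dirderiv v \<psi> (fst z) * \<theta> (snd z)) * q2 y z) =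
      (LINT z|lborel. c z * (\<psi> (fst z) * \<theta> (snd z)) * q1 y z + c z * (dirderiv v \<psi> (fst z) * \<theta> (snd z)) * q2 y z)"
      by (rule Bochner_Integration.integral_add[OF I[OF w1 q1] I[OF w2 q2], symmetric])
    also have "\<dots> = (LINT z|lborel. u1 z * (dirderiv v \<psi>y (fst z) * \<theta> (snd z)) - dirderiv v \<psi>y (fst z) * (a1 (snd z) * \<theta> (snd z)))"
      by (rule Bochner_Integration.integral_cong[OF refl]) (simp add: dy q1_def q2_def c_def algebra_simps)
    also have "\<dots> = (LINT z|lborel. u1 z * (dirderiv v \<psi>y (fst z) * \<theta> (snd z)))"
      by (subst Bochner_Integration.integral_diff[OF iu iz]) (simp add: az)
    also have "\<dots> = - (LINT z|lborel. (g1 z \<bullet> v) * (\<psi>y (fst z) * \<theta> (snd z)))"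
      by (rule weak_gradient_test[OF ty \<theta> \<delta> s])
    also have "\<dots> = - (LINT z|lborel. (g1 z \<bullet> v) * (\<psi> (fst z) * \<theta> (snd z)) * q2 y z)"
      by (simp add: \<psi>y_def q2_def mult_ac)
    finally show ?thesis .
  qed
  have ob: "\<Omega> \<in> sets borel" using op by simp
  let ?i = "\<lambda>y. indicator \<Omega> y :: real"
  have "(LINT y|lborel. ?i y * (LINT z|lborel. c z * (\<psi> (fst z) * \<theta> (snd z)) * q1 y z)) + (LINT y|lborel. ?i y * (LINT z|lborel. c z * (dirderiv v \<psi> (fst z) * \<theta> (snd z)) * q2 y z))
    = (LINT y|lborel. ?i y * (LINT z|lborel. c z * (\<psi> (fst z) * \<theta> (snd z)) * q1 y z) + ?i y * (LINT z|lborel. c z * (dirderiv v \<psi> (fst z) * \<theta> (snd z)) * q2 y z))"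
    by (rule Bochner_Integration.integral_add[OF lborel_integral_average(3)[OF ob bd w1 q1] lborel_integral_average(3)[OF ob bd w2 q2], symmetric])
  also have "\<dots> = (LINT y|lborel. - (?i y * (LINT z|lborel. (g1 z \<bullet> v) * (\<psi> (fst z) * \<theta> (snd z)) * q2 y z)))"
    unfolding distrib_left[symmetric] pt by simp
  also have "\<dots> = - (LINT y|lborel. ?i y * (LINT z|lborel. (g1 z \<bullet> v) * (\<psi> (fst z) * \<theta> (snd z)) * q2 y z))" by simp
  finally have A: "(LINT z|lborel. c z * (\<psi> (fst z) * \<theta> (snd z)) * (LINT y|lborel. ?i y * q1 y z)) + (LINT z|lborel. c z * (dirderiv v \<psi> (fst z) * \<theta> (snd z)) * (LINT y|lborel. ?i y * q2 y z))
    = - (LINT z|lborel. (g1 z \<bullet> v) * (\<psi> (fst z) * \<theta> (snd z)) * (LINT y|lborel. ?i y * q2 y z))"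
    unfolding lborel_integral_average(1)[OF ob bd w1 q1] lborel_integral_average(1)[OF ob bd w2 q2] lborel_integral_average(1)[OF ob bd w3 q2] .
  define m where "m = mcoef TYPE('a) \<epsilon>"
  have m2: "moll \<Omega> \<epsilon> (fst z) = m * (LINT y|lborel. ?i y * q2 y z)" for z :: "'a \<times> real"
    by (simp add: moll_def[OF op bd \<epsilon>] q2_def m_def)
  have m1: "moll_d \<Omega> \<epsilon> v (fst z) = m * (LINT y|lborel. ?i y * q1 y z)" for z :: "'a \<times> real"
    by (simp add: moll_d_def[OF op bd \<epsilon>] q1_def m_def)
  have pull: "(LINT z|lborel. w z * (m * J z)) = m * (LINT z|lborel. w z * J z)" for w J :: "'a \<times> real \<Rightarrow> real"
    by (simp add: mult.left_commute[of _ m])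
  show ?thesis unfolding m1 m2 pull c_def[symmetric] using arg_cong[OF A, of "\<lambda>r. m * r"] by (simp add: distrib_left)
qed

lemma frontier_product_null: "AE z in lborel. fst (z :: 'a \<times> real) \<notin> frontier \<Omega>"
proof -
  have n: "frontier \<Omega> \<in> null_sets lborel" by (rule thin_strip_null[OF frontier_props thin])
  have "emeasure (lborel \<Otimes>\<^sub>M lborel) (frontier \<Omega> \<times> (UNIV :: real set)) = emeasure lborel (frontier \<Omega>) * emeasure lborel (UNIV :: real set)"
    by (rule lborel.emeasure_pair_measure_Times) (use n in auto)
  then have "frontier \<Omega> \<times> (UNIV :: real set) \<in> null_sets lborel"
    using n by (auto simp: null_sets_def lborel_prod borel_closed closed_Times)
  from AE_not_in[OF this] show ?thesis by eventually_elim (auto simp: mem_Times_iff)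
qed

text \<open>The boundary term tends to 0 because \<open>u - a\<close> is small on the \<open>\<epsilon>\<close>-strip, whose measure is \<open>O(\<epsilon>)\<close>, while the
  gradient of the mollified indicator is \<open>O(1 / \<epsilon>)\<close>.\<close>

lemma interface_gradient:
  assumes \<psi>: "test_elem \<psi>" and \<theta>: "elementary \<theta>" and \<delta>: "\<delta> > 0" and s: "\<And>t. \<theta> t \<noteq> 0 \<Longrightarrow> \<delta> \<le> t \<and> t \<le> T"
  shows "(LINT z|lborel. (g1 z \<bullet> v) * (\<psi> (fst z) * \<theta> (snd z)) * indicator \<Omega> (fst z)) =
     - (LINT z|lborel. (u1 z - a1 (snd z)) * (dirderiv v \<psi> (fst z) * \<theta> (snd z)) * indicator \<Omega> (fst z))"
proof -
  have e: "elementary \<psi>" using test_elemD[OF \<psi>] .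
  obtain R where R: "\<forall>z. norm z > R \<longrightarrow> \<psi> z = 0" using \<psi> by (auto simp: test_elem_def)
  obtain R' where R': "\<forall>z. norm z > R' \<longrightarrow> dirderiv v \<psi> z = 0" using test_elem_dirderiv[OF \<psi>, of v] by (auto simp: test_elem_def)
  obtain B\<psi> where B\<psi>: "B\<psi> > 0" "\<And>z. \<bar>\<psi> z\<bar> \<le> B\<psi>" using test_elem_bounded[OF \<psi>] by blast
  obtain Bd where Bd: "Bd > 0" "\<And>z. \<bar>dirderiv v \<psi> z\<bar> \<le> Bd" using test_elem_bounded[OF test_elem_dirderiv[OF \<psi>]] by blast
  have sS: "\<forall>t. \<theta> t \<noteq> 0 \<longrightarrow> \<delta> \<le> t \<and> t \<le> T" using s by blast
  obtain B\<theta> where B\<theta>: "B\<theta> > 0" "\<And>t. \<bar>\<theta> t\<bar> \<le> B\<theta>" using bounded_on_interval[OF elementary_continuous[OF \<theta>] s] by blast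
  have ms[measurable]: "\<psi> \<in> borel_measurable borel" "dirderiv v \<psi> \<in> borel_measurable borel" "\<theta> \<in> borel_measurable borel"
    using e \<theta> by (auto intro!: test_elem_measurable elementary_dirderiv)
  have [measurable]: "\<Omega> \<in> sets borel" using op by simp
  define c where "c z = u1 z - a1 (snd z)" for z
  have c: "c \<in> borel_measurable borel" "\<bar>c z\<bar> \<le> 2 * M" for z
  proof -
    show "c \<in> borel_measurable borel" unfolding c_def[abs_def]
      by (intro borel_measurable_diff u1_meas measurable_compose[OF snd_borel a1_meas])
    show "\<bar>c z\<bar> \<le> 2 * M" using u1_bound[of z] a1_bound[of "snd z"] unfolding c_def by linarith
  qed
  note [measurable] = c(1)
  have bound_prod: "\<bar>p (fst z) * \<theta> (snd z)\<bar> \<le> B * B\<theta>" if "\<And>x. \<bar>p x\<bar> \<le> B" for p :: "'a \<Rightarrow> real" and B and z :: "'a \<times> real"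
    unfolding abs_mult using that[of "fst z"] B\<theta>(2)[of "snd z"] order_trans[OF abs_ge_zero that[of "fst z"]] by (intro mult_mono) auto
  have w2: "integrable lborel (\<lambda>z. c z * (dirderiv v \<psi> (fst z) * \<theta> (snd z)))"
    by (rule bdd_integrable[OF c prod_meas[OF ms(2,3)]], rule bound_prod[OF Bd(2)], erule prod_support[OF R' sS])
  have w3: "integrable lborel (\<lambda>z. (g1 z \<bullet> v) * (\<psi> (fst z) * \<theta> (snd z)))"
    by (rule g1_integrable[OF prod_meas[OF ms(1,3)]], rule bound_prod[OF B\<psi>(2)], drule prod_support[OF R sS], blast)
  define \<epsilon> where "\<epsilon> n = 1 / real (Suc n)" for n
  have \<epsilon>0: "\<epsilon> n > 0" for n by (simp add: \<epsilon>_def)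
  have \<epsilon>lim: "\<epsilon> \<longlonglongrightarrow> 0" unfolding \<epsilon>_def using LIMSEQ_inverse_real_of_nat by (simp add: inverse_eq_divide)
  have mm[measurable]: "moll \<Omega> (\<epsilon> n) \<in> borel_measurable borel" "moll_d \<Omega> (\<epsilon> n) v \<in> borel_measurable borel" for n
    using moll_meas[OF op bd \<epsilon>0] by auto
  have mlim: "AE z in lborel. (\<lambda>n. moll \<Omega> (\<epsilon> n) (fst (z :: 'a \<times> real))) \<longlonglongrightarrow> indicator \<Omega> (fst z)"
    using frontier_product_null
  proof eventually_elim
    case (elim z)
    have "infdist (fst z) (frontier \<Omega>) > 0"
      using elim frontier_props infdist_pos_not_in_closed by blast
    then have "\<forall>\<^sub>F n in sequentially. \<epsilon> n < infdist (fst z) (frontier \<Omega>)" using \<epsilon>lim by (simp add: order_tendstoD)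
    then have "\<forall>\<^sub>F n in sequentially. moll \<Omega> (\<epsilon> n) (fst z) = indicator \<Omega> (fst z)"
      by eventually_elim (rule moll_far(1)[OF op bd \<epsilon>0])
    then show ?case by (rule tendsto_eventually)
  qed
  have lim: "(\<lambda>n. LINT z|lborel. w z * moll \<Omega> (\<epsilon> n) (fst z)) \<longlonglongrightarrow> (LINT z|lborel. w z * indicator \<Omega> (fst z))"
    if w: "integrable lborel w" for w :: "'a \<times> real \<Rightarrow> real"
  proof (rule integral_dominated_convergence[where w="\<lambda>z. \<bar>w z\<bar>"])
    have [measurable]: "w \<in> borel_measurable borel" using w by (auto dest: borel_measurable_integrable)
    have "(\<lambda>z. w z * indicator \<Omega> (fst z)) \<in> borel_measurable borel"
      by (intro borel_measurable_times measurable_compose[OF fst_borel borel_measurable_indicator]) (use op in auto)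
    then show "(\<lambda>z. w z * indicator \<Omega> (fst z)) \<in> borel_measurable lborel" by simp
    have "(\<lambda>z. w z * moll \<Omega> (\<epsilon> n) (fst z)) \<in> borel_measurable borel" for n
      by (intro borel_measurable_times measurable_compose[OF fst_borel mm(1)]) auto
    then show "\<And>n. (\<lambda>z. w z * moll \<Omega> (\<epsilon> n) (fst z)) \<in> borel_measurable lborel" by simp
    show "AE z in lborel. (\<lambda>n. w z * moll \<Omega> (\<epsilon> n) (fst z)) \<longlonglongrightarrow> w z * indicator \<Omega> (fst z)"
      using mlim by eventually_elim (rule tendsto_mult_left)
    show "AE z in lborel. norm (w z * moll \<Omega> (\<epsilon> n) (fst z)) \<le> \<bar>w z\<bar>" for n
      using moll_bound[OF op bd \<epsilon>0, of n] by (intro AE_I2) (auto simp: abs_mult intro: mult_left_le)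
  qed (use w in simp)
  obtain C e0 where C: "C > 0" "e0 > 0" "\<And>\<epsilon>. 0 < \<epsilon> \<Longrightarrow> \<epsilon> \<le> e0 \<Longrightarrow> measure lborel {x. infdist x (frontier \<Omega>) \<le> \<epsilon>} \<le> C * \<epsilon>"
    using thin unfolding thin_strip_def by blast
  define C1 where "C1 = (LINT w::'a|lborel. \<bar>dirderiv v bump w\<bar>) / (LINT z::'a|lborel. bump z)"
  have C1: "C1 \<ge> 0" unfolding C1_def using bump_integral_pos[where 'a='a] by (intro divide_nonneg_pos) auto
  \<comment> \<open>The boundary term is at most \<omega> K: the bounds of \<psi> and \<theta>, the
    factor C1 / \<epsilon> of the mollified gradient, the volume C \<epsilon> of the strip and the
    length of the time interval; the powers of \<epsilon> cancel.\<close>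
  define K where "K = B\<psi> * B\<theta> * C1 * C * \<bar>T - \<delta>\<bar>"
  have K: "K \<ge> 0" unfolding K_def using B\<psi> B\<theta> C1 C by simp
  have term1: "(\<lambda>n. LINT z|lborel. c z * (\<psi> (fst z) * \<theta> (snd z)) * moll_d \<Omega> (\<epsilon> n) v (fst z)) \<longlonglongrightarrow> 0"
  proof (rule LIMSEQ_I)
    fix r :: real assume r: "r > 0"
    define \<omega> where "\<omega> = r / (2 * (K + 1))"
    have \<omega>: "\<omega> > 0" using r K by (simp add: \<omega>_def)
    obtain e1 where e1: "e1 > 0" "\<And>x t. infdist x (frontier \<Omega>) \<le> e1 \<Longrightarrow> \<delta> \<le> t \<Longrightarrow> t \<le> T \<Longrightarrow> \<bar>u x t - u p0 t\<bar> \<le> \<omega>"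
      using near_frontier_small[OF \<delta> \<omega>, of T] by blast
    have "\<forall>\<^sub>F n in sequentially. \<epsilon> n < min e0 e1" using \<epsilon>lim C(2) e1(1) by (intro order_tendstoD) auto
    then obtain N where N: "\<And>n. n \<ge> N \<Longrightarrow> \<epsilon> n < min e0 e1" unfolding eventually_sequentially by blast
    show "\<exists>no. \<forall>n\<ge>no. norm ((LINT z|lborel. c z * (\<psi> (fst z) * \<theta> (snd z)) * moll_d \<Omega> (\<epsilon> n) v (fst z)) - 0) < r"
    proof (intro exI[of _ N] allI impI)
      fix n assume "N \<le> n"
      then have en: "\<epsilon> n \<le> e0" "\<epsilon> n \<le> e1" using N[of n] by auto
      let ?S = "{x. infdist x (frontier \<Omega>) \<le> \<epsilon> n}"
      have S: "?S \<in> sets borel" "emeasure lborel ?S < \<infinity>"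
        using infdist_borel emeasure_bounded_finite[OF infdist_bounded[OF frontier_props]] by auto
      have iS: "integrable lborel (\<lambda>x. indicator ?S x :: real)" using S by (simp add: integrable_indicator_iff)
      have iT: "integrable lborel (\<lambda>t. indicator {\<delta>..T} t :: real)"
        using emeasure_bounded_finite[of "{\<delta>..T}"] by (simp add: integrable_indicator_iff)
      let ?k = "\<omega> * (B\<psi> * B\<theta>) * (C1 / \<epsilon> n)"
      have "\<bar>LINT z|lborel. c z * (\<psi> (fst z) * \<theta> (snd z)) * moll_d \<Omega> (\<epsilon> n) v (fst z)\<bar> \<le>
         (LINT z|lborel. \<bar>c z * (\<psi> (fst z) * \<theta> (snd z)) * moll_d \<Omega> (\<epsilon> n) v (fst z)\<bar>)" by (rule integral_abs_bound)
      also have "\<dots> \<le> (LINT z|lborel. ?k * (indicator ?S (fst z) * indicator {\<delta>..T} (snd z)))"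
      proof (rule integral_mono')
        show "integrable lborel (\<lambda>z. ?k * (indicator ?S (fst z) * indicator {\<delta>..T} (snd z)))"
          by (intro integrable_mult_right lborel_integrable_prod iS iT)
        fix z :: "'a \<times> real"
        have k0: "?k \<ge> 0" using \<omega> B\<psi> B\<theta> C1 \<epsilon>0[of n] by simp
        show nn: "0 \<le> ?k * (indicator ?S (fst z) * indicator {\<delta>..T} (snd z))" by (rule mult_nonneg_nonneg[OF k0]) auto
        show "\<bar>c z * (\<psi> (fst z) * \<theta> (snd z)) * moll_d \<Omega> (\<epsilon> n) v (fst z)\<bar> \<le> ?k * (indicator ?S (fst z) * indicator {\<delta>..T} (snd z))"
        proof (cases "\<theta> (snd z) = 0 \<or> infdist (fst z) (frontier \<Omega>) > \<epsilon> n")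
          case True
          then have "c z * (\<psi> (fst z) * \<theta> (snd z)) * moll_d \<Omega> (\<epsilon> n) v (fst z) = 0"
            using moll_far(2)[OF op bd \<epsilon>0[of n], of "fst z" v] by auto
          then show ?thesis using nn by (simp only: abs_zero)
        next
          case False
          then have t: "\<delta> \<le> snd z" "snd z \<le> T" and x: "infdist (fst z) (frontier \<Omega>) \<le> \<epsilon> n" using s[of "snd z"] by auto
          have "c z = u (fst z) (snd z) - u p0 (snd z)" using t \<delta> by (cases z) (auto simp: c_def u1_def a1_def pos_time_def)
          then have "\<bar>c z\<bar> \<le> \<omega>" using e1(2)[of "fst z" "snd z"] x en t by simp
          then have "\<bar>c z\<bar> * \<bar>\<psi> (fst z) * \<theta> (snd z)\<bar> * \<bar>moll_d \<Omega> (\<epsilon> n) v (fst z)\<bar> \<le> \<omega> * (B\<psi> * B\<theta>) * (C1 / \<epsilon> n)"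
            using bound_prod[OF B\<psi>(2), where z=z] moll_d_bound[OF op bd \<epsilon>0, of n v "fst z"] \<omega> B\<psi>(1) B\<theta>(1)
            by (intro mult_mono) (auto simp: C1_def)
          then show ?thesis using t x by (simp add: abs_mult)
        qed
      qed
      also have "\<dots> = ?k * (measure lborel ?S * measure lborel {\<delta>..T})"
        using lborel_integral_prod[OF iS iT] S by simp
      also have "\<dots> \<le> ?k * (C * \<epsilon> n * \<bar>T - \<delta>\<bar>)"
      proof -
        have "measure lborel {\<delta>..T} \<le> \<bar>T - \<delta>\<bar>" by (cases "\<delta> \<le> T") auto
        then show ?thesis
          using C(3)[OF \<epsilon>0 en(1)] \<omega> B\<psi> B\<theta> C1 \<epsilon>0[of n] C(1)
          by (intro mult_left_mono mult_mono) (auto intro!: divide_nonneg_pos mult_nonneg_nonneg)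
      qed
      also have "\<dots> = \<omega> * K" using \<epsilon>0[of n] by (simp add: K_def)
      also have "\<dots> < r"
      proof -
        have "\<omega> * K \<le> \<omega> * (K + 1)" using \<omega> by (intro mult_left_mono) auto
        also have "\<dots> = r / 2" using K by (simp add: \<omega>_def field_simps)
        finally show ?thesis using r by simp
      qed
      finally show "norm ((LINT z|lborel. c z * (\<psi> (fst z) * \<theta> (snd z)) * moll_d \<Omega> (\<epsilon> n) v (fst z)) - 0) < r" by simp
    qed
  qed
  have each: "(LINT z|lborel. c z * (\<psi> (fst z) * \<theta> (snd z)) * moll_d \<Omega> (\<epsilon> n) v (fst z)) +
      (LINT z|lborel. c z * (dirderiv v \<psi> (fst z) * \<theta> (snd z)) * moll \<Omega> (\<epsilon> n) (fst z)) =
      - (LINT z|lborel. (g1 z \<bullet> v) * (\<psi> (fst z) * \<theta> (snd z)) * moll \<Omega> (\<epsilon> n) (fst z))" for n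
    unfolding c_def by (rule mollified_identity[OF \<psi> \<theta> \<delta> s \<epsilon>0])
  have "(\<lambda>n. (LINT z|lborel. c z * (\<psi> (fst z) * \<theta> (snd z)) * moll_d \<Omega> (\<epsilon> n) v (fst z)) +
      (LINT z|lborel. c z * (dirderiv v \<psi> (fst z) * \<theta> (snd z)) * moll \<Omega> (\<epsilon> n) (fst z))) \<longlonglongrightarrow>
      0 + (LINT z|lborel. c z * (dirderiv v \<psi> (fst z) * \<theta> (snd z)) * indicator \<Omega> (fst z))"
    by (rule tendsto_add[OF term1 lim[OF w2]])
  then have "(\<lambda>n. - (LINT z|lborel. (g1 z \<bullet> v) * (\<psi> (fst z) * \<theta> (snd z)) * moll \<Omega> (\<epsilon> n) (fst z))) \<longlonglongrightarrow>
      (LINT z|lborel. c z * (dirderiv v \<psi> (fst z) * \<theta> (snd z)) * indicator \<Omega> (fst z))"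
    unfolding each by simp
  from LIMSEQ_unique[OF this tendsto_minus[OF lim[OF w3]]]
  show ?thesis by (simp add: c_def)
qed

end

section \<open>Time cutoffs and the gradient of the flux function\<close>

lemma expinv_0_le_1: "\<bar>expinv 0 s\<bar> \<le> 1" using abs_expinv_le[of 0 s] by simp

text \<open>Provides elementary cutoffs that vanish for t <= 1 / n and converge to 1 at every
  positive time.\<close>

lemma expinv_0_tendsto_1: "(\<lambda>n. expinv 0 (t * real n - 1)) \<longlonglongrightarrow> 1" if "t > 0"
proof -
  have f: "filterlim (\<lambda>n. t * real n - 1) at_top sequentially"
    using filterlim_tendsto_add_at_top[OF tendsto_const[of "-1"]
      filterlim_tendsto_pos_mult_at_top[OF tendsto_const[of t] that filterlim_real_sequentially]] by simp
  then have "(\<lambda>n. - 1 / (t * real n - 1)) \<longlonglongrightarrow> 0"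
    by (intro real_tendsto_divide_at_top[OF tendsto_const])
  then have "(\<lambda>n. exp (- 1 / (t * real n - 1))) \<longlonglongrightarrow> exp 0" by (rule tendsto_exp)
  moreover have "\<forall>\<^sub>F n in sequentially. exp (- 1 / (t * real n - 1)) = expinv 0 (t * real n - 1)"
    using filterlim_at_top_dense[THEN iffD1, OF f, rule_format, of 0] by eventually_elim (simp add: expinv_def)
  ultimately show ?thesis by (simp add: tendsto_cong)
qed

lemma integrable_exp_half_line: "integrable lborel (\<lambda>t::real. indicator {0<..} t * exp (- t))"
proof -
  have "(\<integral>\<^sup>+t. ennreal (exp (- t)) * indicator {0..} t \<partial>lborel) = ennreal (0 - (- exp (- 0)))"
  proof (rule nn_integral_FTC_atLeast)
    show "((\<lambda>t. - exp (- t)) has_real_derivative exp (- t)) (at t)" for t :: real by (auto intro!: derivative_eq_intros)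
    have "((\<lambda>t::real. - exp (- t)) \<longlongrightarrow> - 0) at_top"
      by (intro tendsto_minus filterlim_compose[OF exp_at_bot]) (simp add: filterlim_uminus_at_bot_at_top)
    then show "((\<lambda>t::real. - exp (- t)) \<longlongrightarrow> 0) at_top" by simp
  qed auto
  then have fin: "(\<integral>\<^sup>+t. ennreal (exp (- t)) * indicator {0..} t \<partial>lborel) < \<infinity>" by simp
  have "integrable lborel (\<lambda>t::real. exp (- t) * indicator {0..} t)"
  proof (rule integrableI_nonneg)
    have "(\<integral>\<^sup>+t. ennreal (exp (- t) * indicator {0..} t) \<partial>lborel) = (\<integral>\<^sup>+t. ennreal (exp (- t)) * indicator {0..} (t::real) \<partial>lborel)"
      by (rule nn_integral_cong) (auto simp: indicator_def)
    then show "(\<integral>\<^sup>+t. ennreal (exp (- t) * indicator {0..} (t::real)) \<partial>lborel) < \<infinity>" using fin by simp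
  qed auto
  then show ?thesis by (rule Bochner_Integration.integrable_bound) (auto simp: indicator_def)
qed

context weak_solution
begin

text \<open>Equals \<open>\<sigma> (u - a) + \<sigma>m a\<close>; its weak gradient is \<open>\<sigma>\<close> times that of \<open>u\<close>.\<close>

definition "flux \<sigma>p \<sigma>m z = \<sigma>m * u1 z + (\<sigma>p - \<sigma>m) * (indicator \<Omega> (fst z) * (u1 z - a1 (snd z)))"

lemma indicator_fst_meas: "(\<lambda>z. indicator \<Omega> (fst (z :: 'a \<times> real)) :: real) \<in> borel_measurable borel"
  by (intro measurable_compose[OF fst_borel borel_measurable_indicator]) (use op in auto)

lemma diff_meas: "(\<lambda>z. u1 z - a1 (snd z)) \<in> borel_measurable borel"
  by (intro borel_measurable_diff u1_meas measurable_compose[OF snd_borel a1_meas])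

lemma flux_meas: "flux \<sigma>p \<sigma>m \<in> borel_measurable borel"
  unfolding flux_def[abs_def] by (intro borel_measurable_add borel_measurable_times borel_measurable_const u1_meas indicator_fst_meas diff_meas)

lemma flux_bound: "\<bar>flux \<sigma>p \<sigma>m z\<bar> \<le> \<bar>\<sigma>m\<bar> * M + \<bar>\<sigma>p - \<sigma>m\<bar> * (2 * M)"
proof -
  have "\<bar>indicator \<Omega> (fst z) * (u1 z - a1 (snd z))\<bar> \<le> 2 * M"
    using u1_bound[of z] a1_bound[of "snd z"] M_nonneg by (auto simp: indicator_def)
  then have "\<bar>\<sigma>m * u1 z\<bar> + \<bar>(\<sigma>p - \<sigma>m) * (indicator \<Omega> (fst z) * (u1 z - a1 (snd z)))\<bar> \<le> \<bar>\<sigma>m\<bar> * M + \<bar>\<sigma>p - \<sigma>m\<bar> * (2 * M)"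
    unfolding abs_mult using u1_bound[of z] by (intro add_mono mult_left_mono) (auto simp: abs_mult)
  then show ?thesis unfolding flux_def using abs_triangle_ineq order_trans by blast
qed

lemma flux_zero: "z \<notin> pos_time \<Longrightarrow> flux \<sigma>p \<sigma>m z = 0"
  by (cases z) (auto simp: flux_def u1_def a1_def pos_time_def)

context
  fixes \<sigma> :: "'a \<Rightarrow> real" and \<sigma>p \<sigma>m :: real
  assumes \<sigma>: "\<And>x. \<sigma> x = (if x \<in> \<Omega> then \<sigma>p else \<sigma>m)"
begin

lemma sigma_eq: "\<sigma> x = \<sigma>m + (\<sigma>p - \<sigma>m) * indicator \<Omega> x" by (simp add: \<sigma> indicator_def)

text \<open>Write \<sigma> = \<sigma>m + (\<sigma>p - \<sigma>m) 1_\<Omega>. The constant part is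
  the weak gradient identity, the part on \<Omega> is \<open>interface_gradient\<close>.\<close>

lemma flux_direction:
  assumes \<psi>: "test_elem \<psi>" and \<theta>: "elementary \<theta>" and \<delta>: "\<delta> > 0" and s: "\<And>t. \<theta> t \<noteq> 0 \<Longrightarrow> \<delta> \<le> t \<and> t \<le> T"
  shows "(LINT z|lborel. \<sigma> (fst z) * ((g1 z \<bullet> v) * (\<psi> (fst z) * \<theta> (snd z)))) =
     - (LINT z|lborel. flux \<sigma>p \<sigma>m z * (dirderiv v \<psi> (fst z) * \<theta> (snd z)))"
proof -
  obtain R where R: "\<forall>z. norm z > R \<longrightarrow> \<psi> z = 0" using \<psi> by (auto simp: test_elem_def)
  obtain R' where R': "\<forall>z. norm z > R' \<longrightarrow> dirderiv v \<psi> z = 0" using test_elem_dirderiv[OF \<psi>, of v] by (auto simp: test_elem_def)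
  obtain B\<psi> where B\<psi>: "B\<psi> > 0" "\<And>z. \<bar>\<psi> z\<bar> \<le> B\<psi>" using test_elem_bounded[OF \<psi>] by blast
  obtain Bd where Bd: "Bd > 0" "\<And>z. \<bar>dirderiv v \<psi> z\<bar> \<le> Bd" using test_elem_bounded[OF test_elem_dirderiv[OF \<psi>]] by blast
  have sS: "\<forall>t. \<theta> t \<noteq> 0 \<longrightarrow> \<delta> \<le> t \<and> t \<le> T" using s by blast
  obtain B\<theta> where B\<theta>: "B\<theta> > 0" "\<And>t. \<bar>\<theta> t\<bar> \<le> B\<theta>" using bounded_on_interval[OF elementary_continuous[OF \<theta>] s] by blast
  have ms: "\<psi> \<in> borel_measurable borel" "dirderiv v \<psi> \<in> borel_measurable borel" "\<theta> \<in> borel_measurable borel"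
    using test_elemD[OF \<psi>] \<theta> by (auto intro!: test_elem_measurable elementary_dirderiv)
  have bound_prod: "\<bar>p (fst z) * \<theta> (snd z)\<bar> \<le> B * B\<theta>" if "\<And>x. \<bar>p x\<bar> \<le> B" for p :: "'a \<Rightarrow> real" and B and z :: "'a \<times> real"
    unfolding abs_mult using that[of "fst z"] B\<theta>(2)[of "snd z"] order_trans[OF abs_ge_zero that[of "fst z"]] by (intro mult_mono) auto
  have cut: "integrable lborel (\<lambda>z. w z * indicator \<Omega> (fst z) :: real)" if "integrable lborel w" for w :: "'a \<times> real \<Rightarrow> real"
  proof (rule Bochner_Integration.integrable_bound[OF that])
    have "w \<in> borel_measurable borel" using that by (auto dest: borel_measurable_integrable)
    then have "(\<lambda>z. w z * indicator \<Omega> (fst z) :: real) \<in> borel_measurable borel" by (intro borel_measurable_times indicator_fst_meas)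
    then show "(\<lambda>z. w z * indicator \<Omega> (fst z) :: real) \<in> borel_measurable lborel" by simp
  qed (auto simp: indicator_def)
  have i3: "integrable lborel (\<lambda>z. (g1 z \<bullet> v) * (\<psi> (fst z) * \<theta> (snd z)))"
    by (rule g1_integrable[OF prod_meas[OF ms(1,3)]], rule bound_prod[OF B\<psi>(2)], drule prod_support[OF R sS], blast)
  have i2: "integrable lborel (\<lambda>z. u1 z * (dirderiv v \<psi> (fst z) * \<theta> (snd z)))"
    by (rule bdd_integrable[OF u1_meas u1_bound prod_meas[OF ms(2,3)]], rule bound_prod[OF Bd(2)], erule prod_support[OF R' sS])
  have db: "\<bar>u1 z - a1 (snd z)\<bar> \<le> 2 * M" for z using u1_bound[of z] a1_bound[of "snd z"] by linarith
  have i1: "integrable lborel (\<lambda>z. (u1 z - a1 (snd z)) * (dirderiv v \<psi> (fst z) * \<theta> (snd z)))"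
    by (rule bdd_integrable[OF diff_meas db prod_meas[OF ms(2,3)]], rule bound_prod[OF Bd(2)], erule prod_support[OF R' sS])
  have "(LINT z|lborel. \<sigma> (fst z) * ((g1 z \<bullet> v) * (\<psi> (fst z) * \<theta> (snd z)))) =
    (LINT z|lborel. \<sigma>m * ((g1 z \<bullet> v) * (\<psi> (fst z) * \<theta> (snd z))) + (\<sigma>p - \<sigma>m) * ((g1 z \<bullet> v) * (\<psi> (fst z) * \<theta> (snd z)) * indicator \<Omega> (fst z)))"
    by (rule Bochner_Integration.integral_cong[OF refl]) (simp add: sigma_eq algebra_simps)
  also have "\<dots> = \<sigma>m * (LINT z|lborel. (g1 z \<bullet> v) * (\<psi> (fst z) * \<theta> (snd z))) + (\<sigma>p - \<sigma>m) * (LINT z|lborel. (g1 z \<bullet> v) * (\<psi> (fst z) * \<theta> (snd z)) * indicator \<Omega> (fst z))"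
    using i3 cut[OF i3] by (subst Bochner_Integration.integral_add) (auto simp del: mult_indicator_cong)
  also have "\<dots> = - (\<sigma>m * (LINT z|lborel. u1 z * (dirderiv v \<psi> (fst z) * \<theta> (snd z))) + (\<sigma>p - \<sigma>m) * (LINT z|lborel. (u1 z - a1 (snd z)) * (dirderiv v \<psi> (fst z) * \<theta> (snd z)) * indicator \<Omega> (fst z)))"
  proof -
    have "(LINT z|lborel. (g1 z \<bullet> v) * (\<psi> (fst z) * \<theta> (snd z)) * indicator \<Omega> (fst z)) =
      - (LINT z|lborel. (u1 z - a1 (snd z)) * (dirderiv v \<psi> (fst z) * \<theta> (snd z)) * indicator \<Omega> (fst z))"
      by (rule interface_gradient[OF \<psi> \<theta> \<delta> s])
    moreover have "(LINT z|lborel. u1 z * (dirderiv v \<psi> (fst z) * \<theta> (snd z))) = - (LINT z|lborel. (g1 z \<bullet> v) * (\<psi> (fst z) * \<theta> (snd z)))"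
      by (rule weak_gradient_test[OF \<psi> \<theta> \<delta> s])
    ultimately show ?thesis by simp
  qed
  also have "\<sigma>m * (LINT z|lborel. u1 z * (dirderiv v \<psi> (fst z) * \<theta> (snd z))) + (\<sigma>p - \<sigma>m) * (LINT z|lborel. (u1 z - a1 (snd z)) * (dirderiv v \<psi> (fst z) * \<theta> (snd z)) * indicator \<Omega> (fst z))
    = (LINT z|lborel. \<sigma>m * (u1 z * (dirderiv v \<psi> (fst z) * \<theta> (snd z))) + (\<sigma>p - \<sigma>m) * ((u1 z - a1 (snd z)) * (dirderiv v \<psi> (fst z) * \<theta> (snd z)) * indicator \<Omega> (fst z)))"
    using i2 cut[OF i1] by (subst Bochner_Integration.integral_add) auto
  also have "\<dots> = (LINT z|lborel. flux \<sigma>p \<sigma>m z * (dirderiv v \<psi> (fst z) * \<theta> (snd z)))"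
    by (rule Bochner_Integration.integral_cong[OF refl]) (simp add: flux_def algebra_simps)
  finally show ?thesis .
qed

text \<open>Admits functions \<theta> that do not vanish at t = 0, as required to pick up the
  initial datum: time cutoffs are inserted and removed again by dominated convergence.\<close>

lemma flux_direction_closed:
  assumes \<psi>: "test_elem \<psi>" and \<theta>: "elementary \<theta>" and s: "\<And>t. \<theta> t \<noteq> 0 \<Longrightarrow> \<bar>t\<bar> \<le> T"
  shows "(LINT z|lborel. \<sigma> (fst z) * ((g1 z \<bullet> v) * (\<psi> (fst z) * \<theta> (snd z)))) =
     - (LINT z|lborel. flux \<sigma>p \<sigma>m z * (dirderiv v \<psi> (fst z) * \<theta> (snd z)))"
    and "integrable lborel (\<lambda>z. \<sigma> (fst z) * ((g1 z \<bullet> v) * (\<psi> (fst z) * \<theta> (snd z))))"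
    and "integrable lborel (\<lambda>z. flux \<sigma>p \<sigma>m z * (dirderiv v \<psi> (fst z) * \<theta> (snd z)))"
    and "integrable lborel (\<lambda>z. u1 z * (\<psi> (fst z) * \<theta> (snd z)))"
proof -
  obtain R where R: "\<forall>z. norm z > R \<longrightarrow> \<psi> z = 0" using \<psi> by (auto simp: test_elem_def)
  obtain R' where R': "\<forall>z. norm z > R' \<longrightarrow> dirderiv v \<psi> z = 0" using test_elem_dirderiv[OF \<psi>, of v] by (auto simp: test_elem_def)
  obtain B\<psi> where B\<psi>: "B\<psi> > 0" "\<And>z. \<bar>\<psi> z\<bar> \<le> B\<psi>" using test_elem_bounded[OF \<psi>] by blast
  obtain Bd where Bd: "Bd > 0" "\<And>z. \<bar>dirderiv v \<psi> z\<bar> \<le> Bd" using test_elem_bounded[OF test_elem_dirderiv[OF \<psi>]] by blast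
  have s': "- T \<le> t \<and> t \<le> T" if "\<theta> t \<noteq> 0" for t using s[OF that] by auto
  then have sS: "\<forall>t. \<theta> t \<noteq> 0 \<longrightarrow> - T \<le> t \<and> t \<le> T" by blast
  obtain B\<theta> where B\<theta>: "B\<theta> > 0" "\<And>t. \<bar>\<theta> t\<bar> \<le> B\<theta>" using bounded_on_interval[OF elementary_continuous[OF \<theta>] s'] by blast
  have ms: "\<psi> \<in> borel_measurable borel" "dirderiv v \<psi> \<in> borel_measurable borel" "\<theta> \<in> borel_measurable borel"
    using test_elemD[OF \<psi>] \<theta> by (auto intro!: test_elem_measurable elementary_dirderiv)
  have bound_prod: "\<bar>p (fst z) * \<theta> (snd z)\<bar> \<le> B * B\<theta>" if "\<And>x. \<bar>p x\<bar> \<le> B" for p :: "'a \<Rightarrow> real" and B and z :: "'a \<times> real"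
    unfolding abs_mult using that[of "fst z"] B\<theta>(2)[of "snd z"] order_trans[OF abs_ge_zero that[of "fst z"]] by (intro mult_mono) auto
  have i3: "integrable lborel (\<lambda>z. (g1 z \<bullet> v) * (\<psi> (fst z) * \<theta> (snd z)))"
    by (rule g1_integrable[OF prod_meas[OF ms(1,3)]], rule bound_prod[OF B\<psi>(2)], drule prod_support[OF R sS], blast)
  have smeas: "(\<lambda>z. \<sigma> (fst (z :: 'a \<times> real))) \<in> borel_measurable borel"
    unfolding sigma_eq by (intro borel_measurable_add borel_measurable_times borel_measurable_const indicator_fst_meas)
  have sb: "\<bar>\<sigma> x\<bar> \<le> \<bar>\<sigma>p\<bar> + \<bar>\<sigma>m\<bar>" for x by (simp add: \<sigma>)
  show i4: "integrable lborel (\<lambda>z. \<sigma> (fst z) * ((g1 z \<bullet> v) * (\<psi> (fst z) * \<theta> (snd z))))"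
  proof (rule Bochner_Integration.integrable_bound)
    show "integrable lborel (\<lambda>z. (\<bar>\<sigma>p\<bar> + \<bar>\<sigma>m\<bar>) * ((g1 z \<bullet> v) * (\<psi> (fst z) * \<theta> (snd z))))" using i3 by (rule integrable_mult_right)
    have "(\<lambda>z. (g1 z \<bullet> v) * (\<psi> (fst z) * \<theta> (snd z))) \<in> borel_measurable borel" using i3 by (auto dest: borel_measurable_integrable)
    then have "(\<lambda>z. \<sigma> (fst z) * ((g1 z \<bullet> v) * (\<psi> (fst z) * \<theta> (snd z)))) \<in> borel_measurable borel" by (rule borel_measurable_times[OF smeas])
    then show "(\<lambda>z. \<sigma> (fst z) * ((g1 z \<bullet> v) * (\<psi> (fst z) * \<theta> (snd z)))) \<in> borel_measurable lborel" by simp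
    show "AE z in lborel. norm (\<sigma> (fst z) * ((g1 z \<bullet> v) * (\<psi> (fst z) * \<theta> (snd z)))) \<le> norm ((\<bar>\<sigma>p\<bar> + \<bar>\<sigma>m\<bar>) * ((g1 z \<bullet> v) * (\<psi> (fst z) * \<theta> (snd z))))"
      unfolding norm_mult by (intro AE_I2 mult_right_mono) (use sb in auto)
  qed
  show i5: "integrable lborel (\<lambda>z. flux \<sigma>p \<sigma>m z * (dirderiv v \<psi> (fst z) * \<theta> (snd z)))"
    by (rule bdd_integrable[OF flux_meas flux_bound prod_meas[OF ms(2,3)]], rule bound_prod[OF Bd(2)], erule prod_support[OF R' sS])
  show "integrable lborel (\<lambda>z. u1 z * (\<psi> (fst z) * \<theta> (snd z)))"
    by (rule bdd_integrable[OF u1_meas u1_bound prod_meas[OF ms(1,3)]], rule bound_prod[OF B\<psi>(2)], erule prod_support[OF R sS])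
  define \<kappa> where "\<kappa> n t = expinv 0 (t * real n - 1)" for n and t :: real
  have \<kappa>e: "elementary (\<kappa> n)" for n unfolding \<kappa>_def
    by (intro elementary.expinv elementary_diff elementary.mult elementary.const elementary_ident)
  have \<kappa>m: "(\<lambda>z::'a \<times> real. \<kappa> n (snd z)) \<in> borel_measurable borel" for n
    by (rule measurable_compose[OF snd_borel test_elem_measurable[OF \<kappa>e]])
  have lim: "(\<lambda>n. LINT z|lborel. w z * \<kappa> (Suc n) (snd z)) \<longlonglongrightarrow> (LINT z|lborel. w z)"
    if w: "integrable lborel w" and z: "\<And>z. z \<notin> pos_time \<Longrightarrow> w z = 0" for w :: "'a \<times> real \<Rightarrow> real"
  proof (rule integral_dominated_convergence[where w="\<lambda>z. \<bar>w z\<bar>"])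
    have wm: "w \<in> borel_measurable borel" using w by (auto dest: borel_measurable_integrable)
    then show "w \<in> borel_measurable lborel" by simp
    have "(\<lambda>z. w z * \<kappa> (Suc n) (snd z)) \<in> borel_measurable borel" for n by (intro borel_measurable_times wm \<kappa>m)
    then show "\<And>n. (\<lambda>z. w z * \<kappa> (Suc n) (snd z)) \<in> borel_measurable lborel" by simp
    show "AE z in lborel. (\<lambda>n. w z * \<kappa> (Suc n) (snd z)) \<longlonglongrightarrow> w z"
    proof (rule AE_I2)
      fix z :: "'a \<times> real"
      show "(\<lambda>n. w z * \<kappa> (Suc n) (snd z)) \<longlonglongrightarrow> w z"
      proof (cases "z \<in> pos_time")
        case True
        then have "snd z > 0" by (auto simp: pos_time_def)
        from tendsto_mult_left[OF LIMSEQ_Suc[OF expinv_0_tendsto_1[OF this]], of "w z"]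
        show ?thesis by (simp add: \<kappa>_def)
      next
        case False then show ?thesis using z by simp
      qed
    qed
    show "AE z in lborel. norm (w z * \<kappa> (Suc n) (snd z)) \<le> \<bar>w z\<bar>" for n
      using expinv_0_le_1 by (intro AE_I2) (auto simp: abs_mult \<kappa>_def intro: mult_left_le)
  qed (use w in simp)
  have each: "(LINT z|lborel. \<sigma> (fst z) * ((g1 z \<bullet> v) * (\<psi> (fst z) * \<theta> (snd z))) * \<kappa> (Suc n) (snd z)) =
     - (LINT z|lborel. flux \<sigma>p \<sigma>m z * (dirderiv v \<psi> (fst z) * \<theta> (snd z)) * \<kappa> (Suc n) (snd z))" for n
  proof -
    have "(LINT z|lborel. \<sigma> (fst z) * ((g1 z \<bullet> v) * (\<psi> (fst z) * (\<theta> (snd z) * \<kappa> (Suc n) (snd z))))) =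
     - (LINT z|lborel. flux \<sigma>p \<sigma>m z * (dirderiv v \<psi> (fst z) * (\<theta> (snd z) * \<kappa> (Suc n) (snd z))))"
    proof (rule flux_direction[OF \<psi> elementary.mult[OF \<theta> \<kappa>e], where \<delta>="1 / real (Suc n)" and T=T])
      fix t assume t: "\<theta> t * \<kappa> (Suc n) t \<noteq> 0"
      then have "\<kappa> (Suc n) t \<noteq> 0" by auto
      then have "t * real (Suc n) - 1 > 0" unfolding \<kappa>_def expinv_def by (auto split: if_splits)
      then have "1 / real (Suc n) \<le> t" by (subst pos_divide_le_eq) auto
      then show "1 / real (Suc n) \<le> t \<and> t \<le> T" using s'[of t] t by auto
    qed simp
    then show ?thesis by (simp only: mult.assoc)
  qed
  have A: "(\<lambda>n. LINT z|lborel. \<sigma> (fst z) * ((g1 z \<bullet> v) * (\<psi> (fst z) * \<theta> (snd z))) * \<kappa> (Suc n) (snd z)) \<longlonglongrightarrow>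
      (LINT z|lborel. \<sigma> (fst z) * ((g1 z \<bullet> v) * (\<psi> (fst z) * \<theta> (snd z))))"
    by (rule lim[OF i4]) (simp add: g1_def)
  have B: "(\<lambda>n. LINT z|lborel. flux \<sigma>p \<sigma>m z * (dirderiv v \<psi> (fst z) * \<theta> (snd z)) * \<kappa> (Suc n) (snd z)) \<longlonglongrightarrow>
      (LINT z|lborel. flux \<sigma>p \<sigma>m z * (dirderiv v \<psi> (fst z) * \<theta> (snd z)))"
    by (rule lim[OF i5]) (simp add: flux_zero)
  show "(LINT z|lborel. \<sigma> (fst z) * ((g1 z \<bullet> v) * (\<psi> (fst z) * \<theta> (snd z)))) =
     - (LINT z|lborel. flux \<sigma>p \<sigma>m z * (dirderiv v \<psi> (fst z) * \<theta> (snd z)))"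
    using LIMSEQ_unique[OF A[unfolded each] tendsto_minus[OF B]] .
qed

end
end

section \<open>Laplace transform in time\<close>

definition "expker t = indicator {0<..} t * exp (- t)" for t :: real

text \<open>Compactly supported approximations of the Laplace weight exp (- t), up to the factor
  \<open>expinv 0 1\<close>, which is also their exact value at t = 0.\<close>

definition "cutexp n t = exp (- t) * expinv 0 (1 - t\<^sup>2 / (real (Suc n))\<^sup>2)" for t :: real

lemma cutexp_test: "test_elem (cutexp n)"
proof -
  have "elementary (\<lambda>t. exp (- 1 * t) * expinv 0 (1 - (1 / (real (Suc n))\<^sup>2) * (t * t)))"
    by (intro elementary.mult elementary.exp elementary.expinv elementary_diff elementary.const elementary_ident)
  moreover have "cutexp n t = 0" if "norm t > real (Suc n)" for t
  proof -
    have "(real (Suc n))\<^sup>2 \<le> \<bar>t\<bar>\<^sup>2" using that by (intro power_mono) auto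
    then have "(real (Suc n))\<^sup>2 \<le> t\<^sup>2" by simp
    then have "1 \<le> t\<^sup>2 / (real (Suc n))\<^sup>2"
      by (simp only: le_divide_eq_1_pos zero_less_power of_nat_0_less_iff zero_less_Suc)
    then have "\<not> 1 - t\<^sup>2 / (real (Suc n))\<^sup>2 > 0" by linarith
    then show ?thesis by (simp only: cutexp_def expinv_def if_False mult_zero_right)
  qed
  ultimately show ?thesis unfolding test_elem_def cutexp_def[abs_def] by (auto simp: power2_eq_square)
qed

lemma cutexp_deriv:
  "dirderiv 1 (cutexp n) t = - exp (- t) * expinv 0 (1 - t\<^sup>2 / (real (Suc n))\<^sup>2)
     + exp (- t) * (expinv 2 (1 - t\<^sup>2 / (real (Suc n))\<^sup>2) * (- (2 * t) / (real (Suc n))\<^sup>2))"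
proof -
  have 1: "((\<lambda>t. 1 - t\<^sup>2 / (real (Suc n))\<^sup>2) has_real_derivative - (2 * t) / (real (Suc n))\<^sup>2) (at t)"
    by (rule DERIV_cong[OF DERIV_diff[OF DERIV_const DERIV_cdivide[OF DERIV_power[OF DERIV_ident, of 2]]]]) simp
  have 2: "((\<lambda>t. exp (- t)) has_real_derivative - exp (- t)) (at t)" by (auto intro!: derivative_eq_intros)
  have 3: "(expinv 0 has_real_derivative expinv 2 r) (at r)" for r using has_real_derivative_expinv[of 0 r] by (simp add: numeral_2_eq_2)
  have "(cutexp n has_real_derivative - exp (- t) * expinv 0 (1 - t\<^sup>2 / (real (Suc n))\<^sup>2)
     + exp (- t) * (expinv 2 (1 - t\<^sup>2 / (real (Suc n))\<^sup>2) * (- (2 * t) / (real (Suc n))\<^sup>2))) (at t)"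
    unfolding cutexp_def[abs_def]
    by (rule DERIV_cong[OF DERIV_mult[OF 2 DERIV_chain2[OF 3 1]]]) simp
  from elementary_dirderiv_real[OF test_elemD[OF cutexp_test] this, of 1] show ?thesis by simp
qed

lemma cutexp_arg_tendsto: "(\<lambda>n. 1 - t\<^sup>2 / (real (Suc n))\<^sup>2) \<longlonglongrightarrow> 1" and inv_sq_tendsto: "(\<lambda>n. - (2 * t) / (real (Suc n))\<^sup>2) \<longlonglongrightarrow> 0"
proof -
  have "(\<lambda>n. (inverse (real (Suc n)))\<^sup>2) \<longlonglongrightarrow> 0\<^sup>2" by (intro tendsto_power LIMSEQ_inverse_real_of_nat)
  then have N: "(\<lambda>n. 1 / (real (Suc n))\<^sup>2) \<longlonglongrightarrow> 0" by (simp add: inverse_eq_divide power_one_over)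
  show "(\<lambda>n. 1 - t\<^sup>2 / (real (Suc n))\<^sup>2) \<longlonglongrightarrow> 1"
    using tendsto_diff[OF tendsto_const[of 1] tendsto_mult_left[OF N, of "t\<^sup>2"]] by simp
  show "(\<lambda>n. - (2 * t) / (real (Suc n))\<^sup>2) \<longlonglongrightarrow> 0"
    using tendsto_mult_left[OF N, of "- (2 * t)"] by simp
qed

lemma expinv_cut_tendsto: "(\<lambda>n. expinv k (1 - t\<^sup>2 / (real (Suc n))\<^sup>2)) \<longlonglongrightarrow> expinv k 1"
  by (rule isCont_tendsto_compose[OF DERIV_isCont[OF has_real_derivative_expinv] cutexp_arg_tendsto])

lemma cutexp_tendsto: "(\<lambda>n. cutexp n t) \<longlonglongrightarrow> exp (- t) * expinv 0 1"
  unfolding cutexp_def by (intro tendsto_mult tendsto_const expinv_cut_tendsto)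

lemma cutexp_deriv_tendsto: "(\<lambda>n. dirderiv 1 (cutexp n) t) \<longlonglongrightarrow> - exp (- t) * expinv 0 1"
proof -
  have "(\<lambda>n. dirderiv 1 (cutexp n) t) \<longlonglongrightarrow> - exp (- t) * expinv 0 1 + exp (- t) * (expinv 2 1 * 0)"
    unfolding cutexp_deriv by (intro tendsto_add tendsto_mult tendsto_const expinv_cut_tendsto inv_sq_tendsto)
  then show ?thesis by simp
qed

lemma cutexp_bound: "\<bar>cutexp n t\<bar> \<le> exp (- t)"
  using expinv_0_le_1[of "1 - t\<^sup>2 / (real (Suc n))\<^sup>2"] by (simp add: cutexp_def abs_mult)

text \<open>The exponential contributes 1 and the cutoff 4: where it is nonzero, |t| <= n + 1, so |2
  t| / (n + 1)^2 <= 2, and \<open>expinv 2\<close> is at most 2! = 2.\<close>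

lemma cutexp_deriv_bound: "\<bar>dirderiv 1 (cutexp n) t\<bar> \<le> 5 * exp (- t)"
proof -
  let ?s = "1 - t\<^sup>2 / (real (Suc n))\<^sup>2"
  have "\<bar>expinv 2 ?s * (- (2 * t) / (real (Suc n))\<^sup>2)\<bar> \<le> 4"
  proof (cases "\<bar>t\<bar> \<le> real (Suc n)")
    case True
    have p: "(real (Suc n))\<^sup>2 > 0" by simp
    have "\<bar>t\<bar> \<le> (real (Suc n))\<^sup>2" using True self_le_power[of "real (Suc n)" 2] by simp
    then have "\<bar>- (2 * t) / (real (Suc n))\<^sup>2\<bar> \<le> 2" using p by (simp add: abs_mult divide_le_eq)
    moreover have "\<bar>expinv 2 ?s\<bar> \<le> 2" using abs_expinv_le[of 2 ?s] by simp
    ultimately show ?thesis unfolding abs_mult using mult_mono[of "\<bar>expinv 2 ?s\<bar>" 2 "\<bar>- (2 * t) / (real (Suc n))\<^sup>2\<bar>" 2] by simp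
  next
    case False
    then have "(real (Suc n))\<^sup>2 \<le> \<bar>t\<bar>\<^sup>2" by (intro power_mono) auto
    then have "(real (Suc n))\<^sup>2 \<le> t\<^sup>2" by simp
    then have "1 \<le> t\<^sup>2 / (real (Suc n))\<^sup>2"
      by (simp only: le_divide_eq_1_pos zero_less_power of_nat_0_less_iff zero_less_Suc)
    then have "\<not> ?s > 0" by linarith
    then have "expinv 2 ?s = 0" by (simp only: expinv_def if_False)
    then show ?thesis by simp
  qed
  then have "\<bar>exp (- t) * (expinv 2 ?s * (- (2 * t) / (real (Suc n))\<^sup>2))\<bar> \<le> exp (- t) * 4"
    unfolding abs_mult[of "exp (- t)"] by (intro mult_mono) auto
  moreover have "\<bar>- exp (- t) * expinv 0 ?s\<bar> \<le> exp (- t) * 1"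
    using expinv_0_le_1[of ?s] unfolding abs_mult by (intro mult_mono) auto
  ultimately show ?thesis unfolding cutexp_deriv by linarith
qed

context weak_solution
begin

lemma integrable_weighted:
  fixes k :: "'a \<times> real \<Rightarrow> real"
  assumes k: "k \<in> borel_measurable borel" "\<And>z. \<bar>k z\<bar> \<le> C" and \<psi>: "integrable lborel \<psi>" and w: "integrable lborel w"
  shows "integrable lborel (\<lambda>z. k z * (\<psi> (fst z) * w (snd z)))"
proof (rule Bochner_Integration.integrable_bound)
  have m: "\<psi> \<in> borel_measurable borel" "w \<in> borel_measurable borel" using \<psi> w by (auto dest: borel_measurable_integrable)
  show "integrable lborel (\<lambda>z. C * (\<psi> (fst z) * w (snd z)))" by (intro integrable_mult_right lborel_integrable_prod \<psi> w)
  have "(\<lambda>z. k z * (\<psi> (fst z) * w (snd z))) \<in> borel_measurable borel" by (rule borel_measurable_times[OF k(1) prod_meas[OF m]])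
  then show "(\<lambda>z. k z * (\<psi> (fst z) * w (snd z))) \<in> borel_measurable lborel" by simp
  have "\<bar>k z\<bar> \<le> \<bar>C\<bar>" for z using k(2)[of z] by simp
  then show "AE z in lborel. norm (k z * (\<psi> (fst z) * w (snd z))) \<le> norm (C * (\<psi> (fst z) * w (snd z)))"
    unfolding norm_mult by (intro AE_I2 mult_right_mono) auto
qed

lemma integral_weighted:
  fixes k :: "'a \<times> real \<Rightarrow> real"
  assumes k: "k \<in> borel_measurable borel" "\<And>z. \<bar>k z\<bar> \<le> C" and \<psi>: "integrable lborel \<psi>" and w: "integrable lborel w"
  shows "(LINT z|lborel. k z * (\<psi> (fst z) * w (snd z))) = (LINT x|lborel. (LINT t|lborel. k (x, t) * w t) * \<psi> x)"
proof -
  have "integrable (lborel \<Otimes>\<^sub>M lborel) (\<lambda>(x, t). k (x, t) * (\<psi> x * w t))"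
    using integrable_weighted[OF assms] by (simp add: lborel_prod case_prod_unfold)
  from lborel_pair.integral_fst[OF this]
  have "(LINT x|lborel. LINT t|lborel. k (x, t) * (\<psi> x * w t)) = (LINT z|lborel. k z * (\<psi> (fst z) * w (snd z)))"
    by (simp add: lborel_prod case_prod_unfold)
  moreover have "(LINT t|lborel. k (x, t) * (\<psi> x * w t)) = (LINT t|lborel. k (x, t) * w t) * \<psi> x" for x
    by (simp add: mult.left_commute[of _ "\<psi> x"] mult.commute[of _ "\<psi> x"])
  ultimately show ?thesis by simp
qed

text \<open>The bound D exp (- t) is not integrable over negative times, but k vanishes there; the
  majorant is therefore built with \<open>expker\<close>.\<close>

lemma limit_weighted:
  fixes k :: "'a \<times> real \<Rightarrow> real"
  assumes k: "k \<in> borel_measurable borel" "\<And>z. \<bar>k z\<bar> \<le> C" "\<And>z. z \<notin> pos_time \<Longrightarrow> k z = 0" and \<psi>: "integrable lborel \<psi>"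
    and W: "\<And>n. W n \<in> borel_measurable borel" "\<And>n t. \<bar>W n t\<bar> \<le> D * exp (- t)" "\<And>t. (\<lambda>n. W n t) \<longlonglongrightarrow> c * exp (- t)"
  shows "(\<lambda>n. LINT z|lborel. k z * (\<psi> (fst z) * W n (snd z))) \<longlonglongrightarrow> c * (LINT z|lborel. k z * (\<psi> (fst z) * expker (snd z)))"
proof -
  have ei: "integrable lborel expker" using integrable_exp_half_line by (simp add: expker_def[abs_def])
  then have em: "expker \<in> borel_measurable borel" by (auto dest: borel_measurable_integrable)
  have m: "\<psi> \<in> borel_measurable borel" using \<psi> by (auto dest: borel_measurable_integrable)
  have "(\<lambda>n. LINT z|lborel. k z * (\<psi> (fst z) * W n (snd z))) \<longlonglongrightarrow> (LINT z|lborel. c * (k z * (\<psi> (fst z) * expker (snd z))))"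
  proof (rule integral_dominated_convergence[where w="\<lambda>z. norm (D * (k z * (\<psi> (fst z) * expker (snd z))))"])
    have "(\<lambda>z. c * (k z * (\<psi> (fst z) * expker (snd z)))) \<in> borel_measurable borel"
      by (intro borel_measurable_times[OF borel_measurable_const borel_measurable_times[OF k(1) prod_meas[OF m em]]])
    then show "(\<lambda>z. c * (k z * (\<psi> (fst z) * expker (snd z)))) \<in> borel_measurable lborel" by simp
    have "(\<lambda>z. k z * (\<psi> (fst z) * W n (snd z))) \<in> borel_measurable borel" for n
      by (rule borel_measurable_times[OF k(1) prod_meas[OF m W(1)]])
    then show "\<And>n. (\<lambda>z. k z * (\<psi> (fst z) * W n (snd z))) \<in> borel_measurable lborel" by simp
    show "integrable lborel (\<lambda>z. norm (D * (k z * (\<psi> (fst z) * expker (snd z)))))"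
      by (intro integrable_norm integrable_mult_right integrable_weighted[OF k(1,2) \<psi> ei])
    show "AE z in lborel. (\<lambda>n. k z * (\<psi> (fst z) * W n (snd z))) \<longlonglongrightarrow> c * (k z * (\<psi> (fst z) * expker (snd z)))"
    proof (rule AE_I2)
      fix z :: "'a \<times> real"
      show "(\<lambda>n. k z * (\<psi> (fst z) * W n (snd z))) \<longlonglongrightarrow> c * (k z * (\<psi> (fst z) * expker (snd z)))"
      proof (cases "z \<in> pos_time")
        case True
        then have e: "expker (snd z) = exp (- snd z)" by (auto simp: pos_time_def expker_def)
        have "(\<lambda>n. k z * (\<psi> (fst z) * W n (snd z))) \<longlonglongrightarrow> k z * (\<psi> (fst z) * (c * exp (- snd z)))"
          by (intro tendsto_mult tendsto_const W(3))
        then show ?thesis by (simp add: e mult_ac)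
      next
        case False then show ?thesis by (simp add: k(3))
      qed
    qed
    show "AE z in lborel. norm (k z * (\<psi> (fst z) * W n (snd z))) \<le> norm (D * (k z * (\<psi> (fst z) * expker (snd z))))" for n
    proof (rule AE_I2)
      fix z :: "'a \<times> real"
      show "norm (k z * (\<psi> (fst z) * W n (snd z))) \<le> norm (D * (k z * (\<psi> (fst z) * expker (snd z))))"
      proof (cases "z \<in> pos_time")
        case True
        then have e: "expker (snd z) = exp (- snd z)" by (auto simp: pos_time_def expker_def)
        have "\<bar>W n (snd z)\<bar> \<le> \<bar>D\<bar> * exp (- snd z)" using W(2)[of n "snd z"] by (smt (verit) exp_gt_zero mult_right_mono)
        then have "\<bar>k z\<bar> * (\<bar>\<psi> (fst z)\<bar> * \<bar>W n (snd z)\<bar>) \<le> \<bar>k z\<bar> * (\<bar>\<psi> (fst z)\<bar> * (\<bar>D\<bar> * exp (- snd z)))"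
          by (intro mult_left_mono) auto
        then show ?thesis by (simp add: e abs_mult mult_ac)
      next
        case False then show ?thesis by (simp add: k(3))
      qed
    qed
  qed
  then show ?thesis by simp
qed

lemma u1_zero: "z \<notin> pos_time \<Longrightarrow> u1 z = 0" by (simp add: u1_def)

lemma test_elem_lap: assumes "test_elem \<psi>" shows "integrable lborel (lap \<psi>)"
  unfolding lap_def[abs_def] by (intro Bochner_Integration.integrable_sum test_elem_integrable test_elem_dirderiv assms)

text \<open>The equation is tested with \<psi>(x) times \<open>cutexp n\<close>. In the limit the
  time derivative becomes - exp (- t), the value at t = 0 produces the initial datum, and the common
  factor \<open>expinv 0 1\<close> is cancelled.\<close>

lemma laplace_identity:
  assumes \<sigma>: "\<And>x. \<sigma> x = (if x \<in> \<Omega> then \<sigma>p else \<sigma>m)"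
    and eq: "\<And>\<phi>. test_fun_on UNIV \<phi> \<Longrightarrow> (LINT z:UNIV \<times> {0<..}|lborel.
               u (fst z) (snd z) * frechet_derivative \<phi> (at z) (0, 1)
               - \<sigma> (fst z) * frechet_derivative \<phi> (at z) (g (fst z) (snd z), 0))
           + (LINT x|lborel. indicator \<Omega> x * \<phi> (x, 0)) = 0"
    and \<psi>: "test_elem \<psi>"
  shows "- (LINT z|lborel. u1 z * (\<psi> (fst z) * expker (snd z))) + (LINT z|lborel. flux \<sigma>p \<sigma>m z * (lap \<psi> (fst z) * expker (snd z)))
     + (LINT x|lborel. indicator \<Omega> x * \<psi> x) = 0"
proof -
  have e: "elementary \<psi>" using test_elemD[OF \<psi>] .
  obtain R where R: "\<forall>z. norm z > R \<longrightarrow> \<psi> z = 0" using \<psi> by (auto simp: test_elem_def)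
  have step: "(LINT z|lborel. u1 z * (\<psi> (fst z) * dirderiv 1 \<Theta> (snd z))) + (LINT z|lborel. flux \<sigma>p \<sigma>m z * (lap \<psi> (fst z) * \<Theta> (snd z)))
     + \<Theta> 0 * (LINT x|lborel. indicator \<Omega> x * \<psi> x) = 0" if \<Theta>: "test_elem \<Theta>" for \<Theta> :: "real \<Rightarrow> real"
  proof -
    have e\<Theta>: "elementary \<Theta>" using test_elemD[OF \<Theta>] .
    obtain T where T: "\<forall>t. norm t > T \<longrightarrow> \<Theta> t = 0" using \<Theta> by (auto simp: test_elem_def)
    obtain T' where T': "\<forall>t. norm t > T' \<longrightarrow> dirderiv 1 \<Theta> t = 0" using test_elem_dirderiv[OF \<Theta>, of 1] by (auto simp: test_elem_def)
    have s: "\<bar>t\<bar> \<le> T" if "\<Theta> t \<noteq> 0" for t using T that by (metis not_le real_norm_def)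
    have s': "\<bar>t\<bar> \<le> T'" if "dirderiv 1 \<Theta> t \<noteq> 0" for t using T' that by (metis not_le real_norm_def)
    let ?\<Phi> = "\<lambda>z::'a \<times> real. \<psi> (fst z) * \<Theta> (snd z)"
    have "test_fun_on UNIV ?\<Phi>"
    proof (rule test_elem_test_fun[OF elementary_prod[OF e e\<Theta>], of "cball 0 R \<times> cball 0 T"])
      show "compact (cball (0::'a) R \<times> cball (0::real) T)" by (intro compact_Times) auto
      fix z :: "'a \<times> real" assume "z \<notin> cball 0 R \<times> cball 0 T"
      then show "?\<Phi> z = 0" using R T by (cases z) (auto simp: not_le)
    qed simp
    note E = eq[OF this]
    \<comment> \<open>The flux identity is applied to the derivatives of \<psi> in the basis
      directions; the sum over the basis yields \<open>lap\<close>.\<close>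
    have G: "(LINT z|lborel. \<sigma> (fst z) * ((g1 z \<bullet> b) * (dirderiv b \<psi> (fst z) * \<Theta> (snd z)))) =
        - (LINT z|lborel. flux \<sigma>p \<sigma>m z * (dirderiv b (dirderiv b \<psi>) (fst z) * \<Theta> (snd z)))"
      and Gi: "integrable lborel (\<lambda>z. \<sigma> (fst z) * ((g1 z \<bullet> b) * (dirderiv b \<psi> (fst z) * \<Theta> (snd z))))"
      and Fi: "integrable lborel (\<lambda>z. flux \<sigma>p \<sigma>m z * (dirderiv b (dirderiv b \<psi>) (fst z) * \<Theta> (snd z)))" for b
      by (rule flux_direction_closed[OF \<sigma> test_elem_dirderiv[OF \<psi>] e\<Theta> s], assumption)+
    have Ui: "integrable lborel (\<lambda>z. u1 z * (\<psi> (fst z) * dirderiv 1 \<Theta> (snd z)))"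
      by (rule flux_direction_closed(4)[OF \<sigma> \<psi> elementary_dirderiv[OF e\<Theta>] s'])
    have int: "indicator (UNIV \<times> {0<..}) z *\<^sub>R (u (fst z) (snd z) * frechet_derivative ?\<Phi> (at z) (0, 1)
               - \<sigma> (fst z) * frechet_derivative ?\<Phi> (at z) (g (fst z) (snd z), 0)) =
        u1 z * (\<psi> (fst z) * dirderiv 1 \<Theta> (snd z)) - (\<Sum>b\<in>Basis. \<sigma> (fst z) * ((g1 z \<bullet> b) * (dirderiv b \<psi> (fst z) * \<Theta> (snd z))))" for z
    proof (cases "z \<in> pos_time")
      case True
      then have z: "indicator (UNIV \<times> {0<..}) z = (1::real)" "u1 z = u (fst z) (snd z)" "g1 z = g (fst z) (snd z)"
        by (simp_all add: pos_time_def u1_def g1_def)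
      show ?thesis unfolding z frechet_prod_test[OF e e\<Theta>] dirderiv_zero[OF e] dirderiv_zero[OF e\<Theta>]
          dirderiv_sum_Basis[OF e, of "g (fst z) (snd z)"]
        by (simp add: sum_distrib_left sum_distrib_right mult_ac)
    next
      case False
      then have z: "indicator (UNIV \<times> {0<..}) z = (0::real)" "u1 z = 0" "g1 z = 0"
        by (simp_all add: pos_time_def u1_def g1_def)
      show ?thesis unfolding z by simp
    qed
    have "(LINT z:UNIV \<times> {0<..}|lborel.
               u (fst z) (snd z) * frechet_derivative ?\<Phi> (at z) (0, 1)
               - \<sigma> (fst z) * frechet_derivative ?\<Phi> (at z) (g (fst z) (snd z), 0)) =
        (LINT z|lborel. u1 z * (\<psi> (fst z) * dirderiv 1 \<Theta> (snd z))) -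
        (LINT z|lborel. (\<Sum>b\<in>Basis. \<sigma> (fst z) * ((g1 z \<bullet> b) * (dirderiv b \<psi> (fst z) * \<Theta> (snd z)))))"
      unfolding set_lebesgue_integral_def int
      by (rule Bochner_Integration.integral_diff[OF Ui Bochner_Integration.integrable_sum[OF Gi]])
    also have "(LINT z|lborel. (\<Sum>b\<in>Basis. \<sigma> (fst z) * ((g1 z \<bullet> b) * (dirderiv b \<psi> (fst z) * \<Theta> (snd z))))) =
      (\<Sum>b\<in>Basis. (LINT z|lborel. \<sigma> (fst z) * ((g1 z \<bullet> b) * (dirderiv b \<psi> (fst z) * \<Theta> (snd z)))))"
      by (rule Bochner_Integration.integral_sum[OF Gi])
    also have "\<dots> = - (\<Sum>b\<in>Basis. (LINT z|lborel. flux \<sigma>p \<sigma>m z * (dirderiv b (dirderiv b \<psi>) (fst z) * \<Theta> (snd z))))"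
      unfolding G by (simp add: sum_negf)
    also have "(\<Sum>b\<in>Basis. (LINT z|lborel. flux \<sigma>p \<sigma>m z * (dirderiv b (dirderiv b \<psi>) (fst z) * \<Theta> (snd z)))) =
       (LINT z|lborel. (\<Sum>b\<in>Basis. flux \<sigma>p \<sigma>m z * (dirderiv b (dirderiv b \<psi>) (fst z) * \<Theta> (snd z))))"
      by (rule Bochner_Integration.integral_sum[OF Fi, symmetric])
    also have "\<dots> = (LINT z|lborel. flux \<sigma>p \<sigma>m z * (lap \<psi> (fst z) * \<Theta> (snd z)))"
      by (simp add: lap_def sum_distrib_left sum_distrib_right)
    finally show ?thesis using E by (simp add: mult.commute[of "\<Theta> 0"] mult.assoc[symmetric])
  qed
  have cm: "cutexp n \<in> borel_measurable borel" "dirderiv 1 (cutexp n) \<in> borel_measurable borel" for n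
    using test_elemD[OF cutexp_test] by (auto intro!: test_elem_measurable elementary_dirderiv)
  let ?e1 = "expinv 0 1"
  have A: "(\<lambda>n. LINT z|lborel. u1 z * (\<psi> (fst z) * dirderiv 1 (cutexp n) (snd z))) \<longlonglongrightarrow> (- ?e1) * (LINT z|lborel. u1 z * (\<psi> (fst z) * expker (snd z)))"
    by (rule limit_weighted[OF u1_meas u1_bound u1_zero test_elem_integrable[OF \<psi>] cm(2) cutexp_deriv_bound])
       (use cutexp_deriv_tendsto in \<open>simp_all add: mult.commute\<close>)
  have B: "(\<lambda>n. LINT z|lborel. flux \<sigma>p \<sigma>m z * (lap \<psi> (fst z) * cutexp n (snd z))) \<longlonglongrightarrow> ?e1 * (LINT z|lborel. flux \<sigma>p \<sigma>m z * (lap \<psi> (fst z) * expker (snd z)))"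
    by (rule limit_weighted[OF flux_meas flux_bound flux_zero test_elem_lap[OF \<psi>] cm(1), where D=1])
       (use cutexp_tendsto cutexp_bound in \<open>simp_all add: mult.commute\<close>)
  have c0: "cutexp n 0 = ?e1" for n by (simp add: cutexp_def)
  have "(\<lambda>n. (LINT z|lborel. u1 z * (\<psi> (fst z) * dirderiv 1 (cutexp n) (snd z))) + (LINT z|lborel. flux \<sigma>p \<sigma>m z * (lap \<psi> (fst z) * cutexp n (snd z)))
     + cutexp n 0 * (LINT x|lborel. indicator \<Omega> x * \<psi> x)) \<longlonglongrightarrow>
     (- ?e1) * (LINT z|lborel. u1 z * (\<psi> (fst z) * expker (snd z))) + ?e1 * (LINT z|lborel. flux \<sigma>p \<sigma>m z * (lap \<psi> (fst z) * expker (snd z)))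
     + ?e1 * (LINT x|lborel. indicator \<Omega> x * \<psi> x)"
    unfolding c0 by (intro tendsto_add A B tendsto_const)
  then have "(\<lambda>n. 0::real) \<longlonglongrightarrow>
     (- ?e1) * (LINT z|lborel. u1 z * (\<psi> (fst z) * expker (snd z))) + ?e1 * (LINT z|lborel. flux \<sigma>p \<sigma>m z * (lap \<psi> (fst z) * expker (snd z)))
     + ?e1 * (LINT x|lborel. indicator \<Omega> x * \<psi> x)" unfolding step[OF cutexp_test] .
  from LIMSEQ_unique[OF this tendsto_const]
  have "?e1 * (- (LINT z|lborel. u1 z * (\<psi> (fst z) * expker (snd z))) + (LINT z|lborel. flux \<sigma>p \<sigma>m z * (lap \<psi> (fst z) * expker (snd z)))
     + (LINT x|lborel. indicator \<Omega> x * \<psi> x)) = 0" by (simp add: algebra_simps)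
  then show ?thesis using expinv_0_1_pos by simp
qed

end

section \<open>Laplace transforms of temperature and flux\<close>

lemma integrable_expker: "integrable lborel expker" and expker_nonneg: "expker t \<ge> 0"
  using integrable_exp_half_line by (simp_all add: expker_def[abs_def])

context weak_solution
begin

text \<open>Here the prefix stands for the Laplace transform in time, not for the Laplacian
  \<open>lap\<close>.\<close>

definition "lapU x = (LINT t|lborel. u1 (x, t) * expker t)"
definition "lapA = (LINT t|lborel. a1 t * expker t)"
definition "lapV \<sigma>p \<sigma>m x = \<sigma>m * lapU x + (\<sigma>p - \<sigma>m) * (indicator \<Omega> x * (lapU x - lapA))"

lemma bounded_times_expker:
  assumes "h \<in> borel_measurable borel" "\<And>t. \<bar>h t\<bar> \<le> C"
  shows "integrable lborel (\<lambda>t. h t * expker t)"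
proof (rule Bochner_Integration.integrable_bound)
  have em: "expker \<in> borel_measurable borel" using integrable_expker by (auto dest: borel_measurable_integrable)
  show "integrable lborel (\<lambda>t. C * expker t)" by (intro integrable_mult_right integrable_expker)
  have "(\<lambda>t. h t * expker t) \<in> borel_measurable borel" by (intro borel_measurable_times assms em)
  then show "(\<lambda>t. h t * expker t) \<in> borel_measurable lborel" by simp
  have "\<bar>h t\<bar> \<le> \<bar>C\<bar>" for t using assms(2)[of t] by simp
  then show "AE t in lborel. norm (h t * expker t) \<le> norm (C * expker t)"
    unfolding norm_mult by (intro AE_I2 mult_right_mono) auto
qed

lemma u1_slice_meas: "(\<lambda>t. u1 (x, t)) \<in> borel_measurable borel"
proof -
  have "(\<lambda>t::real. (x, t)) \<in> borel_measurable borel" by (intro borel_measurable_continuous_onI continuous_intros)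
  from measurable_compose[OF this u1_meas] show ?thesis .
qed

lemma u1_slice_integrable: "integrable lborel (\<lambda>t. u1 (x, t) * expker t)"
  by (rule bounded_times_expker[OF u1_slice_meas u1_bound])

lemma a1_integrable: "integrable lborel (\<lambda>t. a1 t * expker t)"
  by (rule bounded_times_expker[OF a1_meas a1_bound])

lemma lapU_bound: "\<bar>lapU x\<bar> \<le> M * (LINT t|lborel. expker t)"
proof -
  have "\<bar>lapU x\<bar> \<le> (LINT t|lborel. \<bar>u1 (x, t) * expker t\<bar>)" unfolding lapU_def by (rule integral_abs_bound)
  also have "\<dots> \<le> (LINT t|lborel. M * expker t)"
  proof (rule integral_mono')
    show "integrable lborel (\<lambda>t. M * expker t)" by (intro integrable_mult_right integrable_expker)
    fix t
    show "\<bar>u1 (x, t) * expker t\<bar> \<le> M * expker t" unfolding abs_mult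
      using u1_bound[of "(x, t)"] expker_nonneg[of t] by (intro mult_mono) auto
    show "0 \<le> M * expker t" using M_nonneg expker_nonneg[of t] by simp
  qed
  finally show ?thesis by simp
qed

text \<open>Pointwise continuity in x at each positive time suffices, since the bound M times
  \<open>expker\<close> dominates in t.\<close>

lemma lapU_continuous: "continuous_on UNIV lapU"
proof (rule continuous_at_imp_continuous_on, rule ballI)
  fix x :: 'a
  show "isCont lapU x" unfolding continuous_within tendsto_at_iff_sequentially comp_def lapU_def
  proof (intro allI impI)
    fix X :: "nat \<Rightarrow> 'a" assume X: "\<forall>i. X i \<in> UNIV - {x}" "X \<longlonglongrightarrow> x"
    show "(\<lambda>i. LINT t|lborel. u1 (X i, t) * expker t) \<longlonglongrightarrow> (LINT t|lborel. u1 (x, t) * expker t)"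
    proof (rule integral_dominated_convergence[where w="\<lambda>t. M * expker t"])
      show "(\<lambda>t. u1 (x, t) * expker t) \<in> borel_measurable lborel" using u1_slice_integrable by (rule borel_measurable_integrable)
      show "(\<lambda>t. u1 (X i, t) * expker t) \<in> borel_measurable lborel" for i using u1_slice_integrable by (rule borel_measurable_integrable)
      show "integrable lborel (\<lambda>t. M * expker t)" by (intro integrable_mult_right integrable_expker)
      show "AE t in lborel. (\<lambda>i. u1 (X i, t) * expker t) \<longlonglongrightarrow> u1 (x, t) * expker t"
      proof (rule AE_I2)
        fix t :: real
        show "(\<lambda>i. u1 (X i, t) * expker t) \<longlonglongrightarrow> u1 (x, t) * expker t"
        proof (cases "t > 0")
          case True
          have "continuous_on UNIV (\<lambda>y. case (y, t) of (x, t) \<Rightarrow> u x t)"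
            by (rule continuous_on_compose2[OF uc]) (use True in \<open>auto intro!: continuous_intros\<close>)
          then have "isCont (\<lambda>y. u y t) x" by (simp add: continuous_on_eq_continuous_at)
          from isCont_tendsto_compose[OF this X(2)] have "(\<lambda>i. u (X i) t) \<longlonglongrightarrow> u x t" .
          from tendsto_mult_right[OF this, of "expker t"] show ?thesis using True by (simp add: u1_def pos_time_def)
        next
          case False then show ?thesis by (simp add: expker_def)
        qed
      qed
      show "AE t in lborel. norm (u1 (X i, t) * expker t) \<le> M * expker t" for i
        using u1_bound expker_nonneg by (intro AE_I2) (auto simp: abs_mult intro: mult_right_mono)
    qed
  qed
qed

lemma lapU_frontier: "x \<in> frontier \<Omega> \<Longrightarrow> lapU x = lapA"
  unfolding lapU_def lapA_def
  by (rule Bochner_Integration.integral_cong[OF refl]) (auto simp: u1_def a1_def pos_time_def indicator_def fr)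

lemma lapV_flux: "(LINT t|lborel. flux \<sigma>p \<sigma>m (x, t) * expker t) = lapV \<sigma>p \<sigma>m x"
proof -
  have "(LINT t|lborel. flux \<sigma>p \<sigma>m (x, t) * expker t) =
    (LINT t|lborel. \<sigma>m * (u1 (x, t) * expker t) + (\<sigma>p - \<sigma>m) * (indicator \<Omega> x * (u1 (x, t) * expker t - a1 t * expker t)))"
    by (rule Bochner_Integration.integral_cong[OF refl]) (simp add: flux_def algebra_simps)
  also have "\<dots> = \<sigma>m * lapU x + (\<sigma>p - \<sigma>m) * (indicator \<Omega> x * (lapU x - lapA))"
    unfolding lapU_def lapA_def using u1_slice_integrable[of x] a1_integrable
    by (subst Bochner_Integration.integral_add) auto
  finally show ?thesis by (simp add: lapV_def)
qed

text \<open>The jump of the coefficient multiplies lapU - lapA, which vanishes on the interface; so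
  the two continuous pieces on the closed sets \<open>closure \<Omega>\<close> and
  \<open>- \<Omega>\<close> can be glued.\<close>

lemma lapV_continuous: "continuous_on UNIV (lapV \<sigma>p \<sigma>m)"
proof -
  have c: "continuous_on S (\<lambda>x. lapU x - lapA)" for S
    using continuous_on_subset[OF lapU_continuous] by (intro continuous_intros) auto
  have "continuous_on (closure \<Omega> \<union> - \<Omega>) (\<lambda>x. if x \<in> closure \<Omega> then lapU x - lapA else 0)"
  proof (rule continuous_on_cases[OF closed_closure _ c continuous_on_const])
    show "closed (- \<Omega>)" using op by auto
    show "\<forall>x. x \<in> closure \<Omega> \<and> \<not> x \<in> closure \<Omega> \<or> x \<in> - \<Omega> \<and> x \<in> closure \<Omega> \<longrightarrow> lapU x - lapA = 0"
      using lapU_frontier op by (auto simp: frontier_def interior_open)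
  qed
  moreover have "closure \<Omega> \<union> - \<Omega> = UNIV" using closure_subset by blast
  moreover have "(if x \<in> closure \<Omega> then lapU x - lapA else 0) = indicator \<Omega> x * (lapU x - lapA)" for x
    using lapU_frontier[of x] op closure_subset[of \<Omega>] by (auto simp: frontier_def interior_open indicator_def)
  ultimately have "continuous_on UNIV (\<lambda>x. indicator \<Omega> x * (lapU x - lapA))" by simp
  then show ?thesis unfolding lapV_def[abs_def]
    by (intro continuous_on_add continuous_on_mult_left lapU_continuous)
qed

lemma lapV_bound: "\<exists>C. \<forall>x. \<bar>lapV \<sigma>p \<sigma>m x\<bar> \<le> C"
proof (intro exI allI)
  fix x
  let ?K = "M * (LINT t|lborel. expker t)"
  have A: "\<bar>lapA\<bar> \<le> ?K" using lapU_bound[of p0] lapU_frontier[OF p0] by simp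
  have "\<bar>indicator \<Omega> x * (lapU x - lapA)\<bar> \<le> 2 * ?K"
    using lapU_bound[of x] A by (auto simp: indicator_def abs_le_iff)
  then have "\<bar>\<sigma>m * lapU x\<bar> + \<bar>(\<sigma>p - \<sigma>m) * (indicator \<Omega> x * (lapU x - lapA))\<bar> \<le> \<bar>\<sigma>m\<bar> * ?K + \<bar>\<sigma>p - \<sigma>m\<bar> * (2 * ?K)"
    unfolding abs_mult[of \<sigma>m] abs_mult[of "\<sigma>p - \<sigma>m"] using lapU_bound[of x] by (intro add_mono mult_left_mono) auto
  then show "\<bar>lapV \<sigma>p \<sigma>m x\<bar> \<le> \<bar>\<sigma>m\<bar> * ?K + \<bar>\<sigma>p - \<sigma>m\<bar> * (2 * ?K)"
    unfolding lapV_def using abs_triangle_ineq order_trans by blast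
qed

lemma lapA_pos: assumes a: "\<And>t. t > 0 \<Longrightarrow> u p0 t > 0" shows "lapA > 0"
  unfolding lapA_def
proof (rule integral_pos_of_continuous[OF a1_integrable, of "1/2" 1])
  show "0 \<le> a1 t * expker t" for t using a[of t] by (auto simp: a1_def expker_def indicator_def)
  show "0 < a1 t * expker t" if "t \<in> ball 1 (1/2)" for t
  proof -
    have "\<bar>1 - t\<bar> < 1/2" using that by (simp add: dist_real_def)
    then have "t > 0" by linarith
    then show ?thesis using a[of t] by (simp add: a1_def expker_def)
  qed
qed simp

text \<open>The Laplace identity is the distributional equation for \<open>lapV\<close> with source
  lapU - 1_\<Omega>. Its semigroup form supplies the hypothesis of \<open>two_phase\<close>, so that
  time disappears from the problem.\<close>

lemma is_ball_of_isothermic: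
  assumes \<sigma>: "\<And>x. \<sigma> x = (if x \<in> \<Omega> then \<sigma>p else \<sigma>m)" and sp: "\<sigma>p > 0" and sm: "\<sigma>m > 0"
    and eq: "\<And>\<phi>. test_fun_on UNIV \<phi> \<Longrightarrow> (LINT z:UNIV \<times> {0<..}|lborel.
               u (fst z) (snd z) * frechet_derivative \<phi> (at z) (0, 1)
               - \<sigma> (fst z) * frechet_derivative \<phi> (at z) (g (fst z) (snd z), 0))
           + (LINT x|lborel. indicator \<Omega> x * \<phi> (x, 0)) = 0"
    and pos: "\<And>t. t > 0 \<Longrightarrow> u p0 t > 0" and ne: "\<Omega> \<noteq> {}"
  shows "\<exists>c r. r > 0 \<and> \<Omega> = ball c r"
proof -
  let ?V = "lapV \<sigma>p \<sigma>m"
  define f where "f x = lapU x - indicator \<Omega> x" for x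
  let ?K = "M * (LINT t|lborel. expker t)"
  obtain C where C: "\<And>x. \<bar>?V x\<bar> \<le> C" using lapV_bound by blast
  have Um: "lapU \<in> borel_measurable borel" by (rule borel_measurable_continuous_onI[OF lapU_continuous])
  have Vm: "?V \<in> borel_measurable borel" by (rule borel_measurable_continuous_onI[OF lapV_continuous])
  have ob: "\<Omega> \<in> sets borel" using op by simp
  have fb: "bdd_meas (?K + 1) f" unfolding bdd_meas_def f_def[abs_def]
  proof (intro conjI allI)
    show "(\<lambda>x. lapU x - indicator \<Omega> x) \<in> borel_measurable borel" using Um ob by (intro borel_measurable_diff borel_measurable_indicator)
    show "\<bar>lapU x - indicator \<Omega> x\<bar> \<le> ?K + 1" for x using lapU_bound[of x] by (auto simp: indicator_def)
  qed
  \<comment> \<open>A common bound, since \<open>heat_pair\<close> uses the same constant for the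
    function and its source.\<close>
  define N where "N = max C (?K + 1)"
  have Vb: "bdd_meas N ?V" unfolding bdd_meas_def N_def using Vm C by (auto intro: max.coboundedI1)
  have fb': "bdd_meas N f" by (rule bdd_meas_weaken[OF fb]) (simp add: N_def)
  have weak: "(LINT y|lborel. ?V y * lap \<psi> y) = (LINT y|lborel. f y * \<psi> y)" if \<psi>: "test_elem \<psi>" for \<psi>
  proof -
    have 1: "(LINT z|lborel. u1 z * (\<psi> (fst z) * expker (snd z))) = (LINT x|lborel. lapU x * \<psi> x)"
      using integral_weighted[OF u1_meas u1_bound test_elem_integrable[OF \<psi>] integrable_expker] by (simp add: lapU_def)
    have 2: "(LINT z|lborel. flux \<sigma>p \<sigma>m z * (lap \<psi> (fst z) * expker (snd z))) = (LINT x|lborel. ?V x * lap \<psi> x)"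
      using integral_weighted[OF flux_meas flux_bound test_elem_lap[OF \<psi>] integrable_expker, of \<sigma>p \<sigma>m] by (simp add: lapV_flux)
    have mul: "integrable lborel (\<lambda>x. h x * \<psi> x)" if "h \<in> borel_measurable borel" "\<And>x. \<bar>h x\<bar> \<le> B" for h :: "'a \<Rightarrow> real" and B
    proof (rule Bochner_Integration.integrable_bound)
      show "integrable lborel (\<lambda>x. B * \<psi> x)" by (intro integrable_mult_right test_elem_integrable \<psi>)
      show "(\<lambda>x. h x * \<psi> x) \<in> borel_measurable lborel" using that(1) test_elem_measurable[OF test_elemD[OF \<psi>]] by simp
      have "\<bar>h x\<bar> \<le> \<bar>B\<bar>" for x using that(2)[of x] by simp
      then show "AE x in lborel. norm (h x * \<psi> x) \<le> norm (B * \<psi> x)" unfolding norm_mult by (intro AE_I2 mult_right_mono) auto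
    qed
    have i1: "integrable lborel (\<lambda>x. lapU x * \<psi> x)" by (rule mul[OF Um lapU_bound])
    have i2: "integrable lborel (\<lambda>x. indicator \<Omega> x * \<psi> x)" by (rule mul[of _ 1]) (use ob in \<open>auto simp: indicator_def\<close>)
    have "(LINT y|lborel. f y * \<psi> y) = (LINT x|lborel. lapU x * \<psi> x) - (LINT x|lborel. indicator \<Omega> x * \<psi> x)"
      unfolding f_def left_diff_distrib by (rule Bochner_Integration.integral_diff[OF i1 i2])
    then show ?thesis using laplace_identity[OF \<sigma> eq \<psi>] 1 2 by simp
  qed
  have hp: "heat_pair N ?V f" unfolding heat_pair_def
    using Vb fb' lapV_continuous heat_op_heat_equation[OF _ Vb fb' weak] by blast
  interpret two_phase \<Omega> ?V f N lapA \<sigma>p \<sigma>m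
  proof
    show "lapA > 0" by (rule lapA_pos[OF pos])
    show "f x = lapA - 1 + (?V x - \<sigma>m * lapA) / \<sigma>p" if "x \<in> \<Omega>" for x
      using that sp by (simp add: f_def lapV_def field_simps)
    show "f x = ?V x / \<sigma>m" if "x \<notin> \<Omega>" for x
      using that sm by (simp add: f_def lapV_def)
    show "?V x = \<sigma>m * lapA" if "x \<in> frontier \<Omega>" for x
      using lapU_frontier[OF that] by (simp add: lapV_def)
  qed (use op bd ne sp sm hp in auto)
  show ?thesis by (rule is_ball)
qed

end

theorem theorem1p1:
  fixes \<Omega>s :: "nat \<Rightarrow> 'a::euclidean_space set"
    and m :: nat and \<alpha> \<sigma>p \<sigma>m :: real
    and \<sigma> :: "'a \<Rightarrow> real" and u :: "'a \<Rightarrow> real \<Rightarrow> real" and a :: "real \<Rightarrow> real"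
  defines "\<Omega> \<equiv> (\<Union>j<m. \<Omega>s j)"
  assumes "DIM('a) \<ge> 2"
    and "0 < \<alpha>" "\<alpha> < 1"
    and "m \<ge> 1"
    and "\<forall>j<m. bounded_domain (\<Omega>s j) \<and> C2alpha_boundary \<alpha> (\<Omega>s j)"
    and "\<forall>i<m. \<forall>j<m. i \<noteq> j \<longrightarrow> closure (\<Omega>s i) \<inter> closure (\<Omega>s j) = {}"
    and "\<sigma>p > 0" "\<sigma>m > 0" "\<sigma>p \<noteq> \<sigma>m"
    and "\<forall>x. \<sigma> x = (if x \<in> \<Omega> then \<sigma>p else \<sigma>m)"
    and "bounded_weak_solution \<sigma> (indicator \<Omega>) u"
    and "\<forall>t>0. a t > 0"
    and "\<forall>x\<in>frontier \<Omega>. \<forall>t>0. u x t = a t"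
  shows "\<exists>c r. r > 0 \<and> \<Omega> = ball c r"
proof -
  have dom: "open (\<Omega>s j)" "bounded (\<Omega>s j)" "\<Omega>s j \<noteq> {}" "C2alpha_boundary \<alpha> (\<Omega>s j)" if "j < m" for j
    using assms(6) that unfolding bounded_domain_def by blast+
  have op: "open \<Omega>" and bd: "bounded \<Omega>" unfolding \<Omega>_def using dom by (auto intro!: bounded_UN)
  have "\<Omega>s 0 \<subseteq> \<Omega>" unfolding \<Omega>_def using assms(5) by (intro UN_upper) simp
  then have ne: "\<Omega> \<noteq> {}" using dom(3)[of 0] assms(5) by auto
  \<comment> \<open>A nonempty bounded set has a boundary point, at which the common boundary value
    of u is read off.\<close>
  have "\<Omega> \<noteq> UNIV" using bd not_bounded_UNIV by metis
  then have fne: "frontier \<Omega> \<noteq> {}" using ne frontier_eq_empty by metis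
  then obtain p0 where p0: "p0 \<in> frontier \<Omega>" by blast
  have thin: "thin_strip (frontier \<Omega>)"
    using thin_strip_union[of m \<Omega>s \<alpha>] dom fne unfolding \<Omega>_def by blast
  obtain M g where M: "\<And>x t. t > 0 \<Longrightarrow> \<bar>u x t\<bar> \<le> M" and uc: "continuous_on (UNIV \<times> {0<..}) (\<lambda>(x,t). u x t)"
    and wg: "weak_space_gradient u g" and eq: "\<And>\<phi>. test_fun_on UNIV \<phi> \<Longrightarrow> (LINT z:UNIV \<times> {0<..}|lborel.
               u (fst z) (snd z) * frechet_derivative \<phi> (at z) (0, 1)
               - \<sigma> (fst z) * frechet_derivative \<phi> (at z) (g (fst z) (snd z), 0))
           + (LINT x|lborel. indicator \<Omega> x * \<phi> (x, 0)) = 0"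
    using assms(12) unfolding bounded_weak_solution_def by blast
  interpret weak_solution \<Omega> u g M p0
    by unfold_locales (use op bd thin p0 M uc wg assms(14) in auto)
  show ?thesis
    by (rule is_ball_of_isothermic[of \<sigma> \<sigma>p \<sigma>m]) (use assms(8,9,11,13,14) p0 eq ne in auto)
qed

end
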